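(* Let $n\ge 1$, $\kappa\in\mathbb{N}_+^n$, and let $\mathcal{A},\mathcal{B}\subset\mathbb{N}_0^n$ be finite index sets and $m$ a number such that $(\alpha+\beta)\cdot\kappa=m$ for all $\alpha\in\mathcal{A}$, $\beta\in\mathcal{B}$, with $\mathcal{A}$ being $\mathcal{B}$-complete. Let $R_0>0$ and let $a_{\alpha\beta}$ ($\alpha\in\mathcal{A},\beta\in\mathcal{B}$) and $f_\beta$ ($\beta\in\mathcal{B}$) be complex-valued functions on $B^\kappa_{R_0}=B^\kappa_{R_0}(0)$. Let $u\in C^{\mathcal{A}}(B^\kappa_{R_0})$ solve, in the sense of distributions, $$Pu=\sum_{\beta\in\mathcal{B}}\sum_{\alpha\in\mathcal{A}}D^\beta(a_{\alpha\beta}D^\alpha u)=\sum_{\beta\in\mathcal{B}}D^\beta f_\beta .$$ Define $$\bar\omega_a(\rho):=\sup_{B^\kappa_\rho(x_0)\Subset B^\kappa_{R_0}}\sum_{\alpha\in\mathcal{A},\beta\in\mathcal{B}}\frac{1}{|B^\kappa_\rho(x_0)|}\int_{B^\kappa_\rho(x_0)}|a_{\alpha\beta}(x)-a_{\alpha\beta}(x_0)|\,dx,$$ $$\bar\omega_f(\rho):=\sup_{B^\kappa_\rho(x_0)\Subset B^\kappa_{R_0}}\sum_{\beta\in\mathcal{B}}\frac{1}{|B^\kappa_\rho(x_0)|}\int_{B^\kappa_\rho(x_0)}|f_{\beta}(x)-f_{\beta}(x_0)|\,dx.$$ Suppose that, with $p(x,\xi)=\sum_{\alpha\in\mathcal{A},\beta\in\mathcal{B}}a_{\alpha\beta}(x)(i\xi)^{\alpha+\beta}$,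 there are constants $0<\lambda<\Lambda$ such that for all $(x,\xi)$, $$\lambda|\xi|_\kappa^m\le|p(x,\xi)|\le\Lambda|\xi|_\kappa^m .$$ Then for any $\gamma,\theta\in(0,1)$ there is a constant $C=C(\lambda,\Lambda,\kappa,\gamma,\theta,B^\kappa_{R_0})$ such that for all $\alpha\in\mathcal{A}$ and all $r\in(0,R_0]$, $$ \begin{aligned} \sup_{\substack{x,y\in B^\kappa_{\theta R_0}\\ |x-y|_\kappa\le r}}|D^\alpha u(x)-D^\alpha u(y)| &\le C\left([|u|]_{\mathcal{A},\infty;B^\kappa_{R_0}}r^\gamma+\int_0^{r}\frac{\bar\omega_f(\rho)}{\rho}d\rho+r^\gamma\int_{r}^{R_0}\frac{\bar\omega_f(\rho)}{\rho^{1+\gamma}}d\rho\right)\\ &\quad+C[|u|]_{\mathcal{A},\infty;B^\kappa_{R_0}}\left(\int_0^{r}\frac{\bar\omega_a(\rho)}{\rho}d\rho+r^\gamma\int_{r}^{R_0}\frac{\bar\omega_a(\rho)}{\rho^{1+\gamma}}d\rho\right). \end{aligned} $$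
   Context: For $\kappa\in\mathbb{N}_+^n$ (all $\kappa_l>0$), the $\kappa$-quasi-distance is $|x-y|_\kappa=\big(\sum_{l=1}^n|x^l-y^l|^{2/\kappa_l}\big)^{1/2}$, $B^\kappa_r(x)=\{y:|y-x|_\kappa<r\}$, and $|\kappa|=\sum_l\kappa_l$. For finite $\mathcal{A},\mathcal{B}\subset\mathbb{N}_0^n$ with $(\alpha+\beta)\cdot\kappa=m$ for all $\alpha\in\mathcal{A},\beta\in\mathcal{B}$, $\mathcal{A}$ is called $\mathcal{B}$-complete if $\mathcal{A}$ equals the set of all $\alpha\in\mathbb{N}_0^n$ with $(\alpha+\beta)\cdot\kappa=m$ for all $\beta\in\mathcal{B}$. $D^\alpha$ denotes the (distributional) partial derivative of multi-order $\alpha$. For a domain $\Omega$, $C^{\mathcal{A}}(\Omega)$ is the set of distributions $u$ on $\Omega$ with $D^\alpha u\in C(\Omega)$ for all $\alpha\in\mathcal{A}$, and $[|u|]_{\mathcal{A},\infty;\Omega}=\max_{\alpha\in\mathcal{A}}\sup_\Omega|D^\alpha u|$. The notation $B\Subset B'$ means $\overline B$ is a compact subset of $B'$.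
   Formalization: The constant C may also depend on the index sets 𝒜, ℬ and on m; independence of m fails, e.g. n=1, κ=1, 𝒜={0}, ℬ={l}, a=1, f=0, u the Chebyshev polynomial of degree l−1 rescaled to the ball, as l→∞. *)

theory Defs
  imports "HOL-Analysis.Analysis"
begin

text \<open>Points of R^n are vectors real^'n over a finite index type 'n (so n >= 1).
  Multi-indices are functions 'n => nat.\<close>

type_synonym 'n mindex = "'n \<Rightarrow> nat"

definition mdot :: "'n::finite mindex \<Rightarrow> 'n mindex \<Rightarrow> nat" where
  "mdot \<alpha> \<kappa> = (\<Sum>l\<in>UNIV. \<alpha> l * \<kappa> l)"

definition mlen :: "'n::finite mindex \<Rightarrow> nat" where
  "mlen \<alpha> = (\<Sum>l\<in>UNIV. \<alpha> l)"

definition qdist :: "'n::finite mindex \<Rightarrow> real^'n \<Rightarrow> real^'n \<Rightarrow> real" where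
  "qdist \<kappa> x y = sqrt (\<Sum>l\<in>UNIV. \<bar>x$l - y$l\<bar> powr (2 / real (\<kappa> l)))"

definition qball :: "'n::finite mindex \<Rightarrow> real^'n \<Rightarrow> real \<Rightarrow> (real^'n) set" where
  "qball \<kappa> x r = {y. qdist \<kappa> y x < r}"

definition B_complete :: "'n::finite mindex \<Rightarrow> nat \<Rightarrow> 'n mindex set \<Rightarrow> 'n mindex set \<Rightarrow> bool" where
  "B_complete \<kappa> m A B \<longleftrightarrow> A = {\<alpha>. \<forall>\<beta>\<in>B. mdot (\<lambda>l. \<alpha> l + \<beta> l) \<kappa> = m}"

definition cpt_subset :: "('a::topological_space) set \<Rightarrow> 'a set \<Rightarrow> bool" where
  "cpt_subset S S' \<longleftrightarrow> compact (closure S) \<and> closure S \<subseteq> S'"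

definition partial :: "'n::finite \<Rightarrow> (real^'n \<Rightarrow> complex) \<Rightarrow> real^'n \<Rightarrow> complex" where
  "partial i f x = vector_derivative (\<lambda>t. f (x + t *\<^sub>R axis i 1)) (at 0)"

fun iter_partial :: "'n::finite list \<Rightarrow> (real^'n \<Rightarrow> complex) \<Rightarrow> real^'n \<Rightarrow> complex" where
  "iter_partial [] f = f"
| "iter_partial (i # is) f = partial i (iter_partial is f)"

definition smooth_fun :: "(real^'n::finite \<Rightarrow> complex) \<Rightarrow> bool" where
  "smooth_fun f \<longleftrightarrow>
     (\<forall>is. continuous_on UNIV (iter_partial is f)) \<and>
     (\<forall>is i x. ((\<lambda>t. iter_partial is f (x + t *\<^sub>R axis i 1)) has_vector_derivative
                  iter_partial (i # is) f x) (at 0))"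

text \<open>D^alpha of a smooth function (for smooth functions the order of differentiation
  is irrelevant, so any list with the right multiplicities may be used)\<close>
definition Dm :: "'n::finite mindex \<Rightarrow> (real^'n \<Rightarrow> complex) \<Rightarrow> real^'n \<Rightarrow> complex" where
  "Dm \<alpha> f = iter_partial (SOME xs. \<forall>i. count_list xs i = \<alpha> i) f"

definition test_fun :: "(real^'n::finite) set \<Rightarrow> (real^'n \<Rightarrow> complex) set" where
  "test_fun \<Omega> = {\<phi>. smooth_fun \<phi> \<and> compact (closure {x. \<phi> x \<noteq> 0})
                     \<and> closure {x. \<phi> x \<noteq> 0} \<subseteq> \<Omega>}"

definition is_distribution :: "(real^'n::finite) set \<Rightarrow> ((real^'n \<Rightarrow> complex) \<Rightarrow> complex) \<Rightarrow> bool" where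
  "is_distribution \<Omega> T \<longleftrightarrow>
     (\<forall>\<phi>\<in>test_fun \<Omega>. \<forall>\<psi>\<in>test_fun \<Omega>. T (\<lambda>x. \<phi> x + \<psi> x) = T \<phi> + T \<psi>) \<and>
     (\<forall>\<phi>\<in>test_fun \<Omega>. \<forall>c. T (\<lambda>x. c * \<phi> x) = c * T \<phi>) \<and>
     (\<forall>K. compact K \<and> K \<subseteq> \<Omega> \<longrightarrow>
        (\<exists>C N. \<forall>\<phi>\<in>test_fun \<Omega>. closure {x. \<phi> x \<noteq> 0} \<subseteq> K \<longrightarrow>
            cmod (T \<phi>) \<le> C * (\<Sum>\<alpha>\<in>{\<alpha>::'n mindex. \<forall>i. \<alpha> i \<le> N}. SUP x. cmod (Dm \<alpha> \<phi> x))))"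

definition loc_integrable :: "(real^'n::finite) set \<Rightarrow> (real^'n \<Rightarrow> complex) \<Rightarrow> bool" where
  "loc_integrable \<Omega> g \<longleftrightarrow> (\<forall>K. compact K \<and> K \<subseteq> \<Omega> \<longrightarrow> set_integrable lebesgue K g)"

definition integ :: "(real^'n::finite) set \<Rightarrow> (real^'n \<Rightarrow> complex) \<Rightarrow> complex" where
  "integ \<Omega> g = set_lebesgue_integral lebesgue \<Omega> g"

definition distr_deriv_eq :: "(real^'n::finite) set \<Rightarrow> ((real^'n \<Rightarrow> complex) \<Rightarrow> complex)
     \<Rightarrow> 'n mindex \<Rightarrow> (real^'n \<Rightarrow> complex) \<Rightarrow> bool" where
  "distr_deriv_eq \<Omega> T \<alpha> v \<longleftrightarrow>
     (\<forall>\<phi>\<in>test_fun \<Omega>. (-1) ^ mlen \<alpha> * T (Dm \<alpha> \<phi>) = integ \<Omega> (\<lambda>x. v x * \<phi> x))"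

definition symb :: "'n::finite mindex set \<Rightarrow> 'n mindex set \<Rightarrow>
     ('n mindex \<Rightarrow> 'n mindex \<Rightarrow> real^'n \<Rightarrow> complex) \<Rightarrow> real^'n \<Rightarrow> real^'n \<Rightarrow> complex" where
  "symb A B a x \<xi> = (\<Sum>\<alpha>\<in>A. \<Sum>\<beta>\<in>B. a \<alpha> \<beta> x *
        (\<Prod>l\<in>UNIV. (\<i> * complex_of_real (\<xi>$l)) ^ (\<alpha> l + \<beta> l)))"

text \<open>mean oscillation moduli, valued in [0,\<infinity>]; sup over the empty set is 0\<close>
definition osc_a :: "'n::finite mindex \<Rightarrow> 'n mindex set \<Rightarrow> 'n mindex set \<Rightarrow> real \<Rightarrow>
     ('n mindex \<Rightarrow> 'n mindex \<Rightarrow> real^'n \<Rightarrow> complex) \<Rightarrow> real \<Rightarrow> ennreal" where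
  "osc_a \<kappa> A B R0 a \<rho> = (SUP x0\<in>{x0. cpt_subset (qball \<kappa> x0 \<rho>) (qball \<kappa> 0 R0)}.
      \<Sum>\<alpha>\<in>A. \<Sum>\<beta>\<in>B. set_nn_integral lebesgue (qball \<kappa> x0 \<rho>)
             (\<lambda>x. ennreal (cmod (a \<alpha> \<beta> x - a \<alpha> \<beta> x0))) / emeasure lebesgue (qball \<kappa> x0 \<rho>))"

definition osc_f :: "'n::finite mindex \<Rightarrow> 'n mindex set \<Rightarrow> real \<Rightarrow>
     ('n mindex \<Rightarrow> real^'n \<Rightarrow> complex) \<Rightarrow> real \<Rightarrow> ennreal" where
  "osc_f \<kappa> B R0 f \<rho> = (SUP x0\<in>{x0. cpt_subset (qball \<kappa> x0 \<rho>) (qball \<kappa> 0 R0)}.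
      \<Sum>\<beta>\<in>B. set_nn_integral lebesgue (qball \<kappa> x0 \<rho>)
             (\<lambda>x. ennreal (cmod (f \<beta> x - f \<beta> x0))) / emeasure lebesgue (qball \<kappa> x0 \<rho>))"

definition seminormA :: "'n::finite mindex set \<Rightarrow> (real^'n) set \<Rightarrow> ('n mindex \<Rightarrow> real^'n \<Rightarrow> complex) \<Rightarrow> ennreal" where
  "seminormA A \<Omega> v = (SUP \<alpha>\<in>A. SUP x\<in>\<Omega>. ennreal (cmod (v \<alpha> x)))"

end

theory Submission
  imports Defs "HOL-Computational_Algebra.Polynomial"
begin

text \<open>Freeze the coefficients at a point \<open>x\<close>.  In a box of side \<open>2 d\<close> around \<open>x\<close>, the value
  \<open>D\<^sup>\<alpha> u(x)\<close> is the limit of an anisotropic Littlewood--Paley decomposition built from finite sums of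
  lattice exponentials, localized by a smooth cutoff.  On a block of frequencies of quasi-norm about
  \<open>2\<^sup>j\<close> one divides by the frozen symbol, which ellipticity bounds from below; the frozen equation then
  turns the block into an integral of \<open>(f - f(x)) - (a - a(x)) D\<^sup>\<alpha> u\<close> against a kernel that is at most
  \<open>2\<^bsup>j|\<kappa>|\<^esup> / (1 + 2\<^sup>j |z - x|)\<^sup>N\<close>.  The derivatives that fall on the cutoff cost only \<open>4\<^bsup>-j\<^esup>\<close> times the
  supremum of the \<open>D\<^sup>\<alpha> u\<close>, because ellipticity puts pure powers of every partial derivative into
  \<open>A\<close> and these control the distribution \<open>u\<close> on the box.  For two points at distance \<open>r\<close>, the blocks
  with \<open>2\<^sup>j r > 1\<close> are estimated at each point separately; in the others the two phases differ by a
  multiplier of size \<open>2\<^sup>j r\<close>.  Summing these weights over \<open>j\<close> gives the kernel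
  \<open>min(1, r/t) / t\<^bsup>|\<kappa>|\<^esup>\<close> with \<open>t = |z - x|\<close>, and a layer-cake argument turns its integral into the Dini-type
  integrals of the mean oscillations.\<close>

section \<open>Smooth functions on the line\<close>

text \<open>The obstacle is that only the derivatives \<open>v \<alpha>\<close>, \<alpha> in
  \<open>A\<close>, are controlled, while they determine \<open>T\<close> only up to whatever they
  annihilate. So every error term, in particular each derivative that hits the cutoff, has to be
  written as a combination of test functions differentiated at least as often as some index of
  \<open>A\<close>, and then be bounded by the sup norm of the combination as a whole, not term by
  term. Tensor products make this a one-variable matter: each factor can be integrated back up to
  finitely many derivatives of a fixed bump. The frequencies are \<open>pi / d * k\<close>, so that
  the exponentials have the side \<open>2 * d\<close> of the box as period, and finite sums keep all
  test functions within finite combinations of tensor products; decay of a kernel comes from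
  summation by parts over the lattice. The constant is chosen before the data, so each bound on a
  multiplier must be uniform over all symbols with the given \<open>lam\<close> and
  \<open>Lam\<close>. The exponent 1 of \<open>r / t\<close> in the final kernel is what leaves room
  for every \<gamma> below 1.\<close>

definition nd :: "nat \<Rightarrow> (real \<Rightarrow> complex) \<Rightarrow> real \<Rightarrow> complex" where
  "nd n f = ((\<lambda>g t. vector_derivative g (at t)) ^^ n) f"

lemma nd_0 [simp]: "nd 0 f = f"
  by (simp add: nd_def)

lemma nd_Suc: "nd (Suc n) f = (\<lambda>t. vector_derivative (nd n f) (at t))"
  by (simp add: nd_def)

lemma nd_add: "nd (m + n) f = nd m (nd n f)"
  by (simp add: nd_def funpow_add)

definition smooth1 :: "(real \<Rightarrow> complex) \<Rightarrow> bool" where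
  "smooth1 f \<longleftrightarrow> (\<forall>n t. (nd n f has_vector_derivative nd (Suc n) f t) (at t))"

lemma smooth1_deriv: "smooth1 f \<Longrightarrow> (nd n f has_vector_derivative nd (Suc n) f t) (at t)"
  by (simp add: smooth1_def)

text \<open>\<open>vector_derivative\<close> is defined by a choice, so a closed form of
  \<open>nd n f\<close> is obtained by exhibiting a sequence in which each member has the next one
  as derivative everywhere. The formulas for products, affine substitutions and exponentials below
  are instances.\<close>

lemma nd_eq_sequence:
  assumes "D 0 = f" "\<And>n t. (D n has_vector_derivative D (Suc n) t) (at t)"
  shows "nd n f = D n"
proof (induction n)
  case (Suc n)
  then show ?case using assms(2) by (auto simp: nd_Suc vector_derivative_at)
qed (simp add: assms)

lemma smooth1_sequence:
  assumes "D 0 = f" "\<And>n t. (D n has_vector_derivative D (Suc n) t) (at t)"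
  shows "smooth1 f"
  unfolding smooth1_def nd_eq_sequence[OF assms] using assms(2) by blast

lemma smooth1_nd: "smooth1 f \<Longrightarrow> smooth1 (nd n f)"
  unfolding smooth1_def by (metis add_Suc nd_add)

lemma smooth1_continuous_on: "smooth1 f \<Longrightarrow> continuous_on S (nd n f)"
  by (meson continuous_at_imp_continuous_on has_vector_derivative_continuous smooth1_deriv)

lemma smooth1_continuous_on0: "smooth1 f \<Longrightarrow> continuous_on S f"
  using smooth1_continuous_on[of f S 0] by simp

lemma smooth1_mult_nd:
  assumes f: "smooth1 f" and g: "smooth1 g"
  shows "smooth1 (\<lambda>t. f t * g t)"
    and "nd n (\<lambda>t. f t * g t) = (\<lambda>t. \<Sum>i\<le>n. of_nat (n choose i) * nd i f t * nd (n - i) g t)"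
proof -
  define D where "D n t = (\<Sum>i\<le>n. of_nat (n choose i) * nd i f t * nd (n - i) g t)" for n t
  have D0: "D 0 = (\<lambda>t. f t * g t)" by (simp add: D_def fun_eq_iff)
  have der: "(D n has_vector_derivative D (Suc n) t) (at t)" for n t
  proof -
    have 1: "(D n has_vector_derivative (\<Sum>i\<le>n. of_nat (n choose i) * (nd i f t * nd (Suc (n - i)) g t + nd (Suc i) f t * nd (n - i) g t))) (at t)"
      unfolding D_def
      by (rule has_vector_derivative_sum)
        (auto simp: mult.assoc intro!: has_vector_derivative_mult_right
          has_vector_derivative_mult smooth1_deriv f g)
    have "(\<Sum>i\<le>n. of_nat (n choose i) * (nd i f t * nd (Suc (n - i)) g t + nd (Suc i) f t * nd (n - i) g t))
      = (\<Sum>i\<le>n. of_nat (n choose i) * nd i f t * nd (Suc n - i) g t)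
        + (\<Sum>i\<le>n. of_nat (n choose i) * nd (Suc i) f t * nd (n - i) g t)"
      unfolding sum.distrib[symmetric] by (intro sum.cong refl) (simp add: algebra_simps Suc_diff_le)
    also have "(\<Sum>i\<le>n. of_nat (n choose i) * nd i f t * nd (Suc n - i) g t)
        = (\<Sum>i\<le>Suc n. of_nat (n choose i) * nd i f t * nd (Suc n - i) g t)"
      by simp
    also have "\<dots> = f t * nd (Suc n) g t
        + (\<Sum>i\<le>n. of_nat (n choose Suc i) * nd (Suc i) f t * nd (n - i) g t)"
      by (subst sum.atMost_Suc_shift) simp
    also have "\<dots> + (\<Sum>i\<le>n. of_nat (n choose i) * nd (Suc i) f t * nd (n - i) g t)
        = f t * nd (Suc n) g t
        + (\<Sum>i\<le>n. of_nat (Suc n choose Suc i) * nd (Suc i) f t * nd (n - i) g t)"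
      unfolding add.assoc sum.distrib[symmetric] by (simp add: algebra_simps)
    also have "\<dots> = D (Suc n) t"
      unfolding D_def by (subst sum.atMost_Suc_shift) simp
    finally show ?thesis using 1 by simp
  qed
  show "smooth1 (\<lambda>t. f t * g t)" by (rule smooth1_sequence[OF D0 der])
  show "nd n (\<lambda>t. f t * g t) = (\<lambda>t. \<Sum>i\<le>n. of_nat (n choose i) * nd i f t * nd (n - i) g t)"
    using nd_eq_sequence[OF D0 der] by (simp add: D_def fun_eq_iff)
qed

lemma smooth1_add_nd:
  assumes f: "smooth1 f" and g: "smooth1 g"
  shows "smooth1 (\<lambda>t. f t + g t)" and "nd n (\<lambda>t. f t + g t) = (\<lambda>t. nd n f t + nd n g t)"
proof -
  have D: "(\<lambda>t. nd 0 f t + nd 0 g t) = (\<lambda>t. f t + g t)"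
    "\<And>n t. ((\<lambda>t. nd n f t + nd n g t) has_vector_derivative nd (Suc n) f t + nd (Suc n) g t) (at t)"
    by (auto intro!: has_vector_derivative_add smooth1_deriv f g)
  show "smooth1 (\<lambda>t. f t + g t)" "nd n (\<lambda>t. f t + g t) = (\<lambda>t. nd n f t + nd n g t)"
    using smooth1_sequence[of "\<lambda>n t. nd n f t + nd n g t", OF D]
      nd_eq_sequence[of "\<lambda>n t. nd n f t + nd n g t", OF D] by auto
qed

lemma smooth1_cmult_nd:
  assumes f: "smooth1 f"
  shows "smooth1 (\<lambda>t. c * f t)" and "nd n (\<lambda>t. c * f t) = (\<lambda>t. c * nd n f t)"
proof -
  have D: "(\<lambda>t. c * nd 0 f t) = (\<lambda>t. c * f t)"
    "\<And>n t. ((\<lambda>t. c * nd n f t) has_vector_derivative c * nd (Suc n) f t) (at t)"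
    by (auto intro!: has_vector_derivative_mult_right smooth1_deriv f)
  show "smooth1 (\<lambda>t. c * f t)" "nd n (\<lambda>t. c * f t) = (\<lambda>t. c * nd n f t)"
    using smooth1_sequence[of "\<lambda>n t. c * nd n f t", OF D]
      nd_eq_sequence[of "\<lambda>n t. c * nd n f t", OF D] by auto
qed

lemma smooth1_affine_nd:
  assumes f: "smooth1 f"
  shows "smooth1 (\<lambda>t. f (c * t + d))"
    and "nd n (\<lambda>t. f (c * t + d)) = (\<lambda>t. of_real c ^ n * nd n f (c * t + d))"
proof -
  have D: "(\<lambda>t. of_real c ^ 0 * nd 0 f (c * t + d)) = (\<lambda>t. f (c * t + d))"
    "\<And>n t. ((\<lambda>t. of_real c ^ n * nd n f (c * t + d)) has_vector_derivative
       of_real c ^ Suc n * nd (Suc n) f (c * t + d)) (at t)"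
  proof -
    fix n t
    have "((nd n f \<circ> (\<lambda>t. c * t + d)) has_vector_derivative (c *\<^sub>R nd (Suc n) f (c * t + d))) (at t)"
      by (rule vector_diff_chain_at) (auto intro!: derivative_eq_intros smooth1_deriv f
          simp: has_real_derivative_iff_has_vector_derivative[symmetric])
    from has_vector_derivative_mult_right[OF this, of "of_real c ^ n"]
    show "((\<lambda>t. of_real c ^ n * nd n f (c * t + d)) has_vector_derivative
       of_real c ^ Suc n * nd (Suc n) f (c * t + d)) (at t)"
      by (simp add: o_def scaleR_conv_of_real mult.assoc mult.left_commute)
  qed auto
  show "smooth1 (\<lambda>t. f (c * t + d))"
    "nd n (\<lambda>t. f (c * t + d)) = (\<lambda>t. of_real c ^ n * nd n f (c * t + d))"
    using smooth1_sequence[of "\<lambda>n t. of_real c ^ n * nd n f (c * t + d)", OF D]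
      nd_eq_sequence[of "\<lambda>n t. of_real c ^ n * nd n f (c * t + d)", OF D] by auto
qed

lemma smooth1_exp_nd:
  shows "smooth1 (\<lambda>t. exp (c * of_real t))"
    and "nd n (\<lambda>t. exp (c * of_real t)) = (\<lambda>t. c ^ n * exp (c * of_real t))"
proof -
  have D: "(\<lambda>t. c ^ 0 * exp (c * of_real t)) = (\<lambda>t. exp (c * of_real t))"
    "\<And>n t. ((\<lambda>t. c ^ n * exp (c * of_real t)) has_vector_derivative
       c ^ Suc n * exp (c * of_real t)) (at t)"
  proof -
    fix n t
    have "((\<lambda>z. c ^ n * exp (c * z)) has_field_derivative c ^ Suc n * exp (c * of_real t)) (at (of_real t))"
      by (auto intro!: derivative_eq_intros)
    then show "((\<lambda>t. c ^ n * exp (c * of_real t)) has_vector_derivative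
       c ^ Suc n * exp (c * of_real t)) (at t)" by (rule has_vector_derivative_real_field)
  qed auto
  show "smooth1 (\<lambda>t. exp (c * of_real t))"
    "nd n (\<lambda>t. exp (c * of_real t)) = (\<lambda>t. c ^ n * exp (c * of_real t))"
    using smooth1_sequence[of "\<lambda>n t. c ^ n * exp (c * of_real t)", OF D]
      nd_eq_sequence[of "\<lambda>n t. c ^ n * exp (c * of_real t)", OF D] by auto
qed

section \<open>Smooth functions supported in an interval\<close>

definition test1 :: "real \<Rightarrow> (real \<Rightarrow> complex) set" where
  "test1 d = {f. smooth1 f \<and> (\<forall>t. d < \<bar>t\<bar> \<longrightarrow> f t = 0)}"

lemma test1_smooth1: "f \<in> test1 d \<Longrightarrow> smooth1 f"
  and test1_zero: "f \<in> test1 d \<Longrightarrow> d < \<bar>t\<bar> \<Longrightarrow> f t = 0"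
  by (auto simp: test1_def)

lemma test1_mono: "f \<in> test1 d \<Longrightarrow> d \<le> d' \<Longrightarrow> f \<in> test1 d'"
  by (auto simp: test1_def)

lemma test1_Suc_nd:
  assumes "f \<in> test1 d" shows "nd (Suc 0) f \<in> test1 d"
proof -
  have "vector_derivative f (at t) = 0" if "d < \<bar>t\<bar>" for t
  proof -
    have "((\<lambda>t. 0) has_vector_derivative 0) (at t)" by simp
    then have "(f has_vector_derivative 0) (at t)"
      by (rule has_vector_derivative_transform_within_open[where S = "{t. d < \<bar>t\<bar>}"])
        (use that test1_zero[OF assms] in \<open>auto intro!: open_Collect_less continuous_intros\<close>)
    then show ?thesis by (rule vector_derivative_at)
  qed
  then show ?thesis
    using smooth1_nd[OF test1_smooth1[OF assms], of 1] by (simp add: test1_def nd_Suc)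
qed

lemma test1_nd: "f \<in> test1 d \<Longrightarrow> nd n f \<in> test1 d"
proof (induction n)
  case (Suc n)
  then show ?case using test1_Suc_nd[of "nd n f"] nd_add[of "Suc 0" n f] by simp
qed simp

lemma test1_add: "f \<in> test1 d \<Longrightarrow> g \<in> test1 d \<Longrightarrow> (\<lambda>t. f t + g t) \<in> test1 d"
  by (auto simp: test1_def smooth1_add_nd)

lemma test1_cmult: "f \<in> test1 d \<Longrightarrow> (\<lambda>t. c * f t) \<in> test1 d"
  by (auto simp: test1_def smooth1_cmult_nd)

lemma test1_mult: "f \<in> test1 d \<Longrightarrow> smooth1 g \<Longrightarrow> (\<lambda>t. f t * g t) \<in> test1 d"
  by (auto simp: test1_def smooth1_mult_nd)

lemma test1_zero_fun: "(\<lambda>t. 0) \<in> test1 d"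
  using smooth1_cmult_nd(1)[OF smooth1_exp_nd(1)[of 0], of 0] by (simp add: test1_def)

lemma test1_sum: "(\<And>i. i \<in> F \<Longrightarrow> f i \<in> test1 d) \<Longrightarrow> (\<lambda>t. \<Sum>i\<in>F. c i * f i t) \<in> test1 d"
  by (induction F rule: infinite_finite_induct) (auto intro!: test1_add test1_cmult test1_zero_fun)

lemma test1_bounded:
  assumes "f \<in> test1 d" shows "\<exists>C>0. \<forall>t. cmod (f t) \<le> C"
proof -
  have "compact (f ` {-d..d})"
    by (intro compact_continuous_image smooth1_continuous_on0 test1_smooth1[OF assms]) auto
  then obtain C where C: "\<And>t. t \<in> {-d..d} \<Longrightarrow> cmod (f t) \<le> C"
    by (meson compact_imp_bounded bounded_iff imageI)
  have "cmod (f t) \<le> max C 1" for t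
    using C[of t] test1_zero[OF assms, of t] by (cases "d < \<bar>t\<bar>") (auto simp: abs_le_iff not_less max_def)
  then show ?thesis by (intro exI[of _ "max C 1"]) auto
qed

lemma poly_exp_tendsto_0: "((\<lambda>y::real. poly q y * exp (- y)) \<longlongrightarrow> 0) at_top"
proof -
  have "((\<lambda>y. \<Sum>i\<le>degree q. coeff q i * (y ^ i / exp y)) \<longlongrightarrow> (\<Sum>i\<le>degree q. coeff q i * 0)) at_top"
    by (intro tendsto_intros tendsto_power_div_exp_0)
  then show ?thesis
    by (simp add: poly_altdef sum_distrib_right exp_minus divide_inverse mult.assoc)
qed

text \<open>These are the polynomials q for which the n-th derivative of
  \<open>exp (- (1 / x))\<close> on x > 0 is \<open>q (1 / x) * exp (- (1 / x))\<close>: with y = 1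
  / x, one differentiation turns q into y^2 (q - q').\<close>

definition flat_poly :: "nat \<Rightarrow> real poly" where
  "flat_poly n = ((\<lambda>q. [:0,0,1:] * (q - pderiv q)) ^^ n) 1"

definition flat :: "nat \<Rightarrow> real \<Rightarrow> real" where
  "flat n x = (if x > 0 then poly (flat_poly n) (1 / x) * exp (- (1 / x)) else 0)"

lemma flat_deriv: "(flat n has_real_derivative flat (Suc n) x) (at x)"
proof -
  consider "x < 0" | "x > 0" | "x = 0" by linarith
  then show ?thesis
  proof cases
    case 1
    have "((\<lambda>_. 0) has_real_derivative 0) (at x)" by simp
    then have "(flat n has_real_derivative 0) (at x)"
      by (rule has_field_derivative_transform_within_open[where S = "{..<0}"]) (use 1 in \<open>auto simp: flat_def\<close>)
    then show ?thesis using 1 by (simp add: flat_def)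
  next
    case 2
    have "((\<lambda>x. poly (flat_poly n) (1 / x) * exp (- (1 / x))) has_real_derivative
       poly (flat_poly (Suc n)) (1 / x) * exp (- (1 / x))) (at x)"
      using 2 by (auto intro!: derivative_eq_intros DERIV_chain'[OF _ poly_DERIV] 
          simp: flat_poly_def field_simps power2_eq_square)
    then have "(flat n has_real_derivative poly (flat_poly (Suc n)) (1 / x) * exp (- (1 / x))) (at x)"
      by (rule has_field_derivative_transform_within_open[where S = "{0<..}"]) (use 2 in \<open>auto simp: flat_def\<close>)
    then show ?thesis using 2 by (simp add: flat_def)
  next
    case 3
    \<comment> \<open>The extra factor y is the division by h in the difference quotient at 0, with
      y = 1 / h.\<close>
    have "((\<lambda>y. poly ([:0,1:] * flat_poly n) y * exp (- y)) \<longlongrightarrow> 0) at_top"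
      by (rule poly_exp_tendsto_0)
    then have "((\<lambda>h. poly ([:0,1:] * flat_poly n) (inverse h) * exp (- inverse h)) \<longlongrightarrow> 0) (at_right (0::real))"
      by (rule filterlim_compose[OF _ filterlim_inverse_at_top_right])
    then have r: "((\<lambda>h. (flat n (0 + h) - flat n 0) / h) \<longlongrightarrow> 0) (at_right 0)"
      by (rule Lim_transform_eventually) 
        (auto simp: flat_def divide_simps eventually_at_right_less intro!: eventually_at_rightI[of 0 1])
    have l: "((\<lambda>h. (flat n (0 + h) - flat n 0) / h) \<longlongrightarrow> 0) (at_left 0)"
      by (rule tendsto_eventually) (auto simp: flat_def intro!: eventually_at_leftI[of "-1"])
    have "((\<lambda>h. (flat n (0 + h) - flat n 0) / h) \<longlongrightarrow> 0) (at 0)"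
      using filterlim_split_at[OF l r] .
    then show ?thesis using 3 by (simp add: DERIV_def flat_def)
  qed
qed

lemma smooth1_flat: "smooth1 (\<lambda>x. of_real (flat 0 x))"
  by (rule smooth1_sequence[of "\<lambda>n x. of_real (flat n x)"])
    (auto intro!: has_vector_derivative_of_real flat_deriv simp: has_real_derivative_iff_has_vector_derivative[symmetric])

lemma flat_0_pos: "x > 0 \<Longrightarrow> flat 0 x > 0"
  and flat_0_nonneg: "flat 0 x \<ge> 0"
  and flat_0_zero: "x \<le> 0 \<Longrightarrow> flat 0 x = 0"
  by (auto simp: flat_def flat_poly_def)

lemma smooth1_antiderivative:
  assumes "smooth1 g" "\<And>t. (f has_vector_derivative g t) (at t)"
  shows "smooth1 f" and "nd (Suc n) f = nd n g"
proof -
  define D where "D n = (case n of 0 \<Rightarrow> f | Suc n \<Rightarrow> nd n g)" for n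
  have D0: "D 0 = f" by (simp add: D_def)
  have D: "(D n has_vector_derivative D (Suc n) t) (at t)" for n t
    using assms(2) smooth1_deriv[OF assms(1)] by (cases n) (auto simp: D_def)
  show "smooth1 f" by (rule smooth1_sequence[OF D0 D])
  show "nd (Suc n) f = nd n g" using nd_eq_sequence[OF D0 D, of "Suc n"] by (simp add: D_def)
qed

text \<open>The derivative is two-sided even at \<open>a\<close> and to its left, where
  \<open>{a..t}\<close> is a point or empty: since \<open>g\<close> vanishes up to \<open>a\<close>,
  the base point can be moved to \<open>c\<close>, strictly below both \<open>a\<close> and
  \<open>t\<close>, without changing the integral.\<close>

lemma has_vector_derivative_integral_from:
  fixes g :: "real \<Rightarrow> 'a::banach"
  assumes "continuous_on UNIV g" "\<And>t. t \<le> a \<Longrightarrow> g t = 0"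
  shows "((\<lambda>t. integral {a..t} g) has_vector_derivative g t) (at t)"
proof -
  define c where "c = min a t - 1"
  have eq: "integral {a..s} g = integral {c..s} g" if "s > c" for s
  proof (cases "s \<ge> a")
    case True
    have "integral {c..a} g + integral {a..s} g = integral {c..s} g"
      by (rule Henstock_Kurzweil_Integration.integral_combine)
        (use True in \<open>auto simp: c_def intro!: integrable_continuous_real continuous_on_subset[OF assms(1)]\<close>)
    moreover have "integral {c..a} g = integral {c..a} (\<lambda>_. 0)"
      by (rule integral_cong) (use assms(2) in auto)
    ultimately show ?thesis by simp
  next
    case False
    have "integral {c..s} g = integral {c..s} (\<lambda>_. 0)"
      by (rule integral_cong) (use assms(2) False in auto)
    then show ?thesis using False by simp
  qed
  have "((\<lambda>s. integral {c..s} g) has_vector_derivative g t) (at t within {c..t+1})"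
    by (rule integral_has_vector_derivative) (auto simp: c_def intro: continuous_on_subset[OF assms(1)])
  then have "((\<lambda>s. integral {c..s} g) has_vector_derivative g t) (at t)"
    by (subst (asm) at_within_interior) (auto simp: c_def)
  then show ?thesis
    by (rule has_vector_derivative_transform_within_open[where S = "{c<..}"]) (auto simp: eq c_def)
qed

text \<open>\<open>I\<close> is a smooth step, 0 up to 0 and constant from 1 on. The term
  \<open>I (t + 2)\<close> makes the bump rise on [-2, -1], and subtracting \<open>I (t - 1)\<close>
  makes it fall on [1, 2].\<close>

lemma bump_exists:
  obtains \<phi> :: "real \<Rightarrow> real" where "(\<lambda>t. complex_of_real (\<phi> t)) \<in> test1 2"
    "\<And>t. 0 \<le> \<phi> t" "\<And>t. \<phi> t \<le> 1" "\<And>t. \<bar>t\<bar> \<le> 1 \<Longrightarrow> \<phi> t = 1"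
proof -
  define g where "g t = flat 0 t * flat 0 (1 - t)" for t
  have g0: "g t \<ge> 0" "t \<le> 0 \<or> t \<ge> 1 \<Longrightarrow> g t = 0" for t
    by (auto simp: g_def flat_0_nonneg flat_0_zero)
  have "smooth1 (\<lambda>t. of_real (flat 0 t) * of_real (flat 0 ((-1) * t + 1)))"
    by (intro smooth1_mult_nd(1) smooth1_flat smooth1_affine_nd(1)[of "\<lambda>x. of_real (flat 0 x)", OF smooth1_flat])
  then have sg: "smooth1 (\<lambda>t. of_real (g t))" by (simp add: g_def)
  have cg: "continuous_on UNIV g"
    using continuous_on_Re[OF smooth1_continuous_on0[OF sg, of UNIV]] by simp
  define I where "I t = integral {0..t} g" for t
  have intg: "g integrable_on {a..b}" for a b
    by (intro integrable_continuous_real continuous_on_subset[OF cg]) auto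
  have I': "(I has_vector_derivative g t) (at t)" for t
    unfolding I_def by (rule has_vector_derivative_integral_from) (auto simp: cg g0)
  have mono: "I s \<le> I t" if "s \<le> t" for s t
    by (rule DERIV_nonneg_imp_nondecreasing[OF that])
      (use I' g0 has_real_derivative_iff_has_vector_derivative in blast)
  have I0: "I t = 0" if "t \<le> 0" for t using that by (cases "t = 0") (auto simp: I_def)
  have I1: "I t = I 1" if "t \<ge> 1" for t
  proof -
    have "integral {0..1} g + integral {1..t} g = integral {0..t} g"
      by (rule Henstock_Kurzweil_Integration.integral_combine) (use that intg in auto)
    moreover have "integral {1..t} g = integral {1..t} (\<lambda>_. 0)"
      by (rule integral_cong) (use g0 in auto)
    ultimately show ?thesis by (simp add: I_def)
  qed
  \<comment> \<open>This gives the positivity of \<open>I 1\<close>, by which \<open>\<phi>\<close>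
    is normalized; \<open>g\<close> is positive on [1/4, 3/4] because both flat factors are.\<close>
  have "I (1/4) < I 1"
  proof -
    have "I (1/4) < I (3/4)"
    proof (rule DERIV_pos_imp_increasing[where f = I])
      fix x :: real assume "1/4 \<le> x" "x \<le> 3/4"
      then have "g x > 0" by (auto simp: g_def intro!: mult_pos_pos flat_0_pos)
      then show "\<exists>y. DERIV I x :> y \<and> y > 0"
        using I' has_real_derivative_iff_has_vector_derivative by blast
    qed auto
    then show ?thesis using mono[of "3/4" 1] by simp
  qed
  then have Ipos: "I 1 > 0" using mono[of 0 "1/4"] I0[of 0] by simp
  have sI: "smooth1 (\<lambda>t. of_real (I t))"
    by (rule smooth1_antiderivative[OF sg]) (intro has_vector_derivative_of_real I'[folded has_real_derivative_iff_has_vector_derivative])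
  define \<phi> where "\<phi> t = (I (t + 2) - I (t - 1)) / I 1" for t
  have "smooth1 (\<lambda>t. of_real (1 / I 1) * (of_real (I (1 * t + 2)) + (-1) * of_real (I (1 * t + -1))))"
    by (intro smooth1_add_nd(1) smooth1_cmult_nd(1) smooth1_affine_nd(1)[of "\<lambda>x. of_real (I x)", OF sI])
  then have "smooth1 (\<lambda>t. of_real (\<phi> t))" by (simp add: \<phi>_def)
  moreover have "\<phi> t = 0" if "2 < \<bar>t\<bar>" for t
  proof (cases "t > 0")
    case True
    then show ?thesis using that I1[of "t+2"] I1[of "t-1"] by (simp add: \<phi>_def)
  next
    case False
    then show ?thesis using that I0[of "t+2"] I0[of "t-1"] by (simp add: \<phi>_def)
  qed
  ultimately have "(\<lambda>t. complex_of_real (\<phi> t)) \<in> test1 2" by (simp add: test1_def)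
  moreover have "0 \<le> \<phi> t" for t using mono[of "t-1" "t+2"] Ipos by (simp add: \<phi>_def)
  moreover have "\<phi> t \<le> 1" for t
  proof -
    have "I (t+2) \<le> I 1" using I1[of "t+2"] mono[of "t+2" 1] by (cases "t + 2 \<ge> 1") auto
    moreover have "0 \<le> I (t-1)" using I0[of "t-1"] I0[of 0] mono[of 0 "t-1"] by (cases "t-1 \<ge> 0") auto
    ultimately show ?thesis using Ipos by (simp add: \<phi>_def divide_simps)
  qed
  moreover have "\<phi> t = 1" if "\<bar>t\<bar> \<le> 1" for t
    using I1[of "t+2"] I0[of "t-1"] that Ipos by (simp add: \<phi>_def)
  ultimately show ?thesis using that by blast
qed

section \<open>Tensor product test functions\<close>

definition tens :: "real^'n \<Rightarrow> ('n::finite \<Rightarrow> real \<Rightarrow> complex) \<Rightarrow> real^'n \<Rightarrow> complex" where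
  "tens x h z = (\<Prod>l\<in>UNIV. h l (z$l - x$l))"

text \<open>A Euclidean cube rather than a quasi-ball: integrals of tensor products over it factor
  into one-variable integrals, and it is a full period of the lattice exponentials.\<close>

definition cbx :: "real^'n \<Rightarrow> real \<Rightarrow> (real^'n::finite) set" where
  "cbx x d = {z. \<forall>l. \<bar>z$l - x$l\<bar> \<le> d}"

lemma cbx_eq_cbox: "cbx x d = cbox (x - (\<chi> l. d)) (x + (\<chi> l. d))"
  by (auto simp: cbx_def mem_box_cart abs_le_iff algebra_simps)

lemma compact_cbx: "compact (cbx x d)"
  by (simp add: cbx_eq_cbox compact_cbox)

lemma tens_split: "tens x h z = h i (z$i - x$i) * (\<Prod>l\<in>UNIV-{i}. h l (z$l - x$l))"
  unfolding tens_def by (subst prod.remove[of _ i]) auto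

lemma tens_upd: "tens x (h(i := g)) z = g (z$i - x$i) * (\<Prod>l\<in>UNIV-{i}. h l (z$l - x$l))"
  unfolding tens_split[of x _ z i] by simp

lemma tens_has_partial:
  assumes "\<And>l. smooth1 (h l)"
  shows "((\<lambda>t. tens x h (z + t *\<^sub>R axis i 1)) has_vector_derivative tens x (h(i := nd 1 (h i))) z) (at 0)"
proof -
  have "((h i \<circ> (\<lambda>t. t + (z$i - x$i))) has_vector_derivative (1 *\<^sub>R nd (Suc 0) (h i) (0 + (z$i - x$i)))) (at 0)"
    by (rule vector_diff_chain_at) (use smooth1_deriv[OF assms, of 0 i] in \<open>auto intro!: derivative_eq_intros 
          simp: has_real_derivative_iff_has_vector_derivative[symmetric]\<close>)
  then have "((\<lambda>t. (h i \<circ> (\<lambda>t. t + (z$i - x$i))) t * (\<Prod>l\<in>UNIV-{i}. h l (z$l - x$l))) has_vector_derivative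
      nd 1 (h i) (z$i - x$i) * (\<Prod>l\<in>UNIV-{i}. h l (z$l - x$l))) (at 0)"
    by (intro has_vector_derivative_mult_left) (simp add: o_def)
  moreover have "tens x h (z + t *\<^sub>R axis i 1) = (h i \<circ> (\<lambda>t. t + (z$i - x$i))) t * (\<Prod>l\<in>UNIV-{i}. h l (z$l - x$l))" for t
  proof -
    have "(\<Prod>l\<in>UNIV-{i}. h l ((z + t *\<^sub>R axis i 1)$l - x$l)) = (\<Prod>l\<in>UNIV-{i}. h l (z$l - x$l))"
      by (intro prod.cong) (auto simp: axis_def)
    then show ?thesis unfolding tens_split[of x h _ i] by (simp add: algebra_simps)
  qed
  ultimately show ?thesis by (simp add: tens_upd)
qed

lemma partial_tens:
  assumes "\<And>l. smooth1 (h l)"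
  shows "partial i (tens x h) = tens x (h(i := nd 1 (h i)))"
  unfolding partial_def by (intro ext vector_derivative_at tens_has_partial assms)

text \<open>For tensor products the result depends on the list only through the multiplicities of
  its entries, so partial derivatives visibly commute.\<close>

lemma iter_partial_tens:
  assumes "\<And>l. smooth1 (h l)"
  shows "iter_partial is (tens x h) = tens x (\<lambda>l. nd (count_list is l) (h l))"
proof (induction "is")
  case (Cons i "is")
  have "tens x ((\<lambda>l. nd (count_list is l) (h l))(i := nd 1 (nd (count_list is i) (h i))))
     = tens x (\<lambda>l. nd (count_list (i # is) l) (h l))"
    using nd_add[of 1 "count_list is i" "h i"] by (intro arg_cong[where f = "tens x"]) auto
  then show ?case using Cons by (simp add: partial_tens smooth1_nd assms)
qed simp

lemma continuous_on_tens:
  assumes "\<And>l. continuous_on UNIV (h l)"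
  shows "continuous_on S (tens x h)"
  unfolding tens_def
proof (intro continuous_on_prod)
  fix l show "continuous_on S (\<lambda>z. h l (z$l - x$l))"
    by (rule continuous_on_compose2[OF assms]) (auto intro!: continuous_intros)
qed

lemma smooth_fun_tens:
  assumes "\<And>l. smooth1 (h l)"
  shows "smooth_fun (tens x h)"
proof -
  have *: "(\<lambda>l. nd (count_list is l) (h l))(i := nd 1 (nd (count_list is i) (h i)))
     = (\<lambda>l. nd (count_list (i # is) l) (h l))" for "is" i
    using nd_add[of 1 "count_list is i" "h i"] by auto
  show ?thesis
    unfolding smooth_fun_def iter_partial_tens[OF assms]
    using tens_has_partial[of "\<lambda>l. nd (count_list _ l) (h l)" x _ _, OF smooth1_nd[OF assms], unfolded *]
    by (intro conjI allI continuous_on_tens smooth1_continuous_on assms)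
qed

lemma count_list_replicate': "count_list (replicate n j) i = (if i = j then n else 0)"
  by (induction n) auto

text \<open>\<open>Dm\<close> picks its list by \<open>SOME\<close>; existence is what gives that
  list the prescribed multiplicities.\<close>

lemma ex_list_count: "\<exists>xs. \<forall>i::'n::finite. count_list xs i = \<alpha> i"
proof -
  have "finite S \<Longrightarrow> \<exists>xs. \<forall>i::'n. count_list xs i = (if i \<in> S then \<alpha> i else 0)" for S
  proof (induction S rule: finite_induct)
    case empty
    show ?case by (rule exI[of _ "[]"]) simp
  next
    case (insert j S)
    then obtain xs where "\<forall>i. count_list xs i = (if i \<in> S then \<alpha> i else 0)" by blast
    then show ?case using insert
      by (intro exI[of _ "replicate (\<alpha> j) j @ xs"]) (auto simp: count_list_replicate')
  qed
  from this[of UNIV] show ?thesis by simp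
qed

lemma Dm_tens:
  assumes "\<And>l. smooth1 (h l)"
  shows "Dm \<alpha> (tens x h) = tens x (\<lambda>l. nd (\<alpha> l) (h l))"
proof -
  have "count_list (SOME xs. \<forall>i. count_list xs i = \<alpha> i) l = \<alpha> l" for l
    using someI_ex[OF ex_list_count[of \<alpha>]] by blast
  then show ?thesis unfolding Dm_def iter_partial_tens[OF assms] by presburger
qed

lemma tens_zero_outside:
  assumes "\<And>l. h l \<in> test1 d" "z \<notin> cbx x d"
  shows "tens x h z = 0"
proof -
  obtain l where "d < \<bar>z$l - x$l\<bar>" using assms(2) by (auto simp: cbx_def not_le)
  then have "h l (z$l - x$l) = 0" using test1_zero[OF assms(1)] by blast
  then show ?thesis by (auto simp: tens_def prod_zero_iff)
qed

lemma compact_closure_subset: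
  fixes K :: "'a::t2_space set"
  assumes "closure S \<subseteq> K" "compact K" shows "compact (closure S)"
  using compact_Int_closed[OF assms(2) closed_closure, of S] assms(1) by (simp add: Int_absorb1)

lemma tens_test_fun:
  assumes "\<And>l. h l \<in> test1 d" "cbx x d \<subseteq> \<Omega>"
  shows "tens x h \<in> test_fun \<Omega>"
proof -
  have "closure {z. tens x h z \<noteq> 0} \<subseteq> cbx x d"
    by (rule closure_minimal) (use tens_zero_outside[of h d, OF assms(1)] in \<open>blast intro: compact_imp_closed compact_cbx\<close>)+
  moreover from this have "compact (closure {z. tens x h z \<noteq> 0})"
    by (rule compact_closure_subset[OF _ compact_cbx])
  ultimately show ?thesis
    using assms by (auto simp: test_fun_def intro!: smooth_fun_tens test1_smooth1)
qed

lemma iter_partial_lin: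
  assumes "smooth_fun f" "smooth_fun g"
  shows "iter_partial is (\<lambda>z. c * f z + g z) = (\<lambda>z. c * iter_partial is f z + iter_partial is g z)"
proof (induction "is")
  case (Cons i "is")
  show ?case
  proof
    fix z
    have "((\<lambda>t. c * iter_partial is f (z + t *\<^sub>R axis i 1) + iter_partial is g (z + t *\<^sub>R axis i 1)) has_vector_derivative
       c * iter_partial (i # is) f z + iter_partial (i # is) g z) (at 0)"
      using assms by (intro has_vector_derivative_add has_vector_derivative_mult_right) (auto simp: smooth_fun_def simp del: iter_partial.simps)
    then show "iter_partial (i # is) (\<lambda>z. c * f z + g z) z = c * iter_partial (i # is) f z + iter_partial (i # is) g z"
      using Cons by (auto simp: partial_def intro!: vector_derivative_at)
  qed
qed simp

lemma smooth_fun_lin: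
  assumes "smooth_fun f" "smooth_fun g"
  shows "smooth_fun (\<lambda>z. c * f z + g z)"
proof -
  have "continuous_on UNIV (\<lambda>z. c * iter_partial is f z + iter_partial is g z)" for "is"
    using assms unfolding smooth_fun_def by (intro continuous_intros) blast+
  moreover have "((\<lambda>t. c * iter_partial is f (x + t *\<^sub>R axis i 1) + iter_partial is g (x + t *\<^sub>R axis i 1))
      has_vector_derivative c * iter_partial (i # is) f x + iter_partial (i # is) g x) (at 0)" for "is" i x
    using assms unfolding smooth_fun_def
    by (intro has_vector_derivative_add has_vector_derivative_mult_right) blast+
  ultimately show ?thesis unfolding smooth_fun_def iter_partial_lin[OF assms] by blast
qed

lemma test_fun_lin:
  assumes f: "f \<in> test_fun \<Omega>" and g: "g \<in> test_fun \<Omega>"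
  shows "(\<lambda>z. c * f z + g z) \<in> test_fun \<Omega>"
proof -
  let ?S = "closure {z. f z \<noteq> 0} \<union> closure {z. g z \<noteq> 0}"
  have c: "compact ?S" "?S \<subseteq> \<Omega>" using f g by (auto simp: test_fun_def)
  have "closure {z. c * f z + g z \<noteq> 0} \<subseteq> ?S"
  proof (rule closure_minimal)
    have "{z. c * f z + g z \<noteq> 0} \<subseteq> {z. f z \<noteq> 0} \<union> {z. g z \<noteq> 0}" by auto
    then show "{z. c * f z + g z \<noteq> 0} \<subseteq> ?S" using closure_subset by (meson Un_mono order_trans)
  qed blast
  moreover from this have "compact (closure {z. c * f z + g z \<noteq> 0})"
    by (rule compact_closure_subset[OF _ c(1)])
  ultimately show ?thesis
    using f g c smooth_fun_lin[of f g c] unfolding test_fun_def by blast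
qed

lemma test_fun_zero: "(\<lambda>z. 0) \<in> test_fun \<Omega>"
proof -
  have "iter_partial is (\<lambda>z. 0) = (\<lambda>z::real^'a. 0)" for "is"
    by (induction "is") (auto simp: partial_def)
  then have "smooth_fun (\<lambda>z::real^'a. 0)"
    unfolding smooth_fun_def by (auto simp del: iter_partial.simps)
  then show ?thesis by (simp add: test_fun_def)
qed

lemma test_fun_sum:
  "(\<And>i. i \<in> F \<Longrightarrow> \<phi> i \<in> test_fun \<Omega>) \<Longrightarrow> (\<lambda>z. \<Sum>i\<in>F. c i * \<phi> i z) \<in> test_fun \<Omega>"
  by (induction F rule: infinite_finite_induct) (auto intro!: test_fun_lin test_fun_zero)

lemma distribution_sum:
  assumes T: "is_distribution \<Omega> T"
  shows "finite F \<Longrightarrow> (\<And>i. i \<in> F \<Longrightarrow> \<phi> i \<in> test_fun \<Omega>)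
    \<Longrightarrow> T (\<lambda>z. \<Sum>i\<in>F. c i * \<phi> i z) = (\<Sum>i\<in>F. c i * T (\<phi> i))"
proof (induction F rule: finite_induct)
  case empty
  have "\<forall>\<phi>\<in>test_fun \<Omega>. \<forall>c. T (\<lambda>x. c * \<phi> x) = c * T \<phi>" 
    using T by (auto simp: is_distribution_def)
  from this[rule_format, OF test_fun_zero, of 0] show ?case by simp
next
  case (insert i F)
  have a: "T (\<lambda>x. \<phi> x + \<psi> x) = T \<phi> + T \<psi>" if "\<phi> \<in> test_fun \<Omega>" "\<psi> \<in> test_fun \<Omega>" for \<phi> \<psi>
    using T that unfolding is_distribution_def by blast
  have c: "T (\<lambda>x. c * \<phi> x) = c * T \<phi>" if "\<phi> \<in> test_fun \<Omega>" for \<phi> c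
    using T that unfolding is_distribution_def by blast
  have "(\<lambda>z. c i * \<phi> i z) \<in> test_fun \<Omega>"
    using test_fun_lin[OF _ test_fun_zero, of "\<phi> i" \<Omega> "c i"] insert.prems by simp
  then show ?case using insert by (simp add: a c test_fun_sum)
qed

lemma integ_eq_box:
  assumes "cbx x d \<subseteq> \<Omega>" "\<And>z. z \<notin> cbx x d \<Longrightarrow> g z = 0"
  shows "integ \<Omega> g = (LINT z:cbx x d|lebesgue. g z)"
  unfolding integ_def set_lebesgue_integral_def
proof (intro Bochner_Integration.integral_cong refl)
  fix z show "indicator \<Omega> z *\<^sub>R g z = indicator (cbx x d) z *\<^sub>R g z"
    using assms by (cases "z \<in> cbx x d") (auto simp: indicator_def)
qed

lemma vec_Basis_sum: "(\<Sum>b\<in>(Basis::(real^'n) set). f b *\<^sub>R b) $ l = f (axis l 1)"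
proof -
  have "(\<Sum>b\<in>(Basis::(real^'n) set). f b *\<^sub>R b) $ l = (\<Sum>b\<in>Basis. f b *\<^sub>R b) \<bullet> axis l 1"
    by (simp add: inner_axis)
  also have "\<dots> = f (axis l 1)"
    by (subst inner_sum_left_Basis) (auto simp: axis_in_Basis_iff)
  finally show ?thesis .
qed

lemma prod_Basis_vec: "(\<Prod>b\<in>(Basis::(real^'n::finite) set). G b) = (\<Prod>l\<in>UNIV. G (axis l 1))"
proof -
  have "Basis = (\<lambda>l::'n. axis l (1::real)) ` UNIV" by (auto simp: Basis_vec_def)
  moreover have "inj (\<lambda>l::'n. axis l (1::real))" by (auto simp: inj_def axis_eq_axis)
  ultimately show ?thesis using prod.reindex[of "\<lambda>l::'n. axis l (1::real)" UNIV G] by (simp add: o_def)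
qed

text \<open>Lebesgue measure on \<open>real^'n\<close> is the image of a product measure indexed by
  the basis vectors; \<open>ix\<close> renames each basis vector to its coordinate, after which the
  product formula for integrals applies.\<close>

lemma integral_prod_components:
  fixes F :: "'n::finite \<Rightarrow> real \<Rightarrow> complex"
  assumes "\<And>l. integrable lborel (F l)"
  shows "(\<integral>z. (\<Prod>l\<in>UNIV. F l (z$l)) \<partial>(lborel :: (real^'n) measure)) = (\<Prod>l\<in>UNIV. \<integral>t. F l t \<partial>lborel)"
proof -
  interpret product_sigma_finite "\<lambda>_::real^'n. lborel::real measure" ..
  have [measurable]: "F l \<in> borel_measurable borel" for l using assms[of l] by auto
  define ix where "ix b = (THE l. b = axis l (1::real))" for b :: "real^'n"
  have ix: "ix (axis l 1) = l" for l by (auto simp: ix_def axis_eq_axis)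
  have m: "(\<lambda>z::real^'n. \<Prod>l\<in>UNIV. F l (z$l)) \<in> borel_measurable borel" by measurable
  have "(\<integral>z. (\<Prod>l\<in>UNIV. F l (z$l)) \<partial>(lborel :: (real^'n) measure))
    = (\<integral>f. (\<Prod>l\<in>UNIV. F l ((\<Sum>b\<in>Basis. f b *\<^sub>R b) $ l)) \<partial>(\<Pi>\<^sub>M b\<in>(Basis::(real^'n) set). lborel))"
    by (subst lborel_eq, subst integral_distr) (use m in auto)
  also have "\<dots> = (\<integral>f. (\<Prod>b\<in>Basis. F (ix b) (f b)) \<partial>(\<Pi>\<^sub>M b\<in>(Basis::(real^'n) set). lborel))"
    unfolding vec_Basis_sum prod_Basis_vec ix ..
  also have "\<dots> = (\<Prod>b\<in>(Basis::(real^'n) set). \<integral>t. F (ix b) t \<partial>lborel)"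
    by (rule product_integral_prod) (auto simp: assms)
  also have "\<dots> = (\<Prod>l\<in>UNIV. \<integral>t. F l t \<partial>lborel)" by (simp add: prod_Basis_vec ix)
  finally show ?thesis .
qed

section \<open>Control of a distribution by its pure derivatives\<close>

text \<open>\<open>Sop\<close> integrates a test function after removing its mean with a multiple of the bump \<open>b\<close>, so
  that \<open>f\<close> is the \<open>s\<close>-th derivative of \<open>Sop\<^sup>s f\<close> plus the remainder \<open>Pop\<close>, which is a combination of
  finitely many derivatives of \<open>b\<close>.\<close>

definition Sop :: "real \<Rightarrow> (real \<Rightarrow> complex) \<Rightarrow> (real \<Rightarrow> complex) \<Rightarrow> real \<Rightarrow> complex" where
  "Sop d b f t = integral {-d..t} (\<lambda>s. f s - integral {-d..d} f * b s)"

definition Cop :: "real \<Rightarrow> (real \<Rightarrow> complex) \<Rightarrow> nat \<Rightarrow> (real \<Rightarrow> complex) \<Rightarrow> complex" where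
  "Cop d b j f = integral {-d..d} ((Sop d b ^^ j) f)"

definition Pop :: "real \<Rightarrow> (real \<Rightarrow> complex) \<Rightarrow> nat \<Rightarrow> (real \<Rightarrow> complex) \<Rightarrow> real \<Rightarrow> complex" where
  "Pop d b s f t = (\<Sum>i<s. Cop d b i f * nd i b t)"

lemma test1_integrable: "f \<in> test1 d \<Longrightarrow> f integrable_on {x..y}"
  by (intro integrable_continuous_real smooth1_continuous_on0 test1_smooth1)

text \<open>\<open>test1\<close> speaks only of points strictly outside the interval; continuity
  adds the end points. This removes the boundary terms of the fundamental theorem of calculus
  below.\<close>

lemma test1_zero_le:
  assumes "f \<in> test1 d" "d \<le> \<bar>t\<bar>" shows "f t = 0"
proof -
  consider "d < \<bar>t\<bar>" | "t = d" | "t = -d" using assms(2) by linarith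
  then show ?thesis
  proof cases
    case 2
    have "((\<lambda>s. f s) \<longlongrightarrow> f d) (at_right d)"
      using smooth1_continuous_on0[OF test1_smooth1[OF assms(1)], of UNIV]
      by (meson UNIV_I continuous_on_def tendsto_within_subset subset_UNIV)
    moreover have "((\<lambda>s. f s) \<longlongrightarrow> 0) (at_right d)"
      by (rule tendsto_eventually) (auto intro!: eventually_at_rightI[of d "d+1"] test1_zero[OF assms(1)])
    ultimately show ?thesis using 2 tendsto_unique[OF trivial_limit_at_right_real] by blast
  next
    case 3
    have "((\<lambda>s. f s) \<longlongrightarrow> f (-d)) (at_left (-d))"
      using smooth1_continuous_on0[OF test1_smooth1[OF assms(1)], of UNIV]
      by (meson UNIV_I continuous_on_def tendsto_within_subset subset_UNIV)
    moreover have "((\<lambda>s. f s) \<longlongrightarrow> 0) (at_left (-d))"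
      by (rule tendsto_eventually) (auto intro!: eventually_at_leftI[of "-d-1"] test1_zero[OF assms(1)])
    ultimately show ?thesis using 3 tendsto_unique[OF trivial_limit_at_left_real] by blast
  qed (use test1_zero[OF assms(1)] in auto)
qed

lemma integral_deriv_test1:
  assumes "f \<in> test1 d" "-d \<le> t"
  shows "integral {-d..t} (nd (Suc 0) f) = f t"
proof -
  have "(nd (Suc 0) f has_integral (f t - f (-d))) {-d..t}"
    using smooth1_deriv[OF test1_smooth1[OF assms(1)], of 0]
    by (intro fundamental_theorem_of_calculus assms(2)) (auto intro: has_vector_derivative_at_within)
  moreover have "f (-d) = 0" by (rule test1_zero_le[OF assms(1)]) auto
  ultimately show ?thesis by (simp add: integral_unique)
qed

locale bump1 =
  fixes d :: real and b :: "real \<Rightarrow> complex"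
  assumes d: "0 < d" and b: "b \<in> test1 d" and int_b: "integral {-d..d} b = 1"
begin

lemma sub_test1: "f \<in> test1 d \<Longrightarrow> (\<lambda>s. f s - c * b s) \<in> test1 d"
  using test1_add[of f d "\<lambda>s. (-c) * b s"] test1_cmult[OF b, of "-c"] by simp

text \<open>Subtracting the mean times \<open>b\<close>, which has integral 1, leaves an integrand
  of mean zero; its primitive therefore returns to 0 at \<open>d\<close> and is again supported in
  the interval.\<close>

lemma Sop_test1: "f \<in> test1 d \<Longrightarrow> Sop d b f \<in> test1 d"
  and nd_Sop: "f \<in> test1 d \<Longrightarrow> nd (Suc n) (Sop d b f) = nd n (\<lambda>t. f t - integral {-d..d} f * b t)"
proof -
  assume f: "f \<in> test1 d"
  let ?g = "\<lambda>t. f t - integral {-d..d} f * b t"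
  have g: "?g \<in> test1 d" by (rule sub_test1[OF f])
  have der: "(Sop d b f has_vector_derivative ?g t) (at t)" for t
    unfolding Sop_def
    by (rule has_vector_derivative_integral_from)
      (auto intro!: smooth1_continuous_on0 test1_smooth1[OF g] test1_zero_le[OF g, unfolded right_minus_eq])
  show "nd (Suc n) (Sop d b f) = nd n ?g"
    by (rule smooth1_antiderivative[OF test1_smooth1[OF g] der])
  have "Sop d b f t = 0" if "d < \<bar>t\<bar>" for t
  proof (cases "t < -d")
    case False
    then have t: "d < t" using that by auto
    have "Sop d b f t = integral {-d..d} ?g + integral {d..t} ?g"
      unfolding Sop_def
      by (rule Henstock_Kurzweil_Integration.integral_combine[symmetric]) (use d t test1_integrable[OF g] in auto)
    also have "integral {-d..d} ?g = 0"
      by (subst integral_diff) (use test1_integrable[OF f] test1_integrable[OF test1_cmult[OF b]] int_b in auto)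
    also have "integral {d..t} ?g = integral {d..t} (\<lambda>_. 0)"
      by (rule integral_cong) (auto intro: test1_zero_le[OF g, unfolded right_minus_eq])
    finally show ?thesis by simp
  qed (auto simp: Sop_def)
  then show "Sop d b f \<in> test1 d"
    using smooth1_antiderivative[OF test1_smooth1[OF g] der] by (auto simp: test1_def)
qed

lemma Sop_pow_test1: "f \<in> test1 d \<Longrightarrow> (Sop d b ^^ j) f \<in> test1 d"
  by (induction j) (auto intro: Sop_test1)

lemma Pop_test1: "Pop d b s f \<in> test1 d"
  unfolding Pop_def by (intro test1_sum test1_nd b)

text \<open>A derivative has mean zero, so nothing is subtracted and \<open>Sop\<close> is plain
  integration.\<close>

lemma Sop_nd:
  assumes "f \<in> test1 d" shows "Sop d b (nd (Suc 0) f) = f"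
proof
  fix t
  have f': "nd (Suc 0) f \<in> test1 d" by (rule test1_nd[OF assms])
  have 0: "integral {-d..d} (nd (Suc 0) f) = 0"
    using integral_deriv_test1[OF assms, of d] d test1_zero_le[OF assms, of d] by simp
  show "Sop d b (nd (Suc 0) f) t = f t"
  proof (cases "-d \<le> t")
    case True then show ?thesis by (simp add: Sop_def 0 integral_deriv_test1[OF assms])
  next
    case False
    then show ?thesis using test1_zero[OF Sop_test1[OF f'], of t] test1_zero[OF assms, of t] by auto
  qed
qed

lemma Sop_pow_nd:
  assumes "f \<in> test1 d" shows "(Sop d b ^^ j) (nd (j + k) f) = nd k f"
proof (induction j)
  case (Suc j)
  have "(Sop d b ^^ Suc j) (nd (Suc j + k) f) = (Sop d b ^^ j) (Sop d b (nd (Suc 0) (nd (j + k) f)))"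
    using nd_add[of "Suc 0" "j + k" f] by (simp add: funpow_swap1)
  then show ?case using Suc Sop_nd[OF test1_nd[OF assms]] by simp
qed simp

text \<open>Integrating an \<open>a\<close>-th derivative back fewer than \<open>a\<close> times
  still leaves a derivative, whose mean is zero. This decides in the end which derivatives of
  \<open>b\<close> can occur in the remainder of a differentiated function.\<close>

lemma Cop_nd:
  assumes "f \<in> test1 d" "j < a" shows "Cop d b j (nd a f) = 0"
proof -
  obtain k where k: "a = j + Suc k" using assms(2) less_iff_Suc_add by auto
  have "Cop d b j (nd a f) = integral {-d..d} (nd (Suc k) f)"
    unfolding Cop_def k Sop_pow_nd[OF assms(1)] ..
  also have "nd (Suc k) f = nd (Suc 0) (nd k f)" using nd_add[of "Suc 0" k f] by simp
  also have "integral {-d..d} \<dots> = 0"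
    using integral_deriv_test1[OF test1_nd[OF assms(1)], of d k] d test1_zero_le[OF test1_nd[OF assms(1)], of d k] by simp
  finally show ?thesis .
qed

lemma Pop_decomp:
  assumes "f \<in> test1 d"
  shows "f t = Pop d b s f t + nd s ((Sop d b ^^ s) f) t"
proof (induction s)
  case (Suc s)
  let ?g = "(Sop d b ^^ s) f"
  have g: "?g \<in> test1 d" by (rule Sop_pow_test1[OF assms])
  have "nd (Suc s) ((Sop d b ^^ Suc s) f) = nd s (\<lambda>t. ?g t + (- Cop d b s f) * b t)"
    by (simp add: nd_Sop[OF g] Cop_def)
  also have "\<dots> = (\<lambda>t. nd s ?g t + (- Cop d b s f) * nd s b t)"
    unfolding smooth1_add_nd(2)[OF test1_smooth1[OF g] test1_smooth1[OF test1_cmult[OF b]]]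
      smooth1_cmult_nd(2)[OF test1_smooth1[OF b]] ..
  finally show ?case using Suc by (simp add: Pop_def)
qed (simp add: Pop_def)

end

text \<open>A sup-norm bound that refers to finite combinations instead of single functions:
  cancellation between the terms must survive when the operator acts on one factor in a sum of
  tensor products, where the other factors are absorbed into the coefficients
  \<open>c\<close>.\<close>

definition bdd_op :: "real \<Rightarrow> real \<Rightarrow> ((real \<Rightarrow> complex) \<Rightarrow> real \<Rightarrow> complex) \<Rightarrow> bool" where
  "bdd_op d K L \<longleftrightarrow> 0 \<le> K \<and> (\<forall>(F::nat set) c f \<epsilon>. finite F \<longrightarrow> (\<forall>i\<in>F. f i \<in> test1 d) \<longrightarrow>
     (\<forall>t. cmod (\<Sum>i\<in>F. c i * f i t) \<le> \<epsilon>) \<longrightarrow> (\<forall>t. cmod (\<Sum>i\<in>F. c i * L (f i) t) \<le> K * \<epsilon>))"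

lemma bdd_opD:
  fixes F :: "nat set"
  assumes "bdd_op d K L" "finite F" "\<And>i. i \<in> F \<Longrightarrow> f i \<in> test1 d"
    "\<And>t. cmod (\<Sum>i\<in>F. c i * f i t) \<le> \<epsilon>"
  shows "cmod (\<Sum>i\<in>F. c i * L (f i) t) \<le> K * \<epsilon>"
  using assms unfolding bdd_op_def by blast

lemma bdd_op_comp:
  assumes "bdd_op d K L" "bdd_op d K' L'" "\<And>f. f \<in> test1 d \<Longrightarrow> L f \<in> test1 d"
  shows "bdd_op d (K' * K) (\<lambda>f. L' (L f))"
  unfolding bdd_op_def
proof (intro conjI allI impI)
  show "0 \<le> K' * K" using assms by (auto simp: bdd_op_def)
  fix F :: "nat set" and c f \<epsilon> t
  assume "finite F" "\<forall>i\<in>F. f i \<in> test1 d" "\<forall>t. cmod (\<Sum>i\<in>F. c i * f i t) \<le> \<epsilon>"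
  then have "cmod (\<Sum>i\<in>F. c i * L' (L (f i)) t) \<le> K' * (K * \<epsilon>)"
    by (intro bdd_opD[OF assms(2)] bdd_opD[OF assms(1)] assms(3)) auto
  then show "cmod (\<Sum>i\<in>F. c i * L' (L (f i)) t) \<le> K' * K * \<epsilon>" by (simp add: mult.assoc)
qed

lemma bdd_op_mono: "bdd_op d K L \<Longrightarrow> K \<le> K' \<Longrightarrow> bdd_op d K' L"
  unfolding bdd_op_def
proof (elim conjE, intro conjI allI impI)
  fix F :: "nat set" and c f \<epsilon> t
  assume *: "K \<le> K'" "\<forall>(F::nat set) c f \<epsilon>. finite F \<longrightarrow> (\<forall>i\<in>F. f i \<in> test1 d) \<longrightarrow>
     (\<forall>t. cmod (\<Sum>i\<in>F. c i * f i t) \<le> \<epsilon>) \<longrightarrow> (\<forall>t. cmod (\<Sum>i\<in>F. c i * L (f i) t) \<le> K * \<epsilon>)"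
    "finite F" "\<forall>i\<in>F. f i \<in> test1 d" "\<forall>t. cmod (\<Sum>i\<in>F. c i * f i t) \<le> \<epsilon>"
  have "0 \<le> \<epsilon>" using *(5) norm_ge_zero order_trans by blast
  then have "K * \<epsilon> \<le> K' * \<epsilon>" using *(1) by (rule mult_right_mono[rotated])
  moreover have "cmod (\<Sum>i\<in>F. c i * L (f i) t) \<le> K * \<epsilon>" using * by blast
  ultimately show "cmod (\<Sum>i\<in>F. c i * L (f i) t) \<le> K' * \<epsilon>" by linarith
qed auto

lemma bdd_op_const_mult:
  assumes "bdd_op d K (\<lambda>f t. C f)" "\<And>t. cmod (g t) \<le> B" "0 \<le> B"
  shows "bdd_op d (B * K) (\<lambda>f t. C f * g t)"
  unfolding bdd_op_def
proof (intro conjI allI impI)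
  show "0 \<le> B * K" using assms by (auto simp: bdd_op_def)
  fix F :: "nat set" and c f \<epsilon> t
  assume *: "finite F" "\<forall>i\<in>F. f i \<in> test1 d" "\<forall>t. cmod (\<Sum>i\<in>F. c i * f i t) \<le> \<epsilon>"
  then have 1: "cmod (\<Sum>i\<in>F. c i * C (f i)) \<le> K * \<epsilon>"
    by (intro bdd_opD[OF assms(1)]) auto
  have "(\<Sum>i\<in>F. c i * (C (f i) * g t)) = g t * (\<Sum>i\<in>F. c i * C (f i))"
    by (simp add: sum_distrib_left mult_ac)
  then show "cmod (\<Sum>i\<in>F. c i * (C (f i) * g t)) \<le> B * K * \<epsilon>"
    using mult_mono[OF assms(2) 1 assms(3), of t] by (simp add: norm_mult mult.assoc)
qed

lemma bdd_op_sum: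
  assumes "\<And>i. i < (n::nat) \<Longrightarrow> \<exists>K. bdd_op d K (L i)"
  shows "\<exists>K. bdd_op d K (\<lambda>f t. \<Sum>i<n. L i f t)"
  using assms
proof (induction n)
  case 0
  have "bdd_op d 0 (\<lambda>f t. \<Sum>i<0. L i f t)" by (auto simp: bdd_op_def)
  then show ?case by blast
next
  case (Suc n)
  obtain K where K: "bdd_op d K (\<lambda>f t. \<Sum>i<n. L i f t)" using Suc by (meson less_Suc_eq)
  obtain K' where K': "bdd_op d K' (L n)" using Suc by blast
  have "bdd_op d (K + K') (\<lambda>f t. \<Sum>i<Suc n. L i f t)"
    unfolding bdd_op_def
  proof (intro conjI allI impI)
    show "0 \<le> K + K'" using K K' by (auto simp: bdd_op_def)
    fix F :: "nat set" and c f \<epsilon> t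
    assume *: "finite F" "\<forall>i\<in>F. f i \<in> test1 d" "\<forall>t. cmod (\<Sum>i\<in>F. c i * f i t) \<le> \<epsilon>"
    have "cmod (\<Sum>i\<in>F. c i * (\<Sum>j<n. L j (f i) t)) \<le> K * \<epsilon>"
      "cmod (\<Sum>i\<in>F. c i * L n (f i) t) \<le> K' * \<epsilon>"
      using * by (auto intro!: bdd_opD[OF K] bdd_opD[OF K'])
    moreover have "(\<Sum>i\<in>F. c i * (\<Sum>j<Suc n. L j (f i) t)) = (\<Sum>i\<in>F. c i * (\<Sum>j<n. L j (f i) t)) + (\<Sum>i\<in>F. c i * L n (f i) t)"
      by (simp add: sum.distrib algebra_simps)
    ultimately show "cmod (\<Sum>i\<in>F. c i * (\<Sum>j<Suc n. L j (f i) t)) \<le> (K + K') * \<epsilon>"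
      using norm_triangle_ineq[of "(\<Sum>i\<in>F. c i * (\<Sum>j<n. L j (f i) t))" "(\<Sum>i\<in>F. c i * L n (f i) t)"]
      by (simp add: algebra_simps)
  qed
  then show ?case by blast
qed

context bump1
begin

lemma bdd_op_integral: "bdd_op d (2 * d) (\<lambda>f t. integral {-d..d} f)"
  unfolding bdd_op_def
proof (intro conjI allI impI)
  show "0 \<le> 2 * d" using d by simp
  fix F :: "nat set" and c f \<epsilon> and t :: real
  assume *: "finite F" "\<forall>i\<in>F. f i \<in> test1 d" "\<forall>t. cmod (\<Sum>i\<in>F. c i * f i t) \<le> \<epsilon>"
  have "(\<Sum>i\<in>F. c i * integral {-d..d} (f i)) = integral {-d..d} (\<lambda>t. \<Sum>i\<in>F. c i * f i t)"
    using * by (subst integral_sum) (auto intro!: integrable_on_mult_right test1_integrable[of _ d] test1_cmult)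
  also have "cmod \<dots> \<le> \<epsilon> * (d - (- d))"
    by (rule integral_bound) (use * d in \<open>auto intro!: smooth1_continuous_on0 test1_smooth1[of _ d] test1_sum\<close>)
  finally show "cmod (\<Sum>i\<in>F. c i * integral {-d..d} (f i)) \<le> 2 * d * \<epsilon>" by (simp add: algebra_simps)
qed

lemma bdd_op_Sop: "\<exists>K. bdd_op d K (Sop d b)"
proof -
  obtain B where B: "B > 0" "\<And>t. cmod (b t) \<le> B" using test1_bounded[OF b] by blast
  have "bdd_op d (2 * d * (1 + 2 * d * B)) (Sop d b)"
    unfolding bdd_op_def
  proof (intro conjI allI impI)
    show "0 \<le> 2 * d * (1 + 2 * d * B)" using d B by simp
    fix F :: "nat set" and c f \<epsilon> and t :: real
    assume *: "finite F" "\<forall>i\<in>F. f i \<in> test1 d" "\<forall>t. cmod (\<Sum>i\<in>F. c i * f i t) \<le> \<epsilon>"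
    have \<epsilon>: "0 \<le> \<epsilon>" using *(3) norm_ge_zero order_trans by blast
    let ?g = "\<lambda>i s. f i s - integral {-d..d} (f i) * b s"
    have g: "?g i \<in> test1 d" if "i \<in> F" for i using * that by (auto intro: sub_test1)
    show "cmod (\<Sum>i\<in>F. c i * Sop d b (f i) t) \<le> 2 * d * (1 + 2 * d * B) * \<epsilon>"
    proof (cases "\<bar>t\<bar> \<le> d")
      case True
      have "(\<Sum>i\<in>F. c i * Sop d b (f i) t) = integral {-d..t} (\<lambda>s. \<Sum>i\<in>F. c i * ?g i s)"
        unfolding Sop_def using *(1) 
        by (subst integral_sum) (auto intro!: integrable_on_mult_right test1_integrable[OF g])
      also have "cmod \<dots> \<le> ((1 + 2 * d * B) * \<epsilon>) * (t - (- d))"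
      proof (rule integral_bound)
        show "continuous_on {-d..t} (\<lambda>s. \<Sum>i\<in>F. c i * ?g i s)"
          by (intro smooth1_continuous_on0 test1_smooth1[of _ d] test1_sum g)
        fix s
        have "(\<Sum>i\<in>F. c i * ?g i s) = (\<Sum>i\<in>F. c i * f i s) - b s * (\<Sum>i\<in>F. c i * integral {-d..d} (f i))"
          by (simp add: algebra_simps sum_subtractf sum_distrib_left)
        moreover have "cmod (\<Sum>i\<in>F. c i * integral {-d..d} (f i)) \<le> 2 * d * \<epsilon>"
          using * by (intro bdd_opD[OF bdd_op_integral]) auto
        ultimately have "cmod (\<Sum>i\<in>F. c i * ?g i s) \<le> \<epsilon> + B * (2 * d * \<epsilon>)"
          using *(3) B d \<epsilon> by (auto intro!: order_trans[OF norm_triangle_ineq4] add_mono mult_mono simp: norm_mult)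
        then show "cmod (\<Sum>i\<in>F. c i * ?g i s) \<le> (1 + 2 * d * B) * \<epsilon>" by (simp add: algebra_simps)
      qed (use True in auto)
      also have "\<dots> \<le> ((1 + 2 * d * B) * \<epsilon>) * (2 * d)"
        using True d B \<epsilon> by (intro mult_left_mono mult_nonneg_nonneg) auto
      finally show ?thesis by (simp add: algebra_simps)
    next
      case False
      then have "Sop d b (f i) t = 0" if "i \<in> F" for i
        using test1_zero[OF Sop_test1] * that by (meson not_le)
      then show ?thesis using d B \<epsilon> by simp
    qed
  qed
  then show ?thesis by blast
qed

lemma bdd_op_id: "bdd_op d 1 (\<lambda>f. f)" by (auto simp: bdd_op_def)

lemma bdd_op_Sop_pow: "\<exists>K. bdd_op d K (Sop d b ^^ j)"
proof (induction j)
  case 0 show ?case using bdd_op_id by (auto simp: id_def)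
next
  case (Suc j)
  then obtain K K' where "bdd_op d K (Sop d b ^^ j)" "bdd_op d K' (Sop d b)" using bdd_op_Sop by blast
  from bdd_op_comp[OF this] Sop_pow_test1 show ?case by (auto simp: o_def)
qed

lemma bdd_op_Cop: "\<exists>K. bdd_op d K (\<lambda>f t. Cop d b j f)"
proof -
  obtain K where "bdd_op d K (Sop d b ^^ j)" using bdd_op_Sop_pow by blast
  from bdd_op_comp[OF this bdd_op_integral] Sop_pow_test1 show ?thesis by (auto simp: Cop_def)
qed

lemma bdd_op_Pop: "\<exists>K. bdd_op d K (Pop d b s)"
proof -
  have "\<exists>K. bdd_op d K (\<lambda>f t. Cop d b i f * nd i b t)" for i
  proof -
    obtain B where "B > 0" "\<And>t. cmod (nd i b t) \<le> B" using test1_bounded[OF test1_nd[OF b]] by blast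
    then show ?thesis using bdd_op_const_mult bdd_op_Cop by (meson less_imp_le)
  qed
  from bdd_op_sum[of s d "\<lambda>i f t. Cop d b i f * nd i b t", OF this] show ?thesis
    by (simp add: Pop_def[abs_def])
qed

end

lemma tens_bdd_op:
  fixes F :: "nat set"
  assumes L: "bdd_op d K L" and F: "finite F" "\<And>i. i \<in> F \<Longrightarrow> h i l \<in> test1 d"
    and le: "\<And>z. cmod (\<Sum>i\<in>F. c i * tens x (h i) z) \<le> \<epsilon>"
  shows "cmod (\<Sum>i\<in>F. c i * tens x ((h i)(l := L (h i l))) z) \<le> K * \<epsilon>"
proof -
  define c' where "c' i = c i * (\<Prod>k\<in>UNIV-{l}. h i k (z$k - x$k))" for i
  have "cmod (\<Sum>i\<in>F. c' i * L (h i l) (z$l - x$l)) \<le> K * \<epsilon>"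
  proof (rule bdd_opD[OF L])
    fix t
    define z' where "z' = (\<chi> k. if k = l then x$l + t else z$k)"
    have "tens x (h i) z' = h i l t * (\<Prod>k\<in>UNIV-{l}. h i k (z$k - x$k))" for i
      unfolding tens_split[of x _ _ l] by (auto simp: z'_def intro!: prod.cong)
    then have "(\<Sum>i\<in>F. c' i * h i l t) = (\<Sum>i\<in>F. c i * tens x (h i) z')"
      by (simp add: c'_def mult_ac)
    then show "cmod (\<Sum>i\<in>F. c' i * h i l t) \<le> \<epsilon>" using le by simp
  qed (use F in auto)
  then show ?thesis by (simp add: tens_upd c'_def mult_ac)
qed

lemma tens_bdd_ops:
  fixes F :: "nat set" and L :: "'n::finite \<Rightarrow> _"
  assumes L: "\<And>l. bdd_op d K (L l)" and F: "finite F" "\<And>i l. i \<in> F \<Longrightarrow> h i l \<in> test1 d"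
    and le: "\<And>z. cmod (\<Sum>i\<in>F. c i * tens x (h i) z) \<le> \<epsilon>"
  shows "cmod (\<Sum>i\<in>F. c i * tens x (\<lambda>l. L l (h i l)) z) \<le> K ^ CARD('n) * \<epsilon>"
proof -
  have "finite V \<Longrightarrow> \<forall>z. cmod (\<Sum>i\<in>F. c i * tens x (\<lambda>l. if l \<in> V then L l (h i l) else h i l) z) \<le> K ^ card V * \<epsilon>" for V
  proof (induction V rule: finite_induct)
    case empty then show ?case using le by simp
  next
    case (insert k V)
    have "cmod (\<Sum>i\<in>F. c i * tens x ((\<lambda>l. if l \<in> V then L l (h i l) else h i l)(k := L k ((\<lambda>l. if l \<in> V then L l (h i l) else h i l) k))) z)
      \<le> K * (K ^ card V * \<epsilon>)" for z
      by (rule tens_bdd_op[OF L F(1)]) (use insert F(2) in auto)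
    moreover have "((\<lambda>l. if l \<in> V then L l (h i l) else h i l)(k := L k ((\<lambda>l. if l \<in> V then L l (h i l) else h i l) k)))
      = (\<lambda>l. if l \<in> insert k V then L l (h i l) else h i l)" for i
      using insert(2) by (auto simp: fun_eq_iff)
    ultimately show ?case using insert(1,2) by (simp add: mult.assoc)
  qed
  from this[of UNIV] show ?thesis by simp
qed

lemma measure_cbx: "0 \<le> d \<Longrightarrow> measure lebesgue (cbx (x::real^'n::finite) d) = (2 * d) ^ CARD('n)"
proof -
  assume "0 \<le> d"
  then have "cbox (x - (\<chi> l. d)) (x + (\<chi> l. d)) \<noteq> {}" by (auto simp: interval_ne_empty_cart)
  then show ?thesis by (simp add: cbx_eq_cbox content_cbox_cart)
qed

lemma cbx_lmeasurable: "cbx x d \<in> lmeasurable"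
  by (simp add: cbx_eq_cbox)

lemma cbx_sets_lebesgue [simp]: "cbx x d \<in> sets lebesgue"
  by (simp add: cbx_eq_cbox)

lemma set_integral_cbx_bound:
  fixes w :: "real^'n::finite \<Rightarrow> complex"
  assumes "0 \<le> d" "\<And>z. z \<in> cbx x d \<Longrightarrow> cmod (w z) \<le> B"
  shows "cmod (LINT z:cbx x d|lebesgue. w z) \<le> B * (2 * d) ^ CARD('n)"
proof -
  have B: "0 \<le> B" using assms(2)[of x] assms(1) by (auto simp: cbx_def intro: order_trans[OF norm_ge_zero])
  have "cmod (LINT z:cbx x d|lebesgue. w z) \<le> (\<integral>z. cmod (indicator (cbx x d) z *\<^sub>R w z) \<partial>lebesgue)"
    unfolding set_lebesgue_integral_def by (rule integral_norm_bound)
  also have "\<dots> \<le> (\<integral>z. B * indicator (cbx x d) z \<partial>lebesgue)"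
  proof (rule integral_mono')
    show "integrable lebesgue (\<lambda>z. B * indicator (cbx x d) z)"
      using cbx_lmeasurable[of x d]
      by (intro integrable_mult_right integrable_real_indicator) (auto simp: fmeasurable_def)
  qed (use assms B in \<open>auto simp: indicator_def\<close>)
  also have "\<dots> = B * (2 * d) ^ CARD('n)" by (simp add: measure_cbx assms(1))
  finally show ?thesis .
qed

lemma set_integrable_cbx_continuous:
  fixes w :: "real^'n::finite \<Rightarrow> complex"
  shows "continuous_on (cbx x d) w \<Longrightarrow> set_integrable lebesgue (cbx x d) w"
  by (simp add: cbx_eq_cbox absolutely_integrable_continuous)

lemma set_integral_sum_mult:
  fixes G :: "'i \<Rightarrow> 'a \<Rightarrow> complex"
  assumes "\<And>i. i \<in> F \<Longrightarrow> set_integrable M S (G i)"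
  shows "(\<Sum>i\<in>F. c i * (LINT z:S|M. G i z)) = (LINT z:S|M. \<Sum>i\<in>F. c i * G i z)"
proof -
  have "(LINT z:S|M. \<Sum>i\<in>F. c i * G i z) = (\<integral>z. (\<Sum>i\<in>F. c i * (indicator S z *\<^sub>R G i z)) \<partial>M)"
    by (simp add: set_lebesgue_integral_def scaleR_sum_right)
  also have "\<dots> = (\<Sum>i\<in>F. (\<integral>z. c i * (indicator S z *\<^sub>R G i z) \<partial>M))"
    by (rule Bochner_Integration.integral_sum) (intro integrable_mult_right assms[unfolded set_integrable_def])
  also have "\<dots> = (\<Sum>i\<in>F. c i * (LINT z:S|M. G i z))"
    unfolding set_lebesgue_integral_def by (intro sum.cong refl integral_mult_right_zero)
  finally show ?thesis ..
qed

locale dbox = bump1 d b for d :: real and b +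
  fixes \<Omega> :: "(real^'n::finite) set" and T and A :: "'n mindex set" and v x M
  assumes T: "is_distribution \<Omega> T" and sub: "cbx x d \<subseteq> \<Omega>"
    and v_cont: "\<And>\<alpha>. \<alpha> \<in> A \<Longrightarrow> continuous_on \<Omega> (v \<alpha>)"
    and v_deriv: "\<And>\<alpha>. \<alpha> \<in> A \<Longrightarrow> distr_deriv_eq \<Omega> T \<alpha> (v \<alpha>)"
    and v_le: "\<And>\<alpha> z. \<alpha> \<in> A \<Longrightarrow> z \<in> \<Omega> \<Longrightarrow> cmod (v \<alpha> z) \<le> M"
    and M: "0 \<le> M"
begin

lemma T_Dm:
  assumes "\<alpha> \<in> A" "\<And>l. h l \<in> test1 d"
  shows "T (tens x (\<lambda>l. nd (\<alpha> l) (h l))) = (-1) ^ mlen \<alpha> * (LINT z:cbx x d|lebesgue. v \<alpha> z * tens x h z)"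
proof -
  have "(-1) ^ mlen \<alpha> * T (Dm \<alpha> (tens x h)) = integ \<Omega> (\<lambda>z. v \<alpha> z * tens x h z)"
    using v_deriv[OF assms(1)] tens_test_fun[OF assms(2) sub] by (auto simp: distr_deriv_eq_def)
  also have "\<dots> = (LINT z:cbx x d|lebesgue. v \<alpha> z * tens x h z)"
    by (rule integ_eq_box[OF sub]) (simp add: tens_zero_outside[OF assms(2)])
  also have "Dm \<alpha> (tens x h) = tens x (\<lambda>l. nd (\<alpha> l) (h l))"
    by (rule Dm_tens) (rule test1_smooth1[OF assms(2)])
  finally have "(-1) ^ mlen \<alpha> * ((-1) ^ mlen \<alpha> * T (tens x (\<lambda>l. nd (\<alpha> l) (h l)))) 
     = (-1) ^ mlen \<alpha> * (LINT z:cbx x d|lebesgue. v \<alpha> z * tens x h z)" by simp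
  then show ?thesis by (simp add: power_mult_distrib[symmetric] mult.assoc[symmetric])
qed

lemma v_tens_integrable:
  assumes "\<alpha> \<in> A" "\<And>l. h l \<in> test1 d"
  shows "set_integrable lebesgue (cbx x d) (\<lambda>z. v \<alpha> z * tens x h z)"
  by (intro set_integrable_cbx_continuous continuous_on_mult continuous_on_tens
      continuous_on_subset[OF v_cont sub] assms smooth1_continuous_on0 test1_smooth1[OF assms(2)])

lemma T_add: "\<phi> \<in> test_fun \<Omega> \<Longrightarrow> \<psi> \<in> test_fun \<Omega> \<Longrightarrow> T (\<lambda>x. \<phi> x + \<psi> x) = T \<phi> + T \<psi>"
  using T unfolding is_distribution_def by blast

text \<open>By \<open>Pop_decomp\<close> in the variable \<open>l\<close>, the factor splits into
  its \<open>Pop\<close> part and an \<open>s\<close>-th derivative. On the latter \<open>T\<close>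
  is an integral against the pure derivative of order \<open>s\<close> in direction
  \<open>l\<close>, which is indexed by an element of \<open>A\<close> and hence bounded by
  \<open>M\<close>; \<open>K\<close> is the cost of integrating the factor back \<open>s\<close>
  times.\<close>

lemma T_step:
  fixes F :: "nat set"
  assumes K: "bdd_op d K (Sop d b ^^ s)" and s: "(\<lambda>k. if k = l then s else 0) \<in> A"
    and F: "finite F" "\<And>i l. i \<in> F \<Longrightarrow> h i l \<in> test1 d"
    and le: "\<And>z. cmod (\<Sum>i\<in>F. c i * tens x (h i) z) \<le> \<epsilon>"
  shows "cmod (\<Sum>i\<in>F. c i * T (tens x (h i)))
    \<le> cmod (\<Sum>i\<in>F. c i * T (tens x ((h i)(l := Pop d b s (h i l))))) + M * (K * \<epsilon>) * (2 * d) ^ CARD('n)"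
proof -
  define e where "e = (\<lambda>k. if k = l then s else 0)"
  let ?g = "\<lambda>i. (h i)(l := (Sop d b ^^ s) (h i l))"
  have g: "?g i k \<in> test1 d" if "i \<in> F" for i k using F(2)[OF that] Sop_pow_test1 by auto
  have 1: "T (tens x (h i)) = T (tens x ((h i)(l := Pop d b s (h i l)))) + T (tens x (\<lambda>k. nd (e k) (?g i k)))"
    if "i \<in> F" for i
  proof -
    have "tens x (h i) z = tens x ((h i)(l := Pop d b s (h i l))) z + tens x (\<lambda>k. nd (e k) (?g i k)) z" for z
    proof -
      have "(\<lambda>k. nd (e k) (?g i k)) = (h i)(l := nd s ((Sop d b ^^ s) (h i l)))"
        by (auto simp: e_def)
      then show ?thesis
        using Pop_decomp[OF F(2)[OF that], of l "z$l - x$l" s]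
        by (simp only: tens_upd tens_split[of x "h i" z l]) (simp add: algebra_simps)
    qed
    then have eq: "tens x (h i) = (\<lambda>z. tens x ((h i)(l := Pop d b s (h i l))) z + tens x (\<lambda>k. nd (e k) (?g i k)) z)" by blast
    have t1: "tens x ((h i)(l := Pop d b s (h i l))) \<in> test_fun \<Omega>"
      using F(2)[OF that] Pop_test1 by (intro tens_test_fun[OF _ sub]) auto
    have t2: "tens x (\<lambda>k. nd (e k) (?g i k)) \<in> test_fun \<Omega>"
      by (intro tens_test_fun[OF _ sub] test1_nd g that)
    show ?thesis by (subst eq) (rule T_add[OF t1 t2])
  qed
  have T_Dm': "T (tens x (\<lambda>k. nd (e k) (?g i k))) = (-1) ^ mlen e * (LINT z:cbx x d|lebesgue. v e z * tens x (?g i) z)"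
    if "i \<in> F" for i by (rule T_Dm[OF s[folded e_def] g[OF that]])
  have "(\<Sum>i\<in>F. c i * T (tens x (\<lambda>k. nd (e k) (?g i k))))
     = (-1) ^ mlen e * (\<Sum>i\<in>F. c i * (LINT z:cbx x d|lebesgue. v e z * tens x (?g i) z))"
    unfolding sum_distrib_left
    by (intro sum.cong refl) (simp only: T_Dm' mult.left_commute)
  also have "(\<Sum>i\<in>F. c i * (LINT z:cbx x d|lebesgue. v e z * tens x (?g i) z))
     = (LINT z:cbx x d|lebesgue. \<Sum>i\<in>F. c i * (v e z * tens x (?g i) z))"
    by (rule set_integral_sum_mult, rule v_tens_integrable[OF s[folded e_def] g])
  also have "\<dots> = (LINT z:cbx x d|lebesgue. v e z * (\<Sum>i\<in>F. c i * tens x (?g i) z))"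
    by (simp add: sum_distrib_left mult_ac)
  finally have "cmod (\<Sum>i\<in>F. c i * T (tens x (\<lambda>k. nd (e k) (?g i k))))
     = cmod (LINT z:cbx x d|lebesgue. v e z * (\<Sum>i\<in>F. c i * tens x (?g i) z))"
    by (simp add: norm_mult norm_power)
  also have "\<dots> \<le> (M * (K * \<epsilon>)) * (2 * d) ^ CARD('n)"
  proof (rule set_integral_cbx_bound)
    fix z assume z: "z \<in> cbx x d"
    have "cmod (\<Sum>i\<in>F. c i * tens x (?g i) z) \<le> K * \<epsilon>"
      by (rule tens_bdd_op[OF K F(1)]) (use F le in auto)
    moreover have "cmod (v e z) \<le> M" using v_le[OF s[folded e_def]] sub z by auto
    ultimately show "cmod (v e z * (\<Sum>i\<in>F. c i * tens x (?g i) z)) \<le> M * (K * \<epsilon>)"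
      using M by (auto simp: norm_mult intro!: mult_mono)
  qed (use d in auto)
  finally have 2: "cmod (\<Sum>i\<in>F. c i * T (tens x (\<lambda>k. nd (e k) (?g i k)))) \<le> M * (K * \<epsilon>) * (2 * d) ^ CARD('n)" .
  have "(\<Sum>i\<in>F. c i * T (tens x (h i))) = (\<Sum>i\<in>F. c i * T (tens x ((h i)(l := Pop d b s (h i l)))))
     + (\<Sum>i\<in>F. c i * T (tens x (\<lambda>k. nd (e k) (?g i k))))"
    unfolding sum.distrib[symmetric] by (intro sum.cong refl) (simp add: 1 algebra_simps)
  then show ?thesis using 2 norm_triangle_ineq[of "\<Sum>i\<in>F. c i * T (tens x ((h i)(l := Pop d b s (h i l))))"]
    by (smt (verit))
qed

text \<open>The coordinates are treated one after the other. Those already treated carry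
  \<open>Pop\<close>, the others the identity, so at each stage the sum is bounded by
  \<open>K ^ CARD('n) * \<epsilon>\<close>; \<open>1 \<le> K\<close> lets one constant serve for
  both. The last factor \<open>K\<close> comes from the step itself.\<close>

lemma T_all_steps:
  fixes F :: "nat set" and s :: "'n mindex"
  assumes K: "\<And>l. bdd_op d K (Sop d b ^^ s l)" "\<And>l. bdd_op d K (Pop d b (s l))" "1 \<le> K"
    and s: "\<And>l. (\<lambda>k. if k = l then s l else 0) \<in> A"
    and F: "finite F" "\<And>i l. i \<in> F \<Longrightarrow> h i l \<in> test1 d"
    and le: "\<And>z. cmod (\<Sum>i\<in>F. c i * tens x (h i) z) \<le> \<epsilon>"
  shows "cmod (\<Sum>i\<in>F. c i * T (tens x (h i)))
    \<le> cmod (\<Sum>i\<in>F. c i * T (tens x (\<lambda>l. Pop d b (s l) (h i l))))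
       + CARD('n) * (M * (K ^ (CARD('n) + 1) * \<epsilon>) * (2 * d) ^ CARD('n))"
proof -
  have \<epsilon>: "0 \<le> \<epsilon>" using le norm_ge_zero order_trans by blast
  define hh where "hh V i = (\<lambda>l. if l \<in> V then Pop d b (s l) (h i l) else h i l)" for V i
  have "finite V \<Longrightarrow> cmod (\<Sum>i\<in>F. c i * T (tens x (h i))) \<le> cmod (\<Sum>i\<in>F. c i * T (tens x (hh V i)))
       + card V * (M * (K ^ (CARD('n) + 1) * \<epsilon>) * (2 * d) ^ CARD('n))" for V
  proof (induction V rule: finite_induct)
    case empty show ?case by (simp add: hh_def)
  next
    case (insert k V)
    have L: "bdd_op d K (if l \<in> V then Pop d b (s l) else (\<lambda>f. f))" for l
      using K bdd_op_mono[OF bdd_op_id K(3)] by auto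
    have hhL: "hh V i = (\<lambda>l. (if l \<in> V then Pop d b (s l) else (\<lambda>f. f)) (h i l))" for i
      by (auto simp: hh_def)
    have "cmod (\<Sum>i\<in>F. c i * T (tens x (hh V i)))
      \<le> cmod (\<Sum>i\<in>F. c i * T (tens x ((hh V i)(k := Pop d b (s k) (hh V i k))))) + M * (K * (K ^ CARD('n) * \<epsilon>)) * (2 * d) ^ CARD('n)"
    proof (rule T_step[OF K(1) s F(1)])
      show "hh V i l \<in> test1 d" if "i \<in> F" for i l using F(2)[OF that] Pop_test1 by (auto simp: hh_def)
      show "cmod (\<Sum>i\<in>F. c i * tens x (hh V i) z) \<le> K ^ CARD('n) * \<epsilon>" for z
        unfolding hhL by (rule tens_bdd_ops[OF L F le])
    qed
    moreover have "(hh V i)(k := Pop d b (s k) (hh V i k)) = hh (insert k V) i" for i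
      using insert(2) by (auto simp: hh_def)
    ultimately show ?case using insert by (simp add: algebra_simps)
  qed
  from this[of UNIV] show ?thesis by (simp add: hh_def)
qed

text \<open>After all steps only finitely many tensors of derivatives \<open>nd (j l) b\<close>
  remain. If \<open>j\<close> dominates an index \<open>a\<close> of \<open>A\<close>, then
  \<open>T\<close> on such a tensor is an integral of \<open>v a\<close>; otherwise its coefficient
  is zero, since every term was differentiated at least as often as some index of
  \<open>A\<close>.\<close>

lemma T_final:
  fixes F :: "nat set" and s :: "'n mindex"
  assumes K: "\<And>l j. j < s l \<Longrightarrow> bdd_op d K (\<lambda>f t. Cop d b j f)"
    and B: "\<And>l t j. j < s l \<Longrightarrow> cmod (nd j b t) \<le> B" "0 \<le> B" "0 \<le> K"
    and F: "finite F" "\<And>i l. i \<in> F \<Longrightarrow> f i l \<in> test1 d" "\<And>i. i \<in> F \<Longrightarrow> \<exists>a\<in>A. a \<le> \<alpha> i"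
    and le: "\<And>z. cmod (\<Sum>i\<in>F. c i * tens x (\<lambda>l. nd (\<alpha> i l) (f i l)) z) \<le> \<epsilon>"
  shows "cmod (\<Sum>i\<in>F. c i * T (tens x (\<lambda>l. Pop d b (s l) (nd (\<alpha> i l) (f i l)))))
    \<le> (\<Prod>l\<in>UNIV. s l) * (K ^ CARD('n) * \<epsilon> * (M * B ^ CARD('n) * (2 * d) ^ CARD('n)))"
proof -
  have \<epsilon>: "0 \<le> \<epsilon>" using le norm_ge_zero order_trans by blast
  let ?J = "PiE UNIV (\<lambda>l. {..<s l})"
  have fJ: "finite ?J" by (intro finite_PiE) auto
  define D where "D i j = (\<Prod>l\<in>UNIV. Cop d b (j l) (nd (\<alpha> i l) (f i l)))" for i j
  have tf: "tens x (\<lambda>l. nd (j l) b) \<in> test_fun \<Omega>" for j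
    by (intro tens_test_fun[OF _ sub] test1_nd b)
  have "T (tens x (\<lambda>l. Pop d b (s l) (nd (\<alpha> i l) (f i l)))) = (\<Sum>j\<in>?J. D i j * T (tens x (\<lambda>l. nd (j l) b)))"
    if "i \<in> F" for i
  proof -
    have "tens x (\<lambda>l. Pop d b (s l) (nd (\<alpha> i l) (f i l))) = (\<lambda>z. \<Sum>j\<in>?J. D i j * tens x (\<lambda>l. nd (j l) b) z)"
      unfolding tens_def Pop_def D_def prod.distrib[symmetric] by (subst prod_sum_PiE) auto
    then show ?thesis by (simp add: distribution_sum[OF T fJ tf])
  qed
  then have "(\<Sum>i\<in>F. c i * T (tens x (\<lambda>l. Pop d b (s l) (nd (\<alpha> i l) (f i l)))))
    = (\<Sum>i\<in>F. \<Sum>j\<in>?J. c i * D i j * T (tens x (\<lambda>l. nd (j l) b)))"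
    by (simp add: sum_distrib_left mult.assoc)
  also have "\<dots> = (\<Sum>j\<in>?J. (\<Sum>i\<in>F. c i * D i j) * T (tens x (\<lambda>l. nd (j l) b)))"
    by (subst sum.swap) (simp add: sum_distrib_right)
  also have "cmod \<dots> \<le> of_nat (card ?J) * (K ^ CARD('n) * \<epsilon> * (M * B ^ CARD('n) * (2 * d) ^ CARD('n)))"
  proof (rule sum_norm_bound)
    fix j assume j: "j \<in> ?J"
    show "cmod ((\<Sum>i\<in>F. c i * D i j) * T (tens x (\<lambda>l. nd (j l) b))) \<le> K ^ CARD('n) * \<epsilon> * (M * B ^ CARD('n) * (2 * d) ^ CARD('n))"
    proof (cases "\<exists>a\<in>A. a \<le> j")
      case True
      then obtain a where a: "a \<in> A" "a \<le> j" by blast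
      have "(\<lambda>l. nd (j l) b) = (\<lambda>l. nd (a l) (nd (j l - a l) b))"
        using a(2) by (auto simp: nd_add[symmetric] le_fun_def)
      then have "T (tens x (\<lambda>l. nd (j l) b)) = (-1) ^ mlen a * (LINT z:cbx x d|lebesgue. v a z * tens x (\<lambda>l. nd (j l - a l) b) z)"
        using T_Dm[OF a(1), of "\<lambda>l. nd (j l - a l) b"] test1_nd[OF b] by simp
      also have "cmod \<dots> \<le> M * B ^ CARD('n) * (2 * d) ^ CARD('n)"
        unfolding norm_mult norm_power norm_minus_cancel norm_one power_one mult_1
      proof (rule set_integral_cbx_bound)
        fix z assume z: "z \<in> cbx x d"
        have "cmod (tens x (\<lambda>l. nd (j l - a l) b) z) \<le> (\<Prod>l\<in>(UNIV::'n set). B)"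
          unfolding tens_def prod_norm[symmetric]
        proof (intro prod_mono conjI norm_ge_zero)
          fix l show "cmod (nd (j l - a l) b (z $ l - x $ l)) \<le> B"
            using j by (intro B(1)[of _ l]) (auto simp: PiE_iff less_imp_diff_less)
        qed
        then show "cmod (v a z * tens x (\<lambda>l. nd (j l - a l) b) z) \<le> M * B ^ CARD('n)"
          using v_le[OF a(1), of z] sub z M by (auto simp: norm_mult intro!: mult_mono)
      qed (use d in auto)
      finally have 1: "cmod (T (tens x (\<lambda>l. nd (j l) b))) \<le> M * B ^ CARD('n) * (2 * d) ^ CARD('n)" .
      have "cmod (\<Sum>i\<in>F. c i * tens x (\<lambda>l. (\<lambda>f t. Cop d b (j l) f) (nd (\<alpha> i l) (f i l))) x) \<le> K ^ CARD('n) * \<epsilon>"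
      proof (rule tens_bdd_ops[where h = "\<lambda>i l. nd (\<alpha> i l) (f i l)" and L = "\<lambda>l f t. Cop d b (j l) f"])
        show "bdd_op d K (\<lambda>f t. Cop d b (j l) f)" for l by (rule K[of _ l]) (use j in auto)
      qed (use F le in \<open>auto intro!: test1_nd\<close>)
      then have "cmod (\<Sum>i\<in>F. c i * D i j) \<le> K ^ CARD('n) * \<epsilon>" by (simp add: tens_def D_def)
      then show ?thesis using 1 \<epsilon> B by (auto simp: norm_mult intro!: mult_mono)
    next
      case False
      have "D i j = 0" if i: "i \<in> F" for i
      proof -
        obtain a where "a \<in> A" "a \<le> \<alpha> i" using F(3)[OF i] by blast
        \<comment> \<open>If \<open>\<alpha> i \<le> j\<close> held,
          \<open>a \<le> \<alpha> i\<close> would put \<open>a\<close> below \<open>j\<close>,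
          contrary to the case.\<close>
        then obtain l where "j l < \<alpha> i l" using False by (metis le_fun_def not_le order_trans)
        then have "Cop d b (j l) (nd (\<alpha> i l) (f i l)) = 0" using Cop_nd F(2)[OF i] by blast
        then show ?thesis by (auto simp: D_def)
      qed
      then show ?thesis using \<epsilon> B M d by simp
    qed
  qed
  also have "real (card ?J) = real (\<Prod>l\<in>UNIV. s l)" by (simp add: card_PiE)
  finally show ?thesis .
qed

end

text \<open>\<open>C\<close> depends on \<open>d\<close>, \<open>b\<close>, \<open>s\<close> and the
  dimension only, not on the distribution or the centre. The bound involves the sup norm of the
  whole combination, so it remains useful when the single terms are large.\<close>

lemma (in bump1) T_bound:
  fixes s :: "'n::finite mindex"
  shows "\<exists>C\<ge>0. \<forall>\<Omega> T A v x M (F::nat set) c \<alpha> f \<epsilon>. dbox d b \<Omega> T A v x M \<longrightarrow>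
    (\<forall>l. (\<lambda>k. if k = l then s l else 0) \<in> A) \<longrightarrow> finite F \<longrightarrow>
    (\<forall>i\<in>F. (\<forall>l. f i l \<in> test1 d) \<and> (\<exists>a\<in>A. a \<le> \<alpha> i)) \<longrightarrow>
    (\<forall>z. cmod (\<Sum>i\<in>F. c i * tens x (\<lambda>l. nd (\<alpha> i l) (f i l)) z) \<le> \<epsilon>) \<longrightarrow>
    cmod (\<Sum>i\<in>F. c i * T (tens x (\<lambda>l. nd (\<alpha> i l) (f i l)))) \<le> C * M * \<epsilon>"
proof -
  \<comment> \<open>One constant for all orders below a given one; it is applied to the orders up to
    the largest entry of \<open>s\<close>, so that the coordinates need not be
    distinguished.\<close>
  have "\<exists>K\<ge>1. (\<forall>j<S. bdd_op d K (Sop d b ^^ j) \<and> bdd_op d K (Pop d b j) \<and> bdd_op d K (\<lambda>f t. Cop d b j f)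
     \<and> (\<forall>t. cmod (nd j b t) \<le> K))" for S :: nat
  proof (induction S)
    case 0 show ?case by (intro exI[of _ 1]) auto
  next
    case (Suc S)
    obtain K1 where K1: "bdd_op d K1 (Sop d b ^^ S)" using bdd_op_Sop_pow by blast
    obtain K2 where K2: "bdd_op d K2 (Pop d b S)" using bdd_op_Pop by blast
    obtain K3 where K3: "bdd_op d K3 (\<lambda>f t. Cop d b S f)" using bdd_op_Cop by blast
    obtain K4 where K4: "\<forall>t. cmod (nd S b t) \<le> K4" using test1_bounded[OF test1_nd[OF b]] by blast
    note K = K1 K2 K3 K4
    obtain K0 where K0: "K0 \<ge> 1" "\<forall>j<S. bdd_op d K0 (Sop d b ^^ j) \<and> bdd_op d K0 (Pop d b j) \<and> bdd_op d K0 (\<lambda>f t. Cop d b j f)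
     \<and> (\<forall>t. cmod (nd j b t) \<le> K0)" using Suc by blast
    let ?K = "max K0 (max (max K1 K2) (max K3 K4))"
    have le: "K0 \<le> ?K" "K1 \<le> ?K" "K2 \<le> ?K" "K3 \<le> ?K" "K4 \<le> ?K" by auto
    show ?case
    proof (intro exI[of _ ?K] conjI allI impI)
      show "1 \<le> ?K" using K0 by auto
      fix j assume "j < Suc S"
      then consider "j = S" | "j < S" by linarith
      note cs = this
      show "bdd_op d ?K (Sop d b ^^ j)" using cs bdd_op_mono le K K0 by cases blast+
      show "bdd_op d ?K (Pop d b j)" using cs bdd_op_mono le K K0 by cases blast+
      show "bdd_op d ?K (\<lambda>f t. Cop d b j f)" using cs bdd_op_mono le K K0 by cases blast+
      fix t show "cmod (nd j b t) \<le> ?K" using cs order_trans le K K0 by cases blast+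
    qed
  qed
  from this[of "Suc (Max (range s))"] obtain K where K1: "K \<ge> 1" and K: "\<And>j. j < Suc (Max (range s)) \<Longrightarrow> bdd_op d K (Sop d b ^^ j)"
    "\<And>j. j < Suc (Max (range s)) \<Longrightarrow> bdd_op d K (Pop d b j)" "\<And>j. j < Suc (Max (range s)) \<Longrightarrow> bdd_op d K (\<lambda>f t. Cop d b j f)"
     "\<And>j t. j < Suc (Max (range s)) \<Longrightarrow> cmod (nd j b t) \<le> K" by blast
  have sM: "s l < Suc (Max (range s))" for l by (simp add: less_Suc_eq_le)
  define C where "C = real (\<Prod>l\<in>UNIV. s l) * (K ^ CARD('n) * (K ^ CARD('n) * (2 * d) ^ CARD('n)))
    + CARD('n) * (K ^ (CARD('n) + 1) * (2 * d) ^ CARD('n))"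
  show ?thesis
  proof (intro exI[of _ C] conjI allI impI)
    show "C \<ge> 0" using K1 d by (auto simp del: of_nat_prod simp: C_def intro!: add_nonneg_nonneg mult_nonneg_nonneg)
    fix \<Omega> :: "(real^'n) set" and T A v x M and F :: "nat set" and c \<alpha> f \<epsilon>
    assume dbox: "dbox d b \<Omega> T A v x M" and s: "\<forall>l. (\<lambda>k. if k = l then s l else 0) \<in> A"
      and F: "finite F" "\<forall>i\<in>F. (\<forall>l. f i l \<in> test1 d) \<and> (\<exists>a\<in>A. a \<le> \<alpha> i)"
      and le: "\<forall>z. cmod (\<Sum>i\<in>F. c i * tens x (\<lambda>l. nd (\<alpha> i l) (f i l)) z) \<le> \<epsilon>"
    interpret dbox d b \<Omega> T A v x M by (rule dbox)
    have "cmod (\<Sum>i\<in>F. c i * T (tens x (\<lambda>l. nd (\<alpha> i l) (f i l))))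
     \<le> cmod (\<Sum>i\<in>F. c i * T (tens x (\<lambda>l. Pop d b (s l) (nd (\<alpha> i l) (f i l)))))
       + CARD('n) * (M * (K ^ (CARD('n) + 1) * \<epsilon>) * (2 * d) ^ CARD('n))"
      by (rule T_all_steps) (use K sM K1 s F le in \<open>auto intro!: test1_nd\<close>)
    also have "cmod (\<Sum>i\<in>F. c i * T (tens x (\<lambda>l. Pop d b (s l) (nd (\<alpha> i l) (f i l)))))
      \<le> (\<Prod>l\<in>UNIV. s l) * (K ^ CARD('n) * \<epsilon> * (M * K ^ CARD('n) * (2 * d) ^ CARD('n)))"
      by (rule T_final) (use K(3)[OF less_trans[OF _ sM]] K(4)[OF less_trans[OF _ sM]] K1 F le in auto)
    finally show "cmod (\<Sum>i\<in>F. c i * T (tens x (\<lambda>l. nd (\<alpha> i l) (f i l)))) \<le> C * M * \<epsilon>"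
      unfolding C_def by (simp add: algebra_simps)
  qed
qed

section \<open>Decay of lattice exponential sums\<close>

text \<open>Derivatives are given by existence and only on \<open>S\<close>, because the quotients
  below are controlled on an open interval only and to finite order. A single \<open>C\<close>
  bounds the function and its derivatives up to order \<open>n\<close>.\<close>

primrec Bd :: "nat \<Rightarrow> real set \<Rightarrow> real \<Rightarrow> (real \<Rightarrow> complex) \<Rightarrow> bool" where
  "Bd 0 S C f = (\<forall>t\<in>S. cmod (f t) \<le> C)"
| "Bd (Suc n) S C f = ((\<forall>t\<in>S. cmod (f t) \<le> C) \<and>
     (\<exists>f'. (\<forall>t\<in>S. (f has_vector_derivative f' t) (at t)) \<and> Bd n S C f'))"

lemma Bd_bound: "Bd n S C f \<Longrightarrow> t \<in> S \<Longrightarrow> cmod (f t) \<le> C"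
  by (cases n) auto

lemma Bd_mono: "Bd n S C f \<Longrightarrow> C \<le> D \<Longrightarrow> Bd n S D f"
  by (induction n arbitrary: f) (auto intro: order_trans)

lemma Bd_SucD: "Bd (Suc n) S C f \<Longrightarrow> Bd n S C f"
  by (induction n arbitrary: f) auto

lemma Bd_cong:
  assumes "open S" "\<And>t. t \<in> S \<Longrightarrow> f t = g t" "Bd n S C f"
  shows "Bd n S C g"
proof (cases n)
  case 0 then show ?thesis using assms by auto
next
  case (Suc m)
  then obtain f' where f': "\<forall>t\<in>S. (f has_vector_derivative f' t) (at t)" "Bd m S C f'" using assms(3) by auto
  have "(g has_vector_derivative f' t) (at t)" if "t \<in> S" for t
    by (rule has_vector_derivative_transform_within_open[where S = S and f = f]) (use assms f' that in auto)
  then show ?thesis using f' assms Suc by auto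
qed

lemma Bd_add: "Bd n S C f \<Longrightarrow> Bd n S D g \<Longrightarrow> Bd n S (C + D) (\<lambda>t. f t + g t)"
proof (induction n arbitrary: f g)
  case 0 then show ?case by (auto intro: order_trans[OF norm_triangle_ineq] add_mono)
next
  case (Suc n)
  then obtain f' g' where *: "\<forall>t\<in>S. (f has_vector_derivative f' t) (at t)" "Bd n S C f'"
    "\<forall>t\<in>S. (g has_vector_derivative g' t) (at t)" "Bd n S D g'" by auto
  have "Bd n S (C + D) (\<lambda>t. f' t + g' t)" using Suc.IH * by blast
  moreover have "\<forall>t\<in>S. ((\<lambda>t. f t + g t) has_vector_derivative f' t + g' t) (at t)"
    using * by (auto intro: has_vector_derivative_add)
  moreover have "\<forall>t\<in>S. cmod (f t + g t) \<le> C + D"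
    using Bd_bound[OF Suc.prems(1)] Bd_bound[OF Suc.prems(2)] norm_triangle_mono by blast
  ultimately show ?case by (auto intro!: exI[of _ "\<lambda>t. f' t + g' t"])
qed

lemma Bd_cmult: "Bd n S C f \<Longrightarrow> cmod c \<le> D \<Longrightarrow> 0 \<le> C \<Longrightarrow> Bd n S (D * C) (\<lambda>t. c * f t)"
proof (induction n arbitrary: f)
  case 0 then show ?case by (auto simp: norm_mult intro!: mult_mono intro: order_trans[OF norm_ge_zero])
next
  case (Suc n)
  then obtain f' where *: "\<forall>t\<in>S. (f has_vector_derivative f' t) (at t)" "Bd n S C f'" by auto
  have "Bd n S (D * C) (\<lambda>t. c * f' t)" using Suc * by blast
  moreover have "\<forall>t\<in>S. ((\<lambda>t. c * f t) has_vector_derivative c * f' t) (at t)"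
    using * by (auto intro: has_vector_derivative_mult_right)
  ultimately show ?case
    using Bd_bound[OF Suc.prems(1)] Suc.prems
    by (auto simp: norm_mult intro!: mult_mono intro: order_trans[OF norm_ge_zero])
qed

text \<open>The factor \<open>2 ^ n\<close> comes from the n-fold product rule, each step of which
  doubles the number of terms.\<close>

lemma Bd_mult:
  assumes "0 \<le> C" "0 \<le> D"
  shows "Bd n S C f \<Longrightarrow> Bd n S D g \<Longrightarrow> Bd n S (2 ^ n * C * D) (\<lambda>t. f t * g t)"
proof (induction n arbitrary: f g)
  case 0 then show ?case using assms by (auto simp: norm_mult intro!: mult_mono)
next
  case (Suc n)
  then obtain f' g' where *: "\<forall>t\<in>S. (f has_vector_derivative f' t) (at t)" "Bd n S C f'"
    "\<forall>t\<in>S. (g has_vector_derivative g' t) (at t)" "Bd n S D g'" by auto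
  have "Bd n S (2 ^ n * C * D + 2 ^ n * C * D) (\<lambda>t. f t * g' t + f' t * g t)"
    by (intro Bd_add Suc.IH * Bd_SucD[OF Suc.prems(1)] Bd_SucD[OF Suc.prems(2)])
  then have "Bd n S (2 ^ Suc n * C * D) (\<lambda>t. f t * g' t + f' t * g t)" by (simp add: algebra_simps)
  moreover have "\<forall>t\<in>S. ((\<lambda>t. f t * g t) has_vector_derivative f t * g' t + f' t * g t) (at t)"
    using * by (auto intro!: has_vector_derivative_mult)
  moreover have "cmod (f t * g t) \<le> 2 ^ Suc n * C * D" if "t \<in> S" for t
  proof -
    have "cmod (f t * g t) \<le> C * D"
      using Bd_bound[OF Suc.prems(1) that] Bd_bound[OF Suc.prems(2) that] assms by (auto simp: norm_mult intro!: mult_mono)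
    also have "\<dots> \<le> 2 ^ Suc n * (C * D)"
      using assms mult_right_mono[of 1 "2 ^ Suc n" "C * D"] one_le_power[of "2::real" "Suc n"] by (auto simp del: power_Suc)
    finally show ?thesis by (simp add: mult.assoc)
  qed
  ultimately show ?case by auto
qed

lemma Bd_const: "cmod c \<le> C \<Longrightarrow> Bd n S C (\<lambda>t. c)"
proof (induction n arbitrary: c)
  case (Suc n)
  have "Bd n S C (\<lambda>t. 0)" using Suc.IH[of 0] Suc.prems norm_ge_zero[of c] by (metis norm_zero order_trans)
  then show ?case using Suc.prems by (auto intro!: exI[of _ "\<lambda>t. 0"])
qed auto

lemma Bd_ident: "(\<And>t. t \<in> S \<Longrightarrow> \<bar>t\<bar> \<le> C) \<Longrightarrow> 1 \<le> C \<Longrightarrow> Bd n S C of_real"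
proof (cases n)
  case (Suc m)
  assume "\<And>t. t \<in> S \<Longrightarrow> \<bar>t\<bar> \<le> C" "1 \<le> C"
  moreover have "((\<lambda>t. complex_of_real t) has_vector_derivative 1) (at t)" for t
    using has_vector_derivative_of_real[OF DERIV_ident[of "at t"]] by simp
  moreover have "Bd m S C (\<lambda>t. 1)" by (rule Bd_const) (use calculation in simp)
  ultimately show ?thesis using Suc by (auto intro!: exI[of _ "\<lambda>t. 1"])
qed simp

lemma Bd_power:
  assumes "Bd n S C f" "0 \<le> C" shows "\<exists>D\<ge>0. Bd n S D (\<lambda>t. f t ^ k)"
proof (induction k)
  case 0 show ?case by (auto intro!: exI[of _ 1] Bd_const)
next
  case (Suc k)
  then obtain D where "D \<ge> 0" "Bd n S D (\<lambda>t. f t ^ k)" by blast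
  then show ?case using Bd_mult[OF assms(2) _ assms(1), of D] assms(2)
    by (intro exI[of _ "2 ^ n * C * D"]) auto
qed

lemma Bd_test1:
  assumes "f \<in> test1 d" shows "\<exists>C\<ge>0. Bd n S C f"
  using assms
proof (induction n arbitrary: f)
  case 0
  then show ?case using test1_bounded[OF 0] by (auto intro: less_imp_le)
next
  case (Suc n)
  obtain C where C: "C > 0" "\<forall>t. cmod (f t) \<le> C" using test1_bounded[OF Suc.prems] by blast
  obtain D where D: "D \<ge> 0" "Bd n S D (nd (Suc 0) f)" using Suc.IH[OF test1_nd[OF Suc.prems]] by blast
  have "(f has_vector_derivative nd (Suc 0) f t) (at t)" for t
    using smooth1_deriv[OF test1_smooth1[OF Suc.prems], of 0] by simp
  moreover have "Bd n S (C + D) (nd (Suc 0) f)" using Bd_mono[OF D(2)] C by auto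
  moreover have "\<forall>t. cmod (f t) \<le> C + D" using C D by (meson add_increasing2)
  ultimately show ?case using C D by (intro exI[of _ "C + D"]) auto
qed

text \<open>On the open set where |p| < \<open>lb\<close> the function u vanishes, hence so do u'
  and the quotient. The derivative is u'/p - (u p'/p)/p, and each of its numerators has the same
  vanishing property, so the induction hypothesis applies to it. The constant is chosen before u and
  p, which makes it uniform over symbols.\<close>

lemma Bd_divide:
  assumes S: "open S" and lb: "0 < lb" and C: "0 \<le> C"
  shows "\<exists>C'\<ge>0. \<forall>u p. Bd n S C u \<longrightarrow> Bd n S C p \<longrightarrow> (\<forall>t\<in>S. cmod (p t) < lb \<longrightarrow> u t = 0) \<longrightarrow> Bd n S C' (\<lambda>t. u t / p t)"
  using C
proof (induction n arbitrary: C)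
  case 0
  have *: "cmod (u / p) \<le> C / lb" if "cmod u \<le> C" "cmod p < lb \<longrightarrow> u = 0" for u p
  proof (cases "cmod p < lb")
    case True
    with that lb 0 show ?thesis by simp
  next
    case False
    with that lb 0 show ?thesis by (auto simp: norm_divide intro!: frac_le)
  qed
  then show ?case using 0 lb by (intro exI[of _ "C / lb"]) (auto simp del: norm_divide)
next
  case (Suc n)
  obtain C1 where C1: "C1 \<ge> 0" "\<And>u p. Bd n S C u \<Longrightarrow> Bd n S C p \<Longrightarrow> (\<And>t. t \<in> S \<Longrightarrow> cmod (p t) < lb \<Longrightarrow> u t = 0) \<Longrightarrow> Bd n S C1 (\<lambda>t. u t / p t)"
    using Suc.IH[OF Suc.prems] by blast
  \<comment> \<open>The induction hypothesis is used three times with growing constants: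
    \<open>C1\<close> for u'/p, \<open>C2\<close> for u p'/p, and \<open>C3\<close> for dividing the
    latter by p once more.\<close>
  define D where "D = C + 2 ^ n * C * C"
  have D: "0 \<le> D" "C \<le> D" using Suc.prems by (auto simp: D_def)
  obtain C2 where C2: "C2 \<ge> 0" "\<And>u p. Bd n S D u \<Longrightarrow> Bd n S D p \<Longrightarrow> (\<And>t. t \<in> S \<Longrightarrow> cmod (p t) < lb \<Longrightarrow> u t = 0) \<Longrightarrow> Bd n S C2 (\<lambda>t. u t / p t)"
    using Suc.IH[OF D(1)] by blast
  define E where "E = D + C2"
  have E: "0 \<le> E" "C2 \<le> E" "D \<le> E" using D C2 by (auto simp: E_def)
  obtain C3 where C3: "C3 \<ge> 0" "\<And>u p. Bd n S E u \<Longrightarrow> Bd n S E p \<Longrightarrow> (\<And>t. t \<in> S \<Longrightarrow> cmod (p t) < lb \<Longrightarrow> u t = 0) \<Longrightarrow> Bd n S C3 (\<lambda>t. u t / p t)"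
    using Suc.IH[OF E(1)] by blast
  have "Bd (Suc n) S (C / lb + C1 + C3) (\<lambda>t. u t / p t)"
    if u: "Bd (Suc n) S C u" and p: "Bd (Suc n) S C p" and z: "\<forall>t\<in>S. cmod (p t) < lb \<longrightarrow> u t = 0" for u p
  proof -
    obtain u' p' where u': "\<forall>t\<in>S. (u has_vector_derivative u' t) (at t)" "Bd n S C u'"
      and p': "\<forall>t\<in>S. (p has_vector_derivative p' t) (at t)" "Bd n S C p'" using u p by auto
    have pc: "continuous_on S p"
      using p'(1) by (meson continuous_at_imp_continuous_on has_vector_derivative_continuous)
    define U where "U = {t\<in>S. cmod (p t) < lb}"
    have "open (S \<inter> (\<lambda>t. cmod (p t)) -` {..<lb})"
      by (rule continuous_open_preimage[OF continuous_on_norm[OF pc] S]) simp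
    then have U: "open U" by (simp add: U_def vimage_def Int_def)
    have zd: "(w has_vector_derivative 0) (at t)" if "t \<in> U" "\<forall>t\<in>U. w t = 0" for t and w :: "real \<Rightarrow> complex"
      by (rule has_vector_derivative_transform_within_open[where S = U and f = "\<lambda>t. 0"]) (use that U in auto)
    have u'0: "u' t = 0" if "t \<in> S" "cmod (p t) < lb" for t
    proof -
      have "t \<in> U" using that by (auto simp: U_def)
      then show ?thesis using zd[of t u] u'(1) z that(1) by (auto simp: U_def intro: vector_derivative_unique_at)
    qed
    have der: "((\<lambda>t. u t / p t) has_vector_derivative u' t / p t - u t * p' t / p t / p t) (at t)" if t: "t \<in> S" for t
    proof (cases "cmod (p t) < lb")
      case True
      then have "t \<in> U" using t by (auto simp: U_def)
      then have "((\<lambda>t. u t / p t) has_vector_derivative 0) (at t)"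
        by (rule zd) (use z in \<open>auto simp: U_def\<close>)
      then show ?thesis using u'0 True t z by simp
    next
      case False
      then have nz: "p t \<noteq> 0" using lb by auto
      have "((inverse \<circ> p) has_vector_derivative p' t * (- (inverse (p t) * 1 * inverse (p t)))) (at t)"
        by (rule field_vector_diff_chain_at[OF p'(1)[rule_format, OF t]]) (rule DERIV_inverse'[OF DERIV_ident nz])
      from has_vector_derivative_mult[OF u'(1)[rule_format, OF t] this]
      show ?thesis by (simp add: o_def divide_inverse algebra_simps)
    qed
    have 1: "Bd n S C1 (\<lambda>t. u' t / p t)"
      by (rule C1) (use u' Bd_SucD[OF p] u'0 in auto)
    have "Bd n S (2 ^ n * C * C) (\<lambda>t. u t * p' t)"
      by (rule Bd_mult[OF Suc.prems Suc.prems Bd_SucD[OF u] p'(2)])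
    then have "Bd n S D (\<lambda>t. u t * p' t)" by (rule Bd_mono) (use Suc.prems in \<open>auto simp: D_def\<close>)
    then have "Bd n S C2 (\<lambda>t. u t * p' t / p t)"
      by (rule C2) (use z Bd_mono[OF Bd_SucD[OF p] D(2)] in auto)
    then have "Bd n S E (\<lambda>t. u t * p' t / p t)" using E by (auto intro: Bd_mono)
    then have "Bd n S C3 (\<lambda>t. u t * p' t / p t / p t)"
      by (rule C3) (use z Bd_mono[OF Bd_SucD[OF p] order_trans[OF D(2) E(3)]] in auto)
    from Bd_add[OF 1 Bd_cmult[OF this, of "-1" 1]] C3
    have "Bd n S (C1 + C3) (\<lambda>t. u' t / p t - u t * p' t / p t / p t)" by simp
    then have "Bd n S (C / lb + C1 + C3) (\<lambda>t. u' t / p t - u t * p' t / p t / p t)"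
      by (rule Bd_mono) (use Suc.prems lb in auto)
    moreover have "cmod (u t / p t) \<le> C / lb + C1 + C3" if "t \<in> S" for t
    proof -
      have "cmod (u t / p t) \<le> C / lb"
      proof (cases "cmod (p t) < lb")
        case True
        with z that lb Suc.prems show ?thesis by simp
      next
        case False
        with Bd_bound[OF u that] lb Suc.prems show ?thesis by (auto simp: norm_divide intro!: frac_le)
      qed
      then show ?thesis using C1 C3 by linarith
    qed
    ultimately show ?thesis using der by (auto simp del: norm_divide intro!: exI[of _ "\<lambda>t. u' t / p t - u t * p' t / p t / p t"])
  qed
  then show ?case using C1 C3 Suc.prems lb by (intro exI[of _ "C / lb + C1 + C3"]) auto
qed

text \<open>On the open set \<open>U\<close> the function is locally 0, so on the overlap its
  derivatives are 0 as well and the two pieces fit together.\<close>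

lemma Bd_extend_zero:
  assumes S: "open S" and U: "open U" "S \<union> U = UNIV" and C: "0 \<le> C"
  shows "Bd n S C f \<Longrightarrow> (\<And>t. t \<in> U \<Longrightarrow> f t = 0) \<Longrightarrow> Bd n UNIV C f"
proof (induction n arbitrary: f)
  case 0
  have "cmod (f t) \<le> C" for t
    using 0 U(2) C by (cases "t \<in> S") auto
  then show ?case by simp
next
  case (Suc n)
  then obtain f' where f': "\<forall>t\<in>S. (f has_vector_derivative f' t) (at t)" "Bd n S C f'" by auto
  define g where "g t = (if t \<in> S then f' t else 0)" for t
  have zd: "(f has_vector_derivative 0) (at t)" if "t \<in> U" for t
    by (rule has_vector_derivative_transform_within_open[where S = U and f = "\<lambda>t. 0"]) (use that U Suc.prems in auto)
  have der: "(f has_vector_derivative g t) (at t)" for t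
    using f'(1) zd[of t] U(2) by (cases "t \<in> S") (auto simp: g_def)
  have "Bd n S C g" by (rule Bd_cong[OF S _ f'(2)]) (auto simp: g_def)
  moreover have "g t = 0" if "t \<in> U" for t
    using der[of t] zd[OF that] by (rule vector_derivative_unique_at)
  ultimately have "Bd n UNIV C g" using Suc.IH by blast
  moreover have "cmod (f t) \<le> C" for t
  proof (cases "t \<in> S")
    case False
    then have "f t = 0" using Suc.prems(2) U(2) by blast
    then show ?thesis using C by simp
  qed (rule Bd_bound[OF Suc.prems(1)])
  ultimately show ?case using der unfolding Bd.simps by blast
qed

section \<open>Finite differences and summation by parts\<close>

definition dff :: "real \<Rightarrow> (real \<Rightarrow> complex) \<Rightarrow> real \<Rightarrow> complex" where
  "dff s f t = f (t - s) - f t"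

text \<open>The mean value inequality gives one factor \<open>\<bar>s\<bar>\<close> per difference
  and uses up one order of differentiability.\<close>

lemma Bd_dff: "Bd (Suc n) UNIV C f \<Longrightarrow> Bd n UNIV (\<bar>s\<bar> * C) (dff s f)"
proof (induction n arbitrary: f)
  case 0
  then obtain f' where f': "\<And>t. (f has_vector_derivative f' t) (at t)" "\<And>t. cmod (f' t) \<le> C" by auto
  have "cmod (f (t - s) - f t) \<le> C * norm (t - s - t)" for t
  proof (rule differentiable_bound[where S = UNIV and f' = "\<lambda>t h. h *\<^sub>R f' t"])
    show "onorm (\<lambda>h. h *\<^sub>R f' t) \<le> C" for t
      by (rule onorm_le) (use mult_right_mono[OF f'(2)[of t] abs_ge_zero] in \<open>simp add: mult.commute\<close>)
  qed (use f' in \<open>auto simp: has_vector_derivative_def\<close>)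
  then show ?case by (simp add: dff_def mult.commute)
next
  case (Suc n)
  then obtain f' where f': "\<forall>t\<in>UNIV. (f has_vector_derivative f' t) (at t)" "Bd (Suc n) UNIV C f'"
    by (auto simp del: Bd.simps(2) simp: Bd.simps(2)[of "Suc n"])
  have b: "Bd n UNIV (\<bar>s\<bar> * C) (dff s f)" by (rule Suc.IH) (rule Bd_SucD[OF Suc.prems])
  have "(dff s f has_vector_derivative dff s f' t) (at t)" for t
  proof -
    have "((f \<circ> (\<lambda>t. t - s)) has_vector_derivative 1 *\<^sub>R f' (t - s)) (at t)"
      by (rule vector_diff_chain_at) (use f' in \<open>auto intro!: derivative_eq_intros\<close>)
    then show ?thesis using f'(1) by (auto simp: dff_def[abs_def] o_def intro!: has_vector_derivative_diff)
  qed
  then show ?case using Suc.IH[OF f'(2)] Bd_bound[OF b] by auto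
qed

lemma dff_pow_bound: "Bd n UNIV C f \<Longrightarrow> cmod ((dff s ^^ n) f t) \<le> \<bar>s\<bar> ^ n * C"
proof (induction n arbitrary: f C)
  case (Suc n)
  have "cmod ((dff s ^^ n) (dff s f) t) \<le> \<bar>s\<bar> ^ n * (\<bar>s\<bar> * C)"
    by (rule Suc.IH) (rule Bd_dff[OF Suc.prems])
  then show ?case by (simp add: funpow_swap1 algebra_simps)
qed auto

lemma sin_ge_linear:
  assumes "0 \<le> x" "x \<le> pi / 2" shows "2 / pi * x \<le> sin x"
proof -
  have "convex_on {0..pi/2} (\<lambda>x. - sin x)"
    by (rule f''_ge0_imp_convex[where f' = "\<lambda>x. - cos x" and f'' = sin])
      (auto intro!: derivative_eq_intros sin_ge_zero simp: field_simps)
  from convex_onD_Icc'[OF this, of x] assms show ?thesis by (simp add: field_simps)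
qed

lemma norm_exp_minus_1_ge:
  assumes "\<bar>t\<bar> \<le> pi" shows "2 / pi * \<bar>t\<bar> \<le> cmod (exp (- \<i> * of_real t) - 1)"
proof -
  have "cmod (exp (- \<i> * of_real t) - 1) = 2 * \<bar>sin (t / 2)\<bar>"
    using dist_exp_i_1[of "-t"] by simp
  moreover have "\<bar>sin (t / 2)\<bar> \<ge> 2 / pi * (\<bar>t\<bar> / 2)"
    using sin_ge_linear[of "\<bar>t\<bar>/2"] assms by (cases "t \<ge> 0") auto
  ultimately show ?thesis by simp
qed

text \<open>Each partial derivative acts on it as multiplication by \<open>- \<i>\<close> times a
  coordinate of the frequency \<open>h * k\<close>. With \<open>h = pi / d\<close> its period in
  each coordinate is the side \<open>2 * d\<close> of the box.\<close>

definition ek :: "real \<Rightarrow> ('n::finite \<Rightarrow> int) \<Rightarrow> real^'n \<Rightarrow> complex" where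
  "ek h k z = (\<Prod>l\<in>UNIV. exp (- \<i> * of_real (h * of_int (k l)) * of_real (z$l)))"

text \<open>The range is the support of \<open>\<mu>\<close>, which has to be finite: a sum over an
  infinite set is 0 by convention.\<close>

definition Esum :: "real \<Rightarrow> (('n::finite \<Rightarrow> int) \<Rightarrow> complex) \<Rightarrow> real^'n \<Rightarrow> complex" where
  "Esum h \<mu> z = (\<Sum>k | \<mu> k \<noteq> 0. \<mu> k * ek h k z)"

lemma norm_ek [simp]: "cmod (ek h k z) = 1"
proof -
  have "cmod (ek h k z) = (\<Prod>l\<in>UNIV. cmod (exp (- \<i> * of_real (h * of_int (k l)) * of_real (z$l))))"
    unfolding ek_def by (rule prod_norm[symmetric])
  also have "\<dots> = 1"
    by (rule prod.neutral) (simp only: norm_exp_eq_Re, simp)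
  finally show ?thesis .
qed

lemma Esum_superset:
  assumes "finite S" "{k. \<mu> k \<noteq> 0} \<subseteq> S"
  shows "Esum h \<mu> z = (\<Sum>k\<in>S. \<mu> k * ek h k z)"
  unfolding Esum_def
proof (rule sum.mono_neutral_left[OF assms], intro ballI)
  fix k assume "k \<in> S - {k. \<mu> k \<noteq> 0}"
  then have "\<mu> k = 0" by blast
  then show "\<mu> k * ek h k z = 0" by (simp only: mult_zero_left)
qed

definition kbox :: "('n::finite \<Rightarrow> nat) \<Rightarrow> ('n \<Rightarrow> int) set" where
  "kbox R = {k. \<forall>l. \<bar>k l\<bar> \<le> int (R l)}"

lemma kbox_card: "finite (kbox R)" "card (kbox R) = (\<Prod>l\<in>UNIV. 2 * R l + 1)"
proof -
  have "kbox R = PiE UNIV (\<lambda>l. {- int (R l) .. int (R l)})"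
    by (auto simp: kbox_def PiE_iff abs_le_iff) (metis minus_le_iff)+
  then show "finite (kbox R)" "card (kbox R) = (\<Prod>l\<in>UNIV. 2 * R l + 1)"
    by (auto intro!: finite_PiE prod.cong simp: card_PiE nat_eq_iff)
qed

definition dl :: "'n \<Rightarrow> (('n \<Rightarrow> int) \<Rightarrow> complex) \<Rightarrow> ('n \<Rightarrow> int) \<Rightarrow> complex" where
  "dl l \<mu> k = \<mu> (k(l := k l - 1)) - \<mu> k"

lemma dl_support:
  assumes "{k. \<mu> k \<noteq> 0} \<subseteq> kbox R"
  shows "{k. dl l \<mu> k \<noteq> 0} \<subseteq> kbox (R(l := R l + 1))"
proof
  fix k assume "k \<in> {k. dl l \<mu> k \<noteq> 0}"
  then have "\<mu> (k(l := k l - 1)) \<noteq> 0 \<or> \<mu> k \<noteq> 0" by (auto simp: dl_def)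
  then have "k(l := k l - 1) \<in> kbox R \<or> k \<in> kbox R" using assms by blast
  then show "k \<in> kbox (R(l := R l + 1))"
  proof
    assume a: "k(l := k l - 1) \<in> kbox R"
    have "\<bar>k l'\<bar> \<le> int ((R(l := R l + 1)) l')" for l'
      using a[unfolded kbox_def, simplified, rule_format, of l'] by (cases "l' = l") auto
    then show ?thesis by (auto simp: kbox_def)
  qed (auto simp: kbox_def intro: order_trans)
qed

lemma ek_upd: "ek h (k(l := k l + 1)) z = exp (- \<i> * of_real (h * z$l)) * ek h k z"
proof -
  have "ek h (k(l := k l + 1)) z = exp (- \<i> * of_real (h * of_int (k l + 1)) * of_real (z$l)) *
     (\<Prod>l'\<in>UNIV-{l}. exp (- \<i> * of_real (h * of_int (k l')) * of_real (z$l')))"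
    unfolding ek_def by (subst prod.remove[of _ l]) (auto intro!: prod.cong arg_cong2[where f = times])
  moreover have "ek h k z = exp (- \<i> * of_real (h * of_int (k l)) * of_real (z$l)) *
     (\<Prod>l'\<in>UNIV-{l}. exp (- \<i> * of_real (h * of_int (k l')) * of_real (z$l')))"
    unfolding ek_def by (subst prod.remove[of _ l]) auto
  moreover have "exp (- \<i> * of_real (h * of_int (k l + 1)) * of_real (z$l)) = exp (- \<i> * of_real (h * z$l)) * exp (- \<i> * of_real (h * of_int (k l)) * of_real (z$l))"
    by (simp add: exp_add[symmetric] algebra_simps)
  ultimately show ?thesis by simp
qed

text \<open>Summation by parts: shifting the index by one in direction \<open>l\<close> multiplies
  the exponential by a phase that does not depend on k. There are no boundary terms, since the box
  enlarged by one contains both the support and its translate.\<close>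

lemma Esum_dl:
  assumes "{k. \<mu> k \<noteq> 0} \<subseteq> kbox R"
  shows "Esum h (dl l \<mu>) z = (exp (- \<i> * of_real (h * z$l)) - 1) * Esum h \<mu> z"
proof -
  let ?S = "kbox (R(l := R l + 1))"
  have fin: "finite ?S" "finite (kbox R)" by (auto intro: kbox_card)
  have sub: "kbox R \<subseteq> ?S" by (auto simp: kbox_def intro: order_trans)
  have "Esum h (dl l \<mu>) z = (\<Sum>k\<in>?S. dl l \<mu> k * ek h k z)"
    by (rule Esum_superset[OF fin(1) dl_support[OF assms]])
  also have "\<dots> = (\<Sum>k\<in>?S. \<mu> (k(l := k l - 1)) * ek h k z) - (\<Sum>k\<in>?S. \<mu> k * ek h k z)"
    by (simp add: dl_def algebra_simps sum_subtractf)
  also have "(\<Sum>k\<in>?S. \<mu> k * ek h k z) = Esum h \<mu> z"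
    by (rule Esum_superset[symmetric]) (use assms sub fin in auto)
  also have "(\<Sum>k\<in>?S. \<mu> (k(l := k l - 1)) * ek h k z) = (\<Sum>k\<in>{k. k(l := k l - 1) \<in> kbox R}. \<mu> (k(l := k l - 1)) * ek h k z)"
  proof (rule sum.mono_neutral_right[OF fin(1)])
    show "{k. k(l := k l - 1) \<in> kbox R} \<subseteq> ?S"
    proof
      fix k assume "k \<in> {k. k(l := k l - 1) \<in> kbox R}"
      then have a: "k(l := k l - 1) \<in> kbox R" by simp
      have "\<bar>k l'\<bar> \<le> int ((R(l := R l + 1)) l')" for l'
        using a[unfolded kbox_def, simplified, rule_format, of l'] by (cases "l' = l") auto
      then show "k \<in> ?S" by (auto simp: kbox_def)
    qed
  qed (use assms in auto)
  also have "\<dots> = (\<Sum>k\<in>kbox R. \<mu> k * ek h (k(l := k l + 1)) z)"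
    by (rule sum.reindex_bij_witness[where i = "\<lambda>k. k(l := k l + 1)" and j = "\<lambda>k. k(l := k l - 1)"]) auto
  also have "\<dots> = exp (- \<i> * of_real (h * z$l)) * (\<Sum>k\<in>kbox R. \<mu> k * ek h k z)"
    unfolding ek_upd sum_distrib_left by (intro sum.cong refl mult.left_commute)
  also have "(\<Sum>k\<in>kbox R. \<mu> k * ek h k z) = Esum h \<mu> z"
    by (rule Esum_superset[symmetric]) (use assms fin in auto)
  finally show ?thesis by (simp add: algebra_simps)
qed

lemma Esum_dl_pow:
  assumes "{k. \<mu> k \<noteq> 0} \<subseteq> kbox R"
  shows "{k. (dl l ^^ N) \<mu> k \<noteq> 0} \<subseteq> kbox (R(l := R l + N))
    \<and> Esum h ((dl l ^^ N) \<mu>) z = (exp (- \<i> * of_real (h * z$l)) - 1) ^ N * Esum h \<mu> z"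
proof (induction N)
  case (Suc N)
  have "(R(l := R l + N))(l := (R(l := R l + N)) l + 1) = R(l := R l + Suc N)" by auto
  with dl_support[of "(dl l ^^ N) \<mu>" "R(l := R l + N)" l] Suc
  have "{k. (dl l ^^ Suc N) \<mu> k \<noteq> 0} \<subseteq> kbox (R(l := R l + Suc N))" by (simp only: funpow.simps o_apply)
  moreover have "Esum h (dl l ((dl l ^^ N) \<mu>)) z = (exp (- \<i> * of_real (h * z$l)) - 1) * ((exp (- \<i> * of_real (h * z$l)) - 1) ^ N * Esum h \<mu> z)"
    using Esum_dl[of "(dl l ^^ N) \<mu>" "R(l := R l + N)" h l z] Suc by (simp only:)
  ultimately show ?case by (simp only: funpow.simps o_apply power_Suc mult.assoc)
qed (use assms in \<open>simp del: fun_upd_apply\<close>)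

lemma Esum_le:
  assumes "{k. \<mu> k \<noteq> 0} \<subseteq> kbox R" "\<And>k. cmod (\<mu> k) \<le> A"
  shows "cmod (Esum h \<mu> z) \<le> (\<Prod>l\<in>UNIV. 2 * real (R l) + 1) * A"
proof -
  have "cmod (Esum h \<mu> z) \<le> of_nat (card (kbox R)) * A"
    unfolding Esum_superset[OF kbox_card(1) assms(1)]
    by (rule sum_norm_bound) (use assms(2) in \<open>auto simp: norm_mult\<close>)
  also have "of_nat (card (kbox R)) = (\<Prod>l\<in>UNIV. 2 * real (R l) + 1)" by (simp add: kbox_card add.commute)
  finally show ?thesis .
qed

text \<open>The lattice frequency rescaled anisotropically by \<open>2 ^ j\<close>. Block
  \<open>j\<close> then lives at frequencies of size about 1, and a lattice step in direction
  \<open>l\<close> has length \<open>h / 2 ^ (j * \<kappa> l)\<close>, which is the source of the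
  gain in each difference.\<close>

definition etak :: "'n::finite mindex \<Rightarrow> real \<Rightarrow> nat \<Rightarrow> ('n \<Rightarrow> int) \<Rightarrow> 'n \<Rightarrow> real" where
  "etak \<kappa> h j k l = h / 2 ^ (j * \<kappa> l) * of_int (k l)"

lemma dl_pow_dff:
  "(dl l ^^ N) (\<lambda>k. F (etak \<kappa> h j k)) k = (dff (h / 2 ^ (j * \<kappa> l)) ^^ N) (\<lambda>y. F ((etak \<kappa> h j k)(l := y))) (etak \<kappa> h j k l)"
proof (induction N arbitrary: k)
  case 0 show ?case by (simp only: funpow.simps id_apply fun_upd_triv)
next
  case (Suc N)
  have e: "etak \<kappa> h j (k(l := k l - 1)) = (etak \<kappa> h j k)(l := etak \<kappa> h j k l - h / 2 ^ (j * \<kappa> l))"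
    by (auto simp: etak_def fun_eq_iff right_diff_distrib diff_divide_distrib)
  let ?\<mu> = "\<lambda>k. F (etak \<kappa> h j k)" and ?s = "h / 2 ^ (j * \<kappa> l)" and ?G = "\<lambda>y. F ((etak \<kappa> h j k)(l := y))"
  have "(dl l ^^ Suc N) ?\<mu> k = (dl l ^^ N) ?\<mu> (k(l := k l - 1)) - (dl l ^^ N) ?\<mu> k"
    by (simp only: funpow.simps o_apply dl_def[of l "(dl l ^^ N) ?\<mu>"])
  also have "\<dots> = (dff ?s ^^ N) ?G (etak \<kappa> h j k l - ?s) - (dff ?s ^^ N) ?G (etak \<kappa> h j k l)"
    unfolding Suc e by (simp only: fun_upd_upd fun_upd_same)
  also have "\<dots> = (dff ?s ^^ Suc N) ?G (etak \<kappa> h j k l)"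
    by (simp only: funpow.simps o_apply dff_def[of ?s "(dff ?s ^^ N) ?G"])
  finally show ?case .
qed

definition msum :: "'n::finite mindex \<Rightarrow> nat" where "msum \<kappa> = (\<Sum>l\<in>UNIV. \<kappa> l)"

text \<open>At scale \<open>j\<close> the support has at most a constant times
  \<open>2 ^ (j * msum \<kappa>)\<close> lattice points, and each of \<open>N\<close> differences in
  direction \<open>l\<close> gains the step length \<open>h / 2 ^ (j * \<kappa> l)\<close>.\<close>

lemma Esum_decay_coord:
  fixes F :: "('n::finite \<Rightarrow> real) \<Rightarrow> complex"
  assumes h: "0 < h" and Bd: "\<And>l \<eta>. Bd N UNIV A (\<lambda>y. F (\<eta>(l := y)))"
    and supp: "\<And>\<eta> l. 2 < \<bar>\<eta> l\<bar> \<Longrightarrow> F \<eta> = 0"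
  shows "cmod (exp (- \<i> * of_real (h * z$l)) - 1) ^ N * cmod (Esum h (\<lambda>k. F (etak \<kappa> h j k)) z)
     \<le> (4 / h + 2 * N + 3) ^ CARD('n) * 2 ^ (j * msum \<kappa>) * A * (h / 2 ^ (j * \<kappa> l)) ^ N" (is ?th1)
    and "cmod (Esum h (\<lambda>k. F (etak \<kappa> h j k)) z) \<le> (4 / h + 2 * N + 3) ^ CARD('n) * 2 ^ (j * msum \<kappa>) * A" (is ?th2)
    and "finite {k. F (etak \<kappa> h j k) \<noteq> 0}"
proof -
  define R where "R l = nat \<lceil>2 / h * 2 ^ (j * \<kappa> l)\<rceil>" for l
  let ?\<mu> = "\<lambda>k. F (etak \<kappa> h j k)"
  have suppR: "{k. ?\<mu> k \<noteq> 0} \<subseteq> kbox R"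
  proof
    fix k assume "k \<in> {k. ?\<mu> k \<noteq> 0}"
    then have "\<bar>etak \<kappa> h j k l\<bar> \<le> 2" for l using supp[of "etak \<kappa> h j k" l] by force
    then have "real_of_int \<bar>k l\<bar> \<le> 2 / h * 2 ^ (j * \<kappa> l)" for l
      using h by (simp add: etak_def abs_mult field_simps)
    then have "\<bar>k l\<bar> \<le> \<lceil>2 / h * 2 ^ (j * \<kappa> l)\<rceil>" for l by (metis ceiling_mono ceiling_of_int)
    then have "\<bar>k l\<bar> \<le> int (R l)" for l unfolding R_def by (smt (verit) int_nat_eq)
    then show "k \<in> kbox R" by (simp add: kbox_def)
  qed
  then show "finite {k. F (etak \<kappa> h j k) \<noteq> 0}" by (rule finite_subset) (rule kbox_card)
  have "Bd N UNIV A (\<lambda>y. F ((\<lambda>_. 0)(l := y)))" by (rule Bd)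
  from Bd_bound[OF this, of 0] have A: "0 \<le> A" using norm_ge_zero order_trans by blast
  \<comment> \<open>The radius is at most \<open>2 / h * 2 ^ (j * \<kappa> l') + 1\<close>, and the
    differences enlarge it by at most \<open>N\<close>. Twice this plus 1 gives the constant, once
    the terms without a power of 2 are multiplied by one.\<close>
  have R: "2 * real ((R(l := R l + M)) l') + 1 \<le> (4 / h + 2 * N + 3) * 2 ^ (j * \<kappa> l')" if "M \<le> N" for l' M
  proof -
    have 1: "real (R l') \<le> 2 / h * 2 ^ (j * \<kappa> l') + 1"
      unfolding R_def using h of_int_ceiling_le_add_one[of "2 / h * 2 ^ (j * \<kappa> l')"] by simp
    have "(1::real) \<le> 2 ^ (j * \<kappa> l')" by simp
    then have 2: "2 * real N + 3 \<le> (2 * real N + 3) * 2 ^ (j * \<kappa> l')" using mult_left_mono[of 1 "2 ^ (j * \<kappa> l')" "2 * real N + 3"] by simp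
    have "real ((R(l := R l + M)) l') \<le> real (R l') + N" using that by simp
    then show ?thesis using 1 2 by (simp add: algebra_simps)
  qed
  have P: "(\<Prod>l'\<in>UNIV. 2 * real ((R(l := R l + M)) l') + 1) \<le> (4 / h + 2 * N + 3) ^ CARD('n) * 2 ^ (j * msum \<kappa>)" if "M \<le> N" for M
  proof -
    have "(\<Prod>l'\<in>UNIV. 2 * real ((R(l := R l + M)) l') + 1) \<le> (\<Prod>l'\<in>UNIV. (4 / h + 2 * N + 3) * 2 ^ (j * \<kappa> l'))"
      by (intro prod_mono conjI R that) simp
    also have "\<dots> = (4 / h + 2 * N + 3) ^ CARD('n) * 2 ^ (j * msum \<kappa>)"
      by (simp add: prod.distrib power_sum[symmetric] msum_def sum_distrib_left)
    finally show ?thesis .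
  qed
  have "cmod (exp (- \<i> * of_real (h * z$l)) - 1) ^ N * cmod (Esum h ?\<mu> z) = cmod (Esum h ((dl l ^^ N) ?\<mu>) z)"
    using Esum_dl_pow[OF suppR, of N l h z] by (simp add: norm_mult norm_power)
  also have "\<dots> \<le> (\<Prod>l'\<in>UNIV. 2 * real ((R(l := R l + N)) l') + 1) * ((h / 2 ^ (j * \<kappa> l)) ^ N * A)"
  proof (rule Esum_le)
    show "{k. (dl l ^^ N) ?\<mu> k \<noteq> 0} \<subseteq> kbox (R(l := R l + N))" using Esum_dl_pow[OF suppR] by blast
    show "cmod ((dl l ^^ N) ?\<mu> k) \<le> (h / 2 ^ (j * \<kappa> l)) ^ N * A" for k
    proof -
      have "Bd N UNIV A (\<lambda>y. F ((etak \<kappa> h j k)(l := y)))" by (rule Bd)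
      from dff_pow_bound[OF this, of "h / 2 ^ (j * \<kappa> l)" "etak \<kappa> h j k l"] h
      show ?thesis unfolding dl_pow_dff by simp
    qed
  qed
  also have "\<dots> \<le> ((4 / h + 2 * N + 3) ^ CARD('n) * 2 ^ (j * msum \<kappa>)) * ((h / 2 ^ (j * \<kappa> l)) ^ N * A)"
    by (intro mult_right_mono P) (use h A in auto)
  finally show ?th1 by (simp add: mult_ac)
  have "cmod (Esum h ?\<mu> z) \<le> (\<Prod>l\<in>UNIV. 2 * real (R l) + 1) * A"
  proof (rule Esum_le[OF suppR])
    fix k
    have "Bd N UNIV A (\<lambda>y. F ((etak \<kappa> h j k)(l := y)))" by (rule Bd)
    from Bd_bound[OF this, of "etak \<kappa> h j k l"]
    show "cmod (?\<mu> k) \<le> A" by (simp only: fun_upd_triv UNIV_I)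
  qed
  also have "\<dots> \<le> ((4 / h + 2 * N + 3) ^ CARD('n) * 2 ^ (j * msum \<kappa>)) * A"
    using P[of 0] A by (intro mult_right_mono) auto
  finally show ?th2 .
qed

lemma qdist_max_coord:
  fixes z :: "real^'n::finite"
  assumes "\<forall>l. 0 < \<kappa> l"
  obtains l where "\<bar>z$l\<bar> \<ge> (qdist \<kappa> z 0 / sqrt (CARD('n))) ^ \<kappa> l"
proof -
  let ?f = "\<lambda>l. \<bar>z$l\<bar> powr (2 / real (\<kappa> l))"
  have "Max (range ?f) \<in> range ?f" by (rule Max_in) auto
  then obtain l where "Max (range ?f) = ?f l" by (rule rangeE)
  then have l: "?f l' \<le> ?f l" for l' using Max_ge[of "range ?f" "?f l'"] by simp
  have "(\<Sum>l'\<in>UNIV. ?f l') \<le> of_nat (CARD('n)) * ?f l" by (rule sum_bounded_above) (use l in auto)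
  then have "qdist \<kappa> z 0 \<le> sqrt (CARD('n) * ?f l)" by (simp add: qdist_def)
  also have "\<dots> = sqrt (CARD('n)) * sqrt (?f l)" by (rule real_sqrt_mult)
  also have "sqrt (?f l) = \<bar>z$l\<bar> powr (1 / real (\<kappa> l))"
    by (simp add: powr_half_sqrt[symmetric] powr_powr)
  finally have "qdist \<kappa> z 0 / sqrt (CARD('n)) \<le> \<bar>z$l\<bar> powr (1 / real (\<kappa> l))"
    by (simp add: field_simps)
  then have "(qdist \<kappa> z 0 / sqrt (CARD('n))) ^ \<kappa> l \<le> (\<bar>z$l\<bar> powr (1 / real (\<kappa> l))) ^ \<kappa> l"
    by (intro power_mono) (auto simp: qdist_def intro!: divide_nonneg_nonneg sum_nonneg)
  also have "\<dots> = \<bar>z$l\<bar>"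
    using assms[rule_format, of l] by (cases "z$l = 0") (auto simp: powr_realpow[symmetric] powr_powr)
  finally show ?thesis using that by blast
qed

text \<open>In the coordinate that dominates the quasi-norm,
  \<open>2 ^ j * qdist \<kappa> z 0 / n\<close> is at most
  \<open>2 ^ (j * \<kappa> l) * \<bar>z$l\<bar>\<close> as soon as it exceeds 1, so decay in one
  coordinate is decay in the quasi-norm; for smaller values counting lattice points suffices. The
  restriction \<open>\<bar>z$l\<bar> \<le> pi / h\<close> confines z to one period, beyond which the
  sum recurs.\<close>

lemma Esum_decay:
  assumes h: "0 < h" and \<kappa>: "\<forall>l::'n::finite. 0 < \<kappa> l"
  shows "\<exists>C\<ge>0. \<forall>F A j z. (\<forall>l \<eta>. Bd N UNIV A (\<lambda>y. F (\<eta>(l := y)))) \<longrightarrow> (\<forall>\<eta> l. 2 < \<bar>\<eta> l\<bar> \<longrightarrow> F \<eta> = 0)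
     \<longrightarrow> (\<forall>l. \<bar>z$l\<bar> \<le> pi / h) \<longrightarrow>
     cmod (Esum h (\<lambda>k. F (etak \<kappa> h j k)) z) \<le> C * A * 2 ^ (j * msum \<kappa>) / max 1 (2 ^ j * qdist \<kappa> z 0) ^ N"
proof -
  define c where "c = (4 / h + 2 * N + 3) ^ CARD('n)"
  define n where "n = sqrt (CARD('n))"
  have c: "0 \<le> c" using h by (auto simp: c_def)
  have n: "1 \<le> n" by (auto simp: n_def)
  define C where "C = c * (pi / 2 * n) ^ N"
  have pn: "1 \<le> pi / 2 * n"
    using mult_mono[of 1 "pi/2" 1 n] n pi_ge_two by simp
  show ?thesis
  proof (intro exI[of _ C] conjI allI impI)
    show "C \<ge> 0" using c n by (auto simp: C_def)
    fix F :: "('n \<Rightarrow> real) \<Rightarrow> complex" and A j and z :: "real^'n"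
    assume Bd: "\<forall>l \<eta>. Bd N UNIV A (\<lambda>y. F (\<eta>(l := y)))" and supp: "\<forall>\<eta> l. 2 < \<bar>\<eta> l\<bar> \<longrightarrow> F \<eta> = 0"
      and z: "\<forall>l. \<bar>z$l\<bar> \<le> pi / h"
    have "Bd N UNIV A (\<lambda>y. F ((\<lambda>_. 0)(undefined := y)))" using Bd by blast
    from Bd_bound[OF this, of 0] have A: "0 \<le> A" using norm_ge_zero order_trans by blast
    let ?E = "cmod (Esum h (\<lambda>k. F (etak \<kappa> h j k)) z)"
    let ?t = "2 ^ j * qdist \<kappa> z 0"
    have q: "0 \<le> qdist \<kappa> z 0" by (auto simp: qdist_def intro!: sum_nonneg)
    have triv: "?E \<le> c * 2 ^ (j * msum \<kappa>) * A"
      unfolding c_def by (rule Esum_decay_coord(2)[OF h Bd[rule_format] supp[rule_format]])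
    have "?E * max 1 ?t ^ N \<le> C * A * 2 ^ (j * msum \<kappa>)"
    proof (cases "?t \<le> n")
      case True
      have "?E * max 1 ?t ^ N \<le> (c * 2 ^ (j * msum \<kappa>) * A) * (pi / 2 * n) ^ N"
      proof (intro mult_mono triv power_mono)
        have "n \<le> pi / 2 * n" using n pi_ge_two mult_right_mono[of 1 "pi/2" n] by simp
        then show "max 1 ?t \<le> pi / 2 * n" using True pn by auto
      qed (use c A in auto)
      then show ?thesis by (simp add: C_def mult_ac)
    next
      case False
      then have t: "1 \<le> ?t / n" using n by (simp add: field_simps)
      obtain l where l: "\<bar>z$l\<bar> \<ge> (qdist \<kappa> z 0 / n) ^ \<kappa> l"
        using qdist_max_coord[OF \<kappa>, of z] unfolding n_def by blast
      have "?t / n \<le> (?t / n) ^ \<kappa> l" using t \<kappa> by (metis self_le_power)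
      also have "\<dots> = 2 ^ (j * \<kappa> l) * (qdist \<kappa> z 0 / n) ^ \<kappa> l" by (simp add: power_mult power_mult_distrib power_divide)
      also have "\<dots> \<le> 2 ^ (j * \<kappa> l) * \<bar>z$l\<bar>" using l by (intro mult_left_mono) auto
      finally have t2: "?t / n \<le> 2 ^ (j * \<kappa> l) * \<bar>z$l\<bar>" .
      have e: "2 / pi * (h * \<bar>z$l\<bar>) \<le> cmod (exp (- \<i> * of_real (h * z$l)) - 1)"
        using norm_exp_minus_1_ge[of "h * z$l"] z h by (simp add: abs_mult field_simps)
      have "(2 / pi * (h / 2 ^ (j * \<kappa> l)) * (?t / n)) ^ N * ?E \<le> (2 / pi * (h / 2 ^ (j * \<kappa> l)) * (2 ^ (j * \<kappa> l) * \<bar>z$l\<bar>)) ^ N * ?E"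
        by (intro mult_right_mono power_mono mult_left_mono t2) (use h q n in auto)
      also have "\<dots> = (2 / pi * (h * \<bar>z$l\<bar>)) ^ N * ?E" by simp
      also have "\<dots> \<le> cmod (exp (- \<i> * of_real (h * z$l)) - 1) ^ N * ?E"
        by (intro mult_right_mono power_mono e) (use h in auto)
      also have "\<dots> \<le> c * 2 ^ (j * msum \<kappa>) * A * (h / 2 ^ (j * \<kappa> l)) ^ N"
        unfolding c_def by (rule Esum_decay_coord(1)[OF h Bd[rule_format] supp[rule_format]])
      finally have "(h / 2 ^ (j * \<kappa> l)) ^ N * (?t ^ N * ?E / (pi / 2 * n) ^ N) \<le> (h / 2 ^ (j * \<kappa> l)) ^ N * (c * 2 ^ (j * msum \<kappa>) * A)"
        by (simp add: power_mult_distrib power_divide field_simps)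
      then have "?t ^ N * ?E / (pi / 2 * n) ^ N \<le> c * 2 ^ (j * msum \<kappa>) * A"
        using h by (subst (asm) mult_le_cancel_left_pos) auto
      then have "?t ^ N * ?E \<le> c * 2 ^ (j * msum \<kappa>) * A * (pi / 2 * n) ^ N"
        using n by (subst (asm) pos_divide_le_eq) auto
      moreover have "max 1 ?t = ?t" using False n by auto
      ultimately show ?thesis by (simp add: C_def mult_ac)
    qed
    moreover have "0 < max 1 ?t ^ N" by (intro zero_less_power) auto
    ultimately show "?E \<le> C * A * 2 ^ (j * msum \<kappa>) / max 1 ?t ^ N"
      by (simp add: pos_le_divide_eq)
  qed
qed

section \<open>Elliptic symbols and multipliers\<close>

text \<open>Induction on the degree: synthetic division by one node \<open>s\<close> writes p(t) as
  (t - s) q(t) + p(s), and q is bounded on the other nodes because their distance to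
  \<open>s\<close> is at least \<open>e\<close>.\<close>

lemma poly_coeff_bound:
  assumes "finite S" "card S > n"
  shows "\<exists>C\<ge>0. \<forall>(p::complex poly) M. degree p \<le> n \<longrightarrow> (\<forall>s\<in>S. cmod (poly p s) \<le> M) \<longrightarrow> (\<forall>i. cmod (coeff p i) \<le> C * M)"
  using assms
proof (induction n arbitrary: S)
  case 0
  then obtain s where s: "s \<in> S" by fastforce
  have "cmod (coeff p i) \<le> 1 * M" if "degree p \<le> 0" "\<forall>s\<in>S. cmod (poly p s) \<le> M" for p :: "complex poly" and M i
  proof -
    have "degree p = 0" using that(1) by simp
    then obtain c where p: "p = [:c:]" by (rule degree_eq_zeroE)
    have "cmod c \<le> M" using that(2) s p by auto
    moreover from this have "0 \<le> M" using norm_ge_zero order_trans by blast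
    ultimately show ?thesis using p by (cases i) auto
  qed
  then show ?case by (intro exI[of _ 1]) auto
next
  case (Suc n)
  then obtain s where s: "s \<in> S" by fastforce
  define S' where "S' = S - {s}"
  have S': "finite S'" "card S' > n" using Suc.prems s by (auto simp: S'_def)
  obtain C where C: "C \<ge> 0" "\<And>p M i. degree p \<le> n \<Longrightarrow> (\<And>s. s\<in>S' \<Longrightarrow> cmod (poly p s) \<le> M) \<Longrightarrow> cmod (coeff p i) \<le> C * M"
    using Suc.IH[OF S'] by blast
  have "S' \<noteq> {}" using S' by auto
  define e where "e = Min ((\<lambda>t. cmod (t - s)) ` S')"
  have e: "e > 0" "\<And>t. t \<in> S' \<Longrightarrow> e \<le> cmod (t - s)"
    using S' \<open>S' \<noteq> {}\<close> by (auto simp: e_def S'_def)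
  have "cmod (coeff p i) \<le> ((1 + cmod s) * C * (2 / e) + 1) * M"
    if p: "degree p \<le> Suc n" "\<forall>s\<in>S. cmod (poly p s) \<le> M" for p :: "complex poly" and M i
  proof -
    have M: "0 \<le> M" using p s norm_ge_zero order_trans by blast
    define q where "q = synthetic_div p s"
    have pq: "[:-s, 1:] * q + [:poly p s:] = p" unfolding q_def by (rule synthetic_div_correct')
    have dq: "degree q \<le> n" using p(1) by (simp add: q_def degree_synthetic_div)
    have q: "cmod (coeff q i) \<le> C * (2 * M / e)" for i
    proof (rule C(2)[OF dq])
      fix t assume t: "t \<in> S'"
      have "poly p t = (t - s) * poly q t + poly p s" by (subst pq[symmetric]) (simp add: algebra_simps)
      then have "cmod (t - s) * cmod (poly q t) = cmod (poly p t - poly p s)" by (simp add: norm_mult)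
      also have "\<dots> \<le> M + M" using p(2) t s by (intro order_trans[OF norm_triangle_ineq4] add_mono) (auto simp: S'_def)
      finally have "e * cmod (poly q t) \<le> 2 * M" using e(2)[OF t] mult_right_mono[of e "cmod (t - s)" "cmod (poly q t)"] by simp
      then show "cmod (poly q t) \<le> 2 * M / e" using e(1) by (simp add: field_simps)
    qed
    have "coeff p i = coeff (pCons 0 q) i - s * coeff q i + coeff [:poly p s:] i"
      by (subst pq[symmetric]) (cases i; simp add: algebra_simps)
    also have "cmod \<dots> \<le> C * (2 * M / e) + cmod s * (C * (2 * M / e)) + M"
    proof (intro order_trans[OF norm_triangle_ineq] order_trans[OF norm_triangle_ineq4] add_mono)
      show "cmod (coeff (pCons 0 q) i) \<le> C * (2 * M / e)" using q C M e by (cases i) auto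
      show "cmod (s * coeff q i) \<le> cmod s * (C * (2 * M / e))" unfolding norm_mult by (intro mult_left_mono q) auto
      show "cmod (coeff [:poly p s:] i) \<le> M" using p s M by (cases i) auto
    qed
    also have "\<dots> = ((1 + cmod s) * C * (2 / e) + 1) * M" by (simp add: algebra_simps)
    finally show ?thesis .
  qed
  then show ?case using C e by (intro exI[of _ "(1 + cmod s) * C * (2 / e) + 1"]) auto
qed

text \<open>Kronecker substitution: the new weight \<open>E\<close> exceeds every value attained
  with the old variables, so the new exponent and the old value are recovered as quotient and
  remainder.\<close>

lemma kronecker_injective:
  assumes "finite V"
  shows "\<exists>e::'a \<Rightarrow> nat. inj_on (\<lambda>\<sigma>. \<Sum>l\<in>V. e l * \<sigma> l) {\<sigma>. (\<forall>l\<in>V. \<sigma> l \<le> D) \<and> (\<forall>l. l \<notin> V \<longrightarrow> \<sigma> l = 0)}"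
  using assms
proof (induction V rule: finite_induct)
  case empty
  show ?case by (auto simp: inj_on_def)
next
  case (insert k V)
  then obtain e where e: "inj_on (\<lambda>\<sigma>. \<Sum>l\<in>V. e l * \<sigma> l) {\<sigma>. (\<forall>l\<in>V. \<sigma> l \<le> D) \<and> (\<forall>l. l \<notin> V \<longrightarrow> \<sigma> l = 0)}" by blast
  define E where "E = (\<Sum>l\<in>V. e l * D) + 1"
  define e' where "e' = e(k := E)"
  have "inj_on (\<lambda>\<sigma>. \<Sum>l\<in>insert k V. e' l * \<sigma> l) {\<sigma>. (\<forall>l\<in>insert k V. \<sigma> l \<le> D) \<and> (\<forall>l. l \<notin> insert k V \<longrightarrow> \<sigma> l = 0)}"
  proof (rule inj_onI)
    fix \<sigma> \<tau>
    assume *: "\<sigma> \<in> {\<sigma>. (\<forall>l\<in>insert k V. \<sigma> l \<le> D) \<and> (\<forall>l. l \<notin> insert k V \<longrightarrow> \<sigma> l = 0)}"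
      "\<tau> \<in> {\<sigma>. (\<forall>l\<in>insert k V. \<sigma> l \<le> D) \<and> (\<forall>l. l \<notin> insert k V \<longrightarrow> \<sigma> l = 0)}"
      "(\<Sum>l\<in>insert k V. e' l * \<sigma> l) = (\<Sum>l\<in>insert k V. e' l * \<tau> l)"
    let ?r = "\<lambda>\<sigma>::'a \<Rightarrow> nat. \<Sum>l\<in>V. e l * \<sigma> l"
    have s: "(\<Sum>l\<in>insert k V. e' l * \<sigma> l) = E * \<sigma> k + ?r \<sigma>" for \<sigma>
    proof -
      have "(\<Sum>l\<in>V. e' l * \<sigma> l) = ?r \<sigma>" using insert(2) by (intro sum.cong) (auto simp: e'_def)
      then show ?thesis using insert(1,2) by (simp add: e'_def)
    qed
    have r: "?r \<sigma> < E" "?r \<tau> < E" unfolding E_def using * by (auto intro!: le_imp_less_Suc sum_mono)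
    have eq: "E * \<sigma> k + ?r \<sigma> = E * \<tau> k + ?r \<tau>" using *(3) s by simp
    have "(E * \<sigma> k + ?r \<sigma>) div E = \<sigma> k" "(E * \<tau> k + ?r \<tau>) div E = \<tau> k"
      using r by (simp_all)
    then have k: "\<sigma> k = \<tau> k" using eq by simp
    then have "?r \<sigma> = ?r \<tau>" using eq by simp
    moreover have "?r (\<sigma>(k := 0)) = ?r \<sigma>" for \<sigma> using insert(2) by (intro sum.cong) auto
    ultimately have "?r (\<sigma>(k := 0)) = ?r (\<tau>(k := 0))" by simp
    then have "\<sigma>(k := 0) = \<tau>(k := 0)" using inj_onD[OF e] * by auto
    then show "\<sigma> = \<tau>" using k by (metis fun_upd_triv fun_upd_upd)
  qed
  then show ?case by blast
qed

definition qn :: "'n::finite mindex \<Rightarrow> ('n \<Rightarrow> real) \<Rightarrow> real" where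
  "qn \<kappa> \<eta> = sqrt (\<Sum>l\<in>UNIV. \<bar>\<eta> l\<bar> powr (2 / real (\<kappa> l)))"

lemma qn_nonneg: "0 \<le> qn \<kappa> \<eta>"
  by (auto simp: qn_def intro!: sum_nonneg)

lemma qn_ge_coord:
  assumes "0 < \<kappa> l" "0 \<le> t" "t ^ \<kappa> l \<le> \<bar>\<eta> l\<bar>" shows "t \<le> qn \<kappa> \<eta>"
proof -
  have "t\<^sup>2 = (t ^ \<kappa> l) powr (2 / real (\<kappa> l))"
  proof (cases "t = 0")
    case False
    then have "t ^ \<kappa> l = t powr real (\<kappa> l)" using assms by (simp add: powr_realpow)
    then have "(t ^ \<kappa> l) powr (2 / real (\<kappa> l)) = t powr 2" using assms by (simp add: powr_powr)
    then show ?thesis using False assms by simp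
  qed (use assms in auto)
  also have "\<dots> \<le> \<bar>\<eta> l\<bar> powr (2 / real (\<kappa> l))" using assms by (intro powr_mono2) auto
  also have "\<dots> \<le> (\<Sum>l\<in>UNIV. \<bar>\<eta> l\<bar> powr (2 / real (\<kappa> l)))" by (rule member_le_sum) auto
  finally show ?thesis using assms(2) by (simp add: qn_def real_le_rsqrt)
qed

definition mipow :: "('n::finite \<Rightarrow> complex) \<Rightarrow> 'n mindex \<Rightarrow> complex" where
  "mipow \<eta> \<sigma> = (\<Prod>l\<in>UNIV. \<eta> l ^ \<sigma> l)"

definition psym :: "'n::finite mindex set \<Rightarrow> 'n mindex set \<Rightarrow> ('n mindex \<Rightarrow> 'n mindex \<Rightarrow> complex) \<Rightarrow> ('n \<Rightarrow> real) \<Rightarrow> complex" where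
  "psym A B c \<eta> = (\<Sum>\<alpha>\<in>A. \<Sum>\<beta>\<in>B. c \<alpha> \<beta> * mipow (\<lambda>l. \<i> * of_real (\<eta> l)) (\<lambda>l. \<alpha> l + \<beta> l))"

text \<open>Fixed once by a choice, so that every constant derived from the cutoff is independent of
  the data.\<close>

definition phi1 :: "real \<Rightarrow> real" where
  "phi1 = (SOME \<phi>. (\<lambda>t. complex_of_real (\<phi> t)) \<in> test1 2 \<and> (\<forall>t. 0 \<le> \<phi> t \<and> \<phi> t \<le> 1) \<and> (\<forall>t. \<bar>t\<bar> \<le> 1 \<longrightarrow> \<phi> t = 1))"

lemma phi1: "(\<lambda>t. complex_of_real (phi1 t)) \<in> test1 2" "0 \<le> phi1 t" "phi1 t \<le> 1" "\<bar>t\<bar> \<le> 1 \<Longrightarrow> phi1 t = 1"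
  "2 < \<bar>t\<bar> \<Longrightarrow> phi1 t = 0"
proof -
  have "\<exists>\<phi>. (\<lambda>t. complex_of_real (\<phi> t)) \<in> test1 2 \<and> (\<forall>t. 0 \<le> \<phi> t \<and> \<phi> t \<le> 1) \<and> (\<forall>t. \<bar>t\<bar> \<le> 1 \<longrightarrow> \<phi> t = 1)"
    by (rule bump_exists) blast
  from someI_ex[OF this, folded phi1_def]
  show "(\<lambda>t. complex_of_real (phi1 t)) \<in> test1 2" "0 \<le> phi1 t" "phi1 t \<le> 1" "\<bar>t\<bar> \<le> 1 \<Longrightarrow> phi1 t = 1"
    "2 < \<bar>t\<bar> \<Longrightarrow> phi1 t = 0"
    using test1_zero[of "\<lambda>t. complex_of_real (phi1 t)" 2 t] by auto
qed

definition phin :: "('n::finite \<Rightarrow> real) \<Rightarrow> complex" where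
  "phin \<eta> = (\<Prod>l\<in>UNIV. of_real (phi1 (\<eta> l)))"

text \<open>Multiplying coordinate \<open>l\<close> by \<open>2 ^ \<kappa> l\<close> is the passage
  from scale \<open>j\<close> to scale \<open>j - 1\<close> in \<open>etak\<close>; these are
  therefore the consecutive differences of low-pass cutoffs, and they telescope.\<close>

definition chin :: "'n::finite mindex \<Rightarrow> ('n \<Rightarrow> real) \<Rightarrow> complex" where
  "chin \<kappa> \<eta> = phin \<eta> - phin (\<lambda>l. 2 ^ \<kappa> l * \<eta> l)"

lemma phin_zero: "2 < \<bar>\<eta> l\<bar> \<Longrightarrow> phin \<eta> = 0"
proof -
  assume "2 < \<bar>\<eta> l\<bar>"
  then have "complex_of_real (phi1 (\<eta> l)) = 0" by (simp add: phi1(5))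
  then show ?thesis unfolding phin_def by (intro prod_zero bexI[of _ l]) auto
qed

lemma phin_one: "(\<And>l. \<bar>\<eta> l\<bar> \<le> 1) \<Longrightarrow> phin \<eta> = 1"
  by (auto simp: phin_def phi1(4) intro!: prod.neutral)

lemma chin_zero: "2 < \<bar>\<eta> l\<bar> \<Longrightarrow> chin \<kappa> \<eta> = 0"
proof -
  assume a: "2 < \<bar>\<eta> l\<bar>"
  have "\<bar>\<eta> l\<bar> \<le> \<bar>2 ^ \<kappa> l * \<eta> l\<bar>" using mult_right_mono[of 1 "2 ^ \<kappa> l" "\<bar>\<eta> l\<bar>"] by (simp add: abs_mult)
  then show ?thesis using a phin_zero[of \<eta> l] phin_zero[of "\<lambda>l. 2 ^ \<kappa> l * \<eta> l" l] by (simp add: chin_def)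
qed

text \<open>If no rescaled coordinate exceeds 1, both cutoffs equal 1 and their difference vanishes.
  Where \<open>chin\<close> is nonzero, an elliptic symbol is thus at least
  \<open>lam * (1 / 2) ^ m\<close>.\<close>

lemma chin_nonzero_qn:
  assumes "\<forall>l. 0 < \<kappa> l" "chin \<kappa> \<eta> \<noteq> 0" shows "1 / 2 \<le> qn \<kappa> \<eta>"
proof -
  have "\<exists>l. 1 < \<bar>2 ^ \<kappa> l * \<eta> l\<bar>"
  proof (rule ccontr)
    assume *: "\<not> ?thesis"
    have "\<bar>\<eta> l\<bar> \<le> 1" for l
    proof -
      have "\<bar>\<eta> l\<bar> \<le> \<bar>2 ^ \<kappa> l * \<eta> l\<bar>" using mult_right_mono[of 1 "2 ^ \<kappa> l" "\<bar>\<eta> l\<bar>"] by (simp add: abs_mult)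
      then show ?thesis using * by (meson not_le order_trans)
    qed
    then have "chin \<kappa> \<eta> = 0" using * phin_one[of \<eta>] phin_one[of "\<lambda>l. 2 ^ \<kappa> l * \<eta> l"] by (auto simp: chin_def not_less)
    then show False using assms by simp
  qed
  then obtain l where l: "1 < \<bar>2 ^ \<kappa> l * \<eta> l\<bar>" by blast
  then have "(1 / 2) ^ \<kappa> l \<le> \<bar>\<eta> l\<bar>" by (simp add: abs_mult power_divide field_simps)
  then show ?thesis using qn_ge_coord[of \<kappa> l "1/2" \<eta>] assms by auto
qed

lemma prod_upd:
  fixes f :: "'n::finite \<Rightarrow> real \<Rightarrow> complex"
  shows "(\<Prod>k\<in>UNIV. f k ((\<eta>(l := y)) k)) = f l y * (\<Prod>k\<in>UNIV-{l}. f k (\<eta> k))"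
  by (subst prod.remove[of _ l]) (auto intro!: prod.cong arg_cong2[where f = times])

text \<open>Open and strictly larger than [-2, 2], so that together with the region where the
  cutoffs vanish it covers the line, as the extension by zero requires.\<close>

definition S3 :: "real set" where "S3 = {-3<..<3}"

lemma S3: "open S3" "y \<in> S3 \<Longrightarrow> \<bar>y\<bar> \<le> 3"
  by (auto simp: S3_def)

text \<open>Bounds along one coordinate at a time suffice for the decay estimate.  The other coordinates
  are restricted to the region where the cutoffs \<open>phin\<close> and \<open>chin\<close> can be nonzero.\<close>

definition Qb :: "nat \<Rightarrow> real \<Rightarrow> (('n::finite \<Rightarrow> real) \<Rightarrow> complex) \<Rightarrow> bool" where
  "Qb N C q \<longleftrightarrow> (\<forall>l \<eta>. (\<forall>k. k \<noteq> l \<longrightarrow> \<bar>\<eta> k\<bar> \<le> 2) \<longrightarrow> Bd N S3 C (\<lambda>y. q (\<eta>(l := y))))"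

lemma Qb_mono: "Qb N C q \<Longrightarrow> C \<le> D \<Longrightarrow> Qb N D q"
  unfolding Qb_def by (blast intro: Bd_mono)

lemma Qb_mult: "Qb N C p \<Longrightarrow> Qb N D q \<Longrightarrow> 0 \<le> C \<Longrightarrow> 0 \<le> D \<Longrightarrow> Qb N (2 ^ N * C * D) (\<lambda>\<eta>. p \<eta> * q \<eta>)"
  unfolding Qb_def using Bd_mult by blast

lemma Qb_cmult: "Qb N C p \<Longrightarrow> cmod c \<le> D \<Longrightarrow> 0 \<le> C \<Longrightarrow> Qb N (D * C) (\<lambda>\<eta>. c * p \<eta>)"
  unfolding Qb_def using Bd_cmult by blast

lemma Qb_add: "Qb N C p \<Longrightarrow> Qb N D q \<Longrightarrow> Qb N (C + D) (\<lambda>\<eta>. p \<eta> + q \<eta>)"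
  unfolding Qb_def using Bd_add by blast

lemma Qb_const: "cmod c \<le> C \<Longrightarrow> Qb N C (\<lambda>\<eta>. c)"
  unfolding Qb_def using Bd_const by blast

lemma Qb_sum:
  assumes "finite S" "\<And>s. s \<in> S \<Longrightarrow> Qb N C (p s)"
  shows "Qb N (real (card S) * C) (\<lambda>\<eta>. \<Sum>s\<in>S. p s \<eta>)"
  using assms
proof (induction S rule: finite_induct)
  case empty then show ?case using Qb_const[of 0 0] by simp
next
  case (insert s S)
  then have "Qb N (C + real (card S) * C) (\<lambda>\<eta>. p s \<eta> + (\<Sum>s\<in>S. p s \<eta>))" by (intro Qb_add) auto
  then show ?case using insert by (simp add: algebra_simps)
qed

lemma Qb_prod:
  fixes f :: "'n::finite \<Rightarrow> real \<Rightarrow> complex"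
  assumes "\<And>l. Bd N S3 C (f l)" "1 \<le> C"
  shows "Qb N (C ^ CARD('n)) (\<lambda>\<eta>. \<Prod>k\<in>UNIV. f k (\<eta> k))"
  unfolding Qb_def
proof (intro allI impI)
  fix l :: 'n and \<eta> :: "'n \<Rightarrow> real" assume \<eta>: "\<forall>k. k \<noteq> l \<longrightarrow> \<bar>\<eta> k\<bar> \<le> 2"
  have "cmod (\<Prod>k\<in>UNIV-{l}. f k (\<eta> k)) \<le> (\<Prod>k\<in>UNIV-{l}. C)"
    unfolding prod_norm[symmetric]
    by (intro prod_mono conjI norm_ge_zero Bd_bound[OF assms(1)]) (use \<eta> in \<open>force simp: S3_def\<close>)
  then have "Bd N S3 (C ^ (CARD('n) - 1) * C) (\<lambda>y. (\<Prod>k\<in>UNIV-{l}. f k (\<eta> k)) * f l y)"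
    by (intro Bd_cmult assms) (use assms in auto)
  moreover have "C ^ (CARD('n) - 1) * C = C ^ CARD('n)"
    using power_Suc2[of C "CARD('n) - 1"] by simp
  ultimately show "Bd N S3 (C ^ CARD('n)) (\<lambda>y. \<Prod>k\<in>UNIV. f k ((\<eta>(l := y)) k))"
    unfolding prod_upd by (simp add: mult.commute)
qed

lemma Qb_monom: "\<exists>C\<ge>1. \<forall>(\<sigma>::'n::finite mindex). (\<forall>l. \<sigma> l \<le> D) \<longrightarrow> Qb N C (\<lambda>\<eta>. mipow (\<lambda>l. of_real (\<eta> l)) \<sigma>)"
proof -
  have "\<exists>C\<ge>1. \<forall>k\<le>D. Bd N S3 C (\<lambda>y. complex_of_real y ^ k)"
  proof (induction D)
    case 0 then show ?case by (auto intro!: exI[of _ 1] Bd_const)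
  next
    case (Suc D)
    then obtain C where C: "C \<ge> 1" "\<forall>k\<le>D. Bd N S3 C (\<lambda>y. complex_of_real y ^ k)" by blast
    have "Bd N S3 3 of_real" by (rule Bd_ident) (auto simp: S3)
    then obtain C' where "Bd N S3 C' (\<lambda>y. complex_of_real y ^ Suc D)" using Bd_power[of N S3 3 of_real "Suc D"] by auto
    then show ?case using C by (intro exI[of _ "max C C'"]) (auto simp: le_Suc_eq intro: Bd_mono)
  qed
  then obtain C where C: "C \<ge> 1" "\<And>k. k \<le> D \<Longrightarrow> Bd N S3 C (\<lambda>y. complex_of_real y ^ k)" by blast
  have "Qb N (C ^ CARD('n)) (\<lambda>\<eta>. mipow (\<lambda>l. of_real (\<eta> l)) \<sigma>)" if "\<forall>l. \<sigma> l \<le> D" for \<sigma> :: "'n mindex"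
    unfolding mipow_def by (rule Qb_prod[where f = "\<lambda>l y. complex_of_real y ^ \<sigma> l"]) (use C that in auto)
  then show ?thesis using C by (intro exI[of _ "C ^ CARD('n)"]) auto
qed

lemma Qb_phin: "\<exists>C\<ge>1. Qb N C (\<lambda>\<eta>::'n::finite\<Rightarrow>real. phin \<eta>)"
  and Qb_chin: "\<exists>C\<ge>1. Qb N C (chin (\<kappa>::'n::finite mindex))"
proof -
  have "\<exists>C\<ge>1. Bd N S3 C (\<lambda>y. complex_of_real (phi1 (2 ^ k * y)))" for k :: nat
  proof -
    have "smooth1 (\<lambda>y. complex_of_real (phi1 (2 ^ k * y + 0)))"
      by (rule smooth1_affine_nd(1)[OF test1_smooth1[OF phi1(1)]])
    moreover have "phi1 (2 ^ k * t) = 0" if "2 < \<bar>t\<bar>" for t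
    proof (rule phi1(5))
      show "2 < \<bar>2 ^ k * t\<bar>" using that mult_right_mono[of 1 "2 ^ k" "\<bar>t\<bar>"] by (simp add: abs_mult)
    qed
    ultimately have "(\<lambda>y. complex_of_real (phi1 (2 ^ k * y))) \<in> test1 2" by (simp add: test1_def)
    then obtain C where "Bd N S3 C (\<lambda>y. complex_of_real (phi1 (2 ^ k * y)))" using Bd_test1 by blast
    then show ?thesis by (intro exI[of _ "max 1 C"]) (auto intro: Bd_mono)
  qed
  then obtain C where C: "\<And>k. C k \<ge> 1" "\<And>k. Bd N S3 (C k) (\<lambda>y. complex_of_real (phi1 (2 ^ k * y)))" by metis
  have 1: "Qb N (C 0 ^ CARD('n)) (\<lambda>\<eta>::'n\<Rightarrow>real. phin \<eta>)"
    unfolding phin_def by (rule Qb_prod[where f = "\<lambda>l y. complex_of_real (phi1 y)"]) (use C[of 0] in auto)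
  then show "\<exists>C\<ge>1. Qb N C (\<lambda>\<eta>::'n\<Rightarrow>real. phin \<eta>)" using C[of 0] by (intro exI[of _ "C 0 ^ CARD('n)"]) auto
  define M where "M = Max (range (\<lambda>l. C (\<kappa> l)))"
  have M: "C (\<kappa> l) \<le> M" for l unfolding M_def by (rule Max_ge) auto
  have "Qb N (M ^ CARD('n)) (\<lambda>\<eta>::'n\<Rightarrow>real. phin (\<lambda>l. 2 ^ \<kappa> l * \<eta> l))"
    unfolding phin_def by (rule Qb_prod[where f = "\<lambda>l y. complex_of_real (phi1 (2 ^ \<kappa> l * y))"])
      (use M C in \<open>auto intro: Bd_mono order_trans\<close>)
  from Qb_add[OF 1 Qb_cmult[OF this, of "-1" 1]] order_trans[OF C(1) M]
  have "Qb N (C 0 ^ CARD('n) + M ^ CARD('n)) (chin \<kappa>)" by (simp add: chin_def[abs_def])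
  then show "\<exists>C\<ge>1. Qb N C (chin \<kappa>)" using one_le_power[OF C(1)[of 0], of "CARD('n)"] one_le_power[OF order_trans[OF C(1) M], of "CARD('n)"]
    by (intro exI[of _ "C 0 ^ CARD('n) + M ^ CARD('n)"]) auto
qed

text \<open>Either all other coordinates are at most 2, and the bound on \<open>S3\<close> extends
  by zero, or the function vanishes along the whole line.\<close>

lemma Qb_extend:
  fixes F :: "('n::finite \<Rightarrow> real) \<Rightarrow> complex"
  assumes "Qb N C F" "0 \<le> C" "\<And>\<eta> l. 2 < \<bar>\<eta> l\<bar> \<Longrightarrow> F \<eta> = 0"
  shows "Bd N UNIV C (\<lambda>y. F (\<eta>(l := y)))"
proof (cases "\<forall>k. k \<noteq> l \<longrightarrow> \<bar>\<eta> k\<bar> \<le> 2")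
  case True
  show ?thesis
  proof (rule Bd_extend_zero[OF S3(1), of "{y. 2 < \<bar>y\<bar>}"])
    show "Bd N S3 C (\<lambda>y. F (\<eta>(l := y)))" using assms(1) True unfolding Qb_def by blast
    show "open {y::real. 2 < \<bar>y\<bar>}" by (intro open_Collect_less continuous_intros)
    show "S3 \<union> {y. 2 < \<bar>y\<bar>} = UNIV" by (auto simp: S3_def)
    fix y :: real assume "y \<in> {y. 2 < \<bar>y\<bar>}"
    then show "F (\<eta>(l := y)) = 0" using assms(3)[of "\<eta>(l := y)" l] by simp
  qed (rule assms)
next
  case False
  then obtain k where "k \<noteq> l" "2 < \<bar>\<eta> k\<bar>" by (auto simp: not_le)
  then have "F (\<eta>(l := y)) = 0" for y using assms(3)[of "\<eta>(l := y)" k] by simp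
  then show ?thesis using assms(2) by (simp add: Bd_const)
qed

locale symb_class =
  fixes \<kappa> :: "'n::finite mindex" and A B :: "'n mindex set" and m :: nat and lam Lam :: real
  assumes kpos: "\<forall>l. 0 < \<kappa> l" and finA: "finite A" and finB: "finite B"
    and hom: "\<forall>\<alpha>\<in>A. \<forall>\<beta>\<in>B. mdot (\<lambda>l. \<alpha> l + \<beta> l) \<kappa> = m"
    and lam: "0 < lam"
begin

definition elliptic :: "('n mindex \<Rightarrow> 'n mindex \<Rightarrow> complex) \<Rightarrow> bool" where
  "elliptic c \<longleftrightarrow> (\<forall>\<eta>. lam * qn \<kappa> \<eta> ^ m \<le> cmod (psym A B c \<eta>) \<and> cmod (psym A B c \<eta>) \<le> Lam * qn \<kappa> \<eta> ^ m)"

definition Sg :: "'n mindex set" where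
  "Sg = (\<lambda>(\<alpha>, \<beta>). \<lambda>l. \<alpha> l + \<beta> l) ` (A \<times> B)"

definition coef :: "('n mindex \<Rightarrow> 'n mindex \<Rightarrow> complex) \<Rightarrow> 'n mindex \<Rightarrow> complex" where
  "coef c \<sigma> = (\<Sum>(\<alpha>, \<beta>) | (\<alpha>, \<beta>) \<in> A \<times> B \<and> (\<lambda>l. \<alpha> l + \<beta> l) = \<sigma>. c \<alpha> \<beta>)"

lemma finSg: "finite Sg"
  using finA finB by (auto simp: Sg_def)

lemma sum_coef:
  fixes G :: "'n mindex \<Rightarrow> complex"
  shows "(\<Sum>\<alpha>\<in>A. \<Sum>\<beta>\<in>B. c \<alpha> \<beta> * G (\<lambda>l. \<alpha> l + \<beta> l)) = (\<Sum>\<sigma>\<in>Sg. coef c \<sigma> * G \<sigma>)"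
proof -
  let ?g = "\<lambda>(\<alpha>::'n mindex, \<beta>::'n mindex) l. \<alpha> l + \<beta> l" and ?h = "\<lambda>p::'n mindex \<times> 'n mindex. c (fst p) (snd p) * G (\<lambda>l. fst p l + snd p l)"
  have "(\<Sum>\<alpha>\<in>A. \<Sum>\<beta>\<in>B. c \<alpha> \<beta> * G (\<lambda>l. \<alpha> l + \<beta> l)) = sum ?h (A \<times> B)"
    by (simp add: sum.cartesian_product case_prod_unfold)
  also have "\<dots> = (\<Sum>\<sigma>\<in>Sg. sum ?h {p \<in> A \<times> B. ?g p = \<sigma>})"
    by (rule sum.group[symmetric]) (use finA finB finSg in \<open>auto simp: Sg_def\<close>)
  also have "\<dots> = (\<Sum>\<sigma>\<in>Sg. coef c \<sigma> * G \<sigma>)"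
    unfolding coef_def sum_distrib_right
    by (intro sum.cong refl) (auto simp: case_prod_unfold)
  finally show ?thesis .
qed

lemma psym_coef: "psym A B c \<eta> = (\<Sum>\<sigma>\<in>Sg. coef c \<sigma> * mipow (\<lambda>l. \<i> * of_real (\<eta> l)) \<sigma>)"
  unfolding psym_def by (rule sum_coef)

lemma mipow_scale: "mipow (\<lambda>l. of_real (t ^ \<kappa> l) * \<eta> l) \<sigma> = of_real t ^ mdot \<sigma> \<kappa> * mipow \<eta> \<sigma>"
  by (simp add: mipow_def power_mult_distrib prod.distrib mdot_def power_sum power_mult[symmetric] mult.commute)

lemma Sg_mdot: "\<sigma> \<in> Sg \<Longrightarrow> mdot \<sigma> \<kappa> = m"
  using hom by (auto simp: Sg_def)

text \<open>Every monomial of the symbol has the same weighted degree \<open>m\<close>. This turns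
  the lower bound at frequencies of size 1 into a gain of \<open>2 ^ (j * m)\<close> at scale
  \<open>j\<close>.\<close>

lemma psym_scale: "psym A B c (\<lambda>l. t ^ \<kappa> l * \<eta> l) = of_real t ^ m * psym A B c \<eta>"
proof -
  have "mipow (\<lambda>l. \<i> * of_real (t ^ \<kappa> l * \<eta> l)) \<sigma> = of_real t ^ m * mipow (\<lambda>l. \<i> * of_real (\<eta> l)) \<sigma>" if "\<sigma> \<in> Sg" for \<sigma>
    using mipow_scale[of t "\<lambda>l. \<i> * of_real (\<eta> l)" \<sigma>] Sg_mdot[OF that] by (simp add: mult_ac)
  then show ?thesis unfolding psym_coef by (simp add: sum_distrib_left mult_ac)
qed

lemma mipow_i: "mipow (\<lambda>l. \<i> * \<eta> l) \<sigma> = \<i> ^ mlen \<sigma> * mipow \<eta> \<sigma>"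
  by (simp add: mipow_def power_mult_distrib prod.distrib mlen_def power_sum)

lemma mipow_uminus: "mipow (\<lambda>l. - \<eta> l) \<sigma> = (-1) ^ mlen \<sigma> * mipow \<eta> \<sigma>"
proof -
  have "mipow (\<lambda>l. (-1) * \<eta> l) \<sigma> = (-1) ^ mlen \<sigma> * mipow \<eta> \<sigma>"
    unfolding mipow_def power_mult_distrib prod.distrib by (simp add: mlen_def power_sum)
  then show ?thesis by simp
qed

text \<open>The coefficients of a frozen symbol are not bounded by hypothesis; only their sums over equal
  \<open>\<alpha> + \<beta>\<close> are.  Substituting \<open>\<eta> l = t ^ e l\<close> with exponents \<open>e\<close> that separate the multi-indices makes
  \<open>psym\<close> a polynomial in \<open>t\<close>, whose coefficients are bounded by its values at finitely many points.\<close>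

lemma coef_bound: "\<exists>C\<ge>0. \<forall>c. elliptic c \<longrightarrow> (\<forall>\<sigma>\<in>Sg. cmod (coef c \<sigma>) \<le> C)"
proof -
  define D where "D = Max (insert 0 ((\<lambda>(\<sigma>, l). \<sigma> l) ` (Sg \<times> UNIV)))"
  have D: "\<sigma> l \<le> D" if "\<sigma> \<in> Sg" for \<sigma> l
    unfolding D_def by (rule Max_ge) (use finSg that in \<open>auto intro!: image_eqI[of _ _ "(\<sigma>, l)"]\<close>)
  obtain e :: "'n \<Rightarrow> nat" where e: "inj_on (\<lambda>\<sigma>. \<Sum>l\<in>UNIV. e l * \<sigma> l) {\<sigma>. (\<forall>l\<in>UNIV. \<sigma> l \<le> D) \<and> (\<forall>l. l \<notin> UNIV \<longrightarrow> \<sigma> l = 0)}"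
    using kronecker_injective[OF finite[of "UNIV :: 'n set"], of D] by blast
  define ev where "ev \<sigma> = (\<Sum>l\<in>UNIV. e l * \<sigma> l)" for \<sigma> :: "'n mindex"
  have inj: "inj_on ev Sg" unfolding ev_def by (rule inj_on_subset[OF e]) (use D in auto)
  define n where "n = Max (insert 0 (ev ` Sg))"
  have n: "ev \<sigma> \<le> n" if "\<sigma> \<in> Sg" for \<sigma> unfolding n_def by (rule Max_ge) (use finSg that in auto)
  define S where "S = (\<lambda>i. complex_of_real (real i)) ` {..n}"
  have "card S = Suc n" unfolding S_def by (subst card_image) (auto simp: inj_on_def)
  then obtain C where C: "C \<ge> 0" "\<And>(p::complex poly) M i. degree p \<le> n \<Longrightarrow> (\<And>s. s\<in>S \<Longrightarrow> cmod (poly p s) \<le> M) \<Longrightarrow> cmod (coeff p i) \<le> C * M"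
    using poly_coeff_bound[of S n] by (auto simp: S_def)
  \<comment> \<open>The symbol is sampled at the points with coordinates
    \<open>real i ^ e l\<close>. \<open>Lam\<close> carries no sign in this context, hence the
    absolute value.\<close>
  define M where "M = Max ((\<lambda>i. \<bar>Lam\<bar> * qn \<kappa> (\<lambda>l. real i ^ e l) ^ m) ` {..n})"
  have M: "\<bar>Lam\<bar> * qn \<kappa> (\<lambda>l. real i ^ e l) ^ m \<le> M" if "i \<le> n" for i
    unfolding M_def by (rule Max_ge) (use that in auto)
  have M0: "0 \<le> M" by (rule order_trans[OF _ M[of 0]]) (auto intro!: mult_nonneg_nonneg zero_le_power qn_nonneg)
  have "cmod (coef c \<sigma>) \<le> C * M" if c: "elliptic c" and \<sigma>: "\<sigma> \<in> Sg" for c \<sigma>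
  proof -
    define p where "p = (\<Sum>\<sigma>\<in>Sg. Polynomial.monom (coef c \<sigma> * \<i> ^ mlen \<sigma>) (ev \<sigma>))"
    have dp: "degree p \<le> n" unfolding p_def
      by (rule degree_sum_le[OF finSg]) (use n degree_monom_le order_trans in blast)
    have "cmod (coeff p (ev \<sigma>)) \<le> C * M"
    proof (rule C(2)[OF dp])
      fix s assume "s \<in> S"
      then obtain i where i: "i \<le> n" "s = of_real (real i)" by (auto simp: S_def)
      have "mipow (\<lambda>l. \<i> * of_real (real i ^ e l)) \<sigma> = \<i> ^ mlen \<sigma> * s ^ ev \<sigma>" for \<sigma>
        unfolding mipow_i i by (simp add: mipow_def ev_def power_sum power_mult)
      then have "poly p s = psym A B c (\<lambda>l. real i ^ e l)"
        unfolding p_def psym_coef poly_sum poly_monom by (simp add: mult.assoc)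
      also have "cmod \<dots> \<le> Lam * qn \<kappa> (\<lambda>l. real i ^ e l) ^ m" using c unfolding elliptic_def by blast
      also have "\<dots> \<le> \<bar>Lam\<bar> * qn \<kappa> (\<lambda>l. real i ^ e l) ^ m"
        by (intro mult_right_mono) (auto intro: qn_nonneg zero_le_power)
      also have "\<dots> \<le> M" by (rule M[OF i(1)])
      finally show "cmod (poly p s) \<le> M" .
    qed
    also have "coeff p (ev \<sigma>) = (\<Sum>\<tau>\<in>Sg. if \<tau> = \<sigma> then coef c \<tau> * \<i> ^ mlen \<tau> else 0)"
      unfolding p_def coeff_sum coeff_monom by (intro sum.cong refl) (use inj \<sigma> in \<open>auto simp: inj_on_def\<close>)
    also have "\<dots> = coef c \<sigma> * \<i> ^ mlen \<sigma>" using finSg \<sigma> by simp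
    finally show ?thesis by (simp add: norm_mult norm_power)
  qed
  then show ?thesis using C M0 by (intro exI[of _ "C * M"]) auto
qed

lemma psym_Qb: "\<exists>C\<ge>0. \<forall>c. elliptic c \<longrightarrow> Qb N C (psym A B c)"
proof -
  obtain K where K: "K \<ge> 0" "\<And>c \<sigma>. elliptic c \<Longrightarrow> \<sigma> \<in> Sg \<Longrightarrow> cmod (coef c \<sigma>) \<le> K" using coef_bound by blast
  define D where "D = Max (insert 0 ((\<lambda>(\<sigma>, l). \<sigma> l) ` (Sg \<times> UNIV)))"
  have D: "\<sigma> l \<le> D" if "\<sigma> \<in> Sg" for \<sigma> l
    unfolding D_def by (rule Max_ge) (use finSg that in \<open>auto intro!: image_eqI[of _ _ "(\<sigma>, l)"]\<close>)
  obtain C where C: "C \<ge> 1" "\<And>\<sigma>::'n mindex. (\<forall>l. \<sigma> l \<le> D) \<Longrightarrow> Qb N C (\<lambda>\<eta>. mipow (\<lambda>l. of_real (\<eta> l)) \<sigma>)"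
    using Qb_monom by blast
  have "Qb N (real (card Sg) * (K * C)) (psym A B c)" if c: "elliptic c" for c
  proof -
    have "Qb N (real (card Sg) * (K * C)) (\<lambda>\<eta>. \<Sum>\<sigma>\<in>Sg. (coef c \<sigma> * \<i> ^ mlen \<sigma>) * mipow (\<lambda>l. of_real (\<eta> l)) \<sigma>)"
      by (intro Qb_sum finSg Qb_cmult C(2)) (use K(2)[OF c] D C(1) in \<open>auto simp: norm_mult norm_power\<close>)
    moreover have "psym A B c = (\<lambda>\<eta>. \<Sum>\<sigma>\<in>Sg. (coef c \<sigma> * \<i> ^ mlen \<sigma>) * mipow (\<lambda>l. of_real (\<eta> l)) \<sigma>)"
      by (simp add: fun_eq_iff psym_coef mipow_i mult.assoc)
    ultimately show ?thesis by simp
  qed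
  then show ?thesis using K C by (intro exI[of _ "real (card Sg) * (K * C)"]) auto
qed

text \<open>\<open>chin\<close> vanishes wherever the symbol is below \<open>lb\<close>, so
  \<open>Bd_divide\<close> covers the quotient with a constant uniform over elliptic coefficients.
  The factor \<open>q\<close> is kept apart so that the bound is linear in \<open>Aq\<close>, which
  later carries the weights of the blocks.\<close>

lemma multiplier_bound:
  "\<exists>C\<ge>0. \<forall>c q Aq \<sigma>. elliptic c \<longrightarrow> 0 \<le> Aq \<longrightarrow> Qb N Aq q \<longrightarrow> (\<forall>l. \<sigma> l \<le> D) \<longrightarrow>
     (\<forall>l \<eta>. Bd N UNIV (C * Aq) (\<lambda>y. (\<lambda>\<eta>. chin \<kappa> \<eta> * q \<eta> * mipow (\<lambda>l. of_real (\<eta> l)) \<sigma> / psym A B c \<eta>) (\<eta>(l := y))))"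
proof -
  obtain K1 where K1: "K1 \<ge> 1" "Qb N K1 (chin \<kappa>)" using Qb_chin by blast
  obtain K2 where K2: "K2 \<ge> 1" "\<And>\<sigma>::'n mindex. (\<forall>l. \<sigma> l \<le> D) \<Longrightarrow> Qb N K2 (\<lambda>\<eta>. mipow (\<lambda>l. of_real (\<eta> l)) \<sigma>)"
    using Qb_monom by blast
  obtain K3 where K3: "K3 \<ge> 0" "\<And>c. elliptic c \<Longrightarrow> Qb N K3 (psym A B c)" using psym_Qb by blast
  define K where "K = 2 ^ N * K1 * K2 + K3"
  define lb where "lb = lam * (1 / 2) ^ m"
  have lb: "lb > 0" using lam by (simp add: lb_def)
  have K: "0 \<le> K" "2 ^ N * K1 * K2 \<le> K" "K3 \<le> K" using K1 K2 K3 by (auto simp: K_def)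
  obtain K4 where K4: "K4 \<ge> 0" "\<And>u p. Bd N S3 K u \<Longrightarrow> Bd N S3 K p \<Longrightarrow> (\<forall>t\<in>S3. cmod (p t) < lb \<longrightarrow> u t = 0) \<Longrightarrow> Bd N S3 K4 (\<lambda>t. u t / p t)"
    using Bd_divide[OF S3(1) lb K(1)] by blast
  have "Bd N UNIV (2 ^ N * K4 * Aq) (\<lambda>y. (\<lambda>\<eta>. chin \<kappa> \<eta> * q \<eta> * mipow (\<lambda>l. of_real (\<eta> l)) \<sigma> / psym A B c \<eta>) (\<eta>(l := y)))"
    if c: "elliptic c" and Aq: "0 \<le> Aq" and q: "Qb N Aq q" and \<sigma>: "\<forall>l. \<sigma> l \<le> D" for c q Aq \<sigma> l \<eta>
  proof (rule Qb_extend)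
    have u: "Qb N (2 ^ N * K1 * K2) (\<lambda>\<eta>. chin \<kappa> \<eta> * mipow (\<lambda>l. of_real (\<eta> l)) \<sigma>)"
      by (rule Qb_mult[OF K1(2) K2(2)[OF \<sigma>]]) (use K1 K2 in auto)
    have "Qb N K4 (\<lambda>\<eta>. chin \<kappa> \<eta> * mipow (\<lambda>l. of_real (\<eta> l)) \<sigma> / psym A B c \<eta>)"
      unfolding Qb_def
    proof (intro allI impI)
      fix l and \<eta> :: "'n \<Rightarrow> real" assume \<eta>: "\<forall>k. k \<noteq> l \<longrightarrow> \<bar>\<eta> k\<bar> \<le> 2"
      show "Bd N S3 K4 (\<lambda>y. chin \<kappa> (\<eta>(l := y)) * mipow (\<lambda>k. of_real ((\<eta>(l := y)) k)) \<sigma> / psym A B c (\<eta>(l := y)))"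
      proof (rule K4(2))
        show "Bd N S3 K (\<lambda>y. chin \<kappa> (\<eta>(l := y)) * mipow (\<lambda>k. of_real ((\<eta>(l := y)) k)) \<sigma>)"
          using Qb_mono[OF u K(2)] \<eta> unfolding Qb_def by blast
        show "Bd N S3 K (\<lambda>y. psym A B c (\<eta>(l := y)))"
          using Qb_mono[OF K3(2)[OF c] K(3)] \<eta> unfolding Qb_def by blast
        show "\<forall>y\<in>S3. cmod (psym A B c (\<eta>(l := y))) < lb \<longrightarrow> chin \<kappa> (\<eta>(l := y)) * mipow (\<lambda>k. of_real ((\<eta>(l := y)) k)) \<sigma> = 0"
        proof (intro ballI impI)
          fix y assume *: "cmod (psym A B c (\<eta>(l := y))) < lb"
          have "chin \<kappa> (\<eta>(l := y)) = 0"
          proof (rule ccontr)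
            assume "\<not> ?thesis"
            then have "1 / 2 \<le> qn \<kappa> (\<eta>(l := y))" by (rule chin_nonzero_qn[OF kpos])
            then have "lb \<le> lam * qn \<kappa> (\<eta>(l := y)) ^ m" unfolding lb_def using lam by (intro mult_left_mono power_mono) auto
            also have "\<dots> \<le> cmod (psym A B c (\<eta>(l := y)))" using c unfolding elliptic_def by blast
            finally show False using * by simp
          qed
          then show "chin \<kappa> (\<eta>(l := y)) * mipow (\<lambda>k. of_real ((\<eta>(l := y)) k)) \<sigma> = 0" by (simp only: mult_zero_left)
        qed
      qed
    qed
    from Qb_mult[OF this q K4(1) Aq]
    show "Qb N (2 ^ N * K4 * Aq) (\<lambda>\<eta>. chin \<kappa> \<eta> * q \<eta> * mipow (\<lambda>l. of_real (\<eta> l)) \<sigma> / psym A B c \<eta>)"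
      by (simp add: mult_ac)
    show "0 \<le> 2 ^ N * K4 * Aq" using K4 Aq by simp
    show "chin \<kappa> \<eta> * q \<eta> * mipow (\<lambda>l. of_real (\<eta> l)) \<sigma> / psym A B c \<eta> = 0" if "2 < \<bar>\<eta> l\<bar>" for \<eta> l
      using chin_zero[of \<eta> l \<kappa>, OF that] by simp
  qed
  then show ?thesis using K4 by (intro exI[of _ "2 ^ N * K4"]) auto
qed

end

text \<open>The counterpart without division by the symbol; it serves for \<open>chin\<close> as
  well as for the low-pass cutoff \<open>phin\<close>.\<close>

lemma multiplier_bound_plain:
  fixes w :: "('n::finite \<Rightarrow> real) \<Rightarrow> complex"
  assumes w: "Qb N K w" "\<And>\<eta> l. 2 < \<bar>\<eta> l\<bar> \<Longrightarrow> w \<eta> = 0" "0 \<le> K"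
  shows "\<exists>C\<ge>0. \<forall>q Aq \<sigma>. 0 \<le> Aq \<longrightarrow> Qb N Aq q \<longrightarrow> (\<forall>l. \<sigma> l \<le> D) \<longrightarrow>
     (\<forall>l \<eta>. Bd N UNIV (C * Aq) (\<lambda>y. (\<lambda>\<eta>. w \<eta> * q \<eta> * mipow (\<lambda>l. of_real (\<eta> l)) \<sigma>) (\<eta>(l := y))))"
proof -
  obtain K2 where K2: "K2 \<ge> 1" "\<And>\<sigma>::'n mindex. (\<forall>l. \<sigma> l \<le> D) \<Longrightarrow> Qb N K2 (\<lambda>\<eta>. mipow (\<lambda>l. of_real (\<eta> l)) \<sigma>)"
    using Qb_monom by blast
  have "Bd N UNIV (2 ^ N * (2 ^ N * K * K2) * Aq) (\<lambda>y. (\<lambda>\<eta>. w \<eta> * q \<eta> * mipow (\<lambda>l. of_real (\<eta> l)) \<sigma>) (\<eta>(l := y)))"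
    if Aq: "0 \<le> Aq" and q: "Qb N Aq q" and \<sigma>: "\<forall>l. \<sigma> l \<le> D" for q Aq \<sigma> l \<eta>
  proof (rule Qb_extend)
    have K2': "0 \<le> K2" using K2 by simp
    have "0 \<le> 2 ^ N * K * K2" using K2' w(3) by simp
    from Qb_mult[OF Qb_mult[OF w(1) K2(2)[OF \<sigma>] w(3) K2'] q this Aq]
    show "Qb N (2 ^ N * (2 ^ N * K * K2) * Aq) (\<lambda>\<eta>. w \<eta> * q \<eta> * mipow (\<lambda>l. of_real (\<eta> l)) \<sigma>)"
      by (simp add: mult_ac)
    show "0 \<le> 2 ^ N * (2 ^ N * K * K2) * Aq" using K2' w(3) Aq by simp
    show "w \<eta> * q \<eta> * mipow (\<lambda>l. of_real (\<eta> l)) \<sigma> = 0" if "2 < \<bar>\<eta> l\<bar>" for \<eta> l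
      using w(2)[of \<eta> l, OF that] by simp
  qed
  then show ?thesis using K2 w(3) by (intro exI[of _ "2 ^ N * (2 ^ N * K * K2)"]) auto
qed

lemma lborel_set_integral_cbx_prod:
  fixes h :: "'n::finite \<Rightarrow> real \<Rightarrow> complex"
  assumes "\<And>l. continuous_on UNIV (h l)"
  shows "(LINT z:cbx x d|lebesgue. tens x h z) = (\<Prod>l\<in>UNIV. integral {-d..d} (h l))"
proof -
  define F where "F l t = indicator {x$l - d..x$l + d} t *\<^sub>R h l (t - x$l)" for l t
  have si: "set_integrable lborel {a..c} (\<lambda>t. h l (t - y))" for a c l y
    unfolding set_integrable_def
    by (intro borel_integrable_compact[OF compact_Icc] continuous_on_compose2[OF assms] continuous_intros) auto
  have Fi: "integrable lborel (F l)" for l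
    using si[of "x$l - d" "x$l + d" l "x$l"] by (simp add: F_def[abs_def] set_integrable_def)
  have FI: "(\<integral>t. F l t \<partial>lborel) = integral {-d..d} (h l)" for l
  proof -
    have "(\<integral>t. F l t \<partial>lborel) = (\<integral>t. indicator {-d..d} t *\<^sub>R h l t \<partial>lborel)"
      by (subst lborel_integral_real_affine[of 1 _ "x$l"]) (auto simp: F_def indicator_def intro!: Bochner_Integration.integral_cong)
    also have "\<dots> = integral {-d..d} (h l)"
      using set_borel_integral_eq_integral(2)[OF si[of "-d" d l 0]] by (simp add: set_lebesgue_integral_def)
    finally show ?thesis .
  qed
  have eq: "indicator (cbx x d) z *\<^sub>R tens x h z = (\<Prod>l\<in>UNIV. F l (z$l))" for z
  proof (cases "z \<in> cbx x d")
    case True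
    then have "z$l \<in> {x$l - d..x$l + d}" for l by (auto simp: cbx_def abs_le_iff algebra_simps)
    then show ?thesis using True by (simp add: F_def tens_def)
  next
    case False
    then obtain l where "z$l \<notin> {x$l - d..x$l + d}" by (auto simp: cbx_def abs_le_iff algebra_simps)
    then have "F l (z$l) = 0" by (simp add: F_def)
    then have "(\<Prod>l\<in>UNIV. F l (z$l)) = 0" by (intro prod_zero bexI[of _ l]) auto
    then show ?thesis using False by simp
  qed
  have [measurable]: "F l \<in> borel_measurable borel" for l using Fi[of l] by auto
  have "(LINT z:cbx x d|lebesgue. tens x h z) = (\<integral>z. (\<Prod>l\<in>UNIV. F l (z$l)) \<partial>lebesgue)"
    unfolding set_lebesgue_integral_def eq ..
  also have "\<dots> = (\<integral>z. (\<Prod>l\<in>UNIV. F l (z$l)) \<partial>lborel)"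
    by (rule integral_completion) measurable
  also have "\<dots> = (\<Prod>l\<in>UNIV. integral {-d..d} (h l))"
    unfolding integral_prod_components[OF Fi] FI ..
  finally show ?thesis .
qed

lemma integral_nd_zero:
  assumes "f \<in> test1 d" "0 < n" "0 \<le> d"
  shows "integral {-d..d} (nd n f) = 0"
proof -
  obtain k where "n = Suc 0 + k" using assms(2) by (metis add.commute add_Suc_right gr0_conv_Suc One_nat_def plus_1_eq_Suc)
  then show ?thesis
    using integral_deriv_test1[OF test1_nd[OF assms(1)], of d k] assms(3) test1_zero_le[OF test1_nd[OF assms(1)], of d k]
      \<open>n = Suc 0 + k\<close> nd_add[of "Suc 0" k f] by simp
qed

text \<open>\<open>\<tau>\<close> is a value of \<open>T\<close> on a representation of \<open>H\<close> as a sum of derivatives of tensor products, each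
  of order at least some element of \<open>A\<close>.\<close>

definition inR :: "real \<Rightarrow> real^'n::finite \<Rightarrow> ((real^'n \<Rightarrow> complex) \<Rightarrow> complex) \<Rightarrow> 'n mindex set \<Rightarrow> (real^'n \<Rightarrow> complex) \<Rightarrow> complex \<Rightarrow> bool" where
  "inR d x T A H \<tau> \<longleftrightarrow> (\<exists>L. (\<forall>(c, \<alpha>, f)\<in>set L. (\<forall>l. f l \<in> test1 d) \<and> (\<exists>a\<in>A. a \<le> \<alpha>)) \<and>
     H = (\<lambda>z. \<Sum>(c, \<alpha>, f)\<leftarrow>L. c * tens x (\<lambda>l. nd (\<alpha> l) (f l)) z) \<and>
     \<tau> = (\<Sum>(c, \<alpha>, f)\<leftarrow>L. c * T (tens x (\<lambda>l. nd (\<alpha> l) (f l)))))"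

lemma inR_zero: "inR d x T A (\<lambda>z. 0) 0"
  unfolding inR_def by (rule exI[of _ "[]"]) auto

lemma inR_tens:
  assumes "\<And>l. f l \<in> test1 d" "a \<in> A" "a \<le> \<alpha>"
  shows "inR d x T A (\<lambda>z. c * tens x (\<lambda>l. nd (\<alpha> l) (f l)) z) (c * T (tens x (\<lambda>l. nd (\<alpha> l) (f l))))"
  unfolding inR_def by (rule exI[of _ "[(c, \<alpha>, f)]"]) (use assms in auto)

lemma inR_add:
  assumes "inR d x T A H \<tau>" "inR d x T A H' \<tau>'"
  shows "inR d x T A (\<lambda>z. H z + H' z) (\<tau> + \<tau>')"
proof -
  obtain L L' where "\<forall>(c, \<alpha>, f)\<in>set L. (\<forall>l. f l \<in> test1 d) \<and> (\<exists>a\<in>A. a \<le> \<alpha>)"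
     "H = (\<lambda>z. \<Sum>(c, \<alpha>, f)\<leftarrow>L. c * tens x (\<lambda>l. nd (\<alpha> l) (f l)) z)"
     "\<tau> = (\<Sum>(c, \<alpha>, f)\<leftarrow>L. c * T (tens x (\<lambda>l. nd (\<alpha> l) (f l))))"
     "\<forall>(c, \<alpha>, f)\<in>set L'. (\<forall>l. f l \<in> test1 d) \<and> (\<exists>a\<in>A. a \<le> \<alpha>)"
     "H' = (\<lambda>z. \<Sum>(c, \<alpha>, f)\<leftarrow>L'. c * tens x (\<lambda>l. nd (\<alpha> l) (f l)) z)"
     "\<tau>' = (\<Sum>(c, \<alpha>, f)\<leftarrow>L'. c * T (tens x (\<lambda>l. nd (\<alpha> l) (f l))))"
    using assms unfolding inR_def by blast
  then show ?thesis unfolding inR_def by (intro exI[of _ "L @ L'"]) auto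
qed

lemma inR_sum:
  "finite F \<Longrightarrow> (\<And>i. i \<in> F \<Longrightarrow> inR d x T A (H i) (\<tau> i)) \<Longrightarrow> inR d x T A (\<lambda>z. \<Sum>i\<in>F. H i z) (\<Sum>i\<in>F. \<tau> i)"
  by (induction F rule: finite_induct) (auto intro: inR_zero inR_add)

lemma (in bump1) T_bound_inR:
  fixes s :: "'n::finite mindex"
  shows "\<exists>C\<ge>0. \<forall>\<Omega> T A v x M H \<tau> \<epsilon>. dbox d b \<Omega> T A v x M \<longrightarrow>
    (\<forall>l. (\<lambda>k. if k = l then s l else 0) \<in> A) \<longrightarrow> inR d x T A H \<tau> \<longrightarrow> (\<forall>z. cmod (H z) \<le> \<epsilon>) \<longrightarrow>
    cmod \<tau> \<le> C * M * \<epsilon>"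
proof -
  obtain C where C: "C \<ge> 0" and TB: "\<And>\<Omega> T A v x M (F::nat set) c \<alpha> f \<epsilon>. dbox d b \<Omega> T A v x M \<Longrightarrow>
    (\<forall>l. (\<lambda>k. if k = l then s l else 0) \<in> A) \<Longrightarrow> finite F \<Longrightarrow>
    (\<forall>i\<in>F. (\<forall>l. f i l \<in> test1 d) \<and> (\<exists>a\<in>A. a \<le> \<alpha> i)) \<Longrightarrow>
    (\<forall>z. cmod (\<Sum>i\<in>F. c i * tens x (\<lambda>l. nd (\<alpha> i l) (f i l)) z) \<le> \<epsilon>) \<Longrightarrow>
    cmod (\<Sum>i\<in>F. c i * T (tens x (\<lambda>l. nd (\<alpha> i l) (f i l)))) \<le> C * M * \<epsilon>"
    using T_bound[of s] by blast
  show ?thesis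
  proof (intro exI[of _ C] conjI allI impI C)
    fix \<Omega> :: "(real^'n) set" and T A v x M H \<tau> \<epsilon>
    assume a: "dbox d b \<Omega> T A v x M" "\<forall>l. (\<lambda>k. if k = l then s l else 0) \<in> A" "inR d x T A H \<tau>" "\<forall>z. cmod (H z) \<le> \<epsilon>"
    obtain L where L: "\<forall>(c, \<alpha>, f)\<in>set L. (\<forall>l. f l \<in> test1 d) \<and> (\<exists>a\<in>A. a \<le> \<alpha>)"
     "H = (\<lambda>z. \<Sum>(c, \<alpha>, f)\<leftarrow>L. c * tens x (\<lambda>l. nd (\<alpha> l) (f l)) z)"
     "\<tau> = (\<Sum>(c, \<alpha>, f)\<leftarrow>L. c * T (tens x (\<lambda>l. nd (\<alpha> l) (f l))))"
      using a(3) unfolding inR_def by blast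
    define cc aa ff where "cc i = fst (L ! i)" and "aa i = fst (snd (L ! i))" and "ff i = snd (snd (L ! i))" for i
    have Hz: "H z = (\<Sum>i\<in>{0..<length L}. cc i * tens x (\<lambda>l. nd (aa i l) (ff i l)) z)" for z
      unfolding L(2) by (simp add: sum_list_sum_nth case_prod_unfold cc_def aa_def ff_def)
    have tau: "\<tau> = (\<Sum>i\<in>{0..<length L}. cc i * T (tens x (\<lambda>l. nd (aa i l) (ff i l))))"
      unfolding L(3) by (simp add: sum_list_sum_nth case_prod_unfold cc_def aa_def ff_def)
    show "cmod \<tau> \<le> C * M * \<epsilon>"
      unfolding tau
    proof (rule TB[OF a(1,2)])
      show "\<forall>i\<in>{0..<length L}. (\<forall>l. ff i l \<in> test1 d) \<and> (\<exists>a\<in>A. a \<le> aa i)"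
      proof
        fix i assume "i \<in> {0..<length L}"
        then have "L ! i \<in> set L" by simp
        then show "(\<forall>l. ff i l \<in> test1 d) \<and> (\<exists>a\<in>A. a \<le> aa i)" using L(1) by (auto simp: aa_def ff_def case_prod_unfold)
      qed
    qed (use a(4) Hz in auto)
  qed
qed

section \<open>Localized exponentials\<close>

definition zet :: "real \<Rightarrow> real \<Rightarrow> complex" where
  "zet d t = of_real (phi1 (4 / d * t))"

definition ekt :: "real \<Rightarrow> ('n \<Rightarrow> int) \<Rightarrow> 'n \<Rightarrow> real \<Rightarrow> complex" where
  "ekt d k l t = exp ((- \<i> * of_real (pi / d * of_int (k l))) * of_real t) * zet d t"

definition xik :: "real \<Rightarrow> ('n \<Rightarrow> int) \<Rightarrow> 'n \<Rightarrow> real" where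
  "xik d k l = pi / d * of_int (k l)"

context
  fixes d :: real
  assumes d: "0 < d"
begin

text \<open>Support in half the box leaves room to shift the centre of the cutoff by up to
  \<open>d / 8\<close> in each coordinate without leaving the box, as the comparison of two points
  requires.\<close>

lemma zet_test1: "zet d \<in> test1 (d / 2)"
proof -
  have "smooth1 (\<lambda>t. complex_of_real (phi1 (4 / d * t + 0)))"
    by (rule smooth1_affine_nd(1)[OF test1_smooth1[OF phi1(1)]])
  moreover have "phi1 (4 / d * t) = 0" if "d / 2 < \<bar>t\<bar>" for t
  proof (rule phi1(5))
    show "2 < \<bar>4 / d * t\<bar>" using that d by (simp add: abs_mult field_simps)
  qed
  ultimately show ?thesis by (simp add: test1_def zet_def[abs_def])
qed

lemma zet_one: "\<bar>t\<bar> \<le> d / 4 \<Longrightarrow> zet d t = 1"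
  unfolding zet_def using d by (subst phi1(4)) (auto simp: abs_mult field_simps)

lemma zet_real: "\<exists>r. 0 \<le> r \<and> r \<le> 1 \<and> zet d t = of_real r"
  unfolding zet_def using phi1(2,3) by blast

lemma zet_bound: "cmod (zet d t) \<le> 1"
  using zet_real[of t] by auto

lemma nd_zet_zero:
  assumes "\<bar>t\<bar> < d / 4" "0 < n" shows "nd n (zet d) t = 0"
  using assms
proof (induction n arbitrary: t)
  case (Suc n)
  have "((\<lambda>t. if n = 0 then 1 else 0) has_vector_derivative 0) (at t)" by simp
  then have "(nd n (zet d) has_vector_derivative 0) (at t)"
  proof (rule has_vector_derivative_transform_within_open[where S = "{t. \<bar>t\<bar> < d / 4}"])
    show "open {t. \<bar>t\<bar> < d / 4}" by (intro open_Collect_less continuous_intros)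
    show "(if n = 0 then 1 else 0) = nd n (zet d) t" if "t \<in> {t. \<bar>t\<bar> < d / 4}" for t
      using that Suc.IH[of t] zet_one[of t] by (cases n) auto
  qed (use Suc in auto)
  then show ?case by (simp add: nd_Suc vector_derivative_at)
qed simp

lemma ekt_test1_half: "ekt d k l \<in> test1 (d / 2)"
proof -
  have "(\<lambda>t. zet d t * exp ((- \<i> * of_real (pi / d * of_int (k l))) * of_real t)) \<in> test1 (d / 2)"
    by (rule test1_mult[OF zet_test1 smooth1_exp_nd(1)])
  then show ?thesis by (simp add: ekt_def[abs_def] mult.commute)
qed

lemma ekt_test1: "ekt d k l \<in> test1 d"
  by (rule test1_mono[OF ekt_test1_half]) (use d in simp)

lemma nd_ekt: "nd n (ekt d k l) t = (\<Sum>i\<le>n. of_nat (n choose i) * nd (n - i) (zet d) t * (- \<i> * of_real (xik d k l)) ^ i)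
    * exp ((- \<i> * of_real (pi / d * of_int (k l))) * of_real t)"
proof -
  have "ekt d k l = (\<lambda>t. exp ((- \<i> * of_real (pi / d * of_int (k l))) * of_real t) * zet d t)"
    by (simp add: ekt_def fun_eq_iff)
  then show ?thesis
    by (simp only: smooth1_mult_nd(2)[OF smooth1_exp_nd(1) test1_smooth1[OF zet_test1]] smooth1_exp_nd(2) sum_distrib_right)
      (auto intro!: sum.cong simp: xik_def mult_ac)
qed

lemma tens_nd_ekt:
  fixes x z :: "real^'n::finite"
  shows "tens x (\<lambda>l. nd (\<beta> l) (ekt d k l)) z =
    (\<Sum>i\<in>PiE UNIV (\<lambda>l. {..\<beta> l}). (\<Prod>l\<in>UNIV. of_nat (\<beta> l choose i l) * nd (\<beta> l - i l) (zet d) (z$l - x$l))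
       * (mipow (\<lambda>l. - \<i> * of_real (xik d k l)) i * ek (pi / d) k (z - x)))"
proof -
  have "tens x (\<lambda>l. nd (\<beta> l) (ekt d k l)) z = (\<Prod>l\<in>UNIV. \<Sum>i\<le>\<beta> l. of_nat (\<beta> l choose i) * nd (\<beta> l - i) (zet d) (z$l - x$l) * (- \<i> * of_real (xik d k l)) ^ i)
    * ek (pi / d) k (z - x)"
    unfolding tens_def nd_ekt prod.distrib ek_def by simp
  also have "(\<Prod>l\<in>UNIV. \<Sum>i\<le>\<beta> l. of_nat (\<beta> l choose i) * nd (\<beta> l - i) (zet d) (z$l - x$l) * (- \<i> * of_real (xik d k l)) ^ i)
    = (\<Sum>i\<in>PiE UNIV (\<lambda>l. {..\<beta> l}). \<Prod>l\<in>UNIV. of_nat (\<beta> l choose i l) * nd (\<beta> l - i l) (zet d) (z$l - x$l) * (- \<i> * of_real (xik d k l)) ^ i l)"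
    by (rule prod_sum_PiE) auto
  finally show ?thesis by (simp add: prod.distrib mipow_def sum_distrib_right mult.assoc)
qed

lemma tens_nd_ekt_inner:
  fixes x z :: "real^'n::finite"
  assumes "\<And>l. \<bar>z$l - x$l\<bar> < d / 4"
  shows "tens x (\<lambda>l. nd (\<beta> l) (ekt d k l)) z = mipow (\<lambda>l. - \<i> * of_real (xik d k l)) \<beta> * ek (pi / d) k (z - x)"
proof -
  have "nd n (ekt d k l) t = (- \<i> * of_real (xik d k l)) ^ n * exp ((- \<i> * of_real (pi / d * of_int (k l))) * of_real t)" 
    if "\<bar>t\<bar> < d / 4" for n t and l :: 'n
  proof -
    have "(\<Sum>i\<le>n. of_nat (n choose i) * nd (n - i) (zet d) t * (- \<i> * of_real (xik d k l)) ^ i)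
       = (\<Sum>i\<le>n. if i = n then (- \<i> * of_real (xik d k l)) ^ i else 0)"
      by (intro sum.cong refl) (use that nd_zet_zero[OF that] zet_one[of t] in auto)
    also have "\<dots> = (- \<i> * of_real (xik d k l)) ^ n" by (subst sum.delta) auto
    finally show ?thesis unfolding nd_ekt by (rule arg_cong)
  qed
  then show ?thesis using assms by (simp add: tens_def mipow_def ek_def prod.distrib)
qed

text \<open>By the Leibniz rule the derivatives of the cutoff are factors that do not depend on k
  and come out of the sum. What remains are sums of pure exponentials with monomials of the orders i
  below \<beta>, to which the decay estimate applies.\<close>

lemma tens_nd_ekt_bound:
  fixes \<beta> :: "'n::finite mindex"
  shows "\<exists>C\<ge>0. \<forall>K \<nu> x z W. (\<forall>i. i \<le> \<beta> \<longrightarrow> cmod (\<Sum>k\<in>K. \<nu> k * mipow (\<lambda>l. - \<i> * of_real (xik d k l)) i * ek (pi / d) k (z - x)) \<le> W)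
    \<longrightarrow> cmod (\<Sum>k\<in>K. \<nu> k * tens x (\<lambda>l. nd (\<beta> l) (ekt d k l)) z) \<le> C * W"
proof -
  define D where "D = Max (range \<beta>)"
  have D: "\<beta> l \<le> D" for l by (simp add: D_def)
  have "\<exists>B\<ge>0. \<forall>i\<le>n. \<forall>t. cmod (nd i (zet d) t) \<le> B" for n
  proof (induction n)
    case 0
    then show ?case using zet_bound by (intro exI[of _ 1]) auto
  next
    case (Suc n)
    then obtain B where B: "B \<ge> 0" "\<forall>i\<le>n. \<forall>t. cmod (nd i (zet d) t) \<le> B" by blast
    obtain B' where "\<forall>t. cmod (nd (Suc n) (zet d) t) \<le> B'" using test1_bounded[OF test1_nd[OF zet_test1]] by blast
    then show ?case using B by (intro exI[of _ "max B B'"]) (auto simp: le_Suc_eq le_max_iff_disj)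
  qed
  then obtain B where B: "B \<ge> 0" "\<And>i t. i \<le> D \<Longrightarrow> cmod (nd i (zet d) t) \<le> B" by blast
  let ?I = "PiE UNIV (\<lambda>l. {..\<beta> l})"
  define C where "C = (\<Sum>i\<in>?I. \<Prod>l\<in>UNIV. of_nat (\<beta> l choose i l) * B)"
  have "cmod (\<Sum>k\<in>K. \<nu> k * tens x (\<lambda>l. nd (\<beta> l) (ekt d k l)) z) \<le> C * W"
    if W: "\<forall>i. i \<le> \<beta> \<longrightarrow> cmod (\<Sum>k\<in>K. \<nu> k * mipow (\<lambda>l. - \<i> * of_real (xik d k l)) i * ek (pi / d) k (z - x)) \<le> W" for K \<nu> x z W
  proof -
    have "(\<Sum>k\<in>K. \<nu> k * tens x (\<lambda>l. nd (\<beta> l) (ekt d k l)) z) =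
      (\<Sum>i\<in>?I. (\<Prod>l\<in>UNIV. of_nat (\<beta> l choose i l) * nd (\<beta> l - i l) (zet d) (z$l - x$l)) *
         (\<Sum>k\<in>K. \<nu> k * mipow (\<lambda>l. - \<i> * of_real (xik d k l)) i * ek (pi / d) k (z - x)))"
      unfolding tens_nd_ekt sum_distrib_left by (subst sum.swap) (simp add: mult_ac)
    also have "cmod \<dots> \<le> (\<Sum>i\<in>?I. (\<Prod>l\<in>UNIV. of_nat (\<beta> l choose i l) * B) * W)"
    proof (rule sum_norm_le)
      fix i assume "i \<in> ?I"
      then have i: "i \<le> \<beta>" by (auto simp: le_fun_def PiE_iff)
      show "cmod ((\<Prod>l\<in>UNIV. of_nat (\<beta> l choose i l) * nd (\<beta> l - i l) (zet d) (z$l - x$l)) *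
         (\<Sum>k\<in>K. \<nu> k * mipow (\<lambda>l. - \<i> * of_real (xik d k l)) i * ek (pi / d) k (z - x))) \<le> (\<Prod>l\<in>UNIV. of_nat (\<beta> l choose i l) * B) * W"
        unfolding norm_mult
      proof (intro mult_mono)
        show "cmod (\<Prod>l\<in>UNIV. of_nat (\<beta> l choose i l) * nd (\<beta> l - i l) (zet d) (z$l - x$l)) \<le> (\<Prod>l\<in>UNIV. of_nat (\<beta> l choose i l) * B)"
          unfolding prod_norm[symmetric]
          by (intro prod_mono conjI norm_ge_zero) (auto simp: norm_mult intro!: mult_left_mono B(2) order_trans[OF diff_le_self D])
        show "0 \<le> (\<Prod>l\<in>UNIV. of_nat (\<beta> l choose i l) * B)" using B by (intro prod_nonneg) auto
      qed (use W i in auto)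
    qed
    finally show ?thesis by (simp add: C_def sum_distrib_right)
  qed
  moreover have "0 \<le> C" unfolding C_def using B by (intro sum_nonneg prod_nonneg) auto
  ultimately show ?thesis by (intro exI[of _ C]) blast
qed

text \<open>The cutoff normalized to integral 1; it takes the role of the bump \<open>b\<close> in
  \<open>bump1\<close>.\<close>

definition bfun :: "real \<Rightarrow> complex" where
  "bfun t = inverse (integral {-d..d} (zet d)) * zet d t"

lemma zet_integral_nonzero: "integral {-d..d} (zet d) \<noteq> 0"
proof -
  have c: "continuous_on {-d..d} (\<lambda>t. phi1 (4 / d * t))"
    using continuous_on_Re[OF smooth1_continuous_on0[OF test1_smooth1[OF zet_test1]]] by (simp add: zet_def[abs_def])
  have "integral {-d..d} (zet d) = of_real (integral {-d..d} (\<lambda>t. phi1 (4 / d * t)))"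
    using integral_linear[OF integrable_continuous_real[OF c] bounded_linear_of_real] by (simp add: zet_def[abs_def] o_def)
  moreover have "integral {-d..d} (\<lambda>t. phi1 (4 / d * t)) > 0"
  proof -
    have "integral {-(d/4)..d/4} (\<lambda>t. 1) \<le> integral {-d..d} (\<lambda>t. phi1 (4 / d * t))"
    proof (rule order_trans)
      show "integral {-(d/4)..d/4} (\<lambda>t. 1) \<le> integral {-(d/4)..d/4} (\<lambda>t. phi1 (4 / d * t))"
      proof (rule integral_le)
        show "(\<lambda>t. phi1 (4 / d * t)) integrable_on {-(d/4)..d/4}"
          by (intro integrable_continuous_real continuous_on_subset[OF c]) (use d in auto)
        show "1 \<le> phi1 (4 / d * t)" if "t \<in> {-(d/4)..d/4}" for t
          using phi1(4)[of "4 / d * t"] that d by (auto simp: abs_mult abs_le_iff field_simps)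
      qed (auto intro: integrable_continuous_real)
      show "integral {-(d/4)..d/4} (\<lambda>t. phi1 (4 / d * t)) \<le> integral {-d..d} (\<lambda>t. phi1 (4 / d * t))"
      proof (rule integral_subset_le)
        show "(\<lambda>t. phi1 (4 / d * t)) integrable_on {-(d/4)..d/4}"
          by (intro integrable_continuous_real continuous_on_subset[OF c]) (use d in auto)
        show "(\<lambda>t. phi1 (4 / d * t)) integrable_on {-d..d}" by (intro integrable_continuous_real c)
      qed (use d phi1(2) in auto)
    qed
    then show ?thesis using d by simp
  qed
  ultimately show ?thesis by simp
qed

lemma bump1_bfun: "bump1 d bfun"
proof
  show "0 < d" by (rule d)
  show "bfun \<in> test1 d"
    unfolding bfun_def[abs_def] by (intro test1_cmult test1_mono[OF zet_test1]) (use d in simp)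
  show "integral {-d..d} bfun = 1"
    unfolding bfun_def[abs_def] using zet_integral_nonzero by simp
qed

end

section \<open>Kernel bounds and the frozen equation\<close>

text \<open>A finite index set that depends on the scale and the box alone and contains the support
  of every multiplier at that scale, so that sums with different multipliers share their
  range.\<close>

definition Kset :: "'n::finite mindex \<Rightarrow> real \<Rightarrow> nat \<Rightarrow> ('n \<Rightarrow> int) set" where
  "Kset \<kappa> d j = {k. \<forall>l. \<bar>etak \<kappa> (pi / d) j k l\<bar> \<le> 2}"

lemma finite_Kset:
  assumes "0 < d" shows "finite (Kset \<kappa> d j)"
proof -
  define R where "R l = nat \<lceil>2 * d / pi * 2 ^ (j * \<kappa> l)\<rceil>" for l
  have "Kset \<kappa> d j \<subseteq> kbox R"
  proof
    fix k assume k: "k \<in> Kset \<kappa> d j"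
    have "\<bar>k l\<bar> \<le> int (R l)" for l
    proof -
      have "pi / d / 2 ^ (j * \<kappa> l) * real_of_int \<bar>k l\<bar> \<le> 2"
        using k assms by (auto simp: Kset_def etak_def abs_mult)
      then have "real_of_int \<bar>k l\<bar> \<le> 2 * d / pi * 2 ^ (j * \<kappa> l)"
        using assms by (simp add: field_simps)
      then have "\<bar>k l\<bar> \<le> \<lceil>2 * d / pi * 2 ^ (j * \<kappa> l)\<rceil>" by (metis ceiling_mono ceiling_of_int)
      then show ?thesis unfolding R_def by (smt (verit) int_nat_eq)
    qed
    then show "k \<in> kbox R" by (simp add: kbox_def)
  qed
  then show ?thesis using kbox_card(1) finite_subset by blast
qed

lemma xik_etak: "xik d k l = (2 ^ j) ^ \<kappa> l * etak \<kappa> (pi / d) j k l"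
  by (simp add: xik_def etak_def power_mult)

lemma mipow_add: "mipow \<eta> \<alpha> * mipow \<eta> \<beta> = mipow \<eta> (\<lambda>l. \<alpha> l + \<beta> l)"
  by (simp add: mipow_def power_add prod.distrib)

lemma mipow_scale_xik:
  assumes "cmod u = 1"
  shows "\<exists>c. cmod c = 1 \<and> (\<forall>d k j. mipow (\<lambda>l. u * of_real (xik d k l)) \<sigma> = c * of_real (2 ^ (j * mdot \<sigma> \<kappa>)) * mipow (\<lambda>l. of_real (etak \<kappa> (pi / d) j k l)) \<sigma>)"
proof (intro exI[of _ "u ^ mlen \<sigma>"] conjI allI)
  show "cmod (u ^ mlen \<sigma>) = 1" using assms by (simp add: norm_power)
  fix d k j
  have "mipow (\<lambda>l. u * of_real (xik d k l)) \<sigma> = (\<Prod>l\<in>UNIV. u ^ \<sigma> l) * (\<Prod>l\<in>UNIV. of_real (2 ^ (j * (\<sigma> l * \<kappa> l)))) * mipow (\<lambda>l. of_real (etak \<kappa> (pi / d) j k l)) \<sigma>"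
    unfolding xik_etak[of d k _ j \<kappa>] mipow_def prod.distrib[symmetric]
    by (intro prod.cong refl) (simp add: power_mult_distrib power_mult[symmetric] mult_ac)
  also have "(\<Prod>l\<in>UNIV. u ^ \<sigma> l) = u ^ mlen \<sigma>" by (simp add: mlen_def power_sum)
  also have "(\<Prod>l\<in>UNIV. complex_of_real (2 ^ (j * (\<sigma> l * \<kappa> l)))) = of_real (2 ^ (j * mdot \<sigma> \<kappa>))"
    by (simp add: mdot_def power_sum sum_distrib_left)
  finally show "mipow (\<lambda>l. u * of_real (xik d k l)) \<sigma> = u ^ mlen \<sigma> * of_real (2 ^ (j * mdot \<sigma> \<kappa>)) * mipow (\<lambda>l. of_real (etak \<kappa> (pi / d) j k l)) \<sigma>" .
qed

text \<open>The monomial of order i costs \<open>2 ^ (j * mdot i \<kappa>)\<close>, the price of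
  rescaling it to frequencies of size 1; the rest is \<open>Esum_decay\<close> for the rescaled
  multiplier.\<close>

lemma kernel_bound_plain:
  fixes w :: "('n::finite \<Rightarrow> real) \<Rightarrow> complex"
  assumes d: "0 < d" and \<kappa>: "\<forall>l. 0 < \<kappa> l" and w: "Qb N K w" "\<And>\<eta> l. 2 < \<bar>\<eta> l\<bar> \<Longrightarrow> w \<eta> = 0" "0 \<le> K"
  shows "\<exists>C\<ge>0. \<forall>q Aq i j z. 0 \<le> Aq \<longrightarrow> Qb N Aq q \<longrightarrow> (\<forall>l. i l \<le> D) \<longrightarrow> (\<forall>l. \<bar>z$l\<bar> \<le> d) \<longrightarrow>
    cmod (\<Sum>k\<in>Kset \<kappa> d j. w (etak \<kappa> (pi / d) j k) * q (etak \<kappa> (pi / d) j k) * mipow (\<lambda>l. - \<i> * of_real (xik d k l)) i * ek (pi / d) k z)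
     \<le> C * Aq * 2 ^ (j * mdot i \<kappa>) * (2 ^ (j * msum \<kappa>) / max 1 (2 ^ j * qdist \<kappa> z 0) ^ N)"
proof -
  have h: "0 < pi / d" using d by simp
  have pid: "pi / (pi / d) = d" by simp
  obtain C1 where C1: "C1 \<ge> 0" "\<And>q Aq \<sigma> l \<eta>. 0 \<le> Aq \<Longrightarrow> Qb N Aq q \<Longrightarrow> (\<forall>l. \<sigma> l \<le> D) \<Longrightarrow>
     Bd N UNIV (C1 * Aq) (\<lambda>y. (\<lambda>\<eta>. w \<eta> * q \<eta> * mipow (\<lambda>l. of_real (\<eta> l)) \<sigma>) (\<eta>(l := y)))"
    using multiplier_bound_plain[of N K w D] w by blast
  obtain C2 where C2: "C2 \<ge> 0" "\<And>F A j z. (\<forall>l \<eta>. Bd N UNIV A (\<lambda>y. F (\<eta>(l := y)))) \<Longrightarrow> (\<forall>\<eta> l. 2 < \<bar>\<eta> l\<bar> \<longrightarrow> F \<eta> = 0)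
     \<Longrightarrow> (\<forall>l. \<bar>z$l\<bar> \<le> pi / (pi / d)) \<Longrightarrow>
     cmod (Esum (pi / d) (\<lambda>k. F (etak \<kappa> (pi / d) j k)) z) \<le> C2 * A * 2 ^ (j * msum \<kappa>) / max 1 (2 ^ j * qdist \<kappa> z 0) ^ N"
    using Esum_decay[OF h \<kappa>, of N] by blast
  show ?thesis
  proof (intro exI[of _ "C2 * C1"] conjI allI impI)
    show "0 \<le> C2 * C1" using C1 C2 by simp
    fix q :: "('n \<Rightarrow> real) \<Rightarrow> complex" and Aq :: real and i :: "'n mindex" and j :: nat and z :: "real^'n"
    assume a: "0 \<le> Aq" "Qb N Aq q" "\<forall>l. i l \<le> D" "\<forall>l. \<bar>z$l\<bar> \<le> d"
    define F where "F \<eta> = w \<eta> * q \<eta> * mipow (\<lambda>l. of_real (\<eta> l)) i" for \<eta>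
    have F_Bd: "\<forall>l \<eta>. Bd N UNIV (C1 * Aq) (\<lambda>y. F (\<eta>(l := y)))"
      unfolding F_def by (intro allI C1(2) a(1,2,3))
    have F_supp: "\<forall>\<eta> l. 2 < \<bar>\<eta> l\<bar> \<longrightarrow> F \<eta> = 0"
      unfolding F_def by (intro allI impI) (simp add: w(2))
    obtain c where c: "cmod c = 1" "\<And>d k j. mipow (\<lambda>l. - \<i> * of_real (xik d k l)) i = c * of_real (2 ^ (j * mdot i \<kappa>)) * mipow (\<lambda>l. of_real (etak \<kappa> (pi / d) j k l)) i"
      using mipow_scale_xik[of "-\<i>" i \<kappa>] by auto
    have "Esum (pi / d) (\<lambda>k. F (etak \<kappa> (pi / d) j k)) z = (\<Sum>k\<in>Kset \<kappa> d j. F (etak \<kappa> (pi / d) j k) * ek (pi / d) k z)"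
    proof (rule Esum_superset[OF finite_Kset[OF d]])
      show "{k. F (etak \<kappa> (pi / d) j k) \<noteq> 0} \<subseteq> Kset \<kappa> d j"
      proof
        fix k assume "k \<in> {k. F (etak \<kappa> (pi / d) j k) \<noteq> 0}"
        then have "F (etak \<kappa> (pi / d) j k) \<noteq> 0" by blast
        then have "\<not> 2 < \<bar>etak \<kappa> (pi / d) j k l\<bar>" for l using F_supp[rule_format, of "etak \<kappa> (pi / d) j k" l] by blast
        then show "k \<in> Kset \<kappa> d j" by (simp add: Kset_def not_less)
      qed
    qed
    then have "(\<Sum>k\<in>Kset \<kappa> d j. w (etak \<kappa> (pi / d) j k) * q (etak \<kappa> (pi / d) j k) * mipow (\<lambda>l. - \<i> * of_real (xik d k l)) i * ek (pi / d) k z)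
      = c * of_real (2 ^ (j * mdot i \<kappa>)) * Esum (pi / d) (\<lambda>k. F (etak \<kappa> (pi / d) j k)) z"
      unfolding c(2)[of _ _ j] F_def by (simp add: sum_distrib_left mult_ac)
    also have "cmod \<dots> = 2 ^ (j * mdot i \<kappa>) * cmod (Esum (pi / d) (\<lambda>k. F (etak \<kappa> (pi / d) j k)) z)"
      using c(1) by (simp add: norm_mult norm_power)
    also have "\<dots> \<le> 2 ^ (j * mdot i \<kappa>) * (C2 * (C1 * Aq) * 2 ^ (j * msum \<kappa>) / max 1 (2 ^ j * qdist \<kappa> z 0) ^ N)"
    proof (rule mult_left_mono[OF C2(2)[OF F_Bd F_supp]])
      show "\<forall>l. \<bar>z$l\<bar> \<le> pi / (pi / d)" unfolding pid by (rule a(4))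
    qed simp
    finally show "cmod (\<Sum>k\<in>Kset \<kappa> d j. w (etak \<kappa> (pi / d) j k) * q (etak \<kappa> (pi / d) j k) * mipow (\<lambda>l. - \<i> * of_real (xik d k l)) i * ek (pi / d) k z)
     \<le> C2 * C1 * Aq * 2 ^ (j * mdot i \<kappa>) * (2 ^ (j * msum \<kappa>) / max 1 (2 ^ j * qdist \<kappa> z 0) ^ N)" by (simp add: mult_ac)
  qed
qed

context symb_class
begin

definition muq :: "real \<Rightarrow> nat \<Rightarrow> (('n \<Rightarrow> real) \<Rightarrow> complex) \<Rightarrow> ('n \<Rightarrow> int) \<Rightarrow> complex" where
  "muq d j q k = chin \<kappa> (etak \<kappa> (pi / d) j k) * q (etak \<kappa> (pi / d) j k)"

definition nuq :: "real \<Rightarrow> ('n mindex \<Rightarrow> 'n mindex \<Rightarrow> complex) \<Rightarrow> 'n mindex \<Rightarrow> nat \<Rightarrow> (('n \<Rightarrow> real) \<Rightarrow> complex) \<Rightarrow> ('n \<Rightarrow> int) \<Rightarrow> complex" where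
  "nuq d c \<alpha> j q k = muq d j q k * mipow (\<lambda>l. \<i> * of_real (xik d k l)) \<alpha> / psym A B c (xik d k)"

lemma psym_xik: "psym A B c (xik d k) = of_real (2 ^ (j * m)) * psym A B c (etak \<kappa> (pi / d) j k)"
proof -
  have "xik d k = (\<lambda>l. (2 ^ j) ^ \<kappa> l * etak \<kappa> (pi / d) j k l)"
    using xik_etak[of d k _ j \<kappa>] by blast
  then show ?thesis using psym_scale[of c "2 ^ j" "etak \<kappa> (pi / d) j k"] by (simp add: power_mult)
qed

lemma psym_nonzero:
  assumes "elliptic c" "chin \<kappa> \<eta> \<noteq> 0" shows "psym A B c \<eta> \<noteq> 0"
proof -
  have "0 < qn \<kappa> \<eta>" using chin_nonzero_qn[OF kpos assms(2)] by simp
  then have "0 < lam * qn \<kappa> \<eta> ^ m" using lam by simp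
  also have "\<dots> \<le> cmod (psym A B c \<eta>)" using assms(1) unfolding elliptic_def by blast
  finally show ?thesis by auto
qed

text \<open>Where the symbol could vanish \<open>muq\<close> vanishes as well, so no division by
  zero intrudes.\<close>

lemma nuq_psym:
  assumes "elliptic c"
  shows "nuq d c \<alpha> j q k * psym A B c (xik d k) = muq d j q k * mipow (\<lambda>l. \<i> * of_real (xik d k l)) \<alpha>"
proof (cases "muq d j q k = 0")
  case False
  then have "psym A B c (etak \<kappa> (pi / d) j k) \<noteq> 0"
    by (intro psym_nonzero[OF assms]) (auto simp: muq_def)
  then have "psym A B c (xik d k) \<noteq> 0" unfolding psym_xik[of c d k j] by simp
  then show ?thesis unfolding nuq_def by simp
qed (simp add: nuq_def)

text \<open>Division by the symbol gains \<open>2 ^ (j * m)\<close> by homogeneity. For \<alpha> in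
  \<open>A\<close> and i in \<open>B\<close> this exactly compensates the two weights, whose sum is
  \<open>m\<close>, and leaves the bare kernel.\<close>

lemma kernel_bound_nu:
  assumes d: "0 < d"
  shows "\<exists>C\<ge>0. \<forall>c q Aq \<alpha> i j z. elliptic c \<longrightarrow> 0 \<le> Aq \<longrightarrow> Qb N Aq q \<longrightarrow> (\<forall>l. \<alpha> l + i l \<le> D) \<longrightarrow> (\<forall>l. \<bar>z$l\<bar> \<le> d) \<longrightarrow>
    cmod (\<Sum>k\<in>Kset \<kappa> d j. nuq d c \<alpha> j q k * mipow (\<lambda>l. - \<i> * of_real (xik d k l)) i * ek (pi / d) k z)
     \<le> C * Aq * (2 ^ (j * (mdot \<alpha> \<kappa> + mdot i \<kappa>)) / 2 ^ (j * m)) * (2 ^ (j * msum \<kappa>) / max 1 (2 ^ j * qdist \<kappa> z 0) ^ N)"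
proof -
  have h: "0 < pi / d" using d by simp
  have pid: "pi / (pi / d) = d" by simp
  obtain C1 where C1: "C1 \<ge> 0" "\<And>c q Aq \<sigma> l \<eta>. elliptic c \<Longrightarrow> 0 \<le> Aq \<Longrightarrow> Qb N Aq q \<Longrightarrow> (\<forall>l. \<sigma> l \<le> D) \<Longrightarrow>
     Bd N UNIV (C1 * Aq) (\<lambda>y. (\<lambda>\<eta>. chin \<kappa> \<eta> * q \<eta> * mipow (\<lambda>l. of_real (\<eta> l)) \<sigma> / psym A B c \<eta>) (\<eta>(l := y)))"
    using multiplier_bound[where N = N and D = D] by blast
  obtain C2 where C2: "C2 \<ge> 0" "\<And>F A j z. (\<forall>l \<eta>. Bd N UNIV A (\<lambda>y. F (\<eta>(l := y)))) \<Longrightarrow> (\<forall>\<eta> l. 2 < \<bar>\<eta> l\<bar> \<longrightarrow> F \<eta> = 0)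
     \<Longrightarrow> (\<forall>l. \<bar>z$l\<bar> \<le> pi / (pi / d)) \<Longrightarrow>
     cmod (Esum (pi / d) (\<lambda>k. F (etak \<kappa> (pi / d) j k)) z) \<le> C2 * A * 2 ^ (j * msum \<kappa>) / max 1 (2 ^ j * qdist \<kappa> z 0) ^ N"
    using Esum_decay[OF h kpos, of N] by blast
  show ?thesis
  proof (intro exI[of _ "C2 * C1"] conjI allI impI)
    show "0 \<le> C2 * C1" using C1 C2 by simp
    fix c and q :: "('n \<Rightarrow> real) \<Rightarrow> complex" and Aq :: real and \<alpha> i :: "'n mindex" and j :: nat and z :: "real^'n"
    assume a: "elliptic c" "0 \<le> Aq" "Qb N Aq q" "\<forall>l. \<alpha> l + i l \<le> D" "\<forall>l. \<bar>z$l\<bar> \<le> d"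
    let ?\<sigma> = "\<lambda>l. \<alpha> l + i l"
    define F where "F \<eta> = chin \<kappa> \<eta> * q \<eta> * mipow (\<lambda>l. of_real (\<eta> l)) ?\<sigma> / psym A B c \<eta>" for \<eta>
    have F_Bd: "\<forall>l \<eta>. Bd N UNIV (C1 * Aq) (\<lambda>y. F (\<eta>(l := y)))"
      unfolding F_def by (intro allI C1(2) a(1,2,3)) (use a(4) in blast)
    have F_supp: "\<forall>\<eta> l. 2 < \<bar>\<eta> l\<bar> \<longrightarrow> F \<eta> = 0"
      unfolding F_def by (intro allI impI) (simp add: chin_zero)
    obtain u where u: "cmod u = 1" "\<And>d k j. mipow (\<lambda>l. - \<i> * of_real (xik d k l)) i = u * of_real (2 ^ (j * mdot i \<kappa>)) * mipow (\<lambda>l. of_real (etak \<kappa> (pi / d) j k l)) i"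
      using mipow_scale_xik[of "-\<i>" i \<kappa>] by auto
    obtain u' where u': "cmod u' = 1" "\<And>d k j. mipow (\<lambda>l. \<i> * of_real (xik d k l)) \<alpha> = u' * of_real (2 ^ (j * mdot \<alpha> \<kappa>)) * mipow (\<lambda>l. of_real (etak \<kappa> (pi / d) j k l)) \<alpha>"
      using mipow_scale_xik[of "\<i>" \<alpha> \<kappa>] by auto
    have E: "Esum (pi / d) (\<lambda>k. F (etak \<kappa> (pi / d) j k)) z = (\<Sum>k\<in>Kset \<kappa> d j. F (etak \<kappa> (pi / d) j k) * ek (pi / d) k z)"
    proof (rule Esum_superset[OF finite_Kset[OF d]])
      show "{k. F (etak \<kappa> (pi / d) j k) \<noteq> 0} \<subseteq> Kset \<kappa> d j"
      proof
        fix k assume "k \<in> {k. F (etak \<kappa> (pi / d) j k) \<noteq> 0}"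
        then have "F (etak \<kappa> (pi / d) j k) \<noteq> 0" by blast
        then have "\<not> 2 < \<bar>etak \<kappa> (pi / d) j k l\<bar>" for l using F_supp[rule_format, of "etak \<kappa> (pi / d) j k" l] by blast
        then show "k \<in> Kset \<kappa> d j" by (simp add: Kset_def not_less)
      qed
    qed
    have "nuq d c \<alpha> j q k * mipow (\<lambda>l. - \<i> * of_real (xik d k l)) i = 
       (u * u' * of_real (2 ^ (j * (mdot \<alpha> \<kappa> + mdot i \<kappa>)) / 2 ^ (j * m))) * F (etak \<kappa> (pi / d) j k)" for k
      unfolding nuq_def muq_def u(2)[of _ _ j] u'(2)[of _ _ j] psym_xik[of c d k j] F_def mipow_add[symmetric]
      by (simp add: power_add distrib_left mult_ac)
    then have "(\<Sum>k\<in>Kset \<kappa> d j. nuq d c \<alpha> j q k * mipow (\<lambda>l. - \<i> * of_real (xik d k l)) i * ek (pi / d) k z)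
      = (u * u' * of_real (2 ^ (j * (mdot \<alpha> \<kappa> + mdot i \<kappa>)) / 2 ^ (j * m))) * Esum (pi / d) (\<lambda>k. F (etak \<kappa> (pi / d) j k)) z"
      unfolding E sum_distrib_left by (simp only: mult.assoc)
    also have "cmod \<dots> = 2 ^ (j * (mdot \<alpha> \<kappa> + mdot i \<kappa>)) / 2 ^ (j * m) * cmod (Esum (pi / d) (\<lambda>k. F (etak \<kappa> (pi / d) j k)) z)"
      using u(1) u'(1) by (simp add: norm_mult norm_power norm_divide)
    also have "\<dots> \<le> 2 ^ (j * (mdot \<alpha> \<kappa> + mdot i \<kappa>)) / 2 ^ (j * m) * (C2 * (C1 * Aq) * 2 ^ (j * msum \<kappa>) / max 1 (2 ^ j * qdist \<kappa> z 0) ^ N)"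
    proof (rule mult_left_mono[OF C2(2)[OF F_Bd F_supp]])
      show "\<forall>l. \<bar>z$l\<bar> \<le> pi / (pi / d)" unfolding pid by (rule a(5))
    qed (intro divide_nonneg_nonneg zero_le_power, auto)
    finally show "cmod (\<Sum>k\<in>Kset \<kappa> d j. nuq d c \<alpha> j q k * mipow (\<lambda>l. - \<i> * of_real (xik d k l)) i * ek (pi / d) k z)
     \<le> C2 * C1 * Aq * (2 ^ (j * (mdot \<alpha> \<kappa> + mdot i \<kappa>)) / 2 ^ (j * m)) * (2 ^ (j * msum \<kappa>) / max 1 (2 ^ j * qdist \<kappa> z 0) ^ N)" by (simp add: mult_ac)
  qed
qed

end

text \<open>The minimum with 1 makes the power \<open>\<kappa> l\<close> harmless: a number in
  [0, 1] is not increased by it.\<close>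

lemma qdist_outer:
  fixes w :: "real^'n::finite"
  assumes "\<forall>l. 0 < \<kappa> l" "0 < e" "e \<le> \<bar>w$l\<bar>"
  shows "min 1 e \<le> qdist \<kappa> w 0"
proof -
  have "min 1 e ^ \<kappa> l \<le> min 1 e ^ 1" by (rule power_decreasing) (use assms in \<open>auto simp: Suc_le_eq\<close>)
  then have "min 1 e ^ \<kappa> l \<le> \<bar>w$l\<bar>" using assms by simp
  then have "min 1 e \<le> qn \<kappa> (\<lambda>l. w$l)" using assms by (intro qn_ge_coord[of \<kappa> l]) auto
  then show ?thesis by (simp add: qn_def qdist_def)
qed

lemma set_integrable_mult_tens:
  fixes F :: "real^'n::finite \<Rightarrow> complex"
  assumes F: "set_integrable lebesgue (cbx x d) F" and G: "continuous_on UNIV G"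
  shows "set_integrable lebesgue (cbx x d) (\<lambda>z. F z * G z)"
proof -
  have "compact (G ` cbx x d)" by (intro compact_continuous_image continuous_on_subset[OF G] compact_cbx) auto
  then obtain C where C: "\<And>z. z \<in> cbx x d \<Longrightarrow> cmod (G z) \<le> C"
    by (meson compact_imp_bounded bounded_iff imageI)
  have Gm: "G \<in> borel_measurable lebesgue"
    using borel_measurable_continuous_onI[OF G] by (simp add: measurable_completion)
  have "integrable lebesgue (\<lambda>z. (indicator (cbx x d) z *\<^sub>R F z) * G z)"
  proof (rule Bochner_Integration.integrable_bound)
    show "integrable lebesgue (\<lambda>z. of_real C * (indicator (cbx x d) z *\<^sub>R F z))"
      using F unfolding set_integrable_def by (rule integrable_mult_right)
    show "(\<lambda>z. (indicator (cbx x d) z *\<^sub>R F z) * G z) \<in> borel_measurable lebesgue"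
      by (intro borel_measurable_times Gm) (use F in \<open>simp add: set_integrable_def\<close>)
    have "cmod (F z) * cmod (G z) \<le> \<bar>C\<bar> * cmod (F z)" if "z \<in> cbx x d" for z
      using mult_right_mono[OF order_trans[OF C[OF that] abs_ge_self] norm_ge_zero[of "F z"]] by (simp add: mult.commute)
    then show "AE z in lebesgue. cmod ((indicator (cbx x d) z *\<^sub>R F z) * G z) \<le> cmod (of_real C * (indicator (cbx x d) z *\<^sub>R F z))"
      by (auto simp: indicator_def norm_mult)
  qed
  then show ?thesis by (simp add: set_integrable_def)
qed

text \<open>The right-hand side of the equation frozen at \<open>x\<close>, with the constant
  \<open>f \<beta> x\<close> subtracted and the variation of the coefficients moved over from the
  left.\<close>

definition gfun :: "'n::finite mindex set \<Rightarrow> ('n mindex \<Rightarrow> real^'n \<Rightarrow> complex) \<Rightarrow> ('n mindex \<Rightarrow> 'n mindex \<Rightarrow> real^'n \<Rightarrow> complex)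
    \<Rightarrow> ('n mindex \<Rightarrow> real^'n \<Rightarrow> complex) \<Rightarrow> real^'n \<Rightarrow> 'n mindex \<Rightarrow> real^'n \<Rightarrow> complex" where
  "gfun A v a f x \<beta> z = (f \<beta> z - f \<beta> x) - (\<Sum>\<alpha>\<in>A. (a \<alpha> \<beta> z - a \<alpha> \<beta> x) * v \<alpha> z)"

locale frozen = symb_class \<kappa> A B m lam Lam
  for \<kappa> :: "'n::finite mindex" and A B :: "'n mindex set" and m :: nat and lam Lam :: real +
  fixes d :: real and \<Omega> T and v :: "'n mindex \<Rightarrow> real^'n \<Rightarrow> complex"
    and a :: "'n mindex \<Rightarrow> 'n mindex \<Rightarrow> real^'n \<Rightarrow> complex" and f :: "'n mindex \<Rightarrow> real^'n \<Rightarrow> complex"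
    and x :: "real^'n" and M :: real and s :: "'n mindex"
  assumes d0: "0 < d" and box: "dbox d (bfun d) \<Omega> T A v x M" and B_ne: "B \<noteq> {}"
    and s: "\<forall>l. (\<lambda>k. if k = l then s l else 0) \<in> A"
    and ell: "elliptic (\<lambda>\<alpha> \<beta>. a \<alpha> \<beta> x)"
    and av: "\<And>\<alpha> \<beta>. \<alpha> \<in> A \<Longrightarrow> \<beta> \<in> B \<Longrightarrow> set_integrable lebesgue (cbx x d) (\<lambda>z. a \<alpha> \<beta> z * v \<alpha> z)"
    and fi: "\<And>\<beta>. \<beta> \<in> B \<Longrightarrow> set_integrable lebesgue (cbx x d) (f \<beta>)"
    and eqn: "\<And>\<phi>. \<phi> \<in> test_fun \<Omega> \<Longrightarrow>
       (\<Sum>\<beta>\<in>B. (-1) ^ mlen \<beta> * (\<Sum>\<alpha>\<in>A. integ \<Omega> (\<lambda>z. a \<alpha> \<beta> z * v \<alpha> z * Dm \<beta> \<phi> z)))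
        = (\<Sum>\<beta>\<in>B. (-1) ^ mlen \<beta> * integ \<Omega> (\<lambda>z. f \<beta> z * Dm \<beta> \<phi> z))"
begin

sublocale box: dbox d "bfun d" \<Omega> T A v x M by (rule box)

definition c where "c \<alpha> \<beta> = a \<alpha> \<beta> x"

abbreviation g where "g \<equiv> gfun A v a f x"

lemma g_def: "g \<beta> z = (f \<beta> z - f \<beta> x) - (\<Sum>\<alpha>\<in>A. (a \<alpha> \<beta> z - c \<alpha> \<beta>) * v \<alpha> z)"
  by (simp add: gfun_def c_def)

lemma ell_c: "elliptic c" using ell by (simp add: c_def[abs_def])

lemma v_int: "\<alpha> \<in> A \<Longrightarrow> set_integrable lebesgue (cbx x d) (v \<alpha>)"
  by (intro set_integrable_cbx_continuous continuous_on_subset[OF box.v_cont box.sub])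

lemma const_int: "set_integrable lebesgue (cbx x d) (\<lambda>z. y :: complex)"
  by (intro set_integrable_cbx_continuous continuous_intros)

lemma acv_int: "\<alpha> \<in> A \<Longrightarrow> \<beta> \<in> B \<Longrightarrow> set_integrable lebesgue (cbx x d) (\<lambda>z. (a \<alpha> \<beta> z - c \<alpha> \<beta>) * v \<alpha> z)"
  using set_integral_diff(1)[OF av[of \<alpha> \<beta>] set_integrable_mult_right[OF v_int[of \<alpha>], of "c \<alpha> \<beta>"]]
  by (simp add: algebra_simps)

lemma fc_int: "\<beta> \<in> B \<Longrightarrow> set_integrable lebesgue (cbx x d) (\<lambda>z. f \<beta> z - f \<beta> x)"
  by (intro set_integral_diff(1) fi const_int)

lemma sum_int:
  fixes G :: "'i \<Rightarrow> real^'n \<Rightarrow> complex"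
  assumes "\<And>i. i \<in> F \<Longrightarrow> set_integrable lebesgue (cbx x d) (G i)"
  shows "set_integrable lebesgue (cbx x d) (\<lambda>z. \<Sum>i\<in>F. G i z)"
  unfolding set_integrable_def scaleR_sum_right
  by (rule Bochner_Integration.integrable_sum) (rule assms[unfolded set_integrable_def])

lemma g_int: "\<beta> \<in> B \<Longrightarrow> set_integrable lebesgue (cbx x d) (g \<beta>)"
  unfolding gfun_def[abs_def] using acv_int unfolding c_def by (intro set_integral_diff(1) fc_int sum_int acv_int)

text \<open>The equation tested with a tensor product. Its frozen part is expressed through
  \<open>T\<close> and regrouped by \<sigma> = \<alpha> + \<beta>. Subtracting
  \<open>f \<beta> x\<close> leaves the last sum, constants times means of derivatives of the test
  function, which a suitable choice of the test function will annihilate.\<close>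

lemma EQ:
  assumes h: "\<And>l. h l \<in> test1 d"
  shows "(\<Sum>\<sigma>\<in>Sg. coef c \<sigma> * ((-1) ^ mlen \<sigma> * T (tens x (\<lambda>l. nd (\<sigma> l) (h l))))) =
    (\<Sum>\<beta>\<in>B. (-1) ^ mlen \<beta> * (LINT z:cbx x d|lebesgue. g \<beta> z * tens x (\<lambda>l. nd (\<beta> l) (h l)) z))
    + (\<Sum>\<beta>\<in>B. (-1) ^ mlen \<beta> * (f \<beta> x * (LINT z:cbx x d|lebesgue. tens x (\<lambda>l. nd (\<beta> l) (h l)) z)))"
proof -
  let ?t = "\<lambda>\<beta>. tens x (\<lambda>l. nd (\<beta> l) (h l))"
  have tc: "continuous_on UNIV (?t \<beta>)" for \<beta>
    by (intro continuous_on_tens smooth1_continuous_on test1_smooth1[OF h])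
  have tz: "z \<notin> cbx x d \<Longrightarrow> ?t \<beta> z = 0" for z \<beta>
    by (intro tens_zero_outside[of _ d] test1_nd h)
  have Dmt: "Dm \<beta> (tens x h) = ?t \<beta>" for \<beta> by (intro Dm_tens test1_smooth1[OF h])
  have eqn': "(\<Sum>\<beta>\<in>B. (-1) ^ mlen \<beta> * (\<Sum>\<alpha>\<in>A. (LINT z:cbx x d|lebesgue. a \<alpha> \<beta> z * v \<alpha> z * ?t \<beta> z)))
        = (\<Sum>\<beta>\<in>B. (-1) ^ mlen \<beta> * (LINT z:cbx x d|lebesgue. f \<beta> z * ?t \<beta> z))"
  proof -
    have "integ \<Omega> (\<lambda>z. a \<alpha> \<beta> z * v \<alpha> z * ?t \<beta> z) = (LINT z:cbx x d|lebesgue. a \<alpha> \<beta> z * v \<alpha> z * ?t \<beta> z)"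
      "integ \<Omega> (\<lambda>z. f \<beta> z * ?t \<beta> z) = (LINT z:cbx x d|lebesgue. f \<beta> z * ?t \<beta> z)" for \<alpha> \<beta>
      by (intro integ_eq_box[OF box.sub], simp add: tz)+
    then show ?thesis using eqn[OF tens_test_fun[of h d, OF h box.sub]] unfolding Dmt by simp
  qed
  have TT: "(-1) ^ mlen (\<lambda>l. \<alpha> l + \<beta> l) * T (tens x (\<lambda>l. nd (\<alpha> l + \<beta> l) (h l)))
     = (-1) ^ mlen \<beta> * (LINT z:cbx x d|lebesgue. v \<alpha> z * ?t \<beta> z)" if "\<alpha> \<in> A" for \<alpha> \<beta>
  proof -
    have "T (tens x (\<lambda>l. nd (\<alpha> l) (nd (\<beta> l) (h l)))) = (-1) ^ mlen \<alpha> * (LINT z:cbx x d|lebesgue. v \<alpha> z * ?t \<beta> z)"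
      by (rule box.T_Dm[OF that test1_nd[OF h]])
    moreover have "mlen (\<lambda>l. \<alpha> l + \<beta> l) = mlen \<alpha> + mlen \<beta>" by (simp add: mlen_def sum.distrib)
    ultimately show ?thesis
      by (simp add: nd_add power_add mult.assoc[symmetric] power_mult_distrib[symmetric] mult.commute[of "(-1) ^ mlen \<alpha>"])
  qed
  have gint: "(LINT z:cbx x d|lebesgue. g \<beta> z * ?t \<beta> z) = (LINT z:cbx x d|lebesgue. f \<beta> z * ?t \<beta> z)
     - f \<beta> x * (LINT z:cbx x d|lebesgue. ?t \<beta> z)
     - ((\<Sum>\<alpha>\<in>A. (LINT z:cbx x d|lebesgue. a \<alpha> \<beta> z * v \<alpha> z * ?t \<beta> z))
       - (\<Sum>\<alpha>\<in>A. c \<alpha> \<beta> * (LINT z:cbx x d|lebesgue. v \<alpha> z * ?t \<beta> z)))" if \<beta>: "\<beta> \<in> B" for \<beta>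
  proof -
    have i1: "set_integrable lebesgue (cbx x d) (\<lambda>z. f \<beta> z * ?t \<beta> z)" by (rule set_integrable_mult_tens[OF fi[OF \<beta>] tc])
    have i2: "set_integrable lebesgue (cbx x d) (\<lambda>z. f \<beta> x * ?t \<beta> z)" by (rule set_integrable_mult_tens[OF const_int tc])
    have i3: "set_integrable lebesgue (cbx x d) (\<lambda>z. a \<alpha> \<beta> z * v \<alpha> z * ?t \<beta> z)" if "\<alpha> \<in> A" for \<alpha>
      by (rule set_integrable_mult_tens[OF av[OF that \<beta>] tc])
    have i4: "set_integrable lebesgue (cbx x d) (\<lambda>z. v \<alpha> z * ?t \<beta> z)" if "\<alpha> \<in> A" for \<alpha>
      by (rule set_integrable_mult_tens[OF v_int[OF that] tc])
    have i5: "set_integrable lebesgue (cbx x d) (\<lambda>z. c \<alpha> \<beta> * (v \<alpha> z * ?t \<beta> z))" if "\<alpha> \<in> A" for \<alpha>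
      using i4[OF that] by (intro set_integrable_mult_right)
    have 3: "(\<Sum>\<alpha>\<in>A. (LINT z:cbx x d|lebesgue. a \<alpha> \<beta> z * v \<alpha> z * ?t \<beta> z)) = (LINT z:cbx x d|lebesgue. \<Sum>\<alpha>\<in>A. a \<alpha> \<beta> z * v \<alpha> z * ?t \<beta> z)"
      using set_integral_sum_mult[of A lebesgue "cbx x d" "\<lambda>\<alpha> z. a \<alpha> \<beta> z * v \<alpha> z * ?t \<beta> z" "\<lambda>_. 1", OF i3] by simp
    have 4: "(\<Sum>\<alpha>\<in>A. c \<alpha> \<beta> * (LINT z:cbx x d|lebesgue. v \<alpha> z * ?t \<beta> z)) = (LINT z:cbx x d|lebesgue. \<Sum>\<alpha>\<in>A. c \<alpha> \<beta> * (v \<alpha> z * ?t \<beta> z))"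
      by (rule set_integral_sum_mult[OF i4])
    have "g \<beta> z * ?t \<beta> z = (f \<beta> z * ?t \<beta> z - f \<beta> x * ?t \<beta> z) - ((\<Sum>\<alpha>\<in>A. a \<alpha> \<beta> z * v \<alpha> z * ?t \<beta> z) - (\<Sum>\<alpha>\<in>A. c \<alpha> \<beta> * (v \<alpha> z * ?t \<beta> z)))" for z
      by (simp add: g_def algebra_simps sum_distrib_left sum_distrib_right sum_subtractf)
    then have "(LINT z:cbx x d|lebesgue. g \<beta> z * ?t \<beta> z) = (LINT z:cbx x d|lebesgue. (f \<beta> z * ?t \<beta> z - f \<beta> x * ?t \<beta> z)
       - ((\<Sum>\<alpha>\<in>A. a \<alpha> \<beta> z * v \<alpha> z * ?t \<beta> z) - (\<Sum>\<alpha>\<in>A. c \<alpha> \<beta> * (v \<alpha> z * ?t \<beta> z))))" by simp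
    also have "\<dots> = (LINT z:cbx x d|lebesgue. f \<beta> z * ?t \<beta> z - f \<beta> x * ?t \<beta> z)
       - (LINT z:cbx x d|lebesgue. (\<Sum>\<alpha>\<in>A. a \<alpha> \<beta> z * v \<alpha> z * ?t \<beta> z) - (\<Sum>\<alpha>\<in>A. c \<alpha> \<beta> * (v \<alpha> z * ?t \<beta> z)))"
      by (intro set_integral_diff(2) set_integral_diff(1) i1 i2 sum_int i3 i5)
    also have "(LINT z:cbx x d|lebesgue. f \<beta> z * ?t \<beta> z - f \<beta> x * ?t \<beta> z) = (LINT z:cbx x d|lebesgue. f \<beta> z * ?t \<beta> z) - (LINT z:cbx x d|lebesgue. f \<beta> x * ?t \<beta> z)"
      by (intro set_integral_diff(2) i1 i2)
    also have "(LINT z:cbx x d|lebesgue. (\<Sum>\<alpha>\<in>A. a \<alpha> \<beta> z * v \<alpha> z * ?t \<beta> z) - (\<Sum>\<alpha>\<in>A. c \<alpha> \<beta> * (v \<alpha> z * ?t \<beta> z)))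
       = (LINT z:cbx x d|lebesgue. (\<Sum>\<alpha>\<in>A. a \<alpha> \<beta> z * v \<alpha> z * ?t \<beta> z)) - (LINT z:cbx x d|lebesgue. (\<Sum>\<alpha>\<in>A. c \<alpha> \<beta> * (v \<alpha> z * ?t \<beta> z)))"
      by (intro set_integral_diff(2) sum_int i3 i5)
    finally show ?thesis unfolding 3 4 by simp
  qed
  have "(\<Sum>\<sigma>\<in>Sg. coef c \<sigma> * ((-1) ^ mlen \<sigma> * T (tens x (\<lambda>l. nd (\<sigma> l) (h l))))) =
     (\<Sum>\<alpha>\<in>A. \<Sum>\<beta>\<in>B. c \<alpha> \<beta> * ((-1) ^ mlen (\<lambda>l. \<alpha> l + \<beta> l) * T (tens x (\<lambda>l. nd (\<alpha> l + \<beta> l) (h l)))))"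
    by (rule sum_coef[symmetric])
  also have "\<dots> = (\<Sum>\<beta>\<in>B. (-1) ^ mlen \<beta> * (\<Sum>\<alpha>\<in>A. c \<alpha> \<beta> * (LINT z:cbx x d|lebesgue. v \<alpha> z * ?t \<beta> z)))"
    by (subst sum.swap) (simp add: TT sum_distrib_left mult_ac)
  also have "\<dots> = (\<Sum>\<beta>\<in>B. (-1) ^ mlen \<beta> * (LINT z:cbx x d|lebesgue. g \<beta> z * ?t \<beta> z))
    + (\<Sum>\<beta>\<in>B. (-1) ^ mlen \<beta> * (f \<beta> x * (LINT z:cbx x d|lebesgue. ?t \<beta> z)))
    + ((\<Sum>\<beta>\<in>B. (-1) ^ mlen \<beta> * (\<Sum>\<alpha>\<in>A. (LINT z:cbx x d|lebesgue. a \<alpha> \<beta> z * v \<alpha> z * ?t \<beta> z)))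
      - (\<Sum>\<beta>\<in>B. (-1) ^ mlen \<beta> * (LINT z:cbx x d|lebesgue. f \<beta> z * ?t \<beta> z)))"
    unfolding sum.distrib[symmetric] sum_subtractf[symmetric]
    by (intro sum.cong refl) (simp add: gint algebra_simps)
  finally show ?thesis unfolding eqn' by simp
qed

lemma EQ_sum:
  assumes F: "finite F" and h: "\<And>i l. i \<in> F \<Longrightarrow> h i l \<in> test1 d"
  shows "(\<Sum>i\<in>F. w i * (\<Sum>\<sigma>\<in>Sg. coef c \<sigma> * ((-1) ^ mlen \<sigma> * T (tens x (\<lambda>l. nd (\<sigma> l) (h i l)))))) =
    (\<Sum>\<beta>\<in>B. (-1) ^ mlen \<beta> * (LINT z:cbx x d|lebesgue. g \<beta> z * (\<Sum>i\<in>F. w i * tens x (\<lambda>l. nd (\<beta> l) (h i l)) z)))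
    + (\<Sum>\<beta>\<in>B. (-1) ^ mlen \<beta> * (f \<beta> x * (\<Sum>i\<in>F. w i * (LINT z:cbx x d|lebesgue. tens x (\<lambda>l. nd (\<beta> l) (h i l)) z))))"
proof -
  let ?t = "\<lambda>i \<beta>. tens x (\<lambda>l. nd (\<beta> l) (h i l))"
  have tc: "continuous_on UNIV (?t i \<beta>)" if "i \<in> F" for i \<beta>
    by (intro continuous_on_tens smooth1_continuous_on test1_smooth1[OF h[OF that]])
  have 1: "(\<Sum>i\<in>F. w i * (LINT z:cbx x d|lebesgue. g \<beta> z * ?t i \<beta> z)) = (LINT z:cbx x d|lebesgue. g \<beta> z * (\<Sum>i\<in>F. w i * ?t i \<beta> z))"
    if "\<beta> \<in> B" for \<beta>
  proof -
    have "(\<Sum>i\<in>F. w i * (LINT z:cbx x d|lebesgue. g \<beta> z * ?t i \<beta> z)) = (LINT z:cbx x d|lebesgue. \<Sum>i\<in>F. w i * (g \<beta> z * ?t i \<beta> z))"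
      by (rule set_integral_sum_mult) (rule set_integrable_mult_tens[OF g_int[OF that] tc])
    then show ?thesis by (simp add: sum_distrib_left mult_ac)
  qed
  have "(\<Sum>i\<in>F. w i * (\<Sum>\<sigma>\<in>Sg. coef c \<sigma> * ((-1) ^ mlen \<sigma> * T (?t i \<sigma>)))) =
     (\<Sum>i\<in>F. w i * (\<Sum>\<beta>\<in>B. (-1) ^ mlen \<beta> * (LINT z:cbx x d|lebesgue. g \<beta> z * ?t i \<beta> z)))
    + (\<Sum>i\<in>F. w i * (\<Sum>\<beta>\<in>B. (-1) ^ mlen \<beta> * (f \<beta> x * (LINT z:cbx x d|lebesgue. ?t i \<beta> z))))"
    unfolding sum.distrib[symmetric, where A = F] distrib_left[symmetric, of "w _"]
  proof (intro sum.cong refl)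
    fix i assume i: "i \<in> F"
    show "w i * (\<Sum>\<sigma>\<in>Sg. coef c \<sigma> * ((-1) ^ mlen \<sigma> * T (?t i \<sigma>))) =
      w i * ((\<Sum>\<beta>\<in>B. (-1) ^ mlen \<beta> * (LINT z:cbx x d|lebesgue. g \<beta> z * ?t i \<beta> z))
       + (\<Sum>\<beta>\<in>B. (-1) ^ mlen \<beta> * (f \<beta> x * (LINT z:cbx x d|lebesgue. ?t i \<beta> z))))"
      by (rule arg_cong[where f = "\<lambda>y. w i * y"], rule EQ, rule h[OF i])
  qed
  also have "(\<Sum>i\<in>F. w i * (\<Sum>\<beta>\<in>B. (-1) ^ mlen \<beta> * (LINT z:cbx x d|lebesgue. g \<beta> z * ?t i \<beta> z)))
     = (\<Sum>\<beta>\<in>B. (-1) ^ mlen \<beta> * (\<Sum>i\<in>F. w i * (LINT z:cbx x d|lebesgue. g \<beta> z * ?t i \<beta> z)))"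
    by (simp add: sum_distrib_left mult_ac) (rule sum.swap)
  also have "(\<Sum>i\<in>F. w i * (\<Sum>\<beta>\<in>B. (-1) ^ mlen \<beta> * (f \<beta> x * (LINT z:cbx x d|lebesgue. ?t i \<beta> z))))
     = (\<Sum>\<beta>\<in>B. (-1) ^ mlen \<beta> * (f \<beta> x * (\<Sum>i\<in>F. w i * (LINT z:cbx x d|lebesgue. ?t i \<beta> z))))"
    by (simp add: sum_distrib_left mult_ac) (rule sum.swap)
  finally show ?thesis by (simp add: 1)
qed

end

lemma mdot_mono: "i \<le> \<beta> \<Longrightarrow> mdot i \<kappa> \<le> mdot \<beta> \<kappa>"
  unfolding mdot_def le_fun_def by (intro sum_mono mult_right_mono) auto

lemma integral_exp_period_zero:
  assumes "0 < d" "n \<noteq> (0::int)"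
  shows "integral {-d..d} (\<lambda>t. exp ((- \<i> * of_real (pi / d * of_int n)) * of_real t)) = 0"
proof -
  define c where "c = - \<i> * complex_of_real (pi / d * of_int n)"
  have c: "c \<noteq> 0" using assms by (simp add: c_def)
  have "((\<lambda>t. exp (c * of_real t) / c) has_vector_derivative exp (c * of_real t)) (at t within {-d..d})" for t
  proof -
    have "((\<lambda>z. exp (c * z) / c) has_field_derivative exp (c * of_real t)) (at (of_real t))"
      using c by (auto intro!: derivative_eq_intros)
    then show ?thesis by (rule has_vector_derivative_real_field)
  qed
  then have "((\<lambda>t. exp (c * of_real t)) has_integral (exp (c * of_real d) / c - exp (c * of_real (-d)) / c)) {-d..d}"
    using assms by (intro fundamental_theorem_of_calculus) auto
  moreover have "exp (c * of_real d) = exp (c * of_real (-d))"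
    unfolding exp_eq using assms by (intro exI[of _ "-n"]) (simp add: c_def field_simps)
  ultimately show ?thesis by (simp add: integral_unique c_def)
qed

lemma chin_0: "chin \<kappa> (\<lambda>l. 0) = 0"
  by (simp add: chin_def)

lemma continuous_on_ek: "continuous_on S (ek h k)"
  unfolding ek_def[abs_def] by (intro continuous_intros)

text \<open>Orthogonality to constants over a full period. It gives the blocks mean zero and later
  normalizes the approximate identity.\<close>

lemma LINT_ek:
  fixes x :: "real^'n::finite"
  assumes d: "0 < d"
  shows "(LINT z:cbx x d|lebesgue. ek (pi / d) k (z - x)) = (if k = (\<lambda>l. 0) then of_real ((2 * d) ^ CARD('n)) else 0)"
proof -
  define h where "h l t = exp ((- \<i> * of_real (pi / d * of_int (k l))) * complex_of_real t)" for l t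
  have "(LINT z:cbx x d|lebesgue. ek (pi / d) k (z - x)) = (LINT z:cbx x d|lebesgue. tens x h z)"
    by (simp add: ek_def tens_def h_def)
  also have "\<dots> = (\<Prod>l\<in>UNIV. integral {-d..d} (h l))"
    by (rule lborel_set_integral_cbx_prod) (unfold h_def, intro continuous_intros)
  also have "\<dots> = (if k = (\<lambda>l. 0) then of_real ((2 * d) ^ CARD('n)) else 0)"
  proof (cases "k = (\<lambda>l. 0)")
    case True
    then have "h l = (\<lambda>t. 1)" for l by (simp add: h_def fun_eq_iff)
    then show ?thesis using d True by (simp add: scaleR_conv_of_real)
  next
    case False
    then obtain l where l: "k l \<noteq> 0" by blast
    have "integral {-d..d} (h l) = 0" unfolding h_def by (rule integral_exp_period_zero[OF d l])
    then show ?thesis using False by (simp add: prod_zero[OF finite]) (intro exI[of _ l])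
  qed
  finally show ?thesis .
qed

lemma set_integrable_ek: "set_integrable lebesgue (cbx x d) (\<lambda>z. ek (pi / d) k (z - x))"
  by (intro set_integrable_cbx_continuous continuous_on_compose2[OF continuous_on_ek[of UNIV]] continuous_intros) auto

text \<open>The order of decay exceeds \<open>|\<kappa>| + m\<close> by two, so that at a fixed distance from the centre even
  \<open>2\<^bsup>j m\<^esup>\<close> times the kernel is \<open>O(4\<^bsup>-j\<^esup>)\<close>.\<close>

definition NNc :: "'n::finite mindex \<Rightarrow> nat \<Rightarrow> nat" where "NNc \<kappa> m = msum \<kappa> + m + 2"

definition kerc :: "'n::finite mindex \<Rightarrow> nat \<Rightarrow> nat \<Rightarrow> real^'n \<Rightarrow> real" where
  "kerc \<kappa> m j w = 2 ^ (j * msum \<kappa>) / max 1 (2 ^ j * qdist \<kappa> w 0) ^ NNc \<kappa> m"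

lemma kerc_nonneg: "0 \<le> kerc \<kappa> m j w"
  unfolding kerc_def by (intro divide_nonneg_nonneg zero_le_power) auto

lemma kerc_far:
  assumes "0 < \<delta>" "\<delta> \<le> qdist \<kappa> w 0"
  shows "2 ^ (j * m) * kerc \<kappa> m j w \<le> (1 / \<delta>) ^ NNc \<kappa> m / 4 ^ j"
proof -
  have "(2 ^ j * \<delta>) ^ NNc \<kappa> m \<le> max 1 (2 ^ j * qdist \<kappa> w 0) ^ NNc \<kappa> m"
    using assms by (intro power_mono) (auto simp: le_max_iff_disj)
  then have "kerc \<kappa> m j w \<le> 2 ^ (j * msum \<kappa>) / (2 ^ j * \<delta>) ^ NNc \<kappa> m"
    unfolding kerc_def using assms by (intro divide_left_mono) auto
  then have "2 ^ (j * m) * kerc \<kappa> m j w \<le> 2 ^ (j * m) * (2 ^ (j * msum \<kappa>) / (2 ^ j * \<delta>) ^ NNc \<kappa> m)"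
    by (intro mult_left_mono) auto
  also have "(2 ^ j * \<delta>) ^ NNc \<kappa> m = 2 ^ (j * msum \<kappa>) * 2 ^ (j * m) * 4 ^ j * \<delta> ^ NNc \<kappa> m"
  proof -
    have "(2::real) ^ (j * NNc \<kappa> m) = 2 ^ (j * msum \<kappa>) * 2 ^ (j * m) * 2 ^ (2 * j)"
      by (simp add: NNc_def power_add[symmetric] algebra_simps)
    also have "(2::real) ^ (2 * j) = 4 ^ j" by (simp add: power_mult)
    finally show ?thesis by (simp add: power_mult_distrib power_mult)
  qed
  also have "2 ^ (j * m) * (2 ^ (j * msum \<kappa>) / (2 ^ (j * msum \<kappa>) * 2 ^ (j * m) * 4 ^ j * \<delta> ^ NNc \<kappa> m)) = (1 / \<delta>) ^ NNc \<kappa> m / 4 ^ j"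
    using assms by (simp add: field_simps)
  finally show ?thesis .
qed

context frozen
begin

abbreviation "NN \<equiv> NNc \<kappa> m"
abbreviation "ker \<equiv> kerc \<kappa> m"

definition c1 :: real where "c1 = min 1 (d / 4)"

lemma c1: "0 < c1" using d0 by (simp add: c1_def)

lemma ker_outer:
  assumes "d / 4 \<le> \<bar>w$l\<bar>"
  shows "2 ^ (j * m) * ker j w \<le> (1 / c1) ^ NN / 4 ^ j"
  by (rule kerc_far[OF c1]) (unfold c1_def, rule qdist_outer[OF kpos _ assms], use d0 in simp)

lemma mdot_A: "\<alpha> \<in> A \<Longrightarrow> mdot \<alpha> \<kappa> \<le> m"
proof -
  assume \<alpha>: "\<alpha> \<in> A"
  obtain \<beta> where \<beta>: "\<beta> \<in> B" using B_ne by blast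
  have "mdot \<alpha> \<kappa> \<le> mdot (\<lambda>l. \<alpha> l + \<beta> l) \<kappa>" by (rule mdot_mono) (simp add: le_fun_def)
  then show ?thesis using hom \<alpha> \<beta> by simp
qed

lemma mdot_AB: "\<alpha> \<in> A \<Longrightarrow> \<beta> \<in> B \<Longrightarrow> mdot \<alpha> \<kappa> + mdot \<beta> \<kappa> = m"
  using hom by (simp add: mdot_def add_mult_distrib sum.distrib)

lemma block:
  fixes q :: "('n \<Rightarrow> real) \<Rightarrow> complex" and CB CT CK Kc Bb Aq Q C' :: real
  assumes CB: "0 \<le> CB" "\<And>H \<tau> \<epsilon>. inR d x T A H \<tau> \<Longrightarrow> (\<forall>z. cmod (H z) \<le> \<epsilon>) \<Longrightarrow> cmod \<tau> \<le> CB * M * \<epsilon>"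
    and CT: "0 \<le> CT" "\<And>\<beta> K \<nu> z W. \<beta> \<in> A \<union> B \<union> Sg \<Longrightarrow>
       (\<forall>i. i \<le> \<beta> \<longrightarrow> cmod (\<Sum>k\<in>K. \<nu> k * mipow (\<lambda>l. - \<i> * of_real (xik d k l)) i * ek (pi / d) k (z - x)) \<le> W)
       \<Longrightarrow> cmod (\<Sum>k\<in>K. \<nu> k * tens x (\<lambda>l. nd (\<beta> l) (ekt d k l)) z) \<le> CT * W"
    and CK: "0 \<le> CK" "\<And>\<beta> i z. \<beta> \<in> A \<union> B \<union> Sg \<Longrightarrow> i \<le> \<beta> \<Longrightarrow> (\<forall>l. \<bar>z$l\<bar> \<le> d) \<Longrightarrow>
       cmod (\<Sum>k\<in>Kset \<kappa> d j. nuq d c \<alpha> j q k * mipow (\<lambda>l. - \<i> * of_real (xik d k l)) i * ek (pi / d) k z)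
        \<le> CK * Aq * (2 ^ (j * (mdot \<alpha> \<kappa> + mdot i \<kappa>)) / 2 ^ (j * m)) * ker j z"
    and CM: "\<And>\<beta> i z. \<beta> \<in> A \<union> B \<union> Sg \<Longrightarrow> i \<le> \<beta> \<Longrightarrow> (\<forall>l. \<bar>z$l\<bar> \<le> d) \<Longrightarrow>
       cmod (\<Sum>k\<in>Kset \<kappa> d j. muq d j q k * mipow (\<lambda>l. - \<i> * of_real (xik d k l)) i * ek (pi / d) k z)
        \<le> CK * Aq * 2 ^ (j * mdot i \<kappa>) * ker j z"
    and Kc: "0 \<le> Kc" "\<And>\<sigma>. \<sigma> \<in> Sg \<Longrightarrow> cmod (coef c \<sigma>) \<le> Kc"
    and Bb: "0 \<le> Bb" "\<And>\<beta> z. \<beta> \<in> A \<union> B \<union> Sg \<Longrightarrow> cmod (tens x (\<lambda>l. nd (\<beta> l) (bfun d)) z) \<le> Bb"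
    and \<alpha>: "\<alpha> \<in> A" and Aq: "0 \<le> Aq"
  defines "Q \<equiv> CK * (1 / c1) ^ NN"
  defines "C' \<equiv> CB * (CT * Q + card Sg * (Kc * (CT * Q)) + (2 * d) ^ CARD('n) * Q * (card Sg * (Kc * Bb))) + CT * CK + (2 * d) ^ CARD('n) * Q * Bb"
  shows "ennreal (cmod (\<Sum>k\<in>Kset \<kappa> d j. muq d j q k * (LINT z:cbx x d|lebesgue. v \<alpha> z * tens x (ekt d k) z)))
    \<le> ennreal (C' * Aq * M / 4 ^ j) +
      (\<integral>\<^sup>+z. ennreal (indicator (cbx x d) z * (C' * Aq * (ker j (z - x) + 1 / 4 ^ j)) * (\<Sum>\<beta>\<in>B. cmod (g \<beta> z))) \<partial>lebesgue)"
proof -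
  let ?K = "Kset \<kappa> d j"
  let ?\<mu> = "muq d j q" and ?\<nu> = "nuq d c \<alpha> j q"
  define E where "E = Aq / 4 ^ j"
  have E: "0 \<le> E" using Aq by (simp add: E_def)
  have Q: "0 \<le> Q" using CK(1) c1 by (simp add: Q_def)
  have finK: "finite ?K" by (rule finite_Kset[OF d0])
  have w: "\<forall>l. \<bar>(z - x)$l\<bar> \<le> d" if "z \<in> cbx x d" for z using that by (simp add: cbx_def)
  have mS: "mdot i \<kappa> \<le> m" if "\<beta> \<in> A \<union> B \<union> Sg" "i \<le> \<beta>" for \<beta> i
  proof -
    have "mdot \<beta> \<kappa> \<le> m" using that(1) mdot_A mdot_AB[OF \<alpha>, of \<beta>] Sg_mdot[of \<beta>] by auto
    then show ?thesis using mdot_mono[OF that(2), of \<kappa>] by simp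
  qed
  \<comment> \<open>Outside the inner box the quasi-distance to \<open>x\<close> is at least
    \<open>c1\<close>, and there the decay order of \<open>ker\<close> beats the worst loss
    \<open>2 ^ (j * m)\<close>.\<close>
  have nu_outer: "cmod (\<Sum>k\<in>?K. ?\<nu> k * mipow (\<lambda>l. - \<i> * of_real (xik d k l)) i * ek (pi / d) k (z - x)) \<le> Q * E"
    if "\<beta> \<in> A \<union> B \<union> Sg" "i \<le> \<beta>" "z \<in> cbx x d" "d / 4 \<le> \<bar>(z - x)$l\<bar>" for \<beta> i z l
  proof -
    have "(2::real) ^ (j * (mdot \<alpha> \<kappa> + mdot i \<kappa>)) \<le> 2 ^ (j * (m + m))"
      using mdot_A[OF \<alpha>] mS[OF that(1,2)] by (intro power_increasing mult_left_mono add_mono) auto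
    also have "(2::real) ^ (j * (m + m)) = 2 ^ (j * m) * 2 ^ (j * m)" by (simp add: distrib_left power_add)
    finally have 1: "(2::real) ^ (j * (mdot \<alpha> \<kappa> + mdot i \<kappa>)) / 2 ^ (j * m) \<le> 2 ^ (j * m)"
      by (simp add: divide_le_eq)
    have "cmod (\<Sum>k\<in>?K. ?\<nu> k * mipow (\<lambda>l. - \<i> * of_real (xik d k l)) i * ek (pi / d) k (z - x))
      \<le> CK * Aq * (2 ^ (j * (mdot \<alpha> \<kappa> + mdot i \<kappa>)) / 2 ^ (j * m)) * ker j (z - x)"
      by (rule CK(2)[OF that(1,2) w[OF that(3)]])
    also have "\<dots> \<le> CK * Aq * 2 ^ (j * m) * ker j (z - x)"
      by (intro mult_right_mono mult_left_mono 1 kerc_nonneg mult_nonneg_nonneg CK(1) Aq)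
    also have "\<dots> = CK * Aq * (2 ^ (j * m) * ker j (z - x))" by simp
    also have "\<dots> \<le> CK * Aq * ((1 / c1) ^ NN / 4 ^ j)"
      by (intro mult_left_mono ker_outer[OF that(4)] mult_nonneg_nonneg CK(1) Aq)
    finally show ?thesis by (simp add: Q_def E_def mult_ac)
  qed
  have mu_outer: "cmod (\<Sum>k\<in>?K. ?\<mu> k * mipow (\<lambda>l. - \<i> * of_real (xik d k l)) i * ek (pi / d) k (z - x)) \<le> Q * E"
    if "\<beta> \<in> A \<union> B \<union> Sg" "i \<le> \<beta>" "z \<in> cbx x d" "d / 4 \<le> \<bar>(z - x)$l\<bar>" for \<beta> i z l
  proof -
    have 1: "(2::real) ^ (j * mdot i \<kappa>) \<le> 2 ^ (j * m)"
      using mS[OF that(1,2)] by (intro power_increasing mult_left_mono) auto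
    have "cmod (\<Sum>k\<in>?K. ?\<mu> k * mipow (\<lambda>l. - \<i> * of_real (xik d k l)) i * ek (pi / d) k (z - x))
      \<le> CK * Aq * 2 ^ (j * mdot i \<kappa>) * ker j (z - x)"
      by (rule CM[OF that(1,2) w[OF that(3)]])
    also have "\<dots> \<le> CK * Aq * 2 ^ (j * m) * ker j (z - x)"
      by (intro mult_right_mono mult_left_mono 1 kerc_nonneg mult_nonneg_nonneg CK(1) Aq)
    also have "\<dots> = CK * Aq * (2 ^ (j * m) * ker j (z - x))" by simp
    also have "\<dots> \<le> CK * Aq * ((1 / c1) ^ NN / 4 ^ j)"
      by (intro mult_left_mono ker_outer[OF that(4)] mult_nonneg_nonneg CK(1) Aq)
    finally show ?thesis by (simp add: Q_def E_def mult_ac)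
  qed
  have nu_all: "cmod (\<Sum>k\<in>?K. ?\<nu> k * tens x (\<lambda>l. nd (\<beta> l) (ekt d k l)) z) \<le> CT * (CK * Aq * ker j (z - x))"
    if \<beta>: "\<beta> \<in> B" and z: "z \<in> cbx x d" for \<beta> z
  proof (rule CT(2))
    show "\<forall>i. i \<le> \<beta> \<longrightarrow> cmod (\<Sum>k\<in>?K. ?\<nu> k * mipow (\<lambda>l. - \<i> * of_real (xik d k l)) i * ek (pi / d) k (z - x)) \<le> CK * Aq * ker j (z - x)"
    proof (intro allI impI)
      fix i assume i: "i \<le> \<beta>"
      have "mdot \<alpha> \<kappa> + mdot i \<kappa> \<le> m" using mdot_mono[OF i, of \<kappa>] mdot_AB[OF \<alpha> \<beta>] by simp
      then have "(2::real) ^ (j * (mdot \<alpha> \<kappa> + mdot i \<kappa>)) \<le> 2 ^ (j * m)" by (intro power_increasing mult_left_mono) auto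
      then have 1: "(2::real) ^ (j * (mdot \<alpha> \<kappa> + mdot i \<kappa>)) / 2 ^ (j * m) \<le> 1" by (simp add: divide_le_eq)
      have "cmod (\<Sum>k\<in>?K. ?\<nu> k * mipow (\<lambda>l. - \<i> * of_real (xik d k l)) i * ek (pi / d) k (z - x))
        \<le> CK * Aq * (2 ^ (j * (mdot \<alpha> \<kappa> + mdot i \<kappa>)) / 2 ^ (j * m)) * ker j (z - x)"
        by (rule CK(2)[OF _ i w[OF z]]) (use \<beta> in blast)
      also have "\<dots> \<le> CK * Aq * 1 * ker j (z - x)"
        by (intro mult_right_mono mult_left_mono 1 kerc_nonneg mult_nonneg_nonneg CK(1) Aq)
      finally show "cmod (\<Sum>k\<in>?K. ?\<nu> k * mipow (\<lambda>l. - \<i> * of_real (xik d k l)) i * ek (pi / d) k (z - x)) \<le> CK * Aq * ker j (z - x)" by simp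
    qed
  qed (use \<beta> in blast)
  have inner_or: "(\<forall>l. \<bar>z$l - x$l\<bar> < d / 4) \<or> (\<exists>l. d / 4 \<le> \<bar>(z - x)$l\<bar>)" for z
    by (auto simp: not_less) 
  \<comment> \<open>The multiple \<open>\<theta>0\<close> of the bump is subtracted from the test function to make its integral vanish;
    this removes the constants \<open>f \<beta> x\<close> also when \<open>\<beta> = 0\<close>.\<close>
  define \<theta>0 where "\<theta>0 = (\<Sum>k\<in>?K. ?\<nu> k * (LINT z:cbx x d|lebesgue. tens x (ekt d k) z))"
  have zero_in: "\<exists>\<beta>. \<beta> \<in> A \<union> B \<union> Sg \<and> (\<lambda>l. 0) \<le> \<beta>" using \<alpha> by (intro exI[of _ \<alpha>]) (auto simp: le_fun_def)
  have ekt_int: "set_integrable lebesgue (cbx x d) (tens x (ekt d k))" for k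
    by (intro set_integrable_cbx_continuous continuous_on_tens smooth1_continuous_on0 test1_smooth1[OF ekt_test1[OF d0]])
  \<comment> \<open>Only the zero frequency has nonzero mean, and there \<open>chin\<close>
    vanishes. Hence \<theta>0 comes entirely from the region where the cutoff is not 1, which makes
    it of size \<open>Aq / 4 ^ j\<close>.\<close>
  have nu_mean: "(\<Sum>k\<in>?K. ?\<nu> k * (LINT z:cbx x d|lebesgue. ek (pi / d) k (z - x))) = 0"
  proof (rule sum.neutral, rule ballI)
    fix k
    show "?\<nu> k * (LINT z:cbx x d|lebesgue. ek (pi / d) k (z - x)) = 0"
    proof (cases "k = (\<lambda>l. 0)")
      case True
      then have "etak \<kappa> (pi / d) j k = (\<lambda>l. 0)" by (simp add: etak_def fun_eq_iff)
      then show ?thesis by (simp add: nuq_def muq_def chin_0)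
    qed (simp add: LINT_ek[OF d0])
  qed
  have \<theta>0: "cmod \<theta>0 \<le> Q * E * (2 * d) ^ CARD('n)"
  proof -
    have "\<theta>0 = \<theta>0 - (\<Sum>k\<in>?K. ?\<nu> k * (LINT z:cbx x d|lebesgue. ek (pi / d) k (z - x)))" unfolding nu_mean by simp
    also have "\<dots> = (LINT z:cbx x d|lebesgue. \<Sum>k\<in>?K. ?\<nu> k * tens x (ekt d k) z) - (LINT z:cbx x d|lebesgue. \<Sum>k\<in>?K. ?\<nu> k * ek (pi / d) k (z - x))"
      unfolding \<theta>0_def set_integral_sum_mult[OF ekt_int] set_integral_sum_mult[OF set_integrable_ek] ..
    also have "\<dots> = (LINT z:cbx x d|lebesgue. (\<Sum>k\<in>?K. ?\<nu> k * tens x (ekt d k) z) - (\<Sum>k\<in>?K. ?\<nu> k * ek (pi / d) k (z - x)))"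
      by (rule set_integral_diff(2)[symmetric]; intro sum_int set_integrable_mult_right ekt_int set_integrable_ek)
    also have "cmod \<dots> \<le> Q * E * (2 * d) ^ CARD('n)"
    proof (rule set_integral_cbx_bound)
      fix z assume z: "z \<in> cbx x d"
      define S where "S = (\<Sum>k\<in>?K. ?\<nu> k * ek (pi / d) k (z - x))"
      define r where "r l = phi1 (4 / d * (z$l - x$l))" for l
      have r: "0 \<le> r l" "r l \<le> 1" "zet d (z$l - x$l) = of_real (r l)" for l
        using phi1(2,3) by (auto simp: r_def zet_def)
      have tk: "tens x (ekt d k) z = of_real (\<Prod>l\<in>UNIV. r l) * ek (pi / d) k (z - x)" for k
        by (simp add: tens_def ekt_def ek_def prod.distrib r(3) mult.commute)
      have "(\<Sum>k\<in>?K. ?\<nu> k * tens x (ekt d k) z) = of_real (\<Prod>l\<in>UNIV. r l) * S"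
        unfolding S_def sum_distrib_left tk by (intro sum.cong refl) (simp only: mult.left_commute)
      then have eq: "(\<Sum>k\<in>?K. ?\<nu> k * tens x (ekt d k) z) - S = of_real ((\<Prod>l\<in>UNIV. r l) - 1) * S"
        by (simp add: left_diff_distrib)
      have p: "0 \<le> (\<Prod>l\<in>UNIV. r l)" "(\<Prod>l\<in>UNIV. r l) \<le> 1" using r by (auto intro!: prod_nonneg prod_le_1)
      show "cmod ((\<Sum>k\<in>?K. ?\<nu> k * tens x (ekt d k) z) - (\<Sum>k\<in>?K. ?\<nu> k * ek (pi / d) k (z - x))) \<le> Q * E"
        using inner_or[of z]
      proof
        assume "\<forall>l. \<bar>z$l - x$l\<bar> < d / 4"
        then have "zet d (z$l - x$l) = 1" for l using zet_one[OF d0] by (meson less_imp_le)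
        then have "r l = 1" for l using r(3)[of l] by simp
        then show ?thesis using eq Q E unfolding S_def by simp
      next
        assume "\<exists>l. d / 4 \<le> \<bar>(z - x)$l\<bar>"
        then obtain l where l: "d / 4 \<le> \<bar>(z - x)$l\<bar>" by blast
        obtain \<beta> where \<beta>: "\<beta> \<in> A \<union> B \<union> Sg" "(\<lambda>l. 0) \<le> \<beta>" using zero_in by blast
        have "cmod S \<le> Q * E" using nu_outer[OF \<beta> z l] by (simp add: S_def mipow_def)
        moreover have "cmod (of_real ((\<Prod>l\<in>UNIV. r l) - 1) * S) \<le> 1 * cmod S"
          unfolding norm_mult norm_of_real by (rule mult_right_mono) (use p in auto)
        ultimately show ?thesis using eq unfolding S_def by simp
      qed
    qed (use d0 in simp)
    finally show ?thesis .
  qed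
  \<comment> \<open>The index \<open>None\<close> stands for the bump with weight
    \<open>- \<theta>0\<close>, the index \<open>Some k\<close> for the exponential of frequency k,
    so that the corrected test function is one finite sum.\<close>
  define F' where "F' = insert None (Some ` ?K)"
  define ww where "ww i = (case i of None \<Rightarrow> - \<theta>0 | Some k \<Rightarrow> ?\<nu> k)" for i
  define hh where "hh i l = (case i of None \<Rightarrow> bfun d | Some k \<Rightarrow> ekt d k l)" for i and l :: 'n
  have finF: "finite F'" using finK by (simp add: F'_def)
  have hh_test: "hh i l \<in> test1 d" for i l
    using ekt_test1[OF d0] box.b by (cases i) (auto simp: hh_def)
  have sumF: "(\<Sum>i\<in>F'. ww i * G (hh i)) = (\<Sum>k\<in>?K. ?\<nu> k * G (ekt d k)) - \<theta>0 * G (\<lambda>l. bfun d)" for G :: "('n \<Rightarrow> real \<Rightarrow> complex) \<Rightarrow> complex"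
  proof -
    have hs: "hh (Some k) = ekt d k" "hh None = (\<lambda>l. bfun d)" for k by (auto simp: hh_def fun_eq_iff)
    have "(\<Sum>i\<in>Some ` ?K. ww i * G (hh i)) = (\<Sum>k\<in>?K. ?\<nu> k * G (ekt d k))"
      by (subst sum.reindex) (auto simp: ww_def hs)
    moreover have "(\<Sum>i\<in>F'. ww i * G (hh i)) = ww None * G (hh None) + (\<Sum>i\<in>Some ` ?K. ww i * G (hh i))"
      unfolding F'_def using finK by (subst sum.insert) auto
    ultimately show ?thesis by (simp add: ww_def hs)
  qed
  define Z where "Z = (\<Sum>k\<in>?K. ?\<mu> k * (LINT z:cbx x d|lebesgue. v \<alpha> z * tens x (ekt d k) z))"
  define L where "L = (\<Sum>i\<in>F'. ww i * (\<Sum>\<sigma>\<in>Sg. coef c \<sigma> * ((-1) ^ mlen \<sigma> * T (tens x (\<lambda>l. nd (\<sigma> l) (hh i l))))))"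
  \<comment> \<open>The test function behind \<open>Z - L\<close>. Each term is differentiated at
    least as often as an index of \<open>A\<close>: \<alpha> itself, or the first summand of an
    element of \<open>Sg\<close>.\<close>
  define H where "H z = (\<Sum>k\<in>?K. (?\<mu> k * (-1) ^ mlen \<alpha>) * tens x (\<lambda>l. nd (\<alpha> l) (ekt d k l)) z)
     + (\<Sum>i\<in>F'. \<Sum>\<sigma>\<in>Sg. (- ww i * coef c \<sigma> * (-1) ^ mlen \<sigma>) * tens x (\<lambda>l. nd (\<sigma> l) (hh i l)) z)" for z
  have ZT: "Z = (\<Sum>k\<in>?K. (?\<mu> k * (-1) ^ mlen \<alpha>) * T (tens x (\<lambda>l. nd (\<alpha> l) (ekt d k l))))"
  proof -
    have "(-1) ^ mlen \<alpha> * T (tens x (\<lambda>l. nd (\<alpha> l) (ekt d k l))) = (LINT z:cbx x d|lebesgue. v \<alpha> z * tens x (ekt d k) z)" for k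
      using box.T_Dm[OF \<alpha>, of "ekt d k", OF ekt_test1[OF d0]]
      by (simp add: mult.assoc[symmetric] power_mult_distrib[symmetric])
    then show ?thesis by (simp add: Z_def mult.assoc)
  qed
  have Sg_A: "\<exists>a\<in>A. a \<le> \<sigma>" if "\<sigma> \<in> Sg" for \<sigma>
  proof -
    obtain a b where "\<sigma> = (\<lambda>l. a l + b l)" "a \<in> A" using \<open>\<sigma> \<in> Sg\<close> by (auto simp: Sg_def)
    then show ?thesis by (intro bexI[of _ a]) (auto simp: le_fun_def)
  qed
  have inR: "inR d x T A H (Z - L)"
  proof -
    have "inR d x T A H ((\<Sum>k\<in>?K. (?\<mu> k * (-1) ^ mlen \<alpha>) * T (tens x (\<lambda>l. nd (\<alpha> l) (ekt d k l))))
      + (\<Sum>i\<in>F'. \<Sum>\<sigma>\<in>Sg. (- ww i * coef c \<sigma> * (-1) ^ mlen \<sigma>) * T (tens x (\<lambda>l. nd (\<sigma> l) (hh i l)))))"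
      unfolding H_def
    proof (intro inR_add inR_sum finK finF finSg)
      show "inR d x T A (\<lambda>z. (?\<mu> k * (-1) ^ mlen \<alpha>) * tens x (\<lambda>l. nd (\<alpha> l) (ekt d k l)) z)
        ((?\<mu> k * (-1) ^ mlen \<alpha>) * T (tens x (\<lambda>l. nd (\<alpha> l) (ekt d k l))))" for k
        by (rule inR_tens[OF ekt_test1[OF d0] \<alpha>]) simp
      fix i \<sigma> assume "\<sigma> \<in> Sg"
      then obtain a where a: "a \<in> A" "a \<le> \<sigma>" using Sg_A by blast
      show "inR d x T A (\<lambda>z. (- ww i * coef c \<sigma> * (-1) ^ mlen \<sigma>) * tens x (\<lambda>l. nd (\<sigma> l) (hh i l)) z)
        ((- ww i * coef c \<sigma> * (-1) ^ mlen \<sigma>) * T (tens x (\<lambda>l. nd (\<sigma> l) (hh i l))))"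
        by (rule inR_tens[OF hh_test a])
    qed
    moreover have "(\<Sum>i\<in>F'. \<Sum>\<sigma>\<in>Sg. (- ww i * coef c \<sigma> * (-1) ^ mlen \<sigma>) * T (tens x (\<lambda>l. nd (\<sigma> l) (hh i l)))) = - L"
      by (simp add: L_def sum_negf sum_distrib_left mult.assoc)
    ultimately show ?thesis using ZT by simp
  qed
  have H_eq: "H z = (\<Sum>k\<in>?K. (?\<mu> k * (-1) ^ mlen \<alpha>) * tens x (\<lambda>l. nd (\<alpha> l) (ekt d k l)) z)
     - (\<Sum>\<sigma>\<in>Sg. (coef c \<sigma> * (-1) ^ mlen \<sigma>) * (\<Sum>k\<in>?K. ?\<nu> k * tens x (\<lambda>l. nd (\<sigma> l) (ekt d k l)) z))
     + \<theta>0 * (\<Sum>\<sigma>\<in>Sg. (coef c \<sigma> * (-1) ^ mlen \<sigma>) * tens x (\<lambda>l. nd (\<sigma> l) (bfun d)) z)" for z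
  proof -
    have "(\<Sum>i\<in>F'. \<Sum>\<sigma>\<in>Sg. (- ww i * coef c \<sigma> * (-1) ^ mlen \<sigma>) * tens x (\<lambda>l. nd (\<sigma> l) (hh i l)) z)
      = - (\<Sum>i\<in>F'. ww i * (\<Sum>\<sigma>\<in>Sg. (coef c \<sigma> * (-1) ^ mlen \<sigma>) * tens x (\<lambda>l. nd (\<sigma> l) (hh i l)) z))"
      by (simp add: sum_negf sum_distrib_left mult.assoc)
    also have "\<dots> = - ((\<Sum>k\<in>?K. ?\<nu> k * (\<Sum>\<sigma>\<in>Sg. (coef c \<sigma> * (-1) ^ mlen \<sigma>) * tens x (\<lambda>l. nd (\<sigma> l) (ekt d k l)) z))
       - \<theta>0 * (\<Sum>\<sigma>\<in>Sg. (coef c \<sigma> * (-1) ^ mlen \<sigma>) * tens x (\<lambda>l. nd (\<sigma> l) (bfun d)) z))"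
      by (rule arg_cong[where f = uminus], rule sumF[where G = "\<lambda>h. \<Sum>\<sigma>\<in>Sg. (coef c \<sigma> * (-1) ^ mlen \<sigma>) * tens x (\<lambda>l. nd (\<sigma> l) (h l)) z"])
    also have "(\<Sum>k\<in>?K. ?\<nu> k * (\<Sum>\<sigma>\<in>Sg. (coef c \<sigma> * (-1) ^ mlen \<sigma>) * tens x (\<lambda>l. nd (\<sigma> l) (ekt d k l)) z))
       = (\<Sum>\<sigma>\<in>Sg. (coef c \<sigma> * (-1) ^ mlen \<sigma>) * (\<Sum>k\<in>?K. ?\<nu> k * tens x (\<lambda>l. nd (\<sigma> l) (ekt d k l)) z))"
      unfolding sum_distrib_left by (subst sum.swap) (simp only: mult.left_commute)
    finally show ?thesis unfolding H_def by simp
  qed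
  define CH where "CH = CT * Q + card Sg * (Kc * (CT * Q)) + (2 * d) ^ CARD('n) * Q * (card Sg * (Kc * Bb))"
  have CH: "0 \<le> CH" unfolding CH_def using CT(1) Q Kc(1) Bb(1) d0 by (intro add_nonneg_nonneg mult_nonneg_nonneg) auto
  have b_part: "cmod (\<theta>0 * (\<Sum>\<sigma>\<in>Sg. (coef c \<sigma> * (-1) ^ mlen \<sigma>) * tens x (\<lambda>l. nd (\<sigma> l) (bfun d)) z))
     \<le> (2 * d) ^ CARD('n) * Q * (card Sg * (Kc * Bb)) * E" for z
  proof -
    have "cmod (\<Sum>\<sigma>\<in>Sg. (coef c \<sigma> * (-1) ^ mlen \<sigma>) * tens x (\<lambda>l. nd (\<sigma> l) (bfun d)) z) \<le> of_nat (card Sg) * (Kc * Bb)"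
      by (rule sum_norm_bound) (auto simp: norm_mult norm_power intro!: mult_mono Kc Bb)
    then have "cmod (\<theta>0 * (\<Sum>\<sigma>\<in>Sg. (coef c \<sigma> * (-1) ^ mlen \<sigma>) * tens x (\<lambda>l. nd (\<sigma> l) (bfun d)) z))
      \<le> (Q * E * (2 * d) ^ CARD('n)) * (card Sg * (Kc * Bb))"
      unfolding norm_mult using \<theta>0 Q E d0 by (intro mult_mono) auto
    then show ?thesis by (simp add: mult_ac)
  qed
  have H_bound: "cmod (H z) \<le> CH * E" for z
  proof (cases "z \<in> cbx x d")
    case False
    then have t0: "tens x (\<lambda>l. nd (\<beta> l) (ekt d k l)) z = 0" "tens x (\<lambda>l. nd (\<beta> l) (bfun d)) z = 0" for k \<beta>
      by (auto intro!: tens_zero_outside[of _ d] test1_nd ekt_test1 d0 box.b)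
    show ?thesis unfolding H_eq t0 using CH E by simp
  next
    case z: True
    define X1 where "X1 = (\<Sum>k\<in>?K. (?\<mu> k * (-1) ^ mlen \<alpha>) * tens x (\<lambda>l. nd (\<alpha> l) (ekt d k l)) z)"
    define X2 where "X2 = (\<Sum>\<sigma>\<in>Sg. (coef c \<sigma> * (-1) ^ mlen \<sigma>) * (\<Sum>k\<in>?K. ?\<nu> k * tens x (\<lambda>l. nd (\<sigma> l) (ekt d k l)) z))"
    have "cmod (X1 - X2) \<le> (CT * Q + card Sg * (Kc * (CT * Q))) * E"
      using inner_or[of z]
    proof
      \<comment> \<open>On the inner box each derivative of a localized exponential is
        multiplication by a monomial in the frequency, so \<open>nuq_psym\<close> makes
        \<open>X1\<close> and \<open>X2\<close> equal.\<close>
      assume inn: "\<forall>l. \<bar>z$l - x$l\<bar> < d / 4"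
      have ti: "(-1) ^ mlen \<beta> * tens x (\<lambda>l. nd (\<beta> l) (ekt d k l)) z = mipow (\<lambda>l. \<i> * of_real (xik d k l)) \<beta> * ek (pi / d) k (z - x)" for \<beta> k
      proof -
        have "mipow (\<lambda>l. - \<i> * of_real (xik d k l)) \<beta> = (-1) ^ mlen \<beta> * mipow (\<lambda>l. \<i> * of_real (xik d k l)) \<beta>"
          using mipow_uminus[of "\<lambda>l. \<i> * of_real (xik d k l)" \<beta>] by simp
        then show ?thesis
          using tens_nd_ekt_inner[OF d0, of z x \<beta> k] inn by (simp add: mult.assoc[symmetric] power_mult_distrib[symmetric])
      qed
      have "X1 = (\<Sum>k\<in>?K. ?\<mu> k * ((-1) ^ mlen \<alpha> * tens x (\<lambda>l. nd (\<alpha> l) (ekt d k l)) z))"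
        by (simp add: X1_def mult.assoc)
      then have 1: "X1 = (\<Sum>k\<in>?K. ?\<mu> k * mipow (\<lambda>l. \<i> * of_real (xik d k l)) \<alpha> * ek (pi / d) k (z - x))"
        unfolding ti by (simp only: mult.assoc)
      have "X2 = (\<Sum>\<sigma>\<in>Sg. \<Sum>k\<in>?K. ?\<nu> k * (coef c \<sigma> * ((-1) ^ mlen \<sigma> * tens x (\<lambda>l. nd (\<sigma> l) (ekt d k l)) z)))"
        unfolding X2_def sum_distrib_left by (simp only: mult.assoc mult.left_commute)
      also have "\<dots> = (\<Sum>k\<in>?K. \<Sum>\<sigma>\<in>Sg. ?\<nu> k * (coef c \<sigma> * (mipow (\<lambda>l. \<i> * of_real (xik d k l)) \<sigma> * ek (pi / d) k (z - x))))"
        unfolding ti by (rule sum.swap)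
      also have "\<dots> = (\<Sum>k\<in>?K. ?\<nu> k * psym A B c (xik d k) * ek (pi / d) k (z - x))"
        unfolding psym_coef by (simp add: sum_distrib_left sum_distrib_right mult.assoc)
      finally have "X1 = X2" unfolding 1 nuq_psym[OF ell_c] by simp
      then show ?thesis using CT(1) Q Kc(1) E by (auto intro!: mult_nonneg_nonneg add_nonneg_nonneg)
    next
      assume "\<exists>l. d / 4 \<le> \<bar>(z - x)$l\<bar>"
      then obtain l where l: "d / 4 \<le> \<bar>(z - x)$l\<bar>" by blast
      have "X1 = (-1) ^ mlen \<alpha> * (\<Sum>k\<in>?K. ?\<mu> k * tens x (\<lambda>l. nd (\<alpha> l) (ekt d k l)) z)"
        by (simp add: X1_def sum_distrib_left mult.assoc mult.left_commute)
      moreover have "cmod (\<Sum>k\<in>?K. ?\<mu> k * tens x (\<lambda>l. nd (\<alpha> l) (ekt d k l)) z) \<le> CT * (Q * E)"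
        by (rule CT(2)) (use \<alpha> mu_outer[of \<alpha>, OF _ _ z l] in auto)
      ultimately have 1: "cmod X1 \<le> CT * (Q * E)" by (simp add: norm_mult norm_power)
      have "cmod X2 \<le> of_nat (card Sg) * (Kc * (CT * (Q * E)))"
        unfolding X2_def
      proof (rule sum_norm_bound)
        fix \<sigma> assume \<sigma>: "\<sigma> \<in> Sg"
        have "cmod (\<Sum>k\<in>?K. ?\<nu> k * tens x (\<lambda>l. nd (\<sigma> l) (ekt d k l)) z) \<le> CT * (Q * E)"
          by (rule CT(2)) (use \<sigma> nu_outer[of \<sigma>, OF _ _ z l] in auto)
        then show "cmod ((coef c \<sigma> * (-1) ^ mlen \<sigma>) * (\<Sum>k\<in>?K. ?\<nu> k * tens x (\<lambda>l. nd (\<sigma> l) (ekt d k l)) z)) \<le> Kc * (CT * (Q * E))"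
          using Kc(1) Kc(2)[OF \<sigma>] by (auto simp: norm_mult norm_power intro!: mult_mono)
      qed
      then show ?thesis using 1 norm_triangle_ineq4[of X1 X2] by (simp add: algebra_simps)
    qed
    then show ?thesis
      using b_part[of z] norm_triangle_ineq[of "X1 - X2" "\<theta>0 * (\<Sum>\<sigma>\<in>Sg. (coef c \<sigma> * (-1) ^ mlen \<sigma>) * tens x (\<lambda>l. nd (\<sigma> l) (bfun d)) z)"]
      unfolding H_eq X1_def[symmetric] X2_def[symmetric] CH_def by (simp add: algebra_simps)
  qed
  have ZL: "cmod (Z - L) \<le> CB * M * (CH * E)" by (rule CB(2)[OF inR]) (use H_bound in blast)
  define Phi where "Phi \<beta> z = (\<Sum>i\<in>F'. ww i * tens x (\<lambda>l. nd (\<beta> l) (hh i l)) z)" for \<beta> z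
  have LINT_b: "(LINT z:cbx x d|lebesgue. tens x (\<lambda>l. bfun d) z) = 1"
    by (subst lborel_set_integral_cbx_prod) (auto intro!: smooth1_continuous_on0 test1_smooth1[OF box.b] simp: box.int_b)
  \<comment> \<open>For \<beta> = 0 this is the choice of \<theta>0, the bump having integral 1; for
    any other \<beta> a derivative has mean zero.\<close>
  have zero: "(\<Sum>i\<in>F'. ww i * (LINT z:cbx x d|lebesgue. tens x (\<lambda>l. nd (\<beta> l) (hh i l)) z)) = 0" for \<beta>
  proof (cases "\<beta> = (\<lambda>l. 0)")
    case True
    have "(\<Sum>i\<in>F'. ww i * (LINT z:cbx x d|lebesgue. tens x (hh i) z)) = \<theta>0 - \<theta>0 * 1"
      unfolding sumF[where G = "\<lambda>h. LINT z:cbx x d|lebesgue. tens x h z"] LINT_b \<theta>0_def ..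
    then show ?thesis using True by simp
  next
    case False
    then obtain l where l: "0 < \<beta> l" by auto
    have "(LINT z:cbx x d|lebesgue. tens x (\<lambda>l. nd (\<beta> l) (hh i l)) z) = 0" for i
    proof -
      have "(LINT z:cbx x d|lebesgue. tens x (\<lambda>l. nd (\<beta> l) (hh i l)) z) = (\<Prod>l\<in>UNIV. integral {-d..d} (nd (\<beta> l) (hh i l)))"
        by (rule lborel_set_integral_cbx_prod) (intro smooth1_continuous_on test1_smooth1[OF hh_test])
      also have "\<dots> = 0"
        by (rule prod_zero) (use integral_nd_zero[OF hh_test[of i l] l] d0 in \<open>auto intro!: bexI[of _ l]\<close>)
      finally show ?thesis .
    qed
    then show ?thesis by simp
  qed
  have Leq: "L = (\<Sum>\<beta>\<in>B. (-1) ^ mlen \<beta> * (LINT z:cbx x d|lebesgue. g \<beta> z * Phi \<beta> z))"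
    unfolding L_def Phi_def EQ_sum[OF finF hh_test] zero by simp
  define CP where "CP = CT * CK + (2 * d) ^ CARD('n) * Q * Bb"
  have CP: "0 \<le> CP" unfolding CP_def using CT(1) CK(1) Q Bb(1) d0 by (intro add_nonneg_nonneg mult_nonneg_nonneg) auto
  have Phi_bound: "cmod (Phi \<beta> z) \<le> CP * Aq * (ker j (z - x) + 1 / 4 ^ j)" if \<beta>: "\<beta> \<in> B" and z: "z \<in> cbx x d" for \<beta> z
  proof -
    have "Phi \<beta> z = (\<Sum>k\<in>?K. ?\<nu> k * tens x (\<lambda>l. nd (\<beta> l) (ekt d k l)) z) - \<theta>0 * tens x (\<lambda>l. nd (\<beta> l) (bfun d)) z"
      unfolding Phi_def by (rule sumF[where G = "\<lambda>h. tens x (\<lambda>l. nd (\<beta> l) (h l)) z"])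
    also have "cmod \<dots> \<le> CT * (CK * Aq * ker j (z - x)) + (Q * E * (2 * d) ^ CARD('n)) * Bb"
    proof (intro order_trans[OF norm_triangle_ineq4] add_mono nu_all[OF \<beta> z])
      show "cmod (\<theta>0 * tens x (\<lambda>l. nd (\<beta> l) (bfun d)) z) \<le> (Q * E * (2 * d) ^ CARD('n)) * Bb"
        unfolding norm_mult using \<theta>0 Bb Q E d0 \<beta> by (intro mult_mono) auto
    qed
    also have "\<dots> = (CT * CK) * (Aq * ker j (z - x)) + ((2 * d) ^ CARD('n) * Q * Bb) * E" by (simp add: mult_ac)
    also have "\<dots> \<le> CP * (Aq * ker j (z - x)) + CP * E"
    proof (intro add_mono mult_right_mono)
      show "CT * CK \<le> CP" "(2 * d) ^ CARD('n) * Q * Bb \<le> CP" 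
        unfolding CP_def using CT(1) CK(1) Q Bb(1) d0 by auto
    qed (use Aq E kerc_nonneg[of \<kappa> m j "z - x"] in auto)
    also have "\<dots> = CP * Aq * (ker j (z - x) + 1 / 4 ^ j)" by (simp add: E_def algebra_simps)
    finally show ?thesis .
  qed
  have C': "C' = CB * CH + CP" unfolding C'_def CH_def CP_def by simp
  have "ennreal (cmod L) \<le> (\<integral>\<^sup>+z. ennreal (indicator (cbx x d) z * (C' * Aq * (ker j (z - x) + 1 / 4 ^ j)) * (\<Sum>\<beta>\<in>B. cmod (g \<beta> z))) \<partial>lebesgue)"
  proof -
    have Phic: "continuous_on UNIV (Phi \<beta>)" for \<beta>
      unfolding Phi_def[abs_def]
      by (intro continuous_on_sum continuous_on_mult continuous_on_const continuous_on_tens smooth1_continuous_on test1_smooth1[OF hh_test])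
    have gP: "integrable lebesgue (\<lambda>z. indicator (cbx x d) z *\<^sub>R (g \<beta> z * Phi \<beta> z))" if "\<beta> \<in> B" for \<beta>
      using set_integrable_mult_tens[OF g_int[OF that] Phic] by (simp add: set_integrable_def)
    have "(\<integral>z. (\<Sum>\<beta>\<in>B. (-1) ^ mlen \<beta> * (indicator (cbx x d) z *\<^sub>R (g \<beta> z * Phi \<beta> z))) \<partial>lebesgue)
      = (\<Sum>\<beta>\<in>B. (\<integral>z. (-1) ^ mlen \<beta> * (indicator (cbx x d) z *\<^sub>R (g \<beta> z * Phi \<beta> z)) \<partial>lebesgue))"
      by (rule Bochner_Integration.integral_sum) (intro integrable_mult_right gP)
    also have "\<dots> = L"
      unfolding Leq set_lebesgue_integral_def by (intro sum.cong refl integral_mult_right_zero)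
    finally have "L = (\<integral>z. (\<Sum>\<beta>\<in>B. (-1) ^ mlen \<beta> * (indicator (cbx x d) z *\<^sub>R (g \<beta> z * Phi \<beta> z))) \<partial>lebesgue)" ..
    also have "ennreal (cmod \<dots>) \<le> (\<integral>\<^sup>+z. ennreal (cmod (\<Sum>\<beta>\<in>B. (-1) ^ mlen \<beta> * (indicator (cbx x d) z *\<^sub>R (g \<beta> z * Phi \<beta> z)))) \<partial>lebesgue)"
      by (rule integral_norm_bound_ennreal) (intro Bochner_Integration.integrable_sum integrable_mult_right gP)
    also have "\<dots> \<le> (\<integral>\<^sup>+z. ennreal (indicator (cbx x d) z * (C' * Aq * (ker j (z - x) + 1 / 4 ^ j)) * (\<Sum>\<beta>\<in>B. cmod (g \<beta> z))) \<partial>lebesgue)"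
    proof (intro nn_integral_mono ennreal_leI)
      fix z
      show "cmod (\<Sum>\<beta>\<in>B. (-1) ^ mlen \<beta> * (indicator (cbx x d) z *\<^sub>R (g \<beta> z * Phi \<beta> z)))
        \<le> indicator (cbx x d) z * (C' * Aq * (ker j (z - x) + 1 / 4 ^ j)) * (\<Sum>\<beta>\<in>B. cmod (g \<beta> z))"
      proof (cases "z \<in> cbx x d")
        case z: True
        have "cmod (\<Sum>\<beta>\<in>B. (-1) ^ mlen \<beta> * (g \<beta> z * Phi \<beta> z)) \<le> (\<Sum>\<beta>\<in>B. (C' * Aq * (ker j (z - x) + 1 / 4 ^ j)) * cmod (g \<beta> z))"
        proof (rule sum_norm_le)
          fix \<beta> assume \<beta>: "\<beta> \<in> B"
          have "cmod (Phi \<beta> z) \<le> CP * Aq * (ker j (z - x) + 1 / 4 ^ j)" by (rule Phi_bound[OF \<beta> z])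
          also have "\<dots> \<le> C' * Aq * (ker j (z - x) + 1 / 4 ^ j)"
            unfolding C' using CB(1) CH Aq kerc_nonneg[of \<kappa> m j "z - x"] by (intro mult_right_mono) auto
          finally have "cmod (g \<beta> z) * cmod (Phi \<beta> z) \<le> cmod (g \<beta> z) * (C' * Aq * (ker j (z - x) + 1 / 4 ^ j))"
            by (rule mult_left_mono) simp
          then show "cmod ((-1) ^ mlen \<beta> * (g \<beta> z * Phi \<beta> z)) \<le> (C' * Aq * (ker j (z - x) + 1 / 4 ^ j)) * cmod (g \<beta> z)"
            by (simp add: norm_mult norm_power mult.commute)
        qed
        then show ?thesis using z by (simp add: sum_distrib_left)
      qed simp
    qed
    finally show ?thesis .
  qed
  moreover have "ennreal (cmod (Z - L)) \<le> ennreal (C' * Aq * M / 4 ^ j)"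
  proof (rule ennreal_leI)
    have "CB * M * (CH * E) = (CB * CH) * (M * E)" by simp
    also have "\<dots> \<le> C' * (M * E)" unfolding C' using CP box.M E by (intro mult_right_mono) auto
    finally show "cmod (Z - L) \<le> C' * Aq * M / 4 ^ j" using ZL by (simp add: E_def mult_ac)
  qed
  moreover have "ennreal (cmod Z) \<le> ennreal (cmod (Z - L)) + ennreal (cmod L)"
    using norm_triangle_ineq[of "Z - L" L] by (simp add: ennreal_plus[symmetric] ennreal_leI del: ennreal_plus)
  ultimately show ?thesis unfolding Z_def[symmetric] by (meson add_mono order_trans)
qed

end

lemma finite_uniform_const:
  assumes "finite S" "\<And>s. s \<in> S \<Longrightarrow> \<exists>C\<ge>(0::real). P C s" "\<And>C D s. P C s \<Longrightarrow> C \<le> D \<Longrightarrow> P D s"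
  shows "\<exists>C\<ge>0. \<forall>s\<in>S. P C s"
  using assms(1,2)
proof (induction S rule: finite_induct)
  case (insert s S)
  then obtain C D where "C \<ge> 0" "\<forall>s\<in>S. P C s" "D \<ge> 0" "P D s" by (metis insertCI)
  then show ?case using assms(3) by (intro exI[of _ "C + D"]) (auto intro: assms(3)[of C _ "C + D"] assms(3)[of D _ "C + D"])
qed auto

text \<open>Collects the constants of the preceding estimates, each uniform over the data, into one
  that is fixed before the distribution, the coefficients and the point.\<close>

lemma (in symb_class) main_block:
  assumes d: "0 < d"
  shows "\<exists>C\<ge>0. \<forall>\<Omega> T v a f x M q Aq \<alpha> j. frozen \<kappa> A B m lam Lam d \<Omega> T v a f x M s \<longrightarrow> \<alpha> \<in> A \<longrightarrow> 0 \<le> Aq \<longrightarrow> Qb (NNc \<kappa> m) Aq q \<longrightarrow>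
    ennreal (cmod (\<Sum>k\<in>Kset \<kappa> d j. muq d j q k * (LINT z:cbx x d|lebesgue. v \<alpha> z * tens x (ekt d k) z)))
    \<le> ennreal (C * Aq * M / 4 ^ j) +
      (\<integral>\<^sup>+z. ennreal (indicator (cbx x d) z * (C * Aq * (kerc \<kappa> m j (z - x) + 1 / 4 ^ j)) * (\<Sum>\<beta>\<in>B. cmod (gfun A v a f x \<beta> z))) \<partial>lebesgue)"
proof -
  let ?S = "A \<union> B \<union> Sg"
  have finS: "finite ?S" using finA finB finSg by simp
  define D where "D = Max (insert 0 ((\<lambda>(\<sigma>, l). \<sigma> l) ` (?S \<times> UNIV)))"
  have D: "\<sigma> l \<le> D" if "\<sigma> \<in> ?S" for \<sigma> l
    unfolding D_def by (rule Max_ge) (use finS that in \<open>auto intro!: image_eqI[of _ _ "(\<sigma>, l)"]\<close>)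
  interpret b: bump1 d "bfun d" by (rule bump1_bfun[OF d])
  obtain CB where CB: "CB \<ge> 0" "\<And>\<Omega> T A v x M H \<tau> \<epsilon>. dbox d (bfun d) \<Omega> T A v x M \<Longrightarrow>
    (\<forall>l. (\<lambda>k. if k = l then s l else 0) \<in> A) \<Longrightarrow> inR d x T A H \<tau> \<Longrightarrow> (\<forall>z. cmod (H z) \<le> \<epsilon>) \<Longrightarrow> cmod \<tau> \<le> CB * M * \<epsilon>"
    using b.T_bound_inR[of s] by blast
  define PT where "PT C \<beta> \<longleftrightarrow> (\<forall>K \<nu> (x::real^'n) z W. (\<forall>i. i \<le> \<beta> \<longrightarrow> cmod (\<Sum>k\<in>K. \<nu> k * mipow (\<lambda>l. - \<i> * of_real (xik d k l)) i * ek (pi / d) k (z - x)) \<le> W)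
    \<longrightarrow> cmod (\<Sum>k\<in>K. \<nu> k * tens x (\<lambda>l. nd (\<beta> l) (ekt d k l)) z) \<le> C * W)" for C :: real and \<beta> :: "'n mindex"
  have "\<exists>C\<ge>0. \<forall>\<beta>\<in>?S. PT C \<beta>"
  proof (rule finite_uniform_const[OF finS])
    show "\<exists>C\<ge>0. PT C \<beta>" for \<beta> unfolding PT_def by (rule tens_nd_ekt_bound[OF d])
    fix C D :: real and \<beta> :: "'n mindex"
    assume a: "PT C \<beta>" "C \<le> D"
    show "PT D \<beta>" unfolding PT_def
    proof (intro allI impI)
      fix K \<nu> x z W
      assume W: "\<forall>i. i \<le> \<beta> \<longrightarrow> cmod (\<Sum>k\<in>K. \<nu> k * mipow (\<lambda>l. - \<i> * of_real (xik d k l)) i * ek (pi / d) k (z - x)) \<le> W"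
      then have "0 \<le> W" using norm_ge_zero order_trans by blast
      then have "C * W \<le> D * W" using a(2) by (rule mult_right_mono[rotated])
      moreover have "cmod (\<Sum>k\<in>K. \<nu> k * tens x (\<lambda>l. nd (\<beta> l) (ekt d k l)) z) \<le> C * W"
        using a(1) W unfolding PT_def by blast
      ultimately show "cmod (\<Sum>k\<in>K. \<nu> k * tens x (\<lambda>l. nd (\<beta> l) (ekt d k l)) z) \<le> D * W" by linarith
    qed
  qed
  then obtain CT where CT: "CT \<ge> 0" "\<And>\<beta>. \<beta> \<in> ?S \<Longrightarrow> PT CT \<beta>" by blast
  \<comment> \<open>The numerator contains the sum of two multi-indices bounded by \<open>D\<close>,
    hence \<open>2 * D\<close>.\<close>
  obtain CK where CK: "CK \<ge> 0" "\<And>c q Aq \<alpha> i j z. elliptic c \<Longrightarrow> 0 \<le> Aq \<Longrightarrow> Qb (NNc \<kappa> m) Aq q \<Longrightarrow> (\<forall>l. \<alpha> l + i l \<le> 2 * D) \<Longrightarrow> (\<forall>l. \<bar>z$l\<bar> \<le> d) \<Longrightarrow>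
    cmod (\<Sum>k\<in>Kset \<kappa> d j. nuq d c \<alpha> j q k * mipow (\<lambda>l. - \<i> * of_real (xik d k l)) i * ek (pi / d) k z)
     \<le> CK * Aq * (2 ^ (j * (mdot \<alpha> \<kappa> + mdot i \<kappa>)) / 2 ^ (j * m)) * (2 ^ (j * msum \<kappa>) / max 1 (2 ^ j * qdist \<kappa> z 0) ^ NNc \<kappa> m)"
    using kernel_bound_nu[OF d, where D = "2 * D" and N = "NNc \<kappa> m"] by blast
  obtain K0 where K0: "K0 \<ge> 1" "Qb (NNc \<kappa> m) K0 (chin \<kappa>)" using Qb_chin by blast
  have cz: "2 < \<bar>\<eta> l\<bar> \<Longrightarrow> chin \<kappa> \<eta> = 0" for \<eta> l by (rule chin_zero)
  have K0': "0 \<le> K0" using K0 by simp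
  obtain CM where CM: "CM \<ge> 0" "\<And>q Aq i j z. 0 \<le> Aq \<Longrightarrow> Qb (NNc \<kappa> m) Aq q \<Longrightarrow> (\<forall>l. i l \<le> 2 * D) \<Longrightarrow> (\<forall>l. \<bar>z$l\<bar> \<le> d) \<Longrightarrow>
    cmod (\<Sum>k\<in>Kset \<kappa> d j. chin \<kappa> (etak \<kappa> (pi / d) j k) * q (etak \<kappa> (pi / d) j k) * mipow (\<lambda>l. - \<i> * of_real (xik d k l)) i * ek (pi / d) k z)
     \<le> CM * Aq * 2 ^ (j * mdot i \<kappa>) * (2 ^ (j * msum \<kappa>) / max 1 (2 ^ j * qdist \<kappa> z 0) ^ NNc \<kappa> m)"
  proof (rule exE[OF kernel_bound_plain[where D = "2 * D" and w = "chin \<kappa>", OF d kpos K0(2) _ K0']])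
    fix \<eta> :: "'n \<Rightarrow> real" and l assume "2 < \<bar>\<eta> l\<bar>" then show "chin \<kappa> \<eta> = 0" by (rule cz)
  qed blast
  obtain Kc where Kc: "Kc \<ge> 0" "\<And>c \<sigma>. elliptic c \<Longrightarrow> \<sigma> \<in> Sg \<Longrightarrow> cmod (coef c \<sigma>) \<le> Kc" using coef_bound by blast
  have "\<exists>C\<ge>0. \<forall>\<beta>\<in>?S. \<forall>(x::real^'n) z. cmod (tens x (\<lambda>l. nd (\<beta> l) (bfun d)) z) \<le> C"
  proof (rule finite_uniform_const[OF finS])
    fix \<beta> :: "'n mindex"
    have "\<forall>n. \<exists>B>0. \<forall>t. cmod (nd n (bfun d) t) \<le> B" using test1_bounded[OF test1_nd[OF b.b]] by blast
    then obtain Bn where Bn: "\<And>n. Bn n > 0" "\<And>n t. cmod (nd n (bfun d) t) \<le> Bn n" by metis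
    have "cmod (tens x (\<lambda>l. nd (\<beta> l) (bfun d)) z) \<le> (\<Prod>l\<in>UNIV. Bn (\<beta> l))" for x z :: "real^'n"
      unfolding tens_def prod_norm[symmetric] by (intro prod_mono conjI norm_ge_zero Bn(2))
    moreover have "0 \<le> (\<Prod>l\<in>UNIV. Bn (\<beta> l))" using Bn(1) by (intro prod_nonneg) (auto intro: less_imp_le)
    ultimately show "\<exists>C\<ge>0. \<forall>(x::real^'n) z. cmod (tens x (\<lambda>l. nd (\<beta> l) (bfun d)) z) \<le> C" by blast
  qed (meson order_trans)
  then obtain Bb where Bb: "Bb \<ge> 0" "\<And>\<beta> (x::real^'n) z. \<beta> \<in> ?S \<Longrightarrow> cmod (tens x (\<lambda>l. nd (\<beta> l) (bfun d)) z) \<le> Bb" by blast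
  define CX where "CX = CK + CM"
  have CX: "0 \<le> CX" "CK \<le> CX" "CM \<le> CX" using CK CM by (auto simp: CX_def)
  define c1 where "c1 = min 1 (d / 4)"
  have c1: "0 < c1" using d by (simp add: c1_def)
  define Q where "Q = CX * (1 / c1) ^ NNc \<kappa> m"
  define C where "C = CB * (CT * Q + card Sg * (Kc * (CT * Q)) + (2 * d) ^ CARD('n) * Q * (card Sg * (Kc * Bb))) + CT * CX + (2 * d) ^ CARD('n) * Q * Bb"
  have Q: "0 \<le> Q" using CX c1 by (simp add: Q_def)
  have C: "0 \<le> C" unfolding C_def using CB(1) CT(1) Q Kc(1) Bb(1) d CX(1) by (intro add_nonneg_nonneg mult_nonneg_nonneg) auto
  show ?thesis
  proof (intro exI[of _ C] conjI C allI impI)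
    fix \<Omega> T v a f x M and q :: "('n \<Rightarrow> real) \<Rightarrow> complex" and Aq :: real and \<alpha> :: "'n mindex" and j :: nat
    assume fr: "frozen \<kappa> A B m lam Lam d \<Omega> T v a f x M s" and \<alpha>: "\<alpha> \<in> A" and Aq: "0 \<le> Aq" and q: "Qb (NNc \<kappa> m) Aq q"
    interpret fr: frozen \<kappa> A B m lam Lam d \<Omega> T v a f x M s by (rule fr)
    have c1': "fr.c1 = c1" by (simp add: fr.c1_def c1_def)
    show "ennreal (cmod (\<Sum>k\<in>Kset \<kappa> d j. muq d j q k * (LINT z:cbx x d|lebesgue. v \<alpha> z * tens x (ekt d k) z)))
    \<le> ennreal (C * Aq * M / 4 ^ j) +
      (\<integral>\<^sup>+z. ennreal (indicator (cbx x d) z * (C * Aq * (kerc \<kappa> m j (z - x) + 1 / 4 ^ j)) * (\<Sum>\<beta>\<in>B. cmod (gfun A v a f x \<beta> z))) \<partial>lebesgue)"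
      unfolding C_def Q_def c1'[symmetric]
    proof (rule fr.block[where CB = CB and CT = CT and CK = CX and Kc = Kc and Bb = Bb, OF CB(1) _ CT(1) _ CX(1) _ _ Kc(1) _ Bb(1) _ \<alpha> Aq])
      fix H \<tau> \<epsilon> assume "inR d x T A H \<tau>" "\<forall>z. cmod (H z) \<le> \<epsilon>"
      then show "cmod \<tau> \<le> CB * M * \<epsilon>" by (rule CB(2)[OF fr.box fr.s])
    next
      fix \<beta> K \<nu> W and z :: "real^'n" assume "\<beta> \<in> ?S" "\<forall>i. i \<le> \<beta> \<longrightarrow> cmod (\<Sum>k\<in>K. \<nu> k * mipow (\<lambda>l. - \<i> * of_real (xik d k l)) i * ek (pi / d) k (z - x)) \<le> W"
      then show "cmod (\<Sum>k\<in>K. \<nu> k * tens x (\<lambda>l. nd (\<beta> l) (ekt d k l)) z) \<le> CT * W"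
        using CT(2) unfolding PT_def by blast
    next
      fix \<beta> i and z :: "real^'n" assume a: "\<beta> \<in> ?S" "i \<le> \<beta>" "\<forall>l. \<bar>z $ l\<bar> \<le> d"
      have le: "i l \<le> D" "\<alpha> l \<le> D" for l using D[OF a(1), of l] D[of \<alpha> l] \<alpha> a(2) by (auto simp: le_fun_def intro: order_trans)
      have "\<forall>l. \<alpha> l + i l \<le> 2 * D" "\<forall>l. i l \<le> 2 * D" using add_mono[OF le(2) le(1)] le(1) by (auto simp: mult_2 intro: trans_le_add1)
      note b = this
      have "cmod (\<Sum>k\<in>Kset \<kappa> d j. nuq d fr.c \<alpha> j q k * mipow (\<lambda>l. - \<i> * of_real (xik d k l)) i * ek (pi / d) k z)
        \<le> CK * Aq * (2 ^ (j * (mdot \<alpha> \<kappa> + mdot i \<kappa>)) / 2 ^ (j * m)) * kerc \<kappa> m j z"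
        unfolding kerc_def by (rule CK(2)[OF fr.ell_c Aq q b(1) a(3)])
      also have "\<dots> \<le> CX * Aq * (2 ^ (j * (mdot \<alpha> \<kappa> + mdot i \<kappa>)) / 2 ^ (j * m)) * kerc \<kappa> m j z"
        by (intro mult_right_mono CX Aq kerc_nonneg divide_nonneg_nonneg) auto
      finally show "cmod (\<Sum>k\<in>Kset \<kappa> d j. nuq d fr.c \<alpha> j q k * mipow (\<lambda>l. - \<i> * of_real (xik d k l)) i * ek (pi / d) k z)
        \<le> CX * Aq * (2 ^ (j * (mdot \<alpha> \<kappa> + mdot i \<kappa>)) / 2 ^ (j * m)) * kerc \<kappa> m j z" .
      have "cmod (\<Sum>k\<in>Kset \<kappa> d j. muq d j q k * mipow (\<lambda>l. - \<i> * of_real (xik d k l)) i * ek (pi / d) k z)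
        \<le> CM * Aq * 2 ^ (j * mdot i \<kappa>) * kerc \<kappa> m j z"
        unfolding kerc_def muq_def by (rule CM(2)[OF Aq q b(2) a(3)])
      also have "\<dots> \<le> CX * Aq * 2 ^ (j * mdot i \<kappa>) * kerc \<kappa> m j z"
        by (intro mult_right_mono CX Aq kerc_nonneg) auto
      finally show "cmod (\<Sum>k\<in>Kset \<kappa> d j. muq d j q k * mipow (\<lambda>l. - \<i> * of_real (xik d k l)) i * ek (pi / d) k z)
        \<le> CX * Aq * 2 ^ (j * mdot i \<kappa>) * kerc \<kappa> m j z" .
    next
      fix \<sigma> assume "\<sigma> \<in> Sg" then show "cmod (coef fr.c \<sigma>) \<le> Kc" by (rule Kc(2)[OF fr.ell_c])
    next
      fix \<beta> and z :: "real^'n" assume "\<beta> \<in> ?S" then show "cmod (tens x (\<lambda>l. nd (\<beta> l) (bfun d)) z) \<le> Bb" by (rule Bb(2))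
    qed
  qed
qed

section \<open>Summation over dyadic blocks\<close>

text \<open>\<open>P\<close> is a potential with values in [0, 3] on the positive numbers whose
  increase from \<tau> to 2 \<tau> is at least \<open>min \<tau> (1 / \<tau>)\<close>, so the sum
  telescopes. For 1/2 \<le> \<tau> < 1 the inequality is (1 - \<tau>) (2 \<tau> - 1) \<ge> 0;
  otherwise it is an equality.\<close>

lemma sum_min_dyadic:
  assumes "0 < t"
  shows "(\<Sum>j<n. min (2 ^ j * t) (1 / (2 ^ j * t))) \<le> (3::real)"
proof -
  define P where "P \<tau> = (if \<tau> < 1 then \<tau> else 3 - 2 / \<tau>)" for \<tau> :: real
  have step: "min \<tau> (1 / \<tau>) \<le> P (2 * \<tau>) - P \<tau>" if "0 < \<tau>" for \<tau>
  proof -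
    consider "2 * \<tau> < 1" | "1 \<le> 2 * \<tau>" "\<tau> < 1" | "1 \<le> \<tau>" by linarith
    then show ?thesis
    proof cases
      case 2
      have "1 / \<tau> + 2 * \<tau> \<le> 3"
      proof -
        have "(1 - \<tau>) * (2 * \<tau> - 1) \<ge> 0" using 2 by (intro mult_nonneg_nonneg) auto
        then have "1 + 2 * \<tau> * \<tau> \<le> 3 * \<tau>" by (simp add: algebra_simps)
        then show ?thesis using that by (simp add: field_simps)
      qed
      then show ?thesis using 2 by (simp add: P_def min_def)
    qed (use that in \<open>auto simp: P_def min_def field_simps\<close>)
  qed
  have "(\<Sum>j<n. min (2 ^ j * t) (1 / (2 ^ j * t))) \<le> P (2 ^ n * t) - P t"
  proof (induction n)
    case (Suc n)
    then show ?case using step[of "2 ^ n * t"] assms by (simp add: mult.assoc)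
  qed simp
  moreover have "P \<tau> \<le> 3" "0 \<le> P \<tau>" if "0 < \<tau>" for \<tau> using that by (auto simp: P_def field_simps)
  ultimately show ?thesis using assms by (smt (verit) mult_pos_pos zero_less_power)
qed

lemma sum_weight_quarter:
  assumes "0 \<le> r" shows "(\<Sum>j<n. min 1 (2 ^ j * r) * (1 / 4 ^ j)) \<le> 2 * (r::real)"
proof -
  have "(\<Sum>j<n. min 1 (2 ^ j * r) * (1 / 4 ^ j)) \<le> (\<Sum>j<n. r * (1 / 2) ^ j)"
  proof (rule sum_mono)
    fix j
    have "min 1 (2 ^ j * r) * (1 / 4 ^ j) \<le> 2 ^ j * r * (1 / 4 ^ j)" by (intro mult_right_mono) auto
    also have "\<dots> = r * (2 / 4) ^ j" unfolding power_divide by simp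
    finally show "min 1 (2 ^ j * r) * (1 / 4 ^ j) \<le> r * (1 / 2) ^ j" by simp
  qed
  also have "\<dots> = r * ((1 - (1 / 2) ^ n) / (1 - 1 / 2))" unfolding sum_distrib_left[symmetric] by (subst sum_gp_strict) auto
  also have "\<dots> \<le> r * 2" using assms by (intro mult_left_mono) auto
  finally show ?thesis by simp
qed

text \<open>With \<tau> = \<open>2 ^ j * t\<close>: for small \<tau> the power
  \<open>\<tau> ^ K\<close> with \<open>1 \<le> K\<close> supplies the factor \<tau>; for large
  \<tau> two orders of decay beyond \<open>K\<close> are available, one of which is spent on the
  factor \<open>max 1 \<tau>\<close>.\<close>

lemma kernel_term_bound:
  assumes t: "0 < t" and K: "1 \<le> K" and N: "K + 2 \<le> N"
  shows "max 1 (2 ^ j * t) * (2 ^ (j * K) / max 1 (2 ^ j * t) ^ N) \<le> min (2 ^ j * t) (1 / (2 ^ j * t)) / (t::real) ^ K"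
proof -
  define \<tau> where "\<tau> = 2 ^ j * t"
  have \<tau>: "0 < \<tau>" using t by (simp add: \<tau>_def)
  have eq: "2 ^ (j * K) = \<tau> ^ K / t ^ K" using t by (simp add: \<tau>_def power_mult_distrib power_mult)
  have "max 1 \<tau> * \<tau> ^ K / max 1 \<tau> ^ N \<le> min \<tau> (1 / \<tau>)"
  proof (cases "\<tau> \<le> 1")
    case True
    have "\<tau> ^ K \<le> \<tau> ^ 1" using True \<tau> K by (intro power_decreasing) auto
    moreover have "\<tau> * \<tau> \<le> 1 * 1" using True \<tau> by (intro mult_mono) auto
    ultimately show ?thesis using True \<tau> by (simp add: max_def min_def field_simps)
  next
    case False
    have "\<tau> ^ (K + 2) \<le> \<tau> ^ N" using False N by (intro power_increasing) auto
    then have "\<tau> * \<tau> ^ K * \<tau> \<le> \<tau> ^ N" by (simp add: mult_ac)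
    then have "\<tau> * \<tau> ^ K / \<tau> ^ N \<le> 1 / \<tau>" using \<tau> by (simp add: divide_le_eq le_divide_eq field_simps)
    moreover have "1 / \<tau> \<le> \<tau>" using False \<tau> mult_mono[of 1 \<tau> 1 \<tau>] by (simp add: divide_le_eq)
    then have "min \<tau> (1 / \<tau>) = 1 / \<tau>" by (rule min_absorb2)
    ultimately show ?thesis using False by (simp add: max_def)
  qed
  then have "(max 1 \<tau> * \<tau> ^ K / max 1 \<tau> ^ N) / t ^ K \<le> min \<tau> (1 / \<tau>) / t ^ K"
    using t by (intro divide_right_mono) auto
  then show ?thesis using eq unfolding \<tau>_def[symmetric] by (simp add: mult_ac)
qed

text \<open>The weight satisfies
  \<open>min 1 (2 ^ j * r) \<le> max 1 (2 ^ j * t) * min 1 (r / t)\<close>, after which the sum over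
  j no longer sees \<open>r\<close>. The constant 5 is 3 from that sum and 2 from the terms
  \<open>1 / 4 ^ j\<close>, which are absorbed because \<open>t\<close> and \<open>r\<close> are at
  most 1.\<close>

lemma kernel_sum_bound:
  assumes t: "0 < t" "t \<le> 1" and r: "0 < r" "r \<le> 1" and K: "1 \<le> K" and N: "K + 2 \<le> N"
  shows "(\<Sum>j<n. min 1 (2 ^ j * r) * (2 ^ (j * K) / max 1 (2 ^ j * t) ^ N + 1 / 4 ^ j)) \<le> 5 * (min 1 (r / t) / (t::real) ^ K)"
proof -
  have 1: "min 1 (2 ^ j * r) * (2 ^ (j * K) / max 1 (2 ^ j * t) ^ N) \<le> min 1 (r / t) / t ^ K * min (2 ^ j * t) (1 / (2 ^ j * t))" for j
  proof -
    have "min 1 (2 ^ j * r) \<le> max 1 (2 ^ j * t) * min 1 (r / t)"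
    proof (cases "r \<le> t")
      case True
      then have "min 1 (r / t) = r / t" using t by (simp add: min_def)
      moreover have "2 ^ j * t * (r / t) \<le> max 1 (2 ^ j * t) * (r / t)" using t r by (intro mult_right_mono) auto
      ultimately show ?thesis using t by (simp add: min.coboundedI2)
    next
      case False
      then have "min 1 (r / t) = 1" using t by (simp add: min_def field_simps)
      then show ?thesis by (simp add: le_max_iff_disj min.coboundedI1)
    qed
    then have "min 1 (2 ^ j * r) * (2 ^ (j * K) / max 1 (2 ^ j * t) ^ N) \<le> max 1 (2 ^ j * t) * min 1 (r / t) * (2 ^ (j * K) / max 1 (2 ^ j * t) ^ N)"
      by (intro mult_right_mono divide_nonneg_nonneg zero_le_power) auto
    also have "\<dots> = min 1 (r / t) * (max 1 (2 ^ j * t) * (2 ^ (j * K) / max 1 (2 ^ j * t) ^ N))" by simp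
    also have "\<dots> \<le> min 1 (r / t) * (min (2 ^ j * t) (1 / (2 ^ j * t)) / t ^ K)"
      using t r by (intro mult_left_mono kernel_term_bound K N) auto
    finally show ?thesis by simp
  qed
  define Y where "Y = min 1 (r / t) / t ^ K"
  have "0 \<le> Y" using t r by (simp add: Y_def)
  have "(\<Sum>j<n. min 1 (2 ^ j * r) * (2 ^ (j * K) / max 1 (2 ^ j * t) ^ N)) \<le> (\<Sum>j<n. Y * min (2 ^ j * t) (1 / (2 ^ j * t)))"
    unfolding Y_def by (intro sum_mono 1)
  also have "\<dots> \<le> Y * 3"
    unfolding sum_distrib_left[symmetric] using t(1) \<open>0 \<le> Y\<close> by (intro mult_left_mono sum_min_dyadic)
  finally have S1: "(\<Sum>j<n. min 1 (2 ^ j * r) * (2 ^ (j * K) / max 1 (2 ^ j * t) ^ N)) \<le> Y * 3" .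
  have "r \<le> min 1 (r / t)" using t r by (simp add: le_divide_eq mult_left_le)
  moreover have "min 1 (r / t) \<le> Y"
  proof -
    define y where "y = min 1 (r / t)"
    have "0 \<le> y" using t r by (simp add: y_def)
    moreover have "0 < t ^ K" "t ^ K \<le> 1" using t by (auto simp: power_le_one)
    ultimately show ?thesis unfolding Y_def y_def[symmetric] by (simp add: le_divide_eq mult_left_le)
  qed
  ultimately have "2 * r \<le> Y * 2" by linarith
  moreover have "(\<Sum>j<n. min 1 (2 ^ j * r) * (1 / 4 ^ j)) \<le> 2 * r" by (rule sum_weight_quarter) (use r in simp)
  ultimately have "(\<Sum>j<n. min 1 (2 ^ j * r) * (2 ^ (j * K) / max 1 (2 ^ j * t) ^ N)) + (\<Sum>j<n. min 1 (2 ^ j * r) * (1 / 4 ^ j)) \<le> 5 * Y"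
    using S1 by linarith
  then show ?thesis unfolding Y_def[symmetric] by (simp only: distrib_left sum.distrib)
qed

text \<open>\<open>w s / s ^ K\<close> is at most \<open>2 ^ (K + 2)\<close> times the integral of
  \<open>w \<rho> / \<rho> ^ (K + 1)\<close> over s < \<rho> < 2 s, an interval of length s: there
  \<open>w\<close> drops at most by a factor 2 and \<rho> is at most doubled. Exchanging the
  integrals turns these intervals into sublevel sets of \<open>t\<close>.\<close>

lemma tonelli_layer:
  fixes G :: "real^'n::finite \<Rightarrow> ennreal" and t :: "real^'n \<Rightarrow> real" and w :: "real \<Rightarrow> real"
  assumes G: "G \<in> borel_measurable lebesgue" and t[measurable]: "t \<in> borel_measurable borel"
    and w[measurable]: "w \<in> borel_measurable borel" and w0: "\<And>\<rho>. 0 < \<rho> \<Longrightarrow> 0 \<le> w \<rho>"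
    and w2: "\<And>s \<rho>. 0 < s \<Longrightarrow> s < \<rho> \<Longrightarrow> \<rho> < 2 * s \<Longrightarrow> w s \<le> 2 * w \<rho>"
  shows "(\<integral>\<^sup>+z. indicator {z. 0 < t z \<and> t z \<le> s0} z * ennreal (w (t z) / t z ^ K) * G z \<partial>lebesgue)
    \<le> ennreal (2 ^ (K + 2)) * (\<integral>\<^sup>+\<rho>. indicator {0<..<2 * s0} \<rho> * ennreal (w \<rho> / \<rho> ^ (K + 1)) * (\<integral>\<^sup>+z. indicator {z. t z < \<rho>} z * G z \<partial>lebesgue) \<partial>lborel)"
proof -
  \<comment> \<open>A Borel version of \<open>G\<close>, since the integrals are exchanged for
    \<open>lborel\<close>.\<close>
  obtain G' where G'[measurable]: "G' \<in> borel_measurable lborel" and AE: "AE z in lborel. G z = G' z"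
    using completion_ex_borel_measurable[OF G] by blast
  have layer: "indicator {z. 0 < t z \<and> t z \<le> s0} z * ennreal (w (t z) / t z ^ K) \<le>
    ennreal (2 ^ (K + 2)) * (\<integral>\<^sup>+\<rho>. indicator {0<..<2 * s0} \<rho> * ennreal (w \<rho> / \<rho> ^ (K + 1)) * indicator {z. t z < \<rho>} z \<partial>lborel)" for z
  proof (cases "0 < t z \<and> t z \<le> s0")
    case True
    let ?s = "t z"
    define C where "C = w ?s / (2 * (2 * ?s) ^ (K + 1))"
    have C: "0 \<le> C" using True w0[of ?s] by (simp add: C_def)
    have "ennreal C * ennreal ?s = ennreal C * emeasure lborel {?s<..<2 * ?s}" using True by simp
    also have "\<dots> = (\<integral>\<^sup>+\<rho>. ennreal C * indicator {?s<..<2 * ?s} \<rho> \<partial>lborel)" by (subst nn_integral_cmult_indicator) auto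
    also have "\<dots> \<le> (\<integral>\<^sup>+\<rho>. indicator {0<..<2 * s0} \<rho> * ennreal (w \<rho> / \<rho> ^ (K + 1)) * indicator {z. t z < \<rho>} z \<partial>lborel)"
    proof (rule nn_integral_mono)
      fix \<rho>
      show "ennreal C * indicator {?s<..<2 * ?s} \<rho> \<le> indicator {0<..<2 * s0} \<rho> * ennreal (w \<rho> / \<rho> ^ (K + 1)) * indicator {z. t z < \<rho>} z"
      proof (cases "\<rho> \<in> {?s<..<2 * ?s}")
        case \<rho>: True
        have "C = (w ?s / 2) / (2 * ?s) ^ (K + 1)" by (simp add: C_def)
        also have "\<dots> \<le> w \<rho> / \<rho> ^ (K + 1)"
          using \<rho> True w2[of ?s \<rho>] w0[of \<rho>] w0[of ?s] by (intro frac_le power_mono) auto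
        finally show ?thesis using \<rho> True by (simp add: ennreal_leI)
      qed simp
    qed
    finally have "ennreal (2 ^ (K + 2)) * (ennreal C * ennreal ?s) \<le> ennreal (2 ^ (K + 2)) * (\<integral>\<^sup>+\<rho>. indicator {0<..<2 * s0} \<rho> * ennreal (w \<rho> / \<rho> ^ (K + 1)) * indicator {z. t z < \<rho>} z \<partial>lborel)"
      by (rule mult_left_mono) simp
    moreover have "ennreal (2 ^ (K + 2)) * (ennreal C * ennreal ?s) = ennreal (w ?s / ?s ^ K)"
    proof -
      have "2 ^ (K + 2) * (C * ?s) = w ?s / ?s ^ K" using True by (simp add: C_def power_mult_distrib)
      then show ?thesis using C True by (simp add: ennreal_mult[symmetric] del: ennreal_numeral ennreal_power)
    qed
    ultimately show ?thesis using True by simp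
  qed simp
  have "(\<integral>\<^sup>+z. indicator {z. 0 < t z \<and> t z \<le> s0} z * ennreal (w (t z) / t z ^ K) * G z \<partial>lebesgue)
    = (\<integral>\<^sup>+z. indicator {z. 0 < t z \<and> t z \<le> s0} z * ennreal (w (t z) / t z ^ K) * G' z \<partial>lborel)"
    unfolding nn_integral_completion by (rule nn_integral_cong_AE) (use AE in auto)
  also have "\<dots> \<le> (\<integral>\<^sup>+z. ennreal (2 ^ (K + 2)) * (\<integral>\<^sup>+\<rho>. indicator {0<..<2 * s0} \<rho> * ennreal (w \<rho> / \<rho> ^ (K + 1)) * indicator {z. t z < \<rho>} z \<partial>lborel) * G' z \<partial>lborel)"
    by (intro nn_integral_mono mult_right_mono layer) simp
  also have "\<dots> = (\<integral>\<^sup>+z. ennreal (2 ^ (K + 2)) * (\<integral>\<^sup>+\<rho>. indicator {0<..<2 * s0} \<rho> * ennreal (w \<rho> / \<rho> ^ (K + 1)) * (if t z < \<rho> then 1 else 0) * G' z \<partial>lborel) \<partial>lborel)"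
  proof (rule nn_integral_cong)
    fix z
    have "(\<integral>\<^sup>+\<rho>. indicator {0<..<2 * s0} \<rho> * ennreal (w \<rho> / \<rho> ^ (K + 1)) * indicator {z. t z < \<rho>} z \<partial>lborel) * G' z
      = (\<integral>\<^sup>+\<rho>. indicator {0<..<2 * s0} \<rho> * ennreal (w \<rho> / \<rho> ^ (K + 1)) * (if t z < \<rho> then 1 else 0) * G' z \<partial>lborel)"
      by (subst nn_integral_multc[symmetric]) (auto simp: indicator_def intro!: nn_integral_cong)
    then show "ennreal (2 ^ (K + 2)) * (\<integral>\<^sup>+\<rho>. indicator {0<..<2 * s0} \<rho> * ennreal (w \<rho> / \<rho> ^ (K + 1)) * indicator {z. t z < \<rho>} z \<partial>lborel) * G' z =
       ennreal (2 ^ (K + 2)) * (\<integral>\<^sup>+\<rho>. indicator {0<..<2 * s0} \<rho> * ennreal (w \<rho> / \<rho> ^ (K + 1)) * (if t z < \<rho> then 1 else 0) * G' z \<partial>lborel)"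
      by (simp only: mult.assoc)
  qed
  also have "\<dots> = ennreal (2 ^ (K + 2)) * (\<integral>\<^sup>+z. (\<integral>\<^sup>+\<rho>. indicator {0<..<2 * s0} \<rho> * ennreal (w \<rho> / \<rho> ^ (K + 1)) * (if t z < \<rho> then 1 else 0) * G' z \<partial>lborel) \<partial>lborel)"
    by (rule nn_integral_cmult) measurable
  also have "(\<integral>\<^sup>+z. (\<integral>\<^sup>+\<rho>. indicator {0<..<2 * s0} \<rho> * ennreal (w \<rho> / \<rho> ^ (K + 1)) * (if t z < \<rho> then 1 else 0) * G' z \<partial>lborel) \<partial>lborel)
     = (\<integral>\<^sup>+\<rho>. (\<integral>\<^sup>+z. indicator {0<..<2 * s0} \<rho> * ennreal (w \<rho> / \<rho> ^ (K + 1)) * (if t z < \<rho> then 1 else 0) * G' z \<partial>lborel) \<partial>lborel)"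
    by (rule lborel_pair.Fubini'[symmetric]) measurable
  also have "\<dots> = (\<integral>\<^sup>+\<rho>. indicator {0<..<2 * s0} \<rho> * ennreal (w \<rho> / \<rho> ^ (K + 1)) * (\<integral>\<^sup>+z. indicator {z. t z < \<rho>} z * G z \<partial>lebesgue) \<partial>lborel)"
  proof (rule nn_integral_cong)
    fix \<rho>
    have "(\<integral>\<^sup>+z. indicator {z. t z < \<rho>} z * G z \<partial>lebesgue) = (\<integral>\<^sup>+z. (if t z < \<rho> then 1 else 0) * G' z \<partial>lborel)"
      unfolding nn_integral_completion by (rule nn_integral_cong_AE) (use AE in \<open>auto simp: indicator_def\<close>)
    then show "(\<integral>\<^sup>+z. indicator {0<..<2 * s0} \<rho> * ennreal (w \<rho> / \<rho> ^ (K + 1)) * (if t z < \<rho> then 1 else 0) * G' z \<partial>lborel)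
      = indicator {0<..<2 * s0} \<rho> * ennreal (w \<rho> / \<rho> ^ (K + 1)) * (\<integral>\<^sup>+z. indicator {z. t z < \<rho>} z * G z \<partial>lebesgue)"
      by (simp only: mult.assoc) (subst nn_integral_cmult, measurable, subst nn_integral_cmult, measurable)
  qed
  finally show ?thesis .
qed

section \<open>The quasi-distance and its balls\<close>

lemma powr_subadd:
  fixes a b p :: real
  assumes "0 \<le> a" "0 \<le> b" "0 < p" "p \<le> 1"
  shows "(a + b) powr p \<le> a powr p + b powr p"
proof (cases "a + b = 0")
  case False
  then have s: "0 < a + b" using assms by simp
  have *: "u \<le> u powr p" if "0 \<le> u" "u \<le> 1" for u :: real
    using powr_mono'[of p 1 u] that assms by simp
  have "1 = a / (a + b) + b / (a + b)" using s by (simp add: add_divide_distrib[symmetric])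
  also have "\<dots> \<le> (a / (a + b)) powr p + (b / (a + b)) powr p"
    by (intro add_mono *) (use assms s in auto)
  also have "\<dots> = (a powr p + b powr p) / (a + b) powr p"
    using assms s by (simp add: powr_divide add_divide_distrib)
  finally show ?thesis using s by (simp add: le_divide_eq)
qed (use assms in auto)

lemma qdist_L2: "qdist \<kappa> x y = L2_set (\<lambda>l. \<bar>x$l - y$l\<bar> powr (1 / real (\<kappa> l))) UNIV"
proof -
  have "(\<bar>x$l - y$l\<bar> powr (1 / real (\<kappa> l)))\<^sup>2 = \<bar>x$l - y$l\<bar> powr (2 / real (\<kappa> l))" for l
    by (simp add: power2_eq_square powr_add[symmetric])
  then show ?thesis by (simp add: qdist_def L2_set_def)
qed

text \<open>\<open>t powr (1 / \<kappa> l)\<close> is subadditive because the exponent is at most 1;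
  Minkowski's inequality for the Euclidean norm then combines the coordinates.\<close>

lemma qdist_triangle:
  assumes "\<forall>l. 0 < \<kappa> l" shows "qdist \<kappa> x z \<le> qdist \<kappa> x y + qdist \<kappa> y z"
proof -
  have "qdist \<kappa> x z \<le> L2_set (\<lambda>l. \<bar>x$l - y$l\<bar> powr (1 / real (\<kappa> l)) + \<bar>y$l - z$l\<bar> powr (1 / real (\<kappa> l))) UNIV"
    unfolding qdist_L2
  proof (rule L2_set_mono)
    fix l
    have "\<bar>x$l - z$l\<bar> powr (1 / real (\<kappa> l)) \<le> (\<bar>x$l - y$l\<bar> + \<bar>y$l - z$l\<bar>) powr (1 / real (\<kappa> l))"
      by (intro powr_mono2) auto
    also have "\<dots> \<le> \<bar>x$l - y$l\<bar> powr (1 / real (\<kappa> l)) + \<bar>y$l - z$l\<bar> powr (1 / real (\<kappa> l))"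
      using assms[rule_format, of l] by (intro powr_subadd) auto
    finally show "\<bar>x$l - z$l\<bar> powr (1 / real (\<kappa> l)) \<le> \<bar>x$l - y$l\<bar> powr (1 / real (\<kappa> l)) + \<bar>y$l - z$l\<bar> powr (1 / real (\<kappa> l))" .
  qed auto
  also have "\<dots> \<le> qdist \<kappa> x y + qdist \<kappa> y z"
    unfolding qdist_L2 by (rule L2_set_triangle_ineq)
  finally show ?thesis .
qed

lemma qdist_diff: "qdist \<kappa> x y = qdist \<kappa> (x - y) 0"
  by (simp add: qdist_def)

lemma qdist_pos: "x \<noteq> y \<Longrightarrow> 0 < qdist \<kappa> x y"
proof -
  assume "x \<noteq> y"
  then obtain l where "x$l \<noteq> y$l" by (auto simp: vec_eq_iff)
  then have "0 < (\<Sum>l\<in>UNIV. \<bar>x$l - y$l\<bar> powr (2 / real (\<kappa> l)))"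
    by (intro sum_pos2[of UNIV l]) auto
  then show ?thesis by (simp add: qdist_def)
qed

lemma continuous_on_qdist: "\<forall>l. 0 < \<kappa> l \<Longrightarrow> continuous_on S (\<lambda>y. qdist \<kappa> y x)"
  unfolding qdist_def by (intro continuous_intros continuous_on_powr') auto

lemma qdist_coord_le:
  assumes "0 < \<kappa> l" "qdist \<kappa> x y \<le> \<rho>" shows "\<bar>x$l - y$l\<bar> \<le> \<rho> ^ \<kappa> l"
proof -
  have "\<bar>x$l - y$l\<bar> powr (1 / real (\<kappa> l)) \<le> qdist \<kappa> x y"
    unfolding qdist_L2 by (rule member_le_L2_set) auto
  then have "(\<bar>x$l - y$l\<bar> powr (1 / real (\<kappa> l))) ^ \<kappa> l \<le> \<rho> ^ \<kappa> l" using assms by (intro power_mono) auto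
  moreover have "(\<bar>x$l - y$l\<bar> powr (1 / real (\<kappa> l))) ^ \<kappa> l = \<bar>x$l - y$l\<bar>"
    using assms(1) by (cases "x$l = y$l") (auto simp: powr_realpow[symmetric] powr_powr)
  ultimately show ?thesis by simp
qed

lemma open_qball: "\<forall>l. 0 < \<kappa> l \<Longrightarrow> open (qball \<kappa> x \<rho>)"
  unfolding qball_def by (intro open_Collect_less continuous_on_qdist continuous_intros)

text \<open>The ball lies in a box with half-sides \<open>\<rho> ^ \<kappa> l\<close>, which is
  where the exponent \<open>msum \<kappa>\<close> comes from.\<close>

lemma emeasure_qball_le:
  fixes x :: "real^'n::finite"
  assumes "\<forall>l. 0 < \<kappa> l" "0 < \<rho>"
  shows "emeasure lebesgue (qball \<kappa> x \<rho>) \<le> ennreal (2 ^ CARD('n) * \<rho> ^ msum \<kappa>)"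
proof -
  define e :: "real^'n" where "e = (\<chi> l. \<rho> ^ \<kappa> l)"
  have "qball \<kappa> x \<rho> \<subseteq> cbox (x - e) (x + e)"
  proof
    fix y assume "y \<in> qball \<kappa> x \<rho>"
    then have "\<bar>y$l - x$l\<bar> \<le> \<rho> ^ \<kappa> l" for l using qdist_coord_le[of \<kappa> l y x \<rho>] assms by (auto simp: qball_def)
    then show "y \<in> cbox (x - e) (x + e)" by (auto simp: mem_box_cart e_def abs_le_iff algebra_simps)
  qed
  then have "emeasure lebesgue (qball \<kappa> x \<rho>) \<le> emeasure lebesgue (cbox (x - e) (x + e))" by (intro emeasure_mono) auto
  also have "\<dots> = ennreal (measure lborel (cbox (x - e) (x + e)))"
    using emeasure_eq_ennreal_measure[of lborel "cbox (x - e) (x + e)"] emeasure_lborel_cbox_finite[of "x - e" "x + e"] by simp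
  also have "measure lborel (cbox (x - e) (x + e)) = 2 ^ CARD('n) * \<rho> ^ msum \<kappa>"
  proof -
    have "cbox (x - e) (x + e) \<noteq> {}" using assms(2) by (auto simp: interval_ne_empty_cart e_def)
    then have "measure lborel (cbox (x - e) (x + e)) = (\<Prod>l\<in>UNIV. 2 * \<rho> ^ \<kappa> l)"
      by (simp add: content_cbox_cart e_def)
    then show ?thesis by (simp add: prod.distrib msum_def power_sum)
  qed
  finally show ?thesis .
qed

lemma cpt_subset_qball:
  assumes "\<forall>l. 0 < \<kappa> l" "qdist \<kappa> x 0 + \<rho> < R"
  shows "cpt_subset (qball \<kappa> x \<rho>) (qball \<kappa> 0 R)"
proof -
  have cl: "closed {y. qdist \<kappa> y x \<le> \<rho>}" by (intro closed_Collect_le continuous_on_qdist assms continuous_intros)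
  have sub: "closure (qball \<kappa> x \<rho>) \<subseteq> {y. qdist \<kappa> y x \<le> \<rho>}"
    by (rule closure_minimal[OF _ cl]) (auto simp: qball_def)
  have "{y. qdist \<kappa> y x \<le> \<rho>} \<subseteq> cbox (x - (\<chi> l. \<rho> ^ \<kappa> l)) (x + (\<chi> l. \<rho> ^ \<kappa> l))"
  proof
    fix y assume "y \<in> {y. qdist \<kappa> y x \<le> \<rho>}"
    then have "\<bar>y$l - x$l\<bar> \<le> \<rho> ^ \<kappa> l" for l using qdist_coord_le[of \<kappa> l y x \<rho>] assms by auto
    then show "y \<in> cbox (x - (\<chi> l. \<rho> ^ \<kappa> l)) (x + (\<chi> l. \<rho> ^ \<kappa> l))" by (auto simp: mem_box_cart abs_le_iff algebra_simps)
  qed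
  then have "compact (closure (qball \<kappa> x \<rho>))"
    using sub by (intro compact_closure_subset[of _ "cbox (x - (\<chi> l. \<rho> ^ \<kappa> l)) (x + (\<chi> l. \<rho> ^ \<kappa> l))"]) auto
  moreover have "closure (qball \<kappa> x \<rho>) \<subseteq> qball \<kappa> 0 R"
  proof
    fix y assume "y \<in> closure (qball \<kappa> x \<rho>)"
    then have "qdist \<kappa> y x \<le> \<rho>" using sub by auto
    then show "y \<in> qball \<kappa> 0 R" using qdist_triangle[OF assms(1), of y 0 x] assms(2) by (simp add: qball_def)
  qed
  ultimately show ?thesis by (simp add: cpt_subset_def)
qed

section \<open>Dini integrals of the mean oscillations\<close>

lemma measurable_layer:
  fixes G :: "real^'n::finite \<Rightarrow> ennreal" and t :: "real^'n \<Rightarrow> real"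
  assumes G: "G \<in> borel_measurable lebesgue" and t[measurable]: "t \<in> borel_measurable borel"
  shows "(\<lambda>\<rho>. \<integral>\<^sup>+z. indicator {z. t z < \<rho>} z * G z \<partial>lebesgue) \<in> borel_measurable borel"
proof -
  obtain G' where G'[measurable]: "G' \<in> borel_measurable lborel" and AE: "AE z in lborel. G z = G' z"
    using completion_ex_borel_measurable[OF G] by blast
  have "(\<integral>\<^sup>+z. indicator {z. t z < \<rho>} z * G z \<partial>lebesgue) = (\<integral>\<^sup>+z. (if t z < \<rho> then 1 else 0) * G' z \<partial>lborel)" for \<rho>
    unfolding nn_integral_completion by (rule nn_integral_cong_AE) (use AE in \<open>auto simp: indicator_def\<close>)
  moreover have "(\<lambda>\<rho>. \<integral>\<^sup>+z. (if t z < \<rho> then 1 else 0) * G' z \<partial>lborel) \<in> borel_measurable borel" by measurable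
  ultimately show ?thesis by simp
qed

text \<open>The combination of integrals that occurs in the theorem twice, for the oscillation of
  \<open>f\<close> and for that of \<open>a\<close>.\<close>

definition DI :: "real \<Rightarrow> real \<Rightarrow> real \<Rightarrow> (real \<Rightarrow> ennreal) \<Rightarrow> ennreal" where
  "DI \<gamma> R0 r om = (\<integral>\<^sup>+\<rho>\<in>{0<..<r}. om \<rho> / ennreal \<rho> \<partial>lborel)
     + ennreal (r powr \<gamma>) * (\<integral>\<^sup>+\<rho>\<in>{r<..<R0}. om \<rho> / ennreal (\<rho> powr (1 + \<gamma>)) \<partial>lborel)"

lemma ennreal_cancel_divide:
  assumes "H \<le> ennreal c * om" "0 < c" "0 < u"
  shows "H * ennreal (1 / (c * u)) \<le> om / ennreal u"
proof -
  have "H * ennreal (1 / (c * u)) \<le> ennreal c * om * ennreal (1 / (c * u))"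
    using assms(1) by (rule mult_right_mono) simp
  also have "\<dots> = ennreal (c * (1 / (c * u))) * om"
    using assms by (subst ennreal_mult') (auto simp: mult_ac)
  also have "c * (1 / (c * u)) = inverse u" using assms by (simp add: divide_inverse)
  finally show ?thesis using assms by (simp add: divide_ennreal_def inverse_ennreal mult.commute)
qed

text \<open>Below \<open>r\<close> the factor \<open>min 1 (r / \<rho>)\<close> is bounded by 1,
  above \<open>r\<close> by \<open>(r / \<rho>) powr \<gamma>\<close>. Dividing the mass of
  \<open>G\<close> in a ball by the volume scale \<open>D * \<rho> ^ K\<close> leaves the modulus
  over \<rho> and over \<open>\<rho> powr (1 + \<gamma>)\<close> respectively. The layers reach up
  to \<rho> = \<open>2 * s0\<close>, hence the condition on \<open>R0\<close>.\<close>

lemma layer_osc: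
  fixes G :: "real^'n::finite \<Rightarrow> ennreal" and t :: "real^'n \<Rightarrow> real"
  assumes G: "G \<in> borel_measurable lebesgue" and t[measurable]: "t \<in> borel_measurable borel"
    and r: "0 < r" and \<gamma>: "0 < \<gamma>" "\<gamma> < 1" and s0: "2 * s0 \<le> R0" and D: "0 < D"
    and le: "\<And>\<rho>. 0 < \<rho> \<Longrightarrow> \<rho> < 2 * s0 \<Longrightarrow> (\<integral>\<^sup>+z. indicator {z. t z < \<rho>} z * G z \<partial>lebesgue) \<le> ennreal (D * \<rho> ^ K) * Osc \<rho>"
  shows "(\<integral>\<^sup>+z. indicator {z. 0 < t z \<and> t z \<le> s0} z * ennreal (min 1 (r / t z) / t z ^ K) * G z \<partial>lebesgue)
    \<le> ennreal (2 ^ (K + 2) * D) * DI \<gamma> R0 r Osc"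
proof -
  \<comment> \<open>\<open>Osc\<close> need not be measurable, so linearity of the integral is used only for functions of \<open>H\<close>.\<close>
  define H where "H \<rho> = (\<integral>\<^sup>+z. indicator {z. t z < \<rho>} z * G z \<partial>lebesgue)" for \<rho>
  have Hm[measurable]: "H \<in> borel_measurable borel"
    unfolding H_def by (rule measurable_layer[OF G t])
  define b1 where "b1 \<rho> = indicator {0<..<2 * s0} \<rho> * (indicator {0<..<r} \<rho> * (H \<rho> * ennreal (1 / (D * \<rho> ^ K * \<rho>))))" for \<rho>
  define b2 where "b2 \<rho> = indicator {0<..<2 * s0} \<rho> * (indicator {r<..<R0} \<rho> * (H \<rho> * ennreal (1 / (D * \<rho> ^ K * \<rho> powr (1 + \<gamma>)))))" for \<rho>
  have [measurable]: "b1 \<in> borel_measurable borel" "b2 \<in> borel_measurable borel"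
    unfolding b1_def b2_def by measurable
  have scal: "ennreal c * (H \<rho> * ennreal u) = H \<rho> * ennreal (c * u)" if "0 \<le> c" "0 \<le> u" for c u \<rho>
    using that by (simp add: ennreal_mult mult_ac)
  \<comment> \<open>The point \<rho> = r belongs to neither range of integration; it is a null
    set.\<close>
  have pt: "indicator {0<..<2 * s0} \<rho> * ennreal (min 1 (r / \<rho>) / \<rho> ^ (K + 1)) * H \<rho> \<le> ennreal D * (b1 \<rho> + ennreal (r powr \<gamma>) * b2 \<rho>)"
    if "\<rho> \<noteq> r" for \<rho>
  proof (cases "\<rho> \<in> {0<..<2 * s0}")
    case True
    then have \<rho>: "0 < \<rho>" "\<rho> < 2 * s0" "\<rho> < R0" using s0 by auto
    show ?thesis
    proof (cases "\<rho> < r")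
      case lt: True
      have "min 1 (r / \<rho>) / \<rho> ^ (K + 1) \<le> 1 / \<rho> ^ (K + 1)" using \<rho> by (intro divide_right_mono) auto
      also have "\<dots> = D * (1 / (D * \<rho> ^ K * \<rho>))" using D \<rho> by simp
      finally have "ennreal (min 1 (r / \<rho>) / \<rho> ^ (K + 1)) * H \<rho> \<le> ennreal (D * (1 / (D * \<rho> ^ K * \<rho>))) * H \<rho>"
        by (intro mult_right_mono ennreal_leI) auto
      also have "\<dots> = ennreal D * b1 \<rho>" using lt True \<rho> D by (simp add: b1_def scal mult.commute)
      also have "\<dots> \<le> ennreal D * (b1 \<rho> + ennreal (r powr \<gamma>) * b2 \<rho>)" by (intro mult_left_mono) auto
      finally show ?thesis using True by simp
    next
      case False
      then have gt: "r < \<rho>" using that by simp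
      have "min 1 (r / \<rho>) \<le> (r / \<rho>) powr 1" using r \<rho> by simp
      also have "\<dots> \<le> (r / \<rho>) powr \<gamma>" using r gt \<gamma> by (intro powr_mono') auto
      also have "\<dots> = r powr \<gamma> / \<rho> powr \<gamma>" using r \<rho> by (simp add: powr_divide)
      finally have "min 1 (r / \<rho>) / \<rho> ^ (K + 1) \<le> r powr \<gamma> / \<rho> powr \<gamma> / \<rho> ^ (K + 1)" using \<rho> by (intro divide_right_mono) auto
      also have "\<dots> = D * (r powr \<gamma> * (1 / (D * \<rho> ^ K * \<rho> powr (1 + \<gamma>))))"
        using D \<rho> by (simp add: powr_add)
      finally have "ennreal (min 1 (r / \<rho>) / \<rho> ^ (K + 1)) * H \<rho> \<le> ennreal (D * (r powr \<gamma> * (1 / (D * \<rho> ^ K * \<rho> powr (1 + \<gamma>))))) * H \<rho>"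
        by (intro mult_right_mono ennreal_leI) auto
      also have "\<dots> = ennreal D * (ennreal (r powr \<gamma>) * b2 \<rho>)"
      proof -
        have 1: "0 \<le> 1 / (D * \<rho> ^ K * \<rho> powr (1 + \<gamma>))" using D \<rho> by simp
        have "ennreal D * (ennreal (r powr \<gamma>) * (H \<rho> * ennreal (1 / (D * \<rho> ^ K * \<rho> powr (1 + \<gamma>)))))
          = H \<rho> * ennreal (D * (r powr \<gamma> * (1 / (D * \<rho> ^ K * \<rho> powr (1 + \<gamma>)))))"
          using scal[OF _ 1, of "r powr \<gamma>"] scal[of D "r powr \<gamma> * (1 / (D * \<rho> ^ K * \<rho> powr (1 + \<gamma>)))"] 1 D by simp
        then show ?thesis using gt True \<rho> by (simp add: b2_def mult.commute)
      qed
      also have "\<dots> \<le> ennreal D * (b1 \<rho> + ennreal (r powr \<gamma>) * b2 \<rho>)" by (intro mult_left_mono) auto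
      finally show ?thesis using True by simp
    qed
  qed simp
  have "(\<integral>\<^sup>+z. indicator {z. 0 < t z \<and> t z \<le> s0} z * ennreal (min 1 (r / t z) / t z ^ K) * G z \<partial>lebesgue)
    \<le> ennreal (2 ^ (K + 2)) * (\<integral>\<^sup>+\<rho>. indicator {0<..<2 * s0} \<rho> * ennreal (min 1 (r / \<rho>) / \<rho> ^ (K + 1)) * H \<rho> \<partial>lborel)"
    unfolding H_def
  proof (rule tonelli_layer[OF G t])
    show "min 1 (r / s) \<le> 2 * min 1 (r / \<rho>)" if "0 < s" "s < \<rho>" "\<rho> < 2 * s" for s \<rho>
    proof -
      have "r / s \<le> 2 * (r / \<rho>)" using that r by (simp add: field_simps)
      then show ?thesis by (simp add: min_def)
    qed
  qed (use r in auto)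
  also have "(\<integral>\<^sup>+\<rho>. indicator {0<..<2 * s0} \<rho> * ennreal (min 1 (r / \<rho>) / \<rho> ^ (K + 1)) * H \<rho> \<partial>lborel)
    \<le> (\<integral>\<^sup>+\<rho>. ennreal D * (b1 \<rho> + ennreal (r powr \<gamma>) * b2 \<rho>) \<partial>lborel)"
    by (rule nn_integral_mono_AE) (rule AE_mp[OF AE_lborel_singleton[of r]], use pt in simp)
  also have "\<dots> = ennreal D * ((\<integral>\<^sup>+\<rho>. b1 \<rho> \<partial>lborel) + ennreal (r powr \<gamma>) * (\<integral>\<^sup>+\<rho>. b2 \<rho> \<partial>lborel))"
    by (subst nn_integral_cmult, measurable, subst nn_integral_add, measurable, subst nn_integral_cmult, measurable)
  also have "(\<integral>\<^sup>+\<rho>. b1 \<rho> \<partial>lborel) \<le> (\<integral>\<^sup>+\<rho>\<in>{0<..<r}. Osc \<rho> / ennreal \<rho> \<partial>lborel)"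
  proof (rule nn_integral_mono)
    fix \<rho> show "b1 \<rho> \<le> Osc \<rho> / ennreal \<rho> * indicator {0<..<r} \<rho>"
      using ennreal_cancel_divide[OF le[of \<rho>], of \<rho>] D
      by (cases "0 < \<rho> \<and> \<rho> < 2 * s0"; cases "\<rho> < r") (auto simp: b1_def H_def)
  qed
  also have "(\<integral>\<^sup>+\<rho>. b2 \<rho> \<partial>lborel) \<le> (\<integral>\<^sup>+\<rho>\<in>{r<..<R0}. Osc \<rho> / ennreal (\<rho> powr (1 + \<gamma>)) \<partial>lborel)"
  proof (rule nn_integral_mono)
    fix \<rho> show "b2 \<rho> \<le> Osc \<rho> / ennreal (\<rho> powr (1 + \<gamma>)) * indicator {r<..<R0} \<rho>"
      using ennreal_cancel_divide[OF le[of \<rho>], of "\<rho> powr (1 + \<gamma>)"] D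
      by (cases "0 < \<rho> \<and> \<rho> < 2 * s0"; cases "\<rho> \<in> {r<..<R0}") (auto simp: b2_def H_def)
  qed
  finally show ?thesis
    using D by (simp add: DI_def ennreal_mult mult.assoc mult_left_mono add_mono del: ennreal_power ennreal_numeral)
qed

text \<open>Measure zero is a separate case because the quotient then does not recover the
  integral.\<close>

lemma avg_le:
  assumes "S \<in> sets M" "emeasure M S \<le> ennreal c"
  shows "(\<integral>\<^sup>+x\<in>S. u x \<partial>M) \<le> ennreal c * ((\<integral>\<^sup>+x\<in>S. u x \<partial>M) / emeasure M S)"
proof (cases "emeasure M S = 0")
  case True
  then have "S \<in> null_sets M" using assms by auto
  then show ?thesis by (simp add: nn_integral_null_set)
next
  case False
  have "emeasure M S < top" using assms(2) by (rule le_less_trans) simp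
  then have "emeasure M S * ((\<integral>\<^sup>+x\<in>S. u x \<partial>M) / emeasure M S) = (\<integral>\<^sup>+x\<in>S. u x \<partial>M)"
    using False by (simp add: ennreal_times_divide mult.commute[of "emeasure M S"] mult_divide_eq_ennreal)
  then show ?thesis using mult_right_mono[OF assms(2), of "(\<integral>\<^sup>+x\<in>S. u x \<partial>M) / emeasure M S"] by simp
qed

text \<open>The integral of the sum is split for the measurable minorants \<open>F\<close>; only
  afterwards are the single integrals compared with the averages of \<open>u\<close> that define the
  modulus.\<close>

lemma osc_average_le:
  fixes x :: "real^'n::finite"
  assumes \<kappa>: "\<forall>l. 0 < \<kappa> l" and \<rho>: "0 < \<rho>" and I: "finite I"
    and Fm: "\<And>i. i \<in> I \<Longrightarrow> F i \<in> borel_measurable lebesgue" and Fu: "\<And>i z. i \<in> I \<Longrightarrow> F i z \<le> u i z"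
    and le: "(\<Sum>i\<in>I. (\<integral>\<^sup>+z\<in>qball \<kappa> x \<rho>. u i z \<partial>lebesgue) / emeasure lebesgue (qball \<kappa> x \<rho>)) \<le> Osc"
  shows "(\<integral>\<^sup>+z. indicator {z. qdist \<kappa> z x < \<rho>} z * (\<Sum>i\<in>I. F i z) \<partial>lebesgue) \<le> ennreal (2 ^ CARD('n) * \<rho> ^ msum \<kappa>) * Osc"
proof -
  let ?S = "qball \<kappa> x \<rho>"
  have S: "{z. qdist \<kappa> z x < \<rho>} = ?S" by (simp add: qball_def)
  have Sm[measurable]: "?S \<in> sets lebesgue" using open_qball[OF \<kappa>] by simp
  have "(\<integral>\<^sup>+z. indicator {z. qdist \<kappa> z x < \<rho>} z * (\<Sum>i\<in>I. F i z) \<partial>lebesgue) = (\<Sum>i\<in>I. \<integral>\<^sup>+z. indicator ?S z * F i z \<partial>lebesgue)"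
    unfolding S sum_distrib_left
    by (rule nn_integral_sum) (intro borel_measurable_times_ennreal Fm borel_measurable_indicator Sm)
  also have "\<dots> \<le> (\<Sum>i\<in>I. \<integral>\<^sup>+z\<in>?S. u i z \<partial>lebesgue)"
    by (intro sum_mono nn_integral_mono) (auto simp: indicator_def Fu)
  also have "\<dots> \<le> (\<Sum>i\<in>I. ennreal (2 ^ CARD('n) * \<rho> ^ msum \<kappa>) * ((\<integral>\<^sup>+z\<in>?S. u i z \<partial>lebesgue) / emeasure lebesgue ?S))"
    by (intro sum_mono avg_le Sm emeasure_qball_le \<kappa> \<rho>)
  also have "\<dots> \<le> ennreal (2 ^ CARD('n) * \<rho> ^ msum \<kappa>) * Osc"
    unfolding sum_distrib_left[symmetric] by (rule mult_left_mono[OF le]) simp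
  finally show ?thesis .
qed

lemma msum_ge_1: "\<forall>l. 0 < \<kappa> l \<Longrightarrow> 1 \<le> msum \<kappa>"
proof -
  assume a: "\<forall>l. 0 < \<kappa> l"
  obtain l :: 'a where True by blast
  have "\<kappa> l \<le> msum \<kappa>" unfolding msum_def by (rule member_le_sum) auto
  then show ?thesis using a[rule_format, of l] by linarith
qed

context symb_class
begin

definition Zb :: "real \<Rightarrow> real^'n \<Rightarrow> (real^'n \<Rightarrow> complex) \<Rightarrow> nat \<Rightarrow> (('n \<Rightarrow> real) \<Rightarrow> complex) \<Rightarrow> complex" where
  "Zb d x V j q = (\<Sum>k\<in>Kset \<kappa> d j. muq d j q k * (LINT z:cbx x d|lebesgue. V z * tens x (ekt d k) z))"

text \<open>Multipliers of size \<open>c * min 1 (2 ^ j * r)\<close> are what a comparison at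
  distance \<open>r\<close> produces: of size 1 for high blocks, and small for low ones, where the
  phases nearly cancel. The conditions on \<open>s0\<close> keep all balls of radius below
  \<open>2 * s0\<close> around the admissible \<open>x\<close> compactly inside the large
  ball.\<close>

lemma block_sum:
  assumes d: "0 < d" and s0: "s0 \<le> 1" "2 * s0 \<le> R0" "2 * s0 \<le> (1 - \<theta>) * R0" and \<gamma>: "0 < \<gamma>" "\<gamma> < 1"
    and ds: "\<And>w::real^'n. \<forall>l. \<bar>w$l\<bar> \<le> d \<Longrightarrow> qdist \<kappa> w 0 \<le> s0"
  shows "\<exists>C\<ge>0. \<forall>\<Omega> T v a f x M q c \<alpha> r n. frozen \<kappa> A B m lam Lam d \<Omega> T v a f x M s \<longrightarrow> \<alpha> \<in> A \<longrightarrow> 0 < M \<longrightarrow>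
     qdist \<kappa> x 0 < \<theta> * R0 \<longrightarrow> 0 < r \<longrightarrow> r \<le> 1 \<longrightarrow> 0 \<le> c \<longrightarrow> (\<forall>j. Qb (NNc \<kappa> m) (c * min 1 (2 ^ j * r)) (q j)) \<longrightarrow>
     ennreal (\<Sum>j<n. cmod (Zb d x (v \<alpha>) j (q j))) \<le> ennreal (C * c) * (ennreal (M * r) + DI \<gamma> R0 r (osc_f \<kappa> B R0 f) + ennreal M * DI \<gamma> R0 r (osc_a \<kappa> A B R0 a))"
proof -
  obtain C0 where C0: "0 \<le> C0" "\<And>\<Omega> T v a f x M q Aq \<alpha> j. frozen \<kappa> A B m lam Lam d \<Omega> T v a f x M s \<Longrightarrow> \<alpha> \<in> A \<Longrightarrow> 0 \<le> Aq \<Longrightarrow> Qb (NNc \<kappa> m) Aq q \<Longrightarrow>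
    ennreal (cmod (\<Sum>k\<in>Kset \<kappa> d j. muq d j q k * (LINT z:cbx x d|lebesgue. v \<alpha> z * tens x (ekt d k) z)))
    \<le> ennreal (C0 * Aq * M / 4 ^ j) +
      (\<integral>\<^sup>+z. ennreal (indicator (cbx x d) z * (C0 * Aq * (kerc \<kappa> m j (z - x) + 1 / 4 ^ j)) * (\<Sum>\<beta>\<in>B. cmod (gfun A v a f x \<beta> z))) \<partial>lebesgue)"
    using main_block[OF d, of s] by blast
  define K where "K = msum \<kappa>"
  define D where "D = (2::real) ^ CARD('n)"
  define L where "L = 5 * (2 ^ (K + 2) * D)"
  have K: "1 \<le> K" using msum_ge_1 kpos by (simp add: K_def)
  have D: "1 \<le> D" by (simp add: D_def)
  have KD: "1 \<le> 2 ^ (K + 2) * D" using mult_mono[OF one_le_power[of "2::real" "K + 2"] D] by simp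
  then have L: "2 \<le> L" unfolding L_def by linarith
  show ?thesis
  proof (intro exI[of _ "C0 * L"] conjI allI impI)
    show "0 \<le> C0 * L" using C0(1) L by simp
    fix \<Omega> T v a f x M and q :: "nat \<Rightarrow> ('n \<Rightarrow> real) \<Rightarrow> complex" and c r :: real and \<alpha> :: "'n mindex" and n :: nat
    assume fr: "frozen \<kappa> A B m lam Lam d \<Omega> T v a f x M s" and \<alpha>: "\<alpha> \<in> A" and M: "0 < M" and x: "qdist \<kappa> x 0 < \<theta> * R0"
      and r: "0 < r" "r \<le> 1" and c: "0 \<le> c" and q: "\<forall>j. Qb (NNc \<kappa> m) (c * min 1 (2 ^ j * r)) (q j)"
    interpret fr: frozen \<kappa> A B m lam Lam d \<Omega> T v a f x M s by (rule fr)
    define w where "w j = min 1 (2 ^ j * r)" for j :: nat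
    have w0: "0 \<le> w j" for j using r by (simp add: w_def)
    define S where "S z = (\<Sum>\<beta>\<in>B. cmod (gfun A v a f x \<beta> z))" for z
    define I :: "real^'n \<Rightarrow> real" where "I = indicator (cbx x d)"
    define t where "t z = qdist \<kappa> z x" for z
    define F where "F j z = I z * (C0 * (c * w j) * (kerc \<kappa> m j (z - x) + 1 / 4 ^ j)) * S z" for j z
    define Ff where "Ff \<beta> z = ennreal (cmod (I z *\<^sub>R (f \<beta> z - f \<beta> x)))" for \<beta> z
    \<comment> \<open>The coefficients \<open>a\<close> need not be measurable, only their products with \<open>v\<close>; hence the division by \<open>M\<close>.\<close>
    define Fa where "Fa p z = ennreal (cmod (I z *\<^sub>R ((a (fst p) (snd p) z - a (fst p) (snd p) x) * v (fst p) z)) / M)" for p :: "'n mindex \<times> 'n mindex" and z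
    define \<Phi> where "\<Phi> z = indicator {z. 0 < t z \<and> t z \<le> s0} z * ennreal (min 1 (r / t z) / t z ^ K)" for z
    have tm[measurable]: "t \<in> borel_measurable borel"
      unfolding t_def by (intro borel_measurable_continuous_onI continuous_on_qdist kpos)
    have Im[measurable]: "I \<in> borel_measurable lebesgue" unfolding I_def by (intro borel_measurable_indicator) simp
    have I01: "I z = 0 \<or> I z = 1" for z by (simp add: I_def indicator_def)
    have Ffm: "Ff \<beta> \<in> borel_measurable lebesgue" if "\<beta> \<in> B" for \<beta>
    proof -
      have "(\<lambda>z. I z *\<^sub>R (f \<beta> z - f \<beta> x)) \<in> borel_measurable lebesgue"
        using fr.fc_int[OF that] unfolding I_def set_integrable_def by (rule borel_measurable_integrable)
      then show ?thesis unfolding Ff_def by (intro measurable_compose[OF _ measurable_ennreal] measurable_compose[OF _ borel_measurable_norm])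
    qed
    have Fam: "Fa p \<in> borel_measurable lebesgue" if "p \<in> A \<times> B" for p
    proof -
      have "set_integrable lebesgue (cbx x d) (\<lambda>z. (a (fst p) (snd p) z - fr.c (fst p) (snd p)) * v (fst p) z)"
        using that by (intro fr.acv_int) auto
      then have "(\<lambda>z. I z *\<^sub>R ((a (fst p) (snd p) z - a (fst p) (snd p) x) * v (fst p) z)) \<in> borel_measurable lebesgue"
        unfolding I_def set_integrable_def fr.c_def by (rule borel_measurable_integrable)
      then show ?thesis unfolding Fa_def by (intro measurable_compose[OF _ measurable_ennreal] borel_measurable_divide measurable_compose[OF _ borel_measurable_norm] borel_measurable_const)
    qed
    have S0: "0 \<le> S z" for z unfolding S_def by (intro sum_nonneg) auto
    have F0: "0 \<le> F j z" for j z
      unfolding F_def using I01[of z] C0(1) c w0[of j] S0 kerc_nonneg[of \<kappa> m j "z - x"] by (intro mult_nonneg_nonneg add_nonneg_nonneg) auto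
    have kerm: "(\<lambda>z. kerc \<kappa> m j (z - x)) \<in> borel_measurable lebesgue" for j
    proof -
      have "continuous_on UNIV (\<lambda>z. qdist \<kappa> (z - x) 0)"
        using continuous_on_qdist[OF kpos, of UNIV x] unfolding qdist_diff[of \<kappa> _ x] .
      then have "continuous_on UNIV (\<lambda>z. kerc \<kappa> m j (z - x))"
        unfolding kerc_def by (intro continuous_intros) (auto simp: max_def)
      then have "(\<lambda>z. kerc \<kappa> m j (z - x)) \<in> borel_measurable borel" by (rule borel_measurable_continuous_onI)
      then show ?thesis by (simp add: measurable_completion)
    qed
    have ISm: "(\<lambda>z. I z * S z) \<in> borel_measurable lebesgue"
    proof -
      have "I z * S z = (\<Sum>\<beta>\<in>B. cmod (I z *\<^sub>R gfun A v a f x \<beta> z))" for z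
        using I01[of z] by (auto simp: S_def)
      moreover have "(\<lambda>z. \<Sum>\<beta>\<in>B. cmod (I z *\<^sub>R gfun A v a f x \<beta> z)) \<in> borel_measurable lebesgue"
      proof (intro borel_measurable_sum measurable_compose[OF _ borel_measurable_norm])
        fix \<beta> assume "\<beta> \<in> B"
        then show "(\<lambda>z. I z *\<^sub>R gfun A v a f x \<beta> z) \<in> borel_measurable lebesgue"
          using fr.g_int[of \<beta>] unfolding I_def set_integrable_def by (intro borel_measurable_integrable)
      qed
      ultimately show ?thesis by simp
    qed
    have Fm: "(\<lambda>z. ennreal (F j z)) \<in> borel_measurable lebesgue" for j
    proof -
      have "F j z = (C0 * (c * w j)) * (kerc \<kappa> m j (z - x) + 1 / 4 ^ j) * (I z * S z)" for z by (simp add: F_def)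
      moreover have "(\<lambda>z. (C0 * (c * w j)) * (kerc \<kappa> m j (z - x) + 1 / 4 ^ j) * (I z * S z)) \<in> borel_measurable lebesgue"
        by (intro borel_measurable_times borel_measurable_add kerm ISm borel_measurable_const)
      ultimately show ?thesis by (simp add: measurable_compose[OF _ measurable_ennreal])
    qed
    have Sle: "ennreal (I z * S z) \<le> (\<Sum>\<beta>\<in>B. Ff \<beta> z) + ennreal M * (\<Sum>p\<in>A \<times> B. Fa p z)" for z
    proof -
      have "cmod (gfun A v a f x \<beta> z) \<le> cmod (f \<beta> z - f \<beta> x) + (\<Sum>\<alpha>\<in>A. cmod ((a \<alpha> \<beta> z - a \<alpha> \<beta> x) * v \<alpha> z))" for \<beta>
        unfolding gfun_def by (rule order_trans[OF norm_triangle_ineq4]) (intro add_left_mono norm_sum)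
      then have "S z \<le> (\<Sum>\<beta>\<in>B. cmod (f \<beta> z - f \<beta> x) + (\<Sum>\<alpha>\<in>A. cmod ((a \<alpha> \<beta> z - a \<alpha> \<beta> x) * v \<alpha> z)))"
        unfolding S_def by (rule sum_mono)
      also have "\<dots> = (\<Sum>\<beta>\<in>B. cmod (f \<beta> z - f \<beta> x)) + (\<Sum>p\<in>A \<times> B. cmod ((a (fst p) (snd p) z - a (fst p) (snd p) x) * v (fst p) z))"
        unfolding sum.distrib by (subst sum.swap) (simp add: sum.cartesian_product case_prod_beta)
      finally have "I z * S z \<le> I z * \<dots>" using I01[of z] by auto
      also have "\<dots> = (\<Sum>\<beta>\<in>B. cmod (I z *\<^sub>R (f \<beta> z - f \<beta> x))) + M * (\<Sum>p\<in>A \<times> B. cmod (I z *\<^sub>R ((a (fst p) (snd p) z - a (fst p) (snd p) x) * v (fst p) z)) / M)"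
        using I01[of z] M by (auto simp: sum_divide_distrib[symmetric])
      finally have "ennreal (I z * S z) \<le> ennreal \<dots>" by (rule ennreal_leI)
      also have "\<dots> = (\<Sum>\<beta>\<in>B. Ff \<beta> z) + ennreal M * (\<Sum>p\<in>A \<times> B. Fa p z)"
        unfolding Ff_def Fa_def using M by (simp add: ennreal_plus ennreal_mult sum_nonneg sum_ennreal del: norm_scaleR)
      finally show ?thesis .
    qed
    \<comment> \<open>At \<open>z = x\<close> the function \<open>gfun\<close> vanishes, and outside
      the box the indicator does; elsewhere the distance to \<open>x\<close> lies in (0, s0], where
      the sum of the block kernels is bounded by \<open>kernel_sum_bound\<close>.\<close>
    have Fsum: "(\<Sum>j<n. ennreal (F j z)) \<le> ennreal (C0 * c * 5) * (\<Phi> z * (\<Sum>\<beta>\<in>B. Ff \<beta> z) + ennreal M * (\<Phi> z * (\<Sum>p\<in>A \<times> B. Fa p z)))" for z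
    proof (cases "z = x \<or> z \<notin> cbx x d")
      case True
      then have "F j z = 0" for j by (auto simp: F_def I_def S_def gfun_def)
      then show ?thesis by simp
    next
      case False
      have t: "0 < t z" "t z \<le> s0"
      proof -
        show "0 < t z" using False qdist_pos[of z x \<kappa>] by (simp add: t_def)
        have "\<forall>l. \<bar>(z - x)$l\<bar> \<le> d" using False by (auto simp: cbx_def)
        then show "t z \<le> s0" unfolding t_def qdist_diff[of \<kappa> z x] by (rule ds)
      qed
      have "(\<Sum>j<n. F j z) = (C0 * c * (\<Sum>j<n. w j * (2 ^ (j * K) / max 1 (2 ^ j * t z) ^ NNc \<kappa> m + 1 / 4 ^ j))) * (I z * S z)"
        unfolding F_def kerc_def t_def K_def qdist_diff[of \<kappa> z x] sum_distrib_left sum_distrib_right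
        by (intro sum.cong refl) (simp only: mult_ac)
      also have "\<dots> \<le> (C0 * c * (5 * (min 1 (r / t z) / t z ^ K))) * (I z * S z)"
        unfolding w_def using t r s0(1) K C0(1) c S0[of z] I01[of z]
        by (intro mult_right_mono mult_left_mono kernel_sum_bound) (auto simp: NNc_def K_def)
      finally have "ennreal (\<Sum>j<n. F j z) \<le> ennreal ((C0 * c * 5) * (min 1 (r / t z) / t z ^ K) * (I z * S z))"
        by (intro ennreal_leI) (simp only: mult_ac)
      also have "\<dots> = ennreal (C0 * c * 5) * (\<Phi> z * ennreal (I z * S z))"
        using C0(1) c t r S0[of z] I01[of z] unfolding \<Phi>_def by (subst ennreal_mult, force, force, subst ennreal_mult) (auto simp: mult_ac)
      also have "\<dots> \<le> ennreal (C0 * c * 5) * (\<Phi> z * ((\<Sum>\<beta>\<in>B. Ff \<beta> z) + ennreal M * (\<Sum>p\<in>A \<times> B. Fa p z)))"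
        by (intro mult_left_mono Sle) auto
      finally show ?thesis using F0 by (simp add: sum_ennreal distrib_left mult_ac)
    qed
    have x\<rho>: "cpt_subset (qball \<kappa> x \<rho>) (qball \<kappa> 0 R0)" if "\<rho> < 2 * s0" for \<rho>
      by (rule cpt_subset_qball[OF kpos]) (use x s0 that in \<open>simp add: algebra_simps\<close>)
    have Lf: "(\<integral>\<^sup>+z. \<Phi> z * (\<Sum>\<beta>\<in>B. Ff \<beta> z) \<partial>lebesgue) \<le> ennreal (2 ^ (K + 2) * D) * DI \<gamma> R0 r (osc_f \<kappa> B R0 f)"
      unfolding \<Phi>_def
    proof (rule layer_osc[OF _ tm r(1) \<gamma> s0(2)])
      show "(\<lambda>z. \<Sum>\<beta>\<in>B. Ff \<beta> z) \<in> borel_measurable lebesgue" by (intro borel_measurable_sum Ffm)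
      fix \<rho> assume \<rho>: "0 < \<rho>" "\<rho> < 2 * s0"
      show "(\<integral>\<^sup>+z. indicator {z. t z < \<rho>} z * (\<Sum>\<beta>\<in>B. Ff \<beta> z) \<partial>lebesgue) \<le> ennreal (D * \<rho> ^ K) * osc_f \<kappa> B R0 f \<rho>"
        unfolding t_def D_def K_def
      proof (rule osc_average_le[OF kpos \<rho>(1) finB Ffm, where u = "\<lambda>\<beta> z. ennreal (cmod (f \<beta> z - f \<beta> x))"])
        show "Ff \<beta> z \<le> ennreal (cmod (f \<beta> z - f \<beta> x))" for \<beta> z using I01[of z] by (auto simp: Ff_def)
        show "(\<Sum>i\<in>B. (\<integral>\<^sup>+z\<in>qball \<kappa> x \<rho>. ennreal (cmod (f i z - f i x)) \<partial>lebesgue) / emeasure lebesgue (qball \<kappa> x \<rho>)) \<le> osc_f \<kappa> B R0 f \<rho>"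
          unfolding osc_f_def by (rule SUP_upper2[of x]) (use x\<rho>[OF \<rho>(2)] in auto)
      qed
    qed (use D in simp)
    have La: "(\<integral>\<^sup>+z. \<Phi> z * (\<Sum>p\<in>A \<times> B. Fa p z) \<partial>lebesgue) \<le> ennreal (2 ^ (K + 2) * D) * DI \<gamma> R0 r (osc_a \<kappa> A B R0 a)"
      unfolding \<Phi>_def
    proof (rule layer_osc[OF _ tm r(1) \<gamma> s0(2)])
      show "(\<lambda>z. \<Sum>p\<in>A \<times> B. Fa p z) \<in> borel_measurable lebesgue" by (intro borel_measurable_sum Fam)
      fix \<rho> assume \<rho>: "0 < \<rho>" "\<rho> < 2 * s0"
      show "(\<integral>\<^sup>+z. indicator {z. t z < \<rho>} z * (\<Sum>p\<in>A \<times> B. Fa p z) \<partial>lebesgue) \<le> ennreal (D * \<rho> ^ K) * osc_a \<kappa> A B R0 a \<rho>"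
        unfolding t_def D_def K_def
      proof (rule osc_average_le[OF kpos \<rho>(1) finite_cartesian_product[OF finA finB] Fam, where u = "\<lambda>p z. ennreal (cmod (a (fst p) (snd p) z - a (fst p) (snd p) x))"])
        fix p z assume p: "p \<in> A \<times> B"
        show "Fa p z \<le> ennreal (cmod (a (fst p) (snd p) z - a (fst p) (snd p) x))"
        proof (cases "I z = 0")
          case False
          then have "z \<in> cbx x d" by (auto simp: I_def indicator_def)
          then have "cmod (v (fst p) z) \<le> M" using p fr.box.sub fr.box.v_le[of "fst p" z] by auto
          then have "cmod (a (fst p) (snd p) z - a (fst p) (snd p) x) * cmod (v (fst p) z) \<le> cmod (a (fst p) (snd p) z - a (fst p) (snd p) x) * M"
            by (intro mult_left_mono) auto
          then show ?thesis using I01[of z] False M unfolding Fa_def by (intro ennreal_leI) (simp add: norm_mult divide_le_eq)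
        qed (simp add: Fa_def)
      next
        show "(\<Sum>p\<in>A \<times> B. (\<integral>\<^sup>+z\<in>qball \<kappa> x \<rho>. ennreal (cmod (a (fst p) (snd p) z - a (fst p) (snd p) x)) \<partial>lebesgue) / emeasure lebesgue (qball \<kappa> x \<rho>)) \<le> osc_a \<kappa> A B R0 a \<rho>"
          unfolding osc_a_def by (rule SUP_upper2[of x]) (use x\<rho>[OF \<rho>(2)] in \<open>auto simp: sum.cartesian_product case_prod_beta\<close>)
      qed
    qed (use D in simp)
    have \<Phi>m: "\<Phi> \<in> borel_measurable lebesgue"
    proof -
      have "\<Phi> \<in> borel_measurable borel" unfolding \<Phi>_def by measurable
      then show ?thesis by (simp add: measurable_completion)
    qed
    have P1: "(\<Sum>j<n. \<integral>\<^sup>+z. ennreal (F j z) \<partial>lebesgue) \<le> ennreal (C0 * c * 5) * (ennreal (2 ^ (K + 2) * D) * DI \<gamma> R0 r (osc_f \<kappa> B R0 f) + ennreal M * (ennreal (2 ^ (K + 2) * D) * DI \<gamma> R0 r (osc_a \<kappa> A B R0 a)))"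
    proof -
      have m1: "(\<lambda>z. \<Phi> z * (\<Sum>\<beta>\<in>B. Ff \<beta> z)) \<in> borel_measurable lebesgue" by (intro borel_measurable_times_ennreal \<Phi>m borel_measurable_sum Ffm)
      have m2: "(\<lambda>z. \<Phi> z * (\<Sum>p\<in>A \<times> B. Fa p z)) \<in> borel_measurable lebesgue" by (intro borel_measurable_times_ennreal \<Phi>m borel_measurable_sum Fam)
      have m3: "(\<lambda>z. ennreal M * (\<Phi> z * (\<Sum>p\<in>A \<times> B. Fa p z))) \<in> borel_measurable lebesgue" by (intro borel_measurable_times_ennreal m2 borel_measurable_const)
      have m4: "(\<lambda>z. \<Phi> z * (\<Sum>\<beta>\<in>B. Ff \<beta> z) + ennreal M * (\<Phi> z * (\<Sum>p\<in>A \<times> B. Fa p z))) \<in> borel_measurable lebesgue" by (intro borel_measurable_add m1 m3)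
      have "(\<Sum>j<n. \<integral>\<^sup>+z. ennreal (F j z) \<partial>lebesgue) = (\<integral>\<^sup>+z. (\<Sum>j<n. ennreal (F j z)) \<partial>lebesgue)"
        by (rule nn_integral_sum[symmetric]) (rule Fm)
      also have "\<dots> \<le> (\<integral>\<^sup>+z. ennreal (C0 * c * 5) * (\<Phi> z * (\<Sum>\<beta>\<in>B. Ff \<beta> z) + ennreal M * (\<Phi> z * (\<Sum>p\<in>A \<times> B. Fa p z))) \<partial>lebesgue)"
        by (intro nn_integral_mono Fsum)
      also have "\<dots> = ennreal (C0 * c * 5) * ((\<integral>\<^sup>+z. \<Phi> z * (\<Sum>\<beta>\<in>B. Ff \<beta> z) \<partial>lebesgue) + ennreal M * (\<integral>\<^sup>+z. \<Phi> z * (\<Sum>p\<in>A \<times> B. Fa p z) \<partial>lebesgue))"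
        by (simp only: nn_integral_cmult[OF m4] nn_integral_add[OF m1 m3] nn_integral_cmult[OF m2])
      also have "\<dots> \<le> ennreal (C0 * c * 5) * (ennreal (2 ^ (K + 2) * D) * DI \<gamma> R0 r (osc_f \<kappa> B R0 f) + ennreal M * (ennreal (2 ^ (K + 2) * D) * DI \<gamma> R0 r (osc_a \<kappa> A B R0 a)))"
        by (intro mult_left_mono add_mono Lf La) auto
      finally show ?thesis .
    qed
    have P2: "(\<Sum>j<n. ennreal (C0 * (c * w j) * M / 4 ^ j)) \<le> ennreal (C0 * L * c) * ennreal (M * r)"
    proof -
      have "(\<Sum>j<n. C0 * (c * w j) * M / 4 ^ j) = C0 * c * M * (\<Sum>j<n. w j * (1 / 4 ^ j))"
        unfolding sum_distrib_left by (intro sum.cong refl) simp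
      also have "\<dots> \<le> C0 * c * M * (2 * r)"
        unfolding w_def using C0(1) c M r by (intro mult_left_mono sum_weight_quarter) auto
      also have "\<dots> \<le> C0 * c * M * (L * r)" using C0(1) c M r L by (intro mult_left_mono mult_right_mono) auto
      finally have "ennreal (\<Sum>j<n. C0 * (c * w j) * M / 4 ^ j) \<le> ennreal ((C0 * L * c) * (M * r))"
        by (intro ennreal_leI) (simp add: mult_ac)
      also have "\<dots> = ennreal (C0 * L * c) * ennreal (M * r)" using C0(1) c M r L by (intro ennreal_mult) auto
      finally show ?thesis using C0(1) c M w0 by (simp add: sum_ennreal)
    qed
    have "ennreal (\<Sum>j<n. cmod (Zb d x (v \<alpha>) j (q j))) = (\<Sum>j<n. ennreal (cmod (Zb d x (v \<alpha>) j (q j))))"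
      by (simp add: sum_ennreal)
    also have "\<dots> \<le> (\<Sum>j<n. ennreal (C0 * (c * w j) * M / 4 ^ j) + (\<integral>\<^sup>+z. ennreal (F j z) \<partial>lebesgue))"
    proof (rule sum_mono)
      fix j
      have "Qb (NNc \<kappa> m) (c * w j) (q j)" "0 \<le> c * w j" using q c w0[of j] by (auto simp: w_def)
      then show "ennreal (cmod (Zb d x (v \<alpha>) j (q j))) \<le> ennreal (C0 * (c * w j) * M / 4 ^ j) + (\<integral>\<^sup>+z. ennreal (F j z) \<partial>lebesgue)"
        unfolding Zb_def F_def S_def I_def by (intro C0(2)[OF fr \<alpha>])
    qed
    also have "\<dots> \<le> ennreal (C0 * L * c) * ennreal (M * r) + ennreal (C0 * c * 5) * (ennreal (2 ^ (K + 2) * D) * DI \<gamma> R0 r (osc_f \<kappa> B R0 f) + ennreal M * (ennreal (2 ^ (K + 2) * D) * DI \<gamma> R0 r (osc_a \<kappa> A B R0 a)))"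
      unfolding sum.distrib by (intro add_mono P1 P2)
    also have "\<dots> = ennreal (C0 * L * c) * (ennreal (M * r) + DI \<gamma> R0 r (osc_f \<kappa> B R0 f) + ennreal M * DI \<gamma> R0 r (osc_a \<kappa> A B R0 a))"
    proof -
      have "ennreal (C0 * L * c) = ennreal (C0 * c * 5 * (2 ^ (K + 2) * D))" by (simp add: L_def mult_ac)
      also have "\<dots> = ennreal (C0 * c * 5) * ennreal (2 ^ (K + 2) * D)" using C0(1) c D by (intro ennreal_mult) auto
      finally have e: "ennreal (C0 * L * c) = ennreal (C0 * c * 5) * ennreal (2 ^ (K + 2) * D)" .
      show ?thesis unfolding e by (simp only: distrib_left mult.assoc mult.left_commute add.assoc)
    qed
    finally show "ennreal (\<Sum>j<n. cmod (Zb d x (v \<alpha>) j (q j))) \<le> ennreal (C0 * L * c) * (ennreal (M * r) + DI \<gamma> R0 r (osc_f \<kappa> B R0 f) + ennreal M * DI \<gamma> R0 r (osc_a \<kappa> A B R0 a))" .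
  qed
qed

end

section \<open>Approximate identity\<close>

definition LV :: "real \<Rightarrow> real^'n::finite \<Rightarrow> (real^'n \<Rightarrow> complex) \<Rightarrow> ('n \<Rightarrow> int) \<Rightarrow> complex" where
  "LV d x V k = (LINT z:cbx x d|lebesgue. V z * tens x (ekt d k) z)"

definition cutoff :: "real \<Rightarrow> real^'n::finite \<Rightarrow> real^'n \<Rightarrow> complex" where
  "cutoff d x = tens x (\<lambda>l. zet d)"

text \<open>A smoothed Dirichlet kernel: the trigonometric polynomial of the low-pass cutoff at
  scale \<open>J\<close>, which acts as a mollifier on the box.\<close>

definition Ph :: "'n::finite mindex \<Rightarrow> real \<Rightarrow> nat \<Rightarrow> real^'n \<Rightarrow> complex" where
  "Ph \<kappa> d J w = (\<Sum>k\<in>Kset \<kappa> d J. phin (etak \<kappa> (pi / d) J k) * ek (pi / d) k w)"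

lemma tens_ekt: "tens x (ekt d k) z = cutoff d x z * ek (pi / d) k (z - x)"
  by (simp add: cutoff_def tens_def ekt_def ek_def prod.distrib mult.commute)

lemma continuous_on_cutoff: "0 < d \<Longrightarrow> continuous_on S (cutoff d x)"
  unfolding cutoff_def by (intro continuous_on_subset[OF continuous_on_tens subset_UNIV] smooth1_continuous_on0 test1_smooth1[OF zet_test1])

lemma continuous_on_Ph: "continuous_on S (\<lambda>z. Ph \<kappa> d J (z - x))"
  unfolding Ph_def by (intro continuous_on_sum continuous_on_mult continuous_on_const continuous_on_compose2[OF continuous_on_ek[of UNIV]] continuous_intros) auto

lemma cutoff_real: "\<exists>r. 0 \<le> r \<and> r \<le> 1 \<and> cutoff d x z = complex_of_real r"
proof (intro exI conjI)
  show "cutoff d x z = complex_of_real (\<Prod>l\<in>UNIV. phi1 (4 / d * (z$l - x$l)))" by (simp add: cutoff_def tens_def zet_def)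
qed (auto intro!: prod_nonneg prod_le_1 phi1)

lemma cutoff_one:
  assumes "0 < d" "\<And>l. \<bar>z$l - x$l\<bar> \<le> d / 4" shows "cutoff d x z = 1"
  using zet_one[OF assms] by (simp add: cutoff_def tens_def)

lemma cutoff_zero:
  assumes "0 < d" "d / 2 < \<bar>z$l - x$l\<bar>" shows "cutoff d x z = 0"
proof -
  have "zet d (z$l - x$l) = 0" by (rule test1_zero[OF zet_test1[OF assms(1)] assms(2)])
  then show ?thesis unfolding cutoff_def tens_def by (intro prod_zero[OF finite] bexI[of _ l]) auto
qed

lemma Ph_bound:
  fixes \<kappa> :: "'n::finite mindex"
  assumes d: "0 < d" and \<kappa>: "\<forall>l. 0 < \<kappa> l"
  shows "\<exists>C\<ge>0. \<forall>J w. (\<forall>l. \<bar>w$l\<bar> \<le> d) \<longrightarrow> cmod (Ph \<kappa> d J w) \<le> C * kerc \<kappa> m J w"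
proof -
  obtain K0 where K0: "K0 \<ge> 1" "Qb (NNc \<kappa> m) K0 (\<lambda>\<eta>::'n\<Rightarrow>real. phin \<eta>)" using Qb_phin by blast
  have K0': "0 \<le> K0" using K0 by simp
  show ?thesis
  proof (rule exE[OF kernel_bound_plain[where D = 0 and w = "\<lambda>\<eta>::'n\<Rightarrow>real. phin \<eta>", OF d \<kappa> K0(2) _ K0']])
    fix \<eta> :: "'n \<Rightarrow> real" and l assume "2 < \<bar>\<eta> l\<bar>" then show "phin \<eta> = 0" by (rule phin_zero)
  next
    fix C assume C: "0 \<le> C \<and> (\<forall>q Aq i j z. 0 \<le> Aq \<longrightarrow> Qb (NNc \<kappa> m) Aq q \<longrightarrow> (\<forall>l. i l \<le> 0) \<longrightarrow> (\<forall>l. \<bar>z$l\<bar> \<le> d) \<longrightarrow>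
      cmod (\<Sum>k\<in>Kset \<kappa> d j. phin (etak \<kappa> (pi / d) j k) * q (etak \<kappa> (pi / d) j k) * mipow (\<lambda>l. - \<i> * of_real (xik d k l)) i * ek (pi / d) k z)
       \<le> C * Aq * 2 ^ (j * mdot i \<kappa>) * (2 ^ (j * msum \<kappa>) / max 1 (2 ^ j * qdist \<kappa> z 0) ^ NNc \<kappa> m))"
    show ?thesis
    proof (intro exI[of _ C] conjI allI impI)
      show "0 \<le> C" using C by blast
      fix J and w :: "real^'n" assume w: "\<forall>l. \<bar>w$l\<bar> \<le> d"
      have "Qb (NNc \<kappa> m) 1 (\<lambda>\<eta>::'n\<Rightarrow>real. 1)" by (rule Qb_const) simp
      from C[THEN conjunct2, rule_format, of 1 "\<lambda>_. 1" "\<lambda>_. 0" w J, OF _ this] w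
      show "cmod (Ph \<kappa> d J w) \<le> C * kerc \<kappa> m J w"
        by (simp add: Ph_def kerc_def mipow_def mdot_def)
    qed
  qed
qed

lemma Kset_Suc: "Kset \<kappa> d J \<subseteq> Kset \<kappa> d (Suc J)"
proof
  fix k assume k: "k \<in> Kset \<kappa> d J"
  have "\<bar>etak \<kappa> (pi / d) (Suc J) k l\<bar> \<le> \<bar>etak \<kappa> (pi / d) J k l\<bar>" for l
  proof -
    have "etak \<kappa> (pi / d) J k l = 2 ^ \<kappa> l * etak \<kappa> (pi / d) (Suc J) k l" by (simp add: etak_def power_add)
    moreover have "1 * \<bar>etak \<kappa> (pi / d) (Suc J) k l\<bar> \<le> 2 ^ \<kappa> l * \<bar>etak \<kappa> (pi / d) (Suc J) k l\<bar>"
      by (intro mult_right_mono) auto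
    ultimately show ?thesis by (simp add: abs_mult)
  qed
  then show "k \<in> Kset \<kappa> d (Suc J)" using k by (auto simp: Kset_def intro: order_trans)
qed

text \<open>\<open>chin\<close> at scale \<open>Suc j\<close> is the difference of the low-pass
  cutoffs at scales \<open>Suc j\<close> and \<open>j\<close>. The index sets grow with the scale,
  and the added indices contribute 0 to the coarser sum.\<close>

lemma phin_telescope:
  assumes d: "0 < d"
  shows "(\<Sum>k\<in>Kset \<kappa> d J. phin (etak \<kappa> (pi / d) J k) * L k) = (\<Sum>k\<in>Kset \<kappa> d 0. phin (etak \<kappa> (pi / d) 0 k) * L k)
    + (\<Sum>j<J. \<Sum>k\<in>Kset \<kappa> d (Suc j). chin \<kappa> (etak \<kappa> (pi / d) (Suc j) k) * L k)"
proof (induction J)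
  case (Suc J)
  have e: "(\<lambda>l. 2 ^ \<kappa> l * etak \<kappa> (pi / d) (Suc J) k l) = etak \<kappa> (pi / d) J k" for k
    by (simp add: etak_def power_add fun_eq_iff)
  have "(\<Sum>k\<in>Kset \<kappa> d J. phin (etak \<kappa> (pi / d) J k) * L k) = (\<Sum>k\<in>Kset \<kappa> d (Suc J). phin (etak \<kappa> (pi / d) J k) * L k)"
  proof (rule sum.mono_neutral_left[OF finite_Kset[OF d] Kset_Suc], intro ballI)
    fix k assume "k \<in> Kset \<kappa> d (Suc J) - Kset \<kappa> d J"
    then obtain l where "2 < \<bar>etak \<kappa> (pi / d) J k l\<bar>" by (auto simp: Kset_def not_le)
    then have "phin (etak \<kappa> (pi / d) J k) = 0" by (rule phin_zero)
    then show "phin (etak \<kappa> (pi / d) J k) * L k = 0" by simp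
  qed
  moreover have "(\<Sum>k\<in>Kset \<kappa> d (Suc J). phin (etak \<kappa> (pi / d) (Suc J) k) * L k)
    = (\<Sum>k\<in>Kset \<kappa> d (Suc J). chin \<kappa> (etak \<kappa> (pi / d) (Suc J) k) * L k) + (\<Sum>k\<in>Kset \<kappa> d (Suc J). phin (etak \<kappa> (pi / d) J k) * L k)"
    unfolding sum.distrib[symmetric] by (intro sum.cong refl) (simp add: chin_def e algebra_simps)
  ultimately show ?case using Suc by simp
qed simp

text \<open>Only k = 0 contributes, where \<open>phin\<close> is 1. This is why the decomposition
  converges to the value at the centre times the volume of the box.\<close>

lemma LINT_Ph:
  fixes x :: "real^'n::finite"
  assumes d: "0 < d"
  shows "(LINT z:cbx x d|lebesgue. Ph \<kappa> d J (z - x)) = of_real ((2 * d) ^ CARD('n))"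
proof -
  have "(LINT z:cbx x d|lebesgue. Ph \<kappa> d J (z - x)) = (\<Sum>k\<in>Kset \<kappa> d J. phin (etak \<kappa> (pi / d) J k) * (LINT z:cbx x d|lebesgue. ek (pi / d) k (z - x)))"
    unfolding Ph_def by (rule set_integral_sum_mult[symmetric]) (rule set_integrable_ek)
  also have "\<dots> = (\<Sum>k\<in>{\<lambda>l. 0}. phin (etak \<kappa> (pi / d) J k) * (LINT z:cbx x d|lebesgue. ek (pi / d) k (z - x)))"
    by (rule sum.mono_neutral_right[OF finite_Kset[OF d]]) (auto simp: LINT_ek[OF d] Kset_def etak_def)
  also have "\<dots> = of_real ((2 * d) ^ CARD('n))"
    by (simp add: LINT_ek[OF d] phin_one etak_def)
  finally show ?thesis .
qed

lemma VJ_eq: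
  assumes d: "0 < d" and V: "continuous_on (cbx x d) V"
  shows "(\<Sum>k\<in>Kset \<kappa> d J. phin (etak \<kappa> (pi / d) J k) * LV d x V k) = (LINT z:cbx x d|lebesgue. V z * cutoff d x z * Ph \<kappa> d J (z - x))"
proof -
  have ekc: "continuous_on S (\<lambda>z. ek (pi / d) k (z - x))" for S k
    by (intro continuous_on_compose2[OF continuous_on_ek[of UNIV]] continuous_intros) auto
  have "(\<Sum>k\<in>Kset \<kappa> d J. phin (etak \<kappa> (pi / d) J k) * LV d x V k) = (\<Sum>k\<in>Kset \<kappa> d J. phin (etak \<kappa> (pi / d) J k) * (LINT z:cbx x d|lebesgue. V z * cutoff d x z * ek (pi / d) k (z - x)))"
    unfolding LV_def tens_ekt by (simp only: mult.assoc)
  also have "\<dots> = (LINT z:cbx x d|lebesgue. \<Sum>k\<in>Kset \<kappa> d J. phin (etak \<kappa> (pi / d) J k) * (V z * cutoff d x z * ek (pi / d) k (z - x)))"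
    by (rule set_integral_sum_mult) (intro set_integrable_cbx_continuous continuous_on_mult V continuous_on_cutoff d ekc)
  also have "\<dots> = (LINT z:cbx x d|lebesgue. V z * cutoff d x z * Ph \<kappa> d J (z - x))"
    unfolding Ph_def sum_distrib_left by (simp only: mult.left_commute)
  finally show ?thesis .
qed

lemma dyadic_scale:
  fixes \<tau> :: real
  assumes "1 \<le> \<tau>" "\<tau> < 2 ^ Suc J" shows "\<exists>i\<le>J. 2 ^ i \<le> \<tau> \<and> \<tau> < 2 ^ Suc i"
  using assms(2)
proof (induction J)
  case 0 then show ?case using assms(1) by simp
next
  case (Suc J)
  then show ?case by (cases "\<tau> < 2 ^ Suc J") (auto intro: le_SucI)
qed

text \<open>The box lies within quasi-distance 1, so dyadic balls up to index \<open>J\<close> cover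
  it. The i-th ball has volume of order 2^((i - J) |\<kappa>|), and the decay beyond order
  |\<kappa>| leaves a geometric series.\<close>

lemma kerc_L1:
  fixes x :: "real^'n::finite"
  assumes \<kappa>: "\<forall>l. 0 < \<kappa> l" and ds: "\<And>w::real^'n. \<forall>l. \<bar>w$l\<bar> \<le> d \<Longrightarrow> qdist \<kappa> w 0 \<le> 1"
  shows "(\<integral>\<^sup>+z. ennreal (indicator (cbx x d) z * kerc \<kappa> m J (z - x)) \<partial>lebesgue) \<le> ennreal (2 ^ CARD('n) * 2 ^ msum \<kappa> * 2)"
proof -
  let ?N = "NNc \<kappa> m" and ?K = "msum \<kappa>"
  let ?R = "\<lambda>i. 2 ^ Suc i / 2 ^ J :: real"
  have pt: "ennreal (indicator (cbx x d) z * kerc \<kappa> m J (z - x)) \<le> (\<Sum>i\<le>J. ennreal (2 ^ (J * ?K) / (2 ^ i) ^ ?N) * indicator (qball \<kappa> x (?R i)) z)" for z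
  proof (cases "z \<in> cbx x d")
    case True
    define \<tau> where "\<tau> = 2 ^ J * qdist \<kappa> (z - x) 0"
    have "qdist \<kappa> (z - x) 0 \<le> 1" by (rule ds) (use True in \<open>auto simp: cbx_def\<close>)
    then have \<tau>: "\<tau> \<le> 2 ^ J" by (simp add: \<tau>_def)
    have "\<exists>i\<le>J. 2 ^ i \<le> max 1 \<tau> \<and> \<tau> < 2 ^ Suc i"
    proof (cases "\<tau> < 1")
      case False
      then show ?thesis using dyadic_scale[of \<tau> J] \<tau> by (auto simp: max_def)
    qed (auto intro: exI[of _ 0])
    then obtain i where i: "i \<le> J" "2 ^ i \<le> max 1 \<tau>" "\<tau> < 2 ^ Suc i" by blast
    have "kerc \<kappa> m J (z - x) \<le> 2 ^ (J * ?K) / (2 ^ i) ^ ?N"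
      unfolding kerc_def \<tau>_def[symmetric] using i(2) by (intro divide_left_mono power_mono) auto
    then have "ennreal (indicator (cbx x d) z * kerc \<kappa> m J (z - x)) \<le> ennreal (2 ^ (J * ?K) / (2 ^ i) ^ ?N)"
      using True by (simp add: ennreal_leI)
    also have "\<dots> = ennreal (2 ^ (J * ?K) / (2 ^ i) ^ ?N) * indicator (qball \<kappa> x (?R i)) z"
      using i(3) by (simp add: qball_def \<tau>_def qdist_diff[of \<kappa> z x] less_divide_eq mult.commute)
    also have "\<dots> \<le> (\<Sum>i\<le>J. ennreal (2 ^ (J * ?K) / (2 ^ i) ^ ?N) * indicator (qball \<kappa> x (?R i)) z)"
      using i(1) by (intro member_le_sum) auto
    finally show ?thesis .
  qed simp
  have Sm: "qball \<kappa> x \<rho> \<in> sets lebesgue" for \<rho> using open_qball[OF \<kappa>] by simp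
  have "(\<integral>\<^sup>+z. ennreal (indicator (cbx x d) z * kerc \<kappa> m J (z - x)) \<partial>lebesgue) \<le> (\<integral>\<^sup>+z. (\<Sum>i\<le>J. ennreal (2 ^ (J * ?K) / (2 ^ i) ^ ?N) * indicator (qball \<kappa> x (?R i)) z) \<partial>lebesgue)"
    by (intro nn_integral_mono pt)
  also have "\<dots> = (\<Sum>i\<le>J. \<integral>\<^sup>+z. ennreal (2 ^ (J * ?K) / (2 ^ i) ^ ?N) * indicator (qball \<kappa> x (?R i)) z \<partial>lebesgue)"
    by (rule nn_integral_sum) (intro borel_measurable_times_ennreal borel_measurable_const borel_measurable_indicator Sm)
  also have "\<dots> = (\<Sum>i\<le>J. ennreal (2 ^ (J * ?K) / (2 ^ i) ^ ?N) * emeasure lebesgue (qball \<kappa> x (?R i)))"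
    by (intro sum.cong refl nn_integral_cmult_indicator Sm)
  also have "\<dots> \<le> (\<Sum>i\<le>J. ennreal (2 ^ CARD('n) * 2 ^ ?K * (1 / 2) ^ i))"
  proof (rule sum_mono)
    fix i
    have R: "0 < ?R i" by simp
    have "ennreal (2 ^ (J * ?K) / (2 ^ i) ^ ?N) * emeasure lebesgue (qball \<kappa> x (?R i)) \<le> ennreal (2 ^ (J * ?K) / (2 ^ i) ^ ?N) * ennreal (2 ^ CARD('n) * ?R i ^ ?K)"
      by (intro mult_left_mono emeasure_qball_le \<kappa> R) auto
    also have "\<dots> = ennreal (2 ^ (J * ?K) / (2 ^ i) ^ ?N * (2 ^ CARD('n) * ?R i ^ ?K))"
      by (intro ennreal_mult[symmetric]) auto
    also have "2 ^ (J * ?K) / (2 ^ i) ^ ?N * (2 ^ CARD('n) * ?R i ^ ?K) = 2 ^ CARD('n) * 2 ^ ?K * ((2 ^ i) ^ ?K / (2 ^ i) ^ ?N)"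
      by (simp add: power_divide power_mult power_mult_distrib)
    also have "ennreal \<dots> \<le> ennreal (2 ^ CARD('n) * 2 ^ ?K * (1 / 2) ^ i)"
    proof (intro ennreal_leI mult_left_mono)
      have "((2::real) ^ i) ^ ?N = (2 ^ i) ^ ?K * (2 ^ i) ^ (m + 1) * 2 ^ i" by (simp add: NNc_def power_add)
      then have "((2::real) ^ i) ^ ?K / (2 ^ i) ^ ?N = 1 / (2 ^ i) ^ (m + 1) * (1 / 2) ^ i" by (simp add: power_divide)
      also have "\<dots> \<le> 1 * (1 / 2) ^ i"
      proof (rule mult_right_mono)
        have "1 \<le> ((2::real) ^ i) ^ (m + 1)" by (intro one_le_power) simp
        then show "1 / ((2::real) ^ i) ^ (m + 1) \<le> 1" by simp
      qed simp
      finally show "((2::real) ^ i) ^ ?K / (2 ^ i) ^ ?N \<le> (1 / 2) ^ i" by simp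
    qed auto
    finally show "ennreal (2 ^ (J * ?K) / (2 ^ i) ^ ?N) * emeasure lebesgue (qball \<kappa> x (?R i)) \<le> ennreal (2 ^ CARD('n) * 2 ^ ?K * (1 / 2) ^ i)" .
  qed
  also have "\<dots> = ennreal (\<Sum>i\<le>J. 2 ^ CARD('n) * 2 ^ ?K * (1 / 2) ^ i)" by (simp add: sum_ennreal)
  also have "\<dots> \<le> ennreal (2 ^ CARD('n) * 2 ^ ?K * 2)"
  proof (rule ennreal_leI)
    have "(\<Sum>i\<le>J. (1 / 2 :: real) ^ i) = 2 - (1 / 2) ^ J" by (induction J) auto
    then have "(\<Sum>i\<le>J. (1 / 2 :: real) ^ i) \<le> 2" by simp
    then show "(\<Sum>i\<le>J. 2 ^ CARD('n) * 2 ^ ?K * (1 / 2) ^ i) \<le> 2 ^ CARD('n) * 2 ^ ?K * (2::real)"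
      unfolding sum_distrib_left[symmetric] by (intro mult_left_mono) auto
  qed
  finally show ?thesis .
qed

text \<open>The kernel has constant integral and bounded L1 norm, and away from the centre it is of
  size 4^-J. So only values near \<open>x\<close> count, and there \<open>W\<close> is small by
  continuity.\<close>

lemma approx_identity:
  fixes x :: "real^'n::finite"
  assumes d: "0 < d" and \<kappa>: "\<forall>l. 0 < \<kappa> l" and ds: "\<And>w::real^'n. \<forall>l. \<bar>w$l\<bar> \<le> d \<Longrightarrow> qdist \<kappa> w 0 \<le> 1"
    and V: "continuous_on (cbx x d) V" and M: "\<And>z. z \<in> cbx x d \<Longrightarrow> cmod (V z) \<le> M"
  shows "(\<lambda>J. \<Sum>k\<in>Kset \<kappa> d J. phin (etak \<kappa> (pi / d) J k) * LV d x V k) \<longlonglongrightarrow> of_real ((2 * d) ^ CARD('n)) * V x"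
proof -
  obtain C where C: "C \<ge> 0" "\<And>J w. \<forall>l. \<bar>w$l\<bar> \<le> d \<Longrightarrow> cmod (Ph \<kappa> d J w) \<le> C * kerc \<kappa> 0 J w"
    using Ph_bound[OF d \<kappa>, of 0] by blast
  define C1 where "C1 = (2::real) ^ CARD('n) * 2 ^ msum \<kappa> * 2"
  have C1: "0 \<le> C1" by (simp add: C1_def)
  define W where "W z = V z * cutoff d x z - V x" for z
  have x: "x \<in> cbx x d" using d by (simp add: cbx_def)
  have Wc: "continuous_on (cbx x d) W"
    unfolding W_def by (intro continuous_intros V continuous_on_cutoff d)
  have M0: "0 \<le> M" using M[OF x] norm_ge_zero order_trans by blast
  have WM: "cmod (W z) \<le> 2 * M" if "z \<in> cbx x d" for z
  proof -
    obtain r where r: "0 \<le> r" "r \<le> 1" "cutoff d x z = complex_of_real r" using cutoff_real by blast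
    have "cmod (V z * cutoff d x z) \<le> M * 1" unfolding norm_mult using M[OF that] r M0 by (intro mult_mono) auto
    then show ?thesis using M[OF x] norm_triangle_ineq4[of "V z * cutoff d x z" "V x"] by (simp add: W_def)
  qed
  have W0: "W x = 0" using cutoff_one[OF d, of x x] d by (simp add: W_def)
  have diff: "(\<Sum>k\<in>Kset \<kappa> d J. phin (etak \<kappa> (pi / d) J k) * LV d x V k) - of_real ((2 * d) ^ CARD('n)) * V x
     = (LINT z:cbx x d|lebesgue. W z * Ph \<kappa> d J (z - x))" for J
  proof -
    have "of_real ((2 * d) ^ CARD('n)) * V x = (LINT z:cbx x d|lebesgue. V x * Ph \<kappa> d J (z - x))"
      unfolding LINT_Ph[OF d, of x \<kappa> J, symmetric] by (subst mult.commute) (simp add: set_lebesgue_integral_def)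
    then show ?thesis unfolding VJ_eq[OF d V] W_def left_diff_distrib
      by (subst set_integral_diff(2)) (auto intro!: set_integrable_cbx_continuous continuous_on_mult V continuous_on_cutoff d continuous_on_Ph continuous_on_const)
  qed
  have est: "\<exists>D. \<forall>J. cmod (LINT z:cbx x d|lebesgue. W z * Ph \<kappa> d J (z - x)) \<le> \<epsilon> * (C * C1) + D / 4 ^ J" if \<epsilon>: "0 < \<epsilon>" for \<epsilon>
  proof -
    obtain \<delta>' where \<delta>': "0 < \<delta>'" "\<And>z. z \<in> cbx x d \<Longrightarrow> dist z x < \<delta>' \<Longrightarrow> dist (W z) (W x) < \<epsilon>"
      using Wc x \<epsilon> unfolding continuous_on_iff by metis
    \<comment> \<open>A quasi-distance below \<delta> \<le> 1 bounds every coordinate by \<delta>;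
      the dimension in the denominator then brings the Euclidean distance below \<delta>'.\<close>
    define \<delta> where "\<delta> = min 1 (\<delta>' / (2 * CARD('n)))"
    have \<delta>: "0 < \<delta>" "\<delta> \<le> 1" using \<delta>'(1) by (auto simp: \<delta>_def)
    have near: "cmod (W z) \<le> \<epsilon>" if z: "z \<in> cbx x d" "qdist \<kappa> (z - x) 0 < \<delta>" for z
    proof -
      have "\<bar>(z - x)$l\<bar> \<le> \<delta>" for l
      proof -
        have "\<bar>(z - x)$l - 0$l\<bar> \<le> \<delta> ^ \<kappa> l" by (rule qdist_coord_le) (use \<kappa> z in auto)
        also have "\<dots> \<le> \<delta> ^ 1" using \<delta> \<kappa>[rule_format, of l] by (intro power_decreasing) auto
        finally show ?thesis by simp
      qed
      then have "(\<Sum>l\<in>UNIV. \<bar>(z - x)$l\<bar>) \<le> (\<Sum>l\<in>(UNIV::'n set). \<delta>)" by (intro sum_mono)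
      also have "\<dots> = CARD('n) * \<delta>" by simp
      also have "\<dots> \<le> CARD('n) * (\<delta>' / (2 * CARD('n)))" unfolding \<delta>_def by (intro mult_left_mono) auto
      also have "\<dots> < \<delta>'" using \<delta>'(1) by simp
      finally have "dist z x < \<delta>'" using norm_le_l1_cart[of "z - x"] by (simp add: dist_norm)
      then show ?thesis using \<delta>'(2)[OF z(1)] W0 by (simp add: dist_norm)
    qed
    define E where "E J = 2 * M * C * ((1 / \<delta>) ^ NNc \<kappa> 0 / 4 ^ J)" for J :: nat
    have E: "0 \<le> E J" for J using M0 C \<delta> by (simp add: E_def)
    show ?thesis
    proof (intro exI[of _ "2 * M * C * (1 / \<delta>) ^ NNc \<kappa> 0 * (2 * d) ^ CARD('n)"] allI)
      fix J
      have pt: "cmod (W z * Ph \<kappa> d J (z - x)) \<le> \<epsilon> * C * kerc \<kappa> 0 J (z - x) + E J" if z: "z \<in> cbx x d" for z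
      proof -
        have P: "cmod (Ph \<kappa> d J (z - x)) \<le> C * kerc \<kappa> 0 J (z - x)" by (rule C(2)) (use z in \<open>auto simp: cbx_def\<close>)
        have CK: "0 \<le> C * kerc \<kappa> 0 J (z - x)" by (intro mult_nonneg_nonneg C(1) kerc_nonneg)
        show ?thesis
        proof (cases "qdist \<kappa> (z - x) 0 < \<delta>")
          case True
          have "cmod (W z * Ph \<kappa> d J (z - x)) \<le> \<epsilon> * (C * kerc \<kappa> 0 J (z - x))"
            unfolding norm_mult by (intro mult_mono near z True P) (use \<epsilon> in auto)
          then show ?thesis using E[of J] by (simp add: mult.assoc)
        next
          case False
          have "cmod (W z * Ph \<kappa> d J (z - x)) \<le> (2 * M) * (C * kerc \<kappa> 0 J (z - x))"
            unfolding norm_mult by (intro mult_mono WM z P) (use M0 in auto)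
          also have "\<dots> \<le> (2 * M) * (C * ((1 / \<delta>) ^ NNc \<kappa> 0 / 4 ^ J))"
            using False \<delta> M0 C by (intro mult_left_mono kerc_far[where m = 0, simplified]) auto
          also have "\<dots> = E J" by (simp add: E_def)
          finally have "cmod (W z * Ph \<kappa> d J (z - x)) \<le> E J" .
          moreover have "0 \<le> \<epsilon> * C * kerc \<kappa> 0 J (z - x)" using CK \<epsilon> by (simp add: mult.assoc)
          ultimately show ?thesis by simp
        qed
      qed
      have WPi: "set_integrable lebesgue (cbx x d) (\<lambda>z. W z * Ph \<kappa> d J (z - x))"
        by (intro set_integrable_cbx_continuous continuous_on_mult Wc continuous_on_Ph)
      have km: "(\<lambda>z. ennreal (indicator (cbx x d) z * kerc \<kappa> 0 J (z - x))) \<in> borel_measurable lebesgue"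
      proof -
        have "continuous_on UNIV (\<lambda>z. qdist \<kappa> (z - x) 0)"
          using continuous_on_qdist[OF \<kappa>, of UNIV x] unfolding qdist_diff[of \<kappa> _ x] .
        then have "continuous_on UNIV (\<lambda>z. kerc \<kappa> 0 J (z - x))"
          unfolding kerc_def by (intro continuous_intros) (auto simp: max_def)
        then have "(\<lambda>z. kerc \<kappa> 0 J (z - x)) \<in> borel_measurable lebesgue"
          by (simp add: borel_measurable_continuous_onI measurable_completion)
        then show ?thesis
          by (intro measurable_compose[OF _ measurable_ennreal] borel_measurable_times borel_measurable_indicator) auto
      qed
      have "ennreal (cmod (LINT z:cbx x d|lebesgue. W z * Ph \<kappa> d J (z - x))) \<le> (\<integral>\<^sup>+z. ennreal (cmod (indicator (cbx x d) z *\<^sub>R (W z * Ph \<kappa> d J (z - x)))) \<partial>lebesgue)"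
        unfolding set_lebesgue_integral_def using WPi unfolding set_integrable_def by (rule integral_norm_bound_ennreal)
      also have "\<dots> \<le> (\<integral>\<^sup>+z. ennreal (\<epsilon> * C) * ennreal (indicator (cbx x d) z * kerc \<kappa> 0 J (z - x)) + ennreal (E J) * indicator (cbx x d) z \<partial>lebesgue)"
      proof (rule nn_integral_mono)
        fix z
        show "ennreal (cmod (indicator (cbx x d) z *\<^sub>R (W z * Ph \<kappa> d J (z - x)))) \<le> ennreal (\<epsilon> * C) * ennreal (indicator (cbx x d) z * kerc \<kappa> 0 J (z - x)) + ennreal (E J) * indicator (cbx x d) z"
        proof (cases "z \<in> cbx x d")
          case True
          have "ennreal (cmod (W z * Ph \<kappa> d J (z - x))) \<le> ennreal (\<epsilon> * C * kerc \<kappa> 0 J (z - x) + E J)"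
            by (rule ennreal_leI[OF pt[OF True]])
          also have "\<dots> = ennreal (\<epsilon> * C) * ennreal (kerc \<kappa> 0 J (z - x)) + ennreal (E J)"
          proof -
            have n: "0 \<le> \<epsilon> * C" "0 \<le> kerc \<kappa> 0 J (z - x)" using \<epsilon> C(1) kerc_nonneg by auto
            show ?thesis unfolding ennreal_plus[OF mult_nonneg_nonneg[OF n] E] ennreal_mult[OF n] by (rule refl)
          qed
          finally show ?thesis using True by simp
        qed simp
      qed
      also have "\<dots> = ennreal (\<epsilon> * C) * (\<integral>\<^sup>+z. ennreal (indicator (cbx x d) z * kerc \<kappa> 0 J (z - x)) \<partial>lebesgue) + ennreal (E J) * emeasure lebesgue (cbx x d)"
      proof -
        have m1: "(\<lambda>z. ennreal (\<epsilon> * C) * ennreal (indicator (cbx x d) z * kerc \<kappa> 0 J (z - x))) \<in> borel_measurable lebesgue"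
          by (intro borel_measurable_times_ennreal borel_measurable_const km)
        have m2: "(\<lambda>z. ennreal (E J) * indicator (cbx x d) z) \<in> borel_measurable lebesgue"
          by (intro borel_measurable_times_ennreal borel_measurable_const borel_measurable_indicator cbx_sets_lebesgue)
        show ?thesis by (simp only: nn_integral_add[OF m1 m2] nn_integral_cmult[OF km] nn_integral_cmult_indicator cbx_sets_lebesgue)
      qed
      also have "\<dots> \<le> ennreal (\<epsilon> * C) * ennreal C1 + ennreal (E J) * ennreal ((2 * d) ^ CARD('n))"
      proof (intro add_mono mult_left_mono)
        show "(\<integral>\<^sup>+z. ennreal (indicator (cbx x d) z * kerc \<kappa> 0 J (z - x)) \<partial>lebesgue) \<le> ennreal C1"
          unfolding C1_def by (rule kerc_L1[OF \<kappa> ds])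
        show "emeasure lebesgue (cbx x d) \<le> ennreal ((2 * d) ^ CARD('n))"
          using measure_cbx[of d x] d cbx_lmeasurable[of x d] by (simp add: emeasure_eq_measure2)
      qed auto
      also have "\<dots> = ennreal (\<epsilon> * C * C1 + E J * (2 * d) ^ CARD('n))"
        using \<epsilon> C C1 E d by (simp add: ennreal_plus ennreal_mult)
      finally have "cmod (LINT z:cbx x d|lebesgue. W z * Ph \<kappa> d J (z - x)) \<le> \<epsilon> * C * C1 + E J * (2 * d) ^ CARD('n)"
        using \<epsilon> C C1 E[of J] d by (subst (asm) ennreal_le_iff) (auto intro!: add_nonneg_nonneg mult_nonneg_nonneg)
      then show "cmod (LINT z:cbx x d|lebesgue. W z * Ph \<kappa> d J (z - x)) \<le> \<epsilon> * (C * C1) + 2 * M * C * (1 / \<delta>) ^ NNc \<kappa> 0 * (2 * d) ^ CARD('n) / 4 ^ J"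
        by (simp add: E_def mult_ac)
    qed
  qed
  show ?thesis
  proof (rule LIMSEQ_I)
    fix e :: real assume e: "0 < e"
    define \<epsilon> where "\<epsilon> = e / (2 * (C * C1 + 1))"
    have CC: "0 \<le> C * C1" using C C1 by simp
    have \<epsilon>: "0 < \<epsilon>" using e CC by (simp add: \<epsilon>_def)
    have "\<epsilon> * (C * C1) \<le> \<epsilon> * (C * C1 + 1)" using \<epsilon> by (intro mult_left_mono) auto
    also have "\<dots> = e / 2" using CC by (simp add: \<epsilon>_def field_simps)
    finally have e2: "\<epsilon> * (C * C1) \<le> e / 2" .
    obtain D where D: "\<And>J. cmod (LINT z:cbx x d|lebesgue. W z * Ph \<kappa> d J (z - x)) \<le> \<epsilon> * (C * C1) + D / 4 ^ J"
      using est[OF \<epsilon>] by blast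
    have "(\<lambda>J. D * (1 / 4) ^ J) \<longlonglongrightarrow> D * 0" by (intro tendsto_intros LIMSEQ_realpow_zero) auto
    then have "eventually (\<lambda>J. D * (1 / 4) ^ J < e / 2) sequentially" using e by (intro order_tendstoD(2)) auto
    then obtain J0 where J0: "\<And>J. J \<ge> J0 \<Longrightarrow> D * (1 / 4) ^ J < e / 2" by (auto simp: eventually_sequentially)
    show "\<exists>no. \<forall>J\<ge>no. norm ((\<Sum>k\<in>Kset \<kappa> d J. phin (etak \<kappa> (pi / d) J k) * LV d x V k) - of_real ((2 * d) ^ CARD('n)) * V x) < e"
      unfolding diff
    proof (intro exI[of _ J0] allI impI)
      fix J assume "J0 \<le> J"
      then have "D / 4 ^ J < e / 2" using J0[of J] by (simp add: power_divide)
      then show "cmod (LINT z:cbx x d|lebesgue. W z * Ph \<kappa> d J (z - x)) < e" using D[of J] e2 by linarith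
    qed
  qed
qed

section \<open>Comparison of two points\<close>

lemma phase_le: "cmod (1 - exp (- \<i> * of_real t)) \<le> \<bar>t\<bar>"
proof -
  have "cmod (exp (\<i> * of_real (- t)) - 1) = 2 * \<bar>sin (- t / 2)\<bar>" by (rule dist_exp_i_1)
  also have "\<dots> \<le> 2 * \<bar>- t / 2\<bar>" by (intro mult_left_mono abs_sin_x_le_abs_x) simp
  finally show ?thesis by (simp add: norm_minus_commute)
qed

text \<open>Each derivative multiplies by \<open>\<i> * c\<close>, of modulus at most 1, so one
  constant serves for all orders.\<close>

lemma Bd_exp_phase:
  assumes "\<bar>c\<bar> \<le> 1" "cmod u \<le> C"
  shows "Bd N S C (\<lambda>t. u * exp (\<i> * of_real c * of_real t))"
  using assms(2)
proof (induction N arbitrary: u)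
  case 0
  then show ?case by (simp add: norm_mult mult.assoc flip: of_real_mult)
next
  case (Suc N)
  have "cmod (u * (\<i> * of_real c)) = \<bar>c\<bar> * cmod u" by (simp add: norm_mult)
  also have "\<dots> \<le> 1 * cmod u" using assms(1) by (intro mult_right_mono) auto
  finally have "Bd N S C (\<lambda>t. u * (\<i> * of_real c) * exp (\<i> * of_real c * of_real t))"
    using Suc by (intro Suc.IH) simp
  moreover have "((\<lambda>t. u * exp (\<i> * of_real c * of_real t)) has_vector_derivative u * (\<i> * of_real c) * exp (\<i> * of_real c * of_real t)) (at t)" for t
  proof (rule has_vector_derivative_real_field)
    show "((\<lambda>z. u * exp (\<i> * of_real c * z)) has_field_derivative u * (\<i> * of_real c) * exp (\<i> * of_real c * of_real t)) (at (of_real t))"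
      by (auto intro!: derivative_eq_intros)
  qed
  ultimately show ?case using Suc.prems by (auto simp: norm_mult mult.assoc simp flip: of_real_mult intro!: exI[of _ "\<lambda>t. u * (\<i> * of_real c) * exp (\<i> * of_real c * of_real t)"])
qed

text \<open>The function itself is small because |1 - exp (- i s)| \<le> |s|, its derivatives
  because the first one produces a factor \<open>w l\<close>. The 3 is the bound of the coordinates
  in \<open>S3\<close>.\<close>

lemma Qb_phase:
  fixes w :: "'n::finite \<Rightarrow> real"
  assumes w: "\<And>l. \<bar>w l\<bar> \<le> \<tau>" and \<tau>: "\<tau> \<le> 1"
  shows "Qb N (3 * real CARD('n) * \<tau>) (\<lambda>\<eta>. 1 - exp (- \<i> * of_real (\<Sum>l\<in>UNIV. \<eta> l * w l)))"
  unfolding Qb_def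
proof (intro allI impI)
  fix l :: 'n and \<eta> :: "'n \<Rightarrow> real"
  assume \<eta>: "\<forall>k. k \<noteq> l \<longrightarrow> \<bar>\<eta> k\<bar> \<le> 2"
  have \<tau>0: "0 \<le> \<tau>" using w[of l] by linarith
  define s where "s = (\<Sum>k\<in>UNIV - {l}. \<eta> k * w k)"
  have sum: "(\<Sum>k\<in>UNIV. (\<eta>(l := y)) k * w k) = s + y * w l" for y
    by (subst sum.remove[of UNIV l]) (auto simp: s_def intro!: sum.cong)
  define f where "f y = 1 - exp (- \<i> * complex_of_real (s + y * w l))" for y
  have f: "f y = 1 - exp (- \<i> * of_real s) * exp (\<i> * of_real (- w l) * of_real y)" for y
    by (simp add: f_def exp_add[symmetric] algebra_simps)
  have f_le: "cmod (f y) \<le> 3 * real CARD('n) * \<tau>" if "y \<in> S3" for y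
  proof -
    have "cmod (f y) \<le> \<bar>s + y * w l\<bar>" unfolding f_def by (rule phase_le)
    also have "s + y * w l = (\<Sum>k\<in>UNIV. (\<eta>(l := y)) k * w k)" by (rule sum[symmetric])
    also have "\<bar>\<dots>\<bar> \<le> (\<Sum>k\<in>(UNIV::'n set). 3 * \<tau>)"
    proof (rule order_trans[OF sum_abs], rule sum_mono)
      fix k
      have "\<bar>(\<eta>(l := y)) k\<bar> \<le> 3" using \<eta>[rule_format, of k] S3(2)[OF that] by auto
      then show "\<bar>(\<eta>(l := y)) k * w k\<bar> \<le> 3 * \<tau>" unfolding abs_mult using w by (intro mult_mono) auto
    qed
    finally show ?thesis by simp
  qed
  have "Bd N S3 (3 * real CARD('n) * \<tau>) f"
  proof (cases N)
    case 0
    then show ?thesis using f_le by simp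
  next
    case (Suc n)
    define u where "u = - (exp (- \<i> * of_real s) * (\<i> * of_real (- w l)))"
    have "((\<lambda>t. 1 - exp (- \<i> * of_real s) * exp (\<i> * of_real (- w l) * of_real t)) has_vector_derivative u * exp (\<i> * of_real (- w l) * of_real t)) (at t)" for t
    proof (rule has_vector_derivative_real_field)
      show "((\<lambda>z. 1 - exp (- \<i> * of_real s) * exp (\<i> * of_real (- w l) * z)) has_field_derivative u * exp (\<i> * of_real (- w l) * of_real t)) (at (of_real t))"
        by (auto intro!: derivative_eq_intros simp: u_def)
    qed
    then have D: "(f has_vector_derivative u * exp (\<i> * of_real (- w l) * of_real t)) (at t)" for t
      unfolding f[abs_def] .
    have "cmod (exp (- \<i> * of_real s)) = 1" using norm_exp_i_times[of "- s"] by simp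
    then have "cmod u \<le> \<tau>" using w[of l] by (simp add: u_def norm_mult)
    also have "\<tau> \<le> 3 * real CARD('n) * \<tau>" 
    proof -
      have "1 \<le> real CARD('n)" by (simp add: Suc_le_eq)
      then have "1 \<le> 3 * real CARD('n)" by linarith
      then show ?thesis using mult_right_mono[OF _ \<tau>0, of 1 "3 * real CARD('n)"] by simp
    qed
    finally have "Bd n S3 (3 * real CARD('n) * \<tau>) (\<lambda>t. u * exp (\<i> * of_real (- w l) * of_real t))"
      using w[of l] \<tau> by (intro Bd_exp_phase) auto
    then show ?thesis unfolding Suc Bd.simps
      by (intro conjI ballI exI[of _ "\<lambda>t. u * exp (\<i> * of_real (- w l) * of_real t)"] f_le D)
  qed
  then show "Bd N S3 (3 * real CARD('n) * \<tau>) (\<lambda>y. 1 - exp (- \<i> * of_real (\<Sum>k\<in>UNIV. (\<eta>(l := y)) k * w k)))"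
    unfolding f_def sum .
qed

lemma ek_add: "ek h k (w + w') = ek h k w * ek h k w'"
  by (simp add: ek_def prod.distrib[symmetric] exp_add[symmetric] distrib_left)

text \<open>In terms of the rescaled frequency the displacement appears dilated by
  \<open>2 ^ j\<close>, which shows that at scale \<open>j\<close> the phase is small when
  \<open>2 ^ j\<close> times the quasi-distance is.\<close>

lemma ek_phase: "ek h k w = exp (- \<i> * of_real (\<Sum>l\<in>UNIV. etak \<kappa> h j k l * (2 ^ (j * \<kappa> l) * w$l)))"
proof -
  have "ek h k w = exp (\<Sum>l\<in>UNIV. - \<i> * of_real (h * of_int (k l)) * of_real (w$l))"
    by (simp add: ek_def exp_sum)
  also have "(\<Sum>l\<in>UNIV. - \<i> * of_real (h * of_int (k l)) * of_real (w$l)) = - \<i> * of_real (\<Sum>l\<in>UNIV. etak \<kappa> h j k l * (2 ^ (j * \<kappa> l) * w$l))"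
    unfolding of_real_sum sum_distrib_left by (intro sum.cong refl) (simp add: etak_def)
  finally show ?thesis .
qed

lemma norm_tens_ekt_le: "cmod (tens x (ekt d k) z) \<le> 1"
proof -
  obtain r where "0 \<le> r" "r \<le> 1" "cutoff d x z = complex_of_real r" using cutoff_real by blast
  then show ?thesis by (simp add: tens_ekt norm_mult)
qed

lemma norm_LV_le:
  fixes x :: "real^'n::finite"
  assumes "0 < d" "\<And>z. z \<in> cbx x d \<Longrightarrow> cmod (V z) \<le> M"
  shows "cmod (LV d x V k) \<le> M * (2 * d) ^ CARD('n)"
  unfolding LV_def
proof (rule set_integral_cbx_bound)
  fix z assume "z \<in> cbx x d"
  then have "cmod (V z) * cmod (tens x (ekt d k) z) \<le> M * 1"
    using assms(2)[of z] order_trans[OF norm_ge_zero, of "V z" M] by (intro mult_mono norm_tens_ekt_le) auto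
  then show "cmod (V z * tens x (ekt d k) z) \<le> M" by (simp add: norm_mult)
qed (use assms in simp)

text \<open>The sum at scale 0 contains the zero frequency, where one cannot divide by the symbol.
  Its number of terms is fixed, though, and each phase differs from 1 by at most a multiple of
  \<open>r\<close>.\<close>

lemma low_frequency_bound:
  fixes x y :: "real^'n::finite" and d M r :: real
  assumes d: "0 < d" and \<kappa>: "\<forall>l. 0 < \<kappa> l" and M: "\<And>z. z \<in> cbx x d \<Longrightarrow> cmod (V z) \<le> M"
    and r: "0 < r" "r \<le> 1" "qdist \<kappa> x y \<le> r"
  shows "cmod (\<Sum>k\<in>Kset \<kappa> d 0. phin (etak \<kappa> (pi / d) 0 k) * ((1 - ek (pi / d) k (x - y)) * LV d x V k))
    \<le> (real (card (Kset \<kappa> d 0)) * (2 * real CARD('n) * (2 * d) ^ CARD('n))) * (M * r)"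
proof -
  have "x \<in> cbx x d" using d by (simp add: cbx_def)
  then have M0: "0 \<le> M" using M norm_ge_zero order_trans by blast
  have "cmod (phin (etak \<kappa> (pi / d) 0 k) * ((1 - ek (pi / d) k (x - y)) * LV d x V k)) \<le> 2 * CARD('n) * (2 * d) ^ CARD('n) * (M * r)"
    if k: "k \<in> Kset \<kappa> d 0" for k
  proof -
    have "cmod (phin (etak \<kappa> (pi / d) 0 k)) \<le> 1"
      unfolding phin_def prod_norm[symmetric] by (intro prod_le_1) (simp add: phi1)
    moreover have "cmod (1 - ek (pi / d) k (x - y)) \<le> 2 * CARD('n) * r"
    proof -
      have "cmod (1 - ek (pi / d) k (x - y)) \<le> \<bar>\<Sum>l\<in>UNIV. etak \<kappa> (pi / d) 0 k l * (2 ^ (0 * \<kappa> l) * (x - y)$l)\<bar>"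
        unfolding ek_phase[of _ _ _ \<kappa> 0] by (rule phase_le)
      also have "\<dots> \<le> (\<Sum>l\<in>(UNIV::'n set). 2 * r)"
      proof (rule order_trans[OF sum_abs], rule sum_mono)
        fix l
        have "\<bar>x$l - y$l\<bar> \<le> r ^ \<kappa> l" by (rule qdist_coord_le) (use \<kappa> r in auto)
        also have "\<dots> \<le> r ^ 1" using r \<kappa>[rule_format, of l] by (intro power_decreasing) auto
        finally have "\<bar>etak \<kappa> (pi / d) 0 k l\<bar> * \<bar>x$l - y$l\<bar> \<le> 2 * r"
          using k by (intro mult_mono) (auto simp: Kset_def)
        then show "\<bar>etak \<kappa> (pi / d) 0 k l * (2 ^ (0 * \<kappa> l) * (x - y)$l)\<bar> \<le> 2 * r" by (simp add: abs_mult)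
      qed
      finally show ?thesis by simp
    qed
    moreover have "cmod (LV d x V k) \<le> M * (2 * d) ^ CARD('n)" by (rule norm_LV_le[OF d M])
    ultimately have "cmod (phin (etak \<kappa> (pi / d) 0 k)) * (cmod (1 - ek (pi / d) k (x - y)) * cmod (LV d x V k)) \<le> 1 * ((2 * CARD('n) * r) * (M * (2 * d) ^ CARD('n)))"
      using r by (intro mult_mono) auto
    then show ?thesis by (simp add: norm_mult mult_ac)
  qed
  then have "cmod (\<Sum>k\<in>Kset \<kappa> d 0. phin (etak \<kappa> (pi / d) 0 k) * ((1 - ek (pi / d) k (x - y)) * LV d x V k)) \<le> (\<Sum>k\<in>Kset \<kappa> d 0. 2 * CARD('n) * (2 * d) ^ CARD('n) * (M * r))"
    by (rule sum_norm_le)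
  then show ?thesis by simp
qed

text \<open>Multiplying the coefficients at \<open>x\<close> by \<open>ek (pi / d) k (x - y)\<close>
  recentres the kernel at \<open>y\<close> but keeps the cutoff of \<open>x\<close>. The two cutoffs
  agree for z within \<open>d / 8\<close> of \<open>y\<close> in each coordinate, and elsewhere the
  kernel is of size 4^-J.\<close>

lemma cutoff_change_bound:
  fixes \<kappa> :: "'n::finite mindex"
  assumes d: "0 < d" and \<kappa>: "\<forall>l. 0 < \<kappa> l"
  shows "\<exists>C\<ge>0. \<forall>x y V M J. continuous_on (cbx x d) V \<longrightarrow> continuous_on (cbx y d) V \<longrightarrow> (\<forall>z\<in>cbx y d. cmod (V z) \<le> M) \<longrightarrow>
    (\<forall>l. \<bar>x$l - y$l\<bar> \<le> d / 8) \<longrightarrow>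
    cmod ((\<Sum>k\<in>Kset \<kappa> d J. phin (etak \<kappa> (pi / d) J k) * (ek (pi / d) k (x - y) * LV d x V k)) - (\<Sum>k\<in>Kset \<kappa> d J. phin (etak \<kappa> (pi / d) J k) * LV d y V k))
     \<le> C * M / 4 ^ J"
proof -
  obtain C where C: "C \<ge> 0" "\<And>J w. \<forall>l. \<bar>w$l\<bar> \<le> d \<Longrightarrow> cmod (Ph \<kappa> d J w) \<le> C * kerc \<kappa> 0 J w"
    using Ph_bound[OF d \<kappa>, of 0] by blast
  define \<delta> where "\<delta> = min 1 (d / 8)"
  have \<delta>: "0 < \<delta>" using d by (simp add: \<delta>_def)
  define C' where "C' = C * (1 / \<delta>) ^ NNc \<kappa> 0 * (2 * d) ^ CARD('n)"
  show ?thesis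
  proof (intro exI[of _ C'] conjI allI impI)
    show "0 \<le> C'" using C(1) \<delta> d by (simp add: C'_def)
    fix x y :: "real^'n" and V M J
    assume Vx: "continuous_on (cbx x d) V" and Vy: "continuous_on (cbx y d) V" and M: "\<forall>z\<in>cbx y d. cmod (V z) \<le> M"
      and xy: "\<forall>l. \<bar>x$l - y$l\<bar> \<le> d / 8"
    have "y \<in> cbx y d" using d by (simp add: cbx_def)
    then have M0: "0 \<le> M" using M norm_ge_zero order_trans by blast
    have ekc: "continuous_on S (\<lambda>z. ek (pi / d) k (z - y))" for S k
      by (intro continuous_on_compose2[OF continuous_on_ek[of UNIV]] continuous_intros) auto
    have zy: "z - y = (z - x) + (x - y)" for z by simp
    have "(\<Sum>k\<in>Kset \<kappa> d J. phin (etak \<kappa> (pi / d) J k) * (ek (pi / d) k (x - y) * LV d x V k))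
      = (\<Sum>k\<in>Kset \<kappa> d J. phin (etak \<kappa> (pi / d) J k) * (LINT z:cbx x d|lebesgue. V z * cutoff d x z * ek (pi / d) k (z - y)))"
    proof (intro sum.cong refl arg_cong2[where f = times])
      fix k
      have e: "V z * cutoff d x z * ek (pi / d) k (z - y) = ek (pi / d) k (x - y) * (V z * tens x (ekt d k) z)" for z
        unfolding tens_ekt zy[of z] ek_add by simp
      show "ek (pi / d) k (x - y) * LV d x V k = (LINT z:cbx x d|lebesgue. V z * cutoff d x z * ek (pi / d) k (z - y))"
        unfolding LV_def e by (rule set_integral_mult_right[symmetric])
    qed
    also have "\<dots> = (LINT z:cbx x d|lebesgue. \<Sum>k\<in>Kset \<kappa> d J. phin (etak \<kappa> (pi / d) J k) * (V z * cutoff d x z * ek (pi / d) k (z - y)))"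
      by (rule set_integral_sum_mult) (intro set_integrable_cbx_continuous continuous_on_mult Vx continuous_on_cutoff d ekc)
    also have "\<dots> = (LINT z:cbx x d|lebesgue. V z * cutoff d x z * Ph \<kappa> d J (z - y))"
      unfolding Ph_def sum_distrib_left by (simp only: mult.left_commute)
    also have "\<dots> = (LINT z:cbx y d|lebesgue. V z * cutoff d x z * Ph \<kappa> d J (z - y))"
      unfolding set_lebesgue_integral_def
    proof (rule Bochner_Integration.integral_cong[OF refl])
      fix z
      \<comment> \<open>The cutoff of \<open>x\<close> lives in the half box around
        \<open>x\<close>, which lies in both boxes; thus the domain of integration can be
        exchanged.\<close>
      have zero: "cutoff d x z = 0" if out: "z \<notin> cbx x d \<or> z \<notin> cbx y d"
      proof -
        obtain l where "d < \<bar>z$l - x$l\<bar> \<or> d < \<bar>z$l - y$l\<bar>" using out unfolding cbx_def mem_Collect_eq not_all not_le by blast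
        then have "d / 2 < \<bar>z$l - x$l\<bar>" using xy[rule_format, of l] d by linarith
        then show ?thesis by (rule cutoff_zero[OF d])
      qed
      show "indicator (cbx x d) z *\<^sub>R (V z * cutoff d x z * Ph \<kappa> d J (z - y)) = indicator (cbx y d) z *\<^sub>R (V z * cutoff d x z * Ph \<kappa> d J (z - y))"
        using zero by (cases "z \<in> cbx x d"; cases "z \<in> cbx y d") auto
    qed
    finally have 1: "(\<Sum>k\<in>Kset \<kappa> d J. phin (etak \<kappa> (pi / d) J k) * (ek (pi / d) k (x - y) * LV d x V k)) = (LINT z:cbx y d|lebesgue. V z * cutoff d x z * Ph \<kappa> d J (z - y))" .
    have "(\<Sum>k\<in>Kset \<kappa> d J. phin (etak \<kappa> (pi / d) J k) * (ek (pi / d) k (x - y) * LV d x V k)) - (\<Sum>k\<in>Kset \<kappa> d J. phin (etak \<kappa> (pi / d) J k) * LV d y V k)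
      = (LINT z:cbx y d|lebesgue. V z * cutoff d x z * Ph \<kappa> d J (z - y) - V z * cutoff d y z * Ph \<kappa> d J (z - y))"
      unfolding 1 VJ_eq[OF d Vy]
      by (rule set_integral_diff(2)[symmetric]; intro set_integrable_cbx_continuous continuous_on_mult Vy continuous_on_cutoff d continuous_on_Ph)
    also have "cmod \<dots> \<le> (M * (C * ((1 / \<delta>) ^ NNc \<kappa> 0 / 4 ^ J))) * (2 * d) ^ CARD('n)"
    proof (rule set_integral_cbx_bound)
      fix z assume z: "z \<in> cbx y d"
      have B: "0 \<le> C * ((1 / \<delta>) ^ NNc \<kappa> 0 / 4 ^ J)" using C(1) \<delta> by simp
      have eq: "V z * cutoff d x z * Ph \<kappa> d J (z - y) - V z * cutoff d y z * Ph \<kappa> d J (z - y) = (cutoff d x z - cutoff d y z) * (V z * Ph \<kappa> d J (z - y))"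
        by (simp add: algebra_simps)
      show "cmod (V z * cutoff d x z * Ph \<kappa> d J (z - y) - V z * cutoff d y z * Ph \<kappa> d J (z - y)) \<le> M * (C * ((1 / \<delta>) ^ NNc \<kappa> 0 / 4 ^ J))"
      proof (cases "\<forall>l. \<bar>z$l - y$l\<bar> \<le> d / 8")
        case True
        have "\<bar>z$l - x$l\<bar> \<le> d / 4" "\<bar>z$l - y$l\<bar> \<le> d / 4" for l
          using True[rule_format, of l] xy[rule_format, of l] d by linarith+
        then have "cutoff d x z = 1" "cutoff d y z = 1" by (intro cutoff_one[OF d]; simp)+
        then have zz: "(cutoff d x z - cutoff d y z) * (V z * Ph \<kappa> d J (z - y)) = 0" by simp
        show ?thesis unfolding eq zz using mult_nonneg_nonneg[OF M0 B] by simp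
      next
        case False
        then obtain l where l: "d / 8 \<le> \<bar>(z - y)$l\<bar>" unfolding not_all not_le by (metis less_imp_le vector_minus_component)
        obtain r r' where rr: "0 \<le> r" "r \<le> 1" "cutoff d x z = complex_of_real r" "0 \<le> r'" "r' \<le> 1" "cutoff d y z = complex_of_real r'"
          using cutoff_real by metis
        have "cutoff d x z - cutoff d y z = complex_of_real (r - r')" using rr by simp
        then have 1: "cmod (cutoff d x z - cutoff d y z) \<le> 1" using rr by (simp only: norm_of_real)
        have "\<delta> \<le> qdist \<kappa> (z - y) 0" unfolding \<delta>_def by (rule qdist_outer[OF \<kappa> _ l]) (use d in simp)
        then have "kerc \<kappa> 0 J (z - y) \<le> (1 / \<delta>) ^ NNc \<kappa> 0 / 4 ^ J" using kerc_far[OF \<delta>, where m = 0] by simp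
        then have "C * kerc \<kappa> 0 J (z - y) \<le> C * ((1 / \<delta>) ^ NNc \<kappa> 0 / 4 ^ J)" using C(1) by (rule mult_left_mono)
        moreover have "cmod (Ph \<kappa> d J (z - y)) \<le> C * kerc \<kappa> 0 J (z - y)" by (rule C(2)) (use z in \<open>auto simp: cbx_def\<close>)
        ultimately have "cmod (Ph \<kappa> d J (z - y)) \<le> C * ((1 / \<delta>) ^ NNc \<kappa> 0 / 4 ^ J)" by linarith
        then have "cmod (cutoff d x z - cutoff d y z) * (cmod (V z) * cmod (Ph \<kappa> d J (z - y))) \<le> 1 * (M * (C * ((1 / \<delta>) ^ NNc \<kappa> 0 / 4 ^ J)))"
          using M z M0 by (intro mult_mono 1) auto
        then show ?thesis unfolding eq norm_mult by simp
      qed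
    qed (use d in simp)
    finally show "cmod ((\<Sum>k\<in>Kset \<kappa> d J. phin (etak \<kappa> (pi / d) J k) * (ek (pi / d) k (x - y) * LV d x V k)) - (\<Sum>k\<in>Kset \<kappa> d J. phin (etak \<kappa> (pi / d) J k) * LV d y V k)) \<le> C' * M / 4 ^ J"
      by (simp add: C'_def mult_ac)
  qed
qed

text \<open>The intermediate quantity \<open>V'\<close> separates the change of phases from the
  change of cutoff. The latter is made at the scale \<open>J0\<close> with \<open>2 ^ J0\<close>
  about \<open>1 / r\<close>, where its error 4^-J0 is at most 2 r and thus absorbed by the term
  \<open>M * r\<close>.\<close>

lemma (in symb_class) modulus_bound:
  assumes d: "0 < d" and s0: "s0 \<le> 1" "2 * s0 \<le> R0" "2 * s0 \<le> (1 - \<theta>) * R0" and \<gamma>: "0 < \<gamma>" "\<gamma> < 1"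
    and ds: "\<And>w::real^'n. \<forall>l. \<bar>w$l\<bar> \<le> d \<Longrightarrow> qdist \<kappa> w 0 \<le> s0"
  shows "\<exists>C\<ge>0. \<forall>\<Omega> T v a f x y M \<alpha> r. frozen \<kappa> A B m lam Lam d \<Omega> T v a f x M s \<longrightarrow> frozen \<kappa> A B m lam Lam d \<Omega> T v a f y M s \<longrightarrow> \<alpha> \<in> A \<longrightarrow> 0 < M \<longrightarrow>
     qdist \<kappa> x 0 < \<theta> * R0 \<longrightarrow> qdist \<kappa> y 0 < \<theta> * R0 \<longrightarrow> qdist \<kappa> x y \<le> r \<longrightarrow> 0 < r \<longrightarrow> r \<le> 1 \<longrightarrow> r \<le> d / 8 \<longrightarrow>
     ennreal (cmod (v \<alpha> x - v \<alpha> y)) \<le> ennreal C * (ennreal (M * r) + DI \<gamma> R0 r (osc_f \<kappa> B R0 f) + ennreal M * DI \<gamma> R0 r (osc_a \<kappa> A B R0 a))"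
proof -
  obtain CF where CF: "0 \<le> CF" "\<And>\<Omega> T v a f x M q c \<alpha> r n. frozen \<kappa> A B m lam Lam d \<Omega> T v a f x M s \<Longrightarrow> \<alpha> \<in> A \<Longrightarrow> 0 < M \<Longrightarrow>
     qdist \<kappa> x 0 < \<theta> * R0 \<Longrightarrow> 0 < r \<Longrightarrow> r \<le> 1 \<Longrightarrow> 0 \<le> c \<Longrightarrow> (\<forall>j. Qb (NNc \<kappa> m) (c * min 1 (2 ^ j * r)) (q j)) \<Longrightarrow>
     ennreal (\<Sum>j<n. cmod (Zb d x (v \<alpha>) j (q j))) \<le> ennreal (CF * c) * (ennreal (M * r) + DI \<gamma> R0 r (osc_f \<kappa> B R0 f) + ennreal M * DI \<gamma> R0 r (osc_a \<kappa> A B R0 a))"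
    using block_sum[OF d s0 \<gamma> ds, of s] by blast
  obtain CC where CC: "0 \<le> CC" "\<And>x y V M J. continuous_on (cbx x d) V \<Longrightarrow> continuous_on (cbx y d) V \<Longrightarrow> (\<forall>z\<in>cbx y d. cmod (V z) \<le> M) \<Longrightarrow>
    (\<forall>l. \<bar>x$l - y$l\<bar> \<le> d / 8) \<Longrightarrow>
    cmod ((\<Sum>k\<in>Kset \<kappa> d J. phin (etak \<kappa> (pi / d) J k) * (ek (pi / d) k (x - y) * LV d x V k)) - (\<Sum>k\<in>Kset \<kappa> d J. phin (etak \<kappa> (pi / d) J k) * LV d y V k))
     \<le> CC * M / 4 ^ J"
    using cutoff_change_bound[OF d kpos] by blast
  define n where "n = CARD('n)"
  define CL where "CL = real (card (Kset \<kappa> d 0)) * (2 * real n * (2 * d) ^ n)"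
  define C1 where "C1 = CL + 2 * CC + 2 * CF + CF * (3 * n)"
  have CL: "0 \<le> CL" using d by (simp add: CL_def)
  have C1: "0 \<le> C1" using CL CC(1) CF(1) by (simp add: C1_def)
  define P where "P = (2 * d) ^ n"
  have P: "0 < P" using d by (simp add: P_def)
  show ?thesis
  proof (intro exI[of _ "C1 / P"] conjI allI impI)
    show "0 \<le> C1 / P" using C1 P by simp
    fix \<Omega> T v a f x y M \<alpha> r
    assume fx: "frozen \<kappa> A B m lam Lam d \<Omega> T v a f x M s" and fy: "frozen \<kappa> A B m lam Lam d \<Omega> T v a f y M s"
      and \<alpha>: "\<alpha> \<in> A" and M: "0 < M" and x: "qdist \<kappa> x 0 < \<theta> * R0" and y: "qdist \<kappa> y 0 < \<theta> * R0" and xy: "qdist \<kappa> x y \<le> r"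
      and r: "0 < r" "r \<le> 1" "r \<le> d / 8"
    interpret fx: frozen \<kappa> A B m lam Lam d \<Omega> T v a f x M s by (rule fx)
    interpret fy: frozen \<kappa> A B m lam Lam d \<Omega> T v a f y M s by (rule fy)
    define V where "V = v \<alpha>"
    define E where "E = ennreal (M * r) + DI \<gamma> R0 r (osc_f \<kappa> B R0 f) + ennreal M * DI \<gamma> R0 r (osc_a \<kappa> A B R0 a)"
    have Vc: "continuous_on (cbx x d) V" "continuous_on (cbx y d) V"
      unfolding V_def using fx.box.v_cont[OF \<alpha>] fx.box.sub fy.box.sub by (auto intro: continuous_on_subset)
    have VM: "cmod (V z) \<le> M" if "z \<in> cbx x d \<or> z \<in> cbx y d" for z
      unfolding V_def using that fx.box.v_le[OF \<alpha>, of z] fx.box.sub fy.box.sub by auto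
    have co: "\<bar>x$l - y$l\<bar> \<le> r ^ \<kappa> l" for l by (rule qdist_coord_le) (use kpos xy in auto)
    have "r ^ \<kappa> l \<le> r ^ 1" for l using r kpos[rule_format, of l] by (intro power_decreasing) auto
    then have xyd: "\<forall>l. \<bar>x$l - y$l\<bar> \<le> d / 8" using co r(3) by (metis order_trans power_one_right)
    define VV where "VV x J = (\<Sum>k\<in>Kset \<kappa> d J. phin (etak \<kappa> (pi / d) J k) * LV d x V k)" for x J
    obtain J1 where "1 / r < 2 ^ J1" using real_arch_pow[of 2 "1 / r"] by auto
    then have "1 / r < 2 ^ Suc J1" by (rule less_trans) simp
    then obtain J0 where J0: "2 ^ J0 \<le> 1 / r" "1 / r < 2 ^ Suc J0"
      using dyadic_scale[of "1 / r" J1] r by auto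
    have J0': "2 ^ J0 * r \<le> 1" "1 < 2 ^ Suc J0 * r" using J0 r by (auto simp: field_simps)
    \<comment> \<open>\<open>q1\<close> selects the blocks above \<open>J0\<close>, where the weight
      \<open>min 1 (2 ^ j * r)\<close> is 1; \<open>q2\<close> is the phase difference on the blocks
      from 1 to \<open>J0\<close>. Both vanish at j = 0, since scale 0 is handled by
      \<open>Lo\<close>.\<close>
    define q1 where "q1 j = (\<lambda>\<eta>::'n \<Rightarrow> real. if j \<le> J0 then 0 else (1::complex))" for j
    define q2 where "q2 j = (if 1 \<le> j \<and> j \<le> J0 then (\<lambda>\<eta>. 1 - exp (- \<i> * complex_of_real (\<Sum>l\<in>UNIV. \<eta> l * (2 ^ (j * \<kappa> l) * (x - y)$l)))) else (\<lambda>\<eta>. 0))" for j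
    have Q1: "\<forall>j. Qb (NNc \<kappa> m) (1 * min 1 (2 ^ j * r)) (q1 j)"
    proof
      fix j
      have "1 \<le> 2 ^ j * r" if "\<not> j \<le> J0"
      proof -
        have "(2::real) ^ Suc J0 \<le> 2 ^ j" using that by (intro power_increasing) auto
        then have "2 ^ Suc J0 * r \<le> 2 ^ j * r" using r by (intro mult_right_mono) auto
        then show ?thesis using J0'(2) by linarith
      qed
      then show "Qb (NNc \<kappa> m) (1 * min 1 (2 ^ j * r)) (q1 j)"
        unfolding q1_def using r by (intro Qb_const) auto
    qed
    have Q2: "\<forall>j. Qb (NNc \<kappa> m) ((3 * n) * min 1 (2 ^ j * r)) (q2 j)"
    proof
      fix j
      show "Qb (NNc \<kappa> m) ((3 * n) * min 1 (2 ^ j * r)) (q2 j)"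
      proof (cases "1 \<le> j \<and> j \<le> J0")
        case True
        have "(2::real) ^ j \<le> 2 ^ J0" using True by (intro power_increasing) auto
        then have "2 ^ j * r \<le> 2 ^ J0 * r" using r by (intro mult_right_mono) auto
        then have le: "2 ^ j * r \<le> 1" using J0'(1) by linarith
        have "\<bar>2 ^ (j * \<kappa> l) * (x - y)$l\<bar> \<le> 2 ^ j * r" for l
        proof -
          have "\<bar>2 ^ (j * \<kappa> l) * (x - y)$l\<bar> \<le> 2 ^ (j * \<kappa> l) * r ^ \<kappa> l"
            using co[of l] by (simp add: abs_mult)
          also have "\<dots> = (2 ^ j * r) ^ \<kappa> l" by (simp add: power_mult_distrib power_mult)
          also have "\<dots> \<le> (2 ^ j * r) ^ 1" using le r kpos[rule_format, of l] by (intro power_decreasing) auto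
          finally show ?thesis by simp
        qed
        then have "Qb (NNc \<kappa> m) (3 * real CARD('n) * (2 ^ j * r)) (\<lambda>\<eta>. 1 - exp (- \<i> * complex_of_real (\<Sum>l\<in>UNIV. \<eta> l * (2 ^ (j * \<kappa> l) * (x - y)$l))))"
          by (rule Qb_phase[OF _ le])
        then show ?thesis using True le by (simp add: q2_def n_def)
      next
        case False
        then show ?thesis unfolding q2_def if_not_P[OF False] using r by (intro Qb_const) simp
      qed
    qed
    have Zb: "Zb d x' V j q = (\<Sum>k\<in>Kset \<kappa> d j. chin \<kappa> (etak \<kappa> (pi / d) j k) * (q (etak \<kappa> (pi / d) j k) * LV d x' V k))" for x' j q
      unfolding Zb_def muq_def LV_def by (simp only: mult.assoc)
    have tele1: "VV x' J - VV x' J0 = (\<Sum>j<J. Zb d x' V (Suc j) (q1 (Suc j)))" if "J0 \<le> J" for x' J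
      using that
    proof (induction J rule: dec_induct)
      case base
      have "Zb d x' V (Suc j) (q1 (Suc j)) = 0" if "j < J0" for j using that unfolding Zb by (simp add: q1_def)
      then show ?case by simp
    next
      case (step J)
      have "VV x' (Suc J) = VV x' J + (\<Sum>k\<in>Kset \<kappa> d (Suc J). chin \<kappa> (etak \<kappa> (pi / d) (Suc J) k) * LV d x' V k)"
        unfolding VV_def phin_telescope[OF d, of \<kappa> "Suc J"] phin_telescope[OF d, of \<kappa> J] by simp
      moreover have "Zb d x' V (Suc J) (q1 (Suc J)) = (\<Sum>k\<in>Kset \<kappa> d (Suc J). chin \<kappa> (etak \<kappa> (pi / d) (Suc J) k) * LV d x' V k)"
        using step(1) unfolding Zb by (simp add: q1_def)
      ultimately show ?case using step.IH by simp
    qed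
    have shift: "cmod (\<Sum>j<J. Zb d x' V (Suc j) (q (Suc j))) \<le> (\<Sum>j<Suc J. cmod (Zb d x' V j (q j)))" for x' J q
      unfolding sum.lessThan_Suc_shift by (rule order_trans[OF norm_sum]) simp
    \<comment> \<open>\<open>V'\<close> has the cutoff of \<open>x\<close> and the phases of \<open>y\<close>.\<close>
    define V' where "V' = (\<Sum>k\<in>Kset \<kappa> d J0. phin (etak \<kappa> (pi / d) J0 k) * (ek (pi / d) k (x - y) * LV d x V k))"
    define Lo where "Lo = (\<Sum>k\<in>Kset \<kappa> d 0. phin (etak \<kappa> (pi / d) 0 k) * ((1 - ek (pi / d) k (x - y)) * LV d x V k))"
    have tele2: "VV x J0 - V' = Lo + (\<Sum>j<J0. Zb d x V (Suc j) (q2 (Suc j)))"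
    proof -
      have "VV x J0 - V' = (\<Sum>k\<in>Kset \<kappa> d J0. phin (etak \<kappa> (pi / d) J0 k) * ((1 - ek (pi / d) k (x - y)) * LV d x V k))"
        unfolding VV_def V'_def sum_subtractf[symmetric] by (intro sum.cong refl) (simp add: algebra_simps)
      also have "\<dots> = Lo + (\<Sum>j<J0. \<Sum>k\<in>Kset \<kappa> d (Suc j). chin \<kappa> (etak \<kappa> (pi / d) (Suc j) k) * ((1 - ek (pi / d) k (x - y)) * LV d x V k))"
        unfolding Lo_def by (rule phin_telescope[OF d])
      also have "(\<Sum>j<J0. \<Sum>k\<in>Kset \<kappa> d (Suc j). chin \<kappa> (etak \<kappa> (pi / d) (Suc j) k) * ((1 - ek (pi / d) k (x - y)) * LV d x V k)) = (\<Sum>j<J0. Zb d x V (Suc j) (q2 (Suc j)))"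
      proof (rule sum.cong[OF refl])
        fix j assume "j \<in> {..<J0}"
        then have q2: "q2 (Suc j) = (\<lambda>\<eta>. 1 - exp (- \<i> * complex_of_real (\<Sum>l\<in>UNIV. \<eta> l * (2 ^ (Suc j * \<kappa> l) * (x - y)$l))))"
          by (simp add: q2_def)
        show "(\<Sum>k\<in>Kset \<kappa> d (Suc j). chin \<kappa> (etak \<kappa> (pi / d) (Suc j) k) * ((1 - ek (pi / d) k (x - y)) * LV d x V k)) = Zb d x V (Suc j) (q2 (Suc j))"
          unfolding Zb q2 ek_phase[of "pi / d" _ "x - y" \<kappa> "Suc j"] by (rule refl)
      qed
      finally show ?thesis .
    qed
    have S: "ennreal (\<Sum>j<N. cmod (Zb d x V j (q1 j))) \<le> ennreal (CF * 1) * E" "ennreal (\<Sum>j<N. cmod (Zb d y V j (q1 j))) \<le> ennreal (CF * 1) * E"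
      "ennreal (\<Sum>j<N. cmod (Zb d x V j (q2 j))) \<le> ennreal (CF * (3 * n)) * E" for N
      unfolding V_def E_def
      by (rule CF(2)[OF fx \<alpha> M x r(1,2) _ Q1], simp, rule CF(2)[OF fy \<alpha> M y r(1,2) _ Q1], simp, rule CF(2)[OF fx \<alpha> M x r(1,2) _ Q2], simp)
    have Lo: "cmod Lo \<le> CL * (M * r)"
      unfolding Lo_def CL_def n_def by (rule low_frequency_bound[OF d kpos _ r(1,2) xy], rule VM) blast
    have Cu: "cmod (V' - VV y J0) \<le> 2 * CC * (M * r)"
    proof -
      have "cmod (V' - VV y J0) \<le> CC * M / 4 ^ J0"
        unfolding V'_def VV_def by (rule CC(2)[OF Vc _ xyd]) (use VM in blast)
      also have "1 / 4 ^ J0 \<le> 2 * r"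
      proof -
        have "(2::real) ^ J0 \<le> 4 ^ J0" by (intro power_mono) auto
        then have "1 / 4 ^ J0 \<le> 1 / (2::real) ^ J0" by (intro divide_left_mono) auto
        also have "\<dots> \<le> 2 * r" using J0'(2) by (simp add: field_simps)
        finally show ?thesis .
      qed
      then have "CC * M * (1 / 4 ^ J0) \<le> CC * M * (2 * r)" using CC(1) M by (intro mult_left_mono) auto
      then have "CC * M / 4 ^ J0 \<le> 2 * CC * (M * r)" by simp
      finally show ?thesis .
    qed
    have bound: "ennreal (cmod (VV x J - VV y J)) \<le> ennreal C1 * E" if "J0 \<le> J" for J
    proof -
      let ?s1 = "\<Sum>j<Suc J. cmod (Zb d x V j (q1 j))" and ?s2 = "\<Sum>j<Suc J. cmod (Zb d y V j (q1 j))" and ?s3 = "\<Sum>j<Suc J0. cmod (Zb d x V j (q2 j))"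
      have "VV x J - VV y J = ((VV x J - VV x J0) - (VV y J - VV y J0)) + ((VV x J0 - V') + (V' - VV y J0))" by simp
      also have "cmod \<dots> \<le> (cmod (VV x J - VV x J0) + cmod (VV y J - VV y J0)) + (cmod (VV x J0 - V') + cmod (V' - VV y J0))"
        by (intro norm_triangle_le add_mono norm_triangle_ineq4 norm_triangle_ineq)
      also have "\<dots> \<le> (?s1 + ?s2) + ((CL * (M * r) + ?s3) + 2 * CC * (M * r))"
      proof (intro add_mono Cu)
        show "cmod (VV x J - VV x J0) \<le> ?s1" "cmod (VV y J - VV y J0) \<le> ?s2" unfolding tele1[OF that] by (rule shift)+
        show "cmod (VV x J0 - V') \<le> CL * (M * r) + ?s3"
          unfolding tele2 by (intro norm_triangle_le add_mono Lo shift)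
      qed
      finally have "ennreal (cmod (VV x J - VV y J)) \<le> ennreal ((?s1 + ?s2) + ((CL * (M * r) + ?s3) + 2 * CC * (M * r)))"
        by (rule ennreal_leI)
      also have "\<dots> = (ennreal ?s1 + ennreal ?s2) + ((ennreal CL * ennreal (M * r) + ennreal ?s3) + ennreal (2 * CC) * ennreal (M * r))"
      proof -
        have nn: "0 \<le> ?s1" "0 \<le> ?s2" "0 \<le> ?s3" by (intro sum_nonneg norm_ge_zero)+
        have mr: "0 \<le> M * r" using M r by simp
        have cc: "0 \<le> 2 * CC" using CC(1) by simp
        have lm: "0 \<le> CL * (M * r)" "0 \<le> 2 * CC * (M * r)" using CL cc mr by auto
        show ?thesis
          by (simp only: ennreal_plus[OF add_nonneg_nonneg[OF nn(1,2)] add_nonneg_nonneg[OF add_nonneg_nonneg[OF lm(1) nn(3)] lm(2)]]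
            ennreal_plus[OF nn(1,2)] ennreal_plus[OF add_nonneg_nonneg[OF lm(1) nn(3)] lm(2)] ennreal_plus[OF lm(1) nn(3)] ennreal_mult[OF CL mr] ennreal_mult[OF cc mr])
      qed
      also have "\<dots> \<le> (ennreal (CF * 1) * E + ennreal (CF * 1) * E) + ((ennreal CL * E + ennreal (CF * (3 * n)) * E) + ennreal (2 * CC) * E)"
      proof (intro add_mono S mult_left_mono)
        show "ennreal (M * r) \<le> E" unfolding E_def by (simp add: add.assoc)
        then show "ennreal (M * r) \<le> E" .
      qed simp_all
      also have "\<dots> = ennreal C1 * E"
      proof -
        have "ennreal C1 = (ennreal (CF * 1) + ennreal (CF * 1)) + ((ennreal CL + ennreal (CF * (3 * n))) + ennreal (2 * CC))"
          using CL CC(1) CF(1) by (simp add: C1_def ennreal_plus[symmetric] del: ennreal_plus)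
        then show ?thesis by (simp only: distrib_right)
      qed
      finally show ?thesis .
    qed
    have "(\<lambda>J. VV x J - VV y J) \<longlonglongrightarrow> of_real P * V x - of_real P * V y"
    proof -
      have ds1: "\<And>w::real^'n. \<forall>l. \<bar>w$l\<bar> \<le> d \<Longrightarrow> qdist \<kappa> w 0 \<le> 1" using ds s0(1) order_trans by blast
      have "(\<lambda>J. VV x J) \<longlonglongrightarrow> of_real P * V x" "(\<lambda>J. VV y J) \<longlonglongrightarrow> of_real P * V y"
        unfolding VV_def P_def n_def by (rule approx_identity[OF d kpos ds1 Vc(1), where M = M], assumption, rule VM, blast)
          (rule approx_identity[OF d kpos ds1 Vc(2), where M = M], assumption, rule VM, blast)
      then show ?thesis by (rule tendsto_diff)
    qed
    then have "(\<lambda>J. ennreal (cmod (VV x J - VV y J))) \<longlonglongrightarrow> ennreal (cmod (of_real P * V x - of_real P * V y))"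
      by (intro tendsto_ennrealI tendsto_norm)
    then have "ennreal (cmod (of_real P * V x - of_real P * V y)) \<le> ennreal C1 * E"
      by (rule LIMSEQ_le_const2) (use bound in blast)
    moreover have "cmod (of_real P * V x - of_real P * V y) = P * cmod (V x - V y)"
      using P by (simp add: right_diff_distrib[symmetric] norm_mult)
    ultimately have "ennreal P * ennreal (cmod (V x - V y)) \<le> ennreal C1 * E" using P by (simp add: ennreal_mult)
    then have "ennreal (1 / P) * (ennreal P * ennreal (cmod (V x - V y))) \<le> ennreal (1 / P) * (ennreal C1 * E)"
      by (rule mult_left_mono) simp
    moreover have "ennreal (1 / P) * (ennreal P * z) = z" for z
      using P by (simp add: mult.assoc[symmetric] ennreal_mult[symmetric])
    moreover have "ennreal (1 / P) * (ennreal C1 * E) = ennreal (C1 / P) * E"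
      using P C1 by (simp add: mult.assoc[symmetric] ennreal_mult[symmetric])
    ultimately show "ennreal (cmod (v \<alpha> x - v \<alpha> y)) \<le> ennreal (C1 / P) * (ennreal (M * r) + DI \<gamma> R0 r (osc_f \<kappa> B R0 f) + ennreal M * DI \<gamma> R0 r (osc_a \<kappa> A B R0 a))"
      unfolding V_def E_def by simp
  qed
qed

section \<open>The modulus of continuity\<close>

lemma box_scale_exists:
  fixes \<kappa> :: "'n::finite mindex"
  assumes \<kappa>: "\<forall>l. 0 < \<kappa> l" and s0: "0 < s0"
  shows "\<exists>d>0. \<forall>w::real^'n. (\<forall>l. \<bar>w$l\<bar> \<le> d) \<longrightarrow> qdist \<kappa> w 0 \<le> s0"
proof -
  have "(0::real^'n) \<in> qball \<kappa> 0 s0" using s0 by (simp add: qball_def qdist_def)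
  then obtain e where e: "0 < e" "ball 0 e \<subseteq> qball \<kappa> (0::real^'n) s0"
    using open_qball[OF \<kappa>] by (meson open_contains_ball)
  define d where "d = e / (2 * CARD('n))"
  show ?thesis
  proof (intro exI[of _ d] conjI allI impI)
    show "0 < d" using e by (simp add: d_def)
    fix w :: "real^'n" assume "\<forall>l. \<bar>w$l\<bar> \<le> d"
    then have "(\<Sum>l\<in>UNIV. \<bar>w$l\<bar>) \<le> (\<Sum>l\<in>(UNIV::'n set). d)" by (intro sum_mono) simp
    also have "\<dots> < e" using e by (simp add: d_def)
    finally have "w \<in> ball 0 e" using norm_le_l1_cart[of w] by simp
    then show "qdist \<kappa> w 0 \<le> s0" using e by (auto simp: qball_def)
  qed
qed

lemma symb_psym: "symb A B a x \<xi> = psym A B (\<lambda>\<alpha> \<beta>. a \<alpha> \<beta> x) (\<lambda>l. \<xi>$l)"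
  by (simp add: symb_def psym_def mipow_def)

lemma qdist_qn: "qdist \<kappa> \<xi> 0 = qn \<kappa> (\<lambda>l. \<xi>$l)"
  by (simp add: qdist_def qn_def)

lemma (in symb_class) elliptic_symb:
  assumes "\<And>\<xi>::real^'n. lam * qdist \<kappa> \<xi> 0 ^ m \<le> cmod (symb A B a x \<xi>) \<and> cmod (symb A B a x \<xi>) \<le> Lam * qdist \<kappa> \<xi> 0 ^ m"
  shows "elliptic (\<lambda>\<alpha> \<beta>. a \<alpha> \<beta> x)"
  unfolding elliptic_def
proof
  fix \<eta> :: "'n \<Rightarrow> real"
  show "lam * qn \<kappa> \<eta> ^ m \<le> cmod (psym A B (\<lambda>\<alpha> \<beta>. a \<alpha> \<beta> x) \<eta>) \<and> cmod (psym A B (\<lambda>\<alpha> \<beta>. a \<alpha> \<beta> x) \<eta>) \<le> Lam * qn \<kappa> \<eta> ^ m"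
    using assms[of "\<chi> l. \<eta> l"] by (simp add: symb_psym qdist_qn)
qed

text \<open>At a coordinate vector every monomial involving another coordinate is zero. As the
  symbol does not vanish there, some \<alpha> in \<open>A\<close> must be concentrated on
  \<open>l\<close>.\<close>

lemma pure_power_index:
  fixes l :: "'n::finite"
  assumes lam: "0 < lam" and low: "\<And>\<xi>::real^'n. lam * qdist \<kappa> \<xi> 0 ^ m \<le> cmod (symb A B a x \<xi>)"
  shows "\<exists>t. (\<lambda>k. if k = l then t else 0) \<in> A" and "B \<noteq> {}"
proof -
  let ?\<xi> = "axis l 1 :: real^'n"
  have "0 < qdist \<kappa> ?\<xi> 0" by (rule qdist_pos) (simp add: axis_eq_0_iff)
  then have "0 < lam * qdist \<kappa> ?\<xi> 0 ^ m" using lam by simp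
  then have ne: "symb A B a x ?\<xi> \<noteq> 0" using low[of ?\<xi>] by auto
  show "B \<noteq> {}" using ne by (auto simp: symb_def)
  obtain \<alpha> where \<alpha>: "\<alpha> \<in> A" "(\<Sum>\<beta>\<in>B. a \<alpha> \<beta> x * (\<Prod>l\<in>UNIV. (\<i> * complex_of_real (?\<xi>$l)) ^ (\<alpha> l + \<beta> l))) \<noteq> 0"
    using ne unfolding symb_def by (meson sum.neutral)
  then obtain \<beta> where "a \<alpha> \<beta> x * (\<Prod>k\<in>UNIV. (\<i> * complex_of_real (?\<xi>$k)) ^ (\<alpha> k + \<beta> k)) \<noteq> 0"
    by (meson sum.neutral)
  then have ne: "(\<Prod>k\<in>UNIV. (\<i> * complex_of_real (?\<xi>$k)) ^ (\<alpha> k + \<beta> k)) \<noteq> 0" by simp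
  have "\<alpha> k = 0" if "k \<noteq> l" for k
  proof (rule ccontr)
    assume "\<alpha> k \<noteq> 0"
    then have "(\<i> * complex_of_real (?\<xi>$k)) ^ (\<alpha> k + \<beta> k) = 0" using that by (simp add: axis_def)
    then have "(\<Prod>k\<in>UNIV. (\<i> * complex_of_real (?\<xi>$k)) ^ (\<alpha> k + \<beta> k)) = 0" by (intro prod_zero[OF finite] bexI[of _ k]) auto
    then show False using ne by simp
  qed
  then have "\<alpha> = (\<lambda>k. if k = l then \<alpha> l else 0)" by auto
  then show "\<exists>t. (\<lambda>k. if k = l then t else 0) \<in> A" using \<alpha>(1) by metis
qed

theorem theorem1p1:
  fixes \<kappa> :: "'n::finite mindex" and A B :: "'n mindex set" and m :: nat
    and R0 lam Lam \<gamma> \<theta> :: real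
  assumes kpos: "\<forall>l. 0 < \<kappa> l"
    and finA: "finite A" and finB: "finite B"
    and hom: "\<forall>\<alpha>\<in>A. \<forall>\<beta>\<in>B. mdot (\<lambda>l. \<alpha> l + \<beta> l) \<kappa> = m"
    and compl: "B_complete \<kappa> m A B"
    and R0: "0 < R0"
    and lam: "0 < lam" "lam < Lam"
    and gam: "0 < \<gamma>" "\<gamma> < 1"
    and th: "0 < \<theta>" "\<theta> < 1"
  shows "\<exists>C::real. \<forall>(a :: 'n mindex \<Rightarrow> 'n mindex \<Rightarrow> real^'n \<Rightarrow> complex)
                        (f :: 'n mindex \<Rightarrow> real^'n \<Rightarrow> complex)
                        (T :: (real^'n \<Rightarrow> complex) \<Rightarrow> complex)
                        (v :: 'n mindex \<Rightarrow> real^'n \<Rightarrow> complex).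
      ( is_distribution (qball \<kappa> 0 R0) T
      \<and> (\<forall>\<alpha>\<in>A. continuous_on (qball \<kappa> 0 R0) (v \<alpha>)
                \<and> distr_deriv_eq (qball \<kappa> 0 R0) T \<alpha> (v \<alpha>))
      \<and> (\<forall>\<alpha>\<in>A. \<forall>\<beta>\<in>B. loc_integrable (qball \<kappa> 0 R0) (\<lambda>x. a \<alpha> \<beta> x * v \<alpha> x))
      \<and> (\<forall>\<beta>\<in>B. loc_integrable (qball \<kappa> 0 R0) (f \<beta>))
      \<and> (\<forall>\<phi>\<in>test_fun (qball \<kappa> 0 R0).
            (\<Sum>\<beta>\<in>B. (-1) ^ mlen \<beta> * (\<Sum>\<alpha>\<in>A.
                 integ (qball \<kappa> 0 R0) (\<lambda>x. a \<alpha> \<beta> x * v \<alpha> x * Dm \<beta> \<phi> x)))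
          = (\<Sum>\<beta>\<in>B. (-1) ^ mlen \<beta> * integ (qball \<kappa> 0 R0) (\<lambda>x. f \<beta> x * Dm \<beta> \<phi> x)))
      \<and> (\<forall>x\<in>qball \<kappa> 0 R0. \<forall>\<xi>::real^'n.
            lam * qdist \<kappa> \<xi> 0 ^ m \<le> cmod (symb A B a x \<xi>)
          \<and> cmod (symb A B a x \<xi>) \<le> Lam * qdist \<kappa> \<xi> 0 ^ m) )
      \<longrightarrow>
      (\<forall>\<alpha>\<in>A. \<forall>r. 0 < r \<and> r \<le> R0 \<longrightarrow>
         (SUP xy\<in>{(x, y). x \<in> qball \<kappa> 0 (\<theta> * R0) \<and> y \<in> qball \<kappa> 0 (\<theta> * R0)
                            \<and> qdist \<kappa> x y \<le> r}.
              ennreal (cmod (v \<alpha> (fst xy) - v \<alpha> (snd xy))))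
         \<le> ennreal C * ( seminormA A (qball \<kappa> 0 R0) v * ennreal (r powr \<gamma>)
                 + set_nn_integral lborel {0<..<r} (\<lambda>\<rho>. osc_f \<kappa> B R0 f \<rho> / ennreal \<rho>)
                 + ennreal (r powr \<gamma>) * set_nn_integral lborel {r<..<R0}
                      (\<lambda>\<rho>. osc_f \<kappa> B R0 f \<rho> / ennreal (\<rho> powr (1 + \<gamma>))))
           + ennreal C * seminormA A (qball \<kappa> 0 R0) v *
               ( set_nn_integral lborel {0<..<r} (\<lambda>\<rho>. osc_a \<kappa> A B R0 a \<rho> / ennreal \<rho>)
                 + ennreal (r powr \<gamma>) * set_nn_integral lborel {r<..<R0}
                      (\<lambda>\<rho>. osc_a \<kappa> A B R0 a \<rho> / ennreal (\<rho> powr (1 + \<gamma>)))))"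
proof (cases "\<forall>l. \<exists>t. (\<lambda>k. if k = l then t else 0) \<in> A")
  case False
  have zero: "(0::real^'n) \<in> qball \<kappa> 0 R0" using R0 by (simp add: qball_def qdist_def)
  \<comment> \<open>Without a pure power in some direction no symbol over \<open>A\<close> and
    \<open>B\<close> is elliptic, so the claim is vacuous with any constant.\<close>
  have no: "\<not> (\<forall>x\<in>qball \<kappa> 0 R0. \<forall>\<xi>::real^'n. lam * qdist \<kappa> \<xi> 0 ^ m \<le> cmod (symb A B a x \<xi>) \<and> cmod (symb A B a x \<xi>) \<le> Lam * qdist \<kappa> \<xi> 0 ^ m)" for a
    using False pure_power_index(1)[OF lam(1), of \<kappa> m A B a 0] zero by blast
  show ?thesis by (intro exI[of _ 0] allI impI) (use no in blast)
next
  case True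
  then obtain s where s: "\<forall>l. (\<lambda>k. if k = l then s l else 0) \<in> A" by metis
  interpret symb_class \<kappa> A B m lam Lam
    by unfold_locales (use kpos finA finB hom lam in auto)
  let ?\<Omega> = "qball \<kappa> (0::real^'n) R0"
  \<comment> \<open>Balls of radius up to \<open>2 * s0\<close> around points of the inner ball stay
    compactly inside the outer one, and \<open>s0 \<le> 1\<close> is what the kernel sums
    require.\<close>
  define s0 where "s0 = min 1 ((1 - \<theta>) * R0 / 4)"
  have s0: "0 < s0" "s0 \<le> 1" "4 * s0 \<le> (1 - \<theta>) * R0" using th R0 by (auto simp: s0_def min_def)
  have "(1 - \<theta>) * R0 \<le> 1 * R0" using th R0 by (intro mult_right_mono) auto
  then have s0': "2 * s0 \<le> R0" "2 * s0 \<le> (1 - \<theta>) * R0" using s0 by linarith+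
  obtain d where d: "0 < d" and ds: "\<And>w::real^'n. \<forall>l. \<bar>w$l\<bar> \<le> d \<Longrightarrow> qdist \<kappa> w 0 \<le> s0"
    using box_scale_exists[OF kpos s0(1)] by blast
  obtain C0 where C0: "0 \<le> C0" "\<And>\<Omega> T v a f x y M \<alpha> r. frozen \<kappa> A B m lam Lam d \<Omega> T v a f x M s \<Longrightarrow> frozen \<kappa> A B m lam Lam d \<Omega> T v a f y M s \<Longrightarrow> \<alpha> \<in> A \<Longrightarrow> 0 < M \<Longrightarrow>
     qdist \<kappa> x 0 < \<theta> * R0 \<Longrightarrow> qdist \<kappa> y 0 < \<theta> * R0 \<Longrightarrow> qdist \<kappa> x y \<le> r \<Longrightarrow> 0 < r \<Longrightarrow> r \<le> 1 \<Longrightarrow> r \<le> d / 8 \<Longrightarrow>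
     ennreal (cmod (v \<alpha> x - v \<alpha> y)) \<le> ennreal C0 * (ennreal (M * r) + DI \<gamma> R0 r (osc_f \<kappa> B R0 f) + ennreal M * DI \<gamma> R0 r (osc_a \<kappa> A B R0 a))"
    using modulus_bound[OF d s0(2) s0' gam ds, of s] by blast
  define r0 where "r0 = min 1 (d / 8)"
  have r0: "0 < r0" "r0 \<le> 1" "r0 \<le> d / 8" using d by (auto simp: r0_def)
  \<comment> \<open>The second summand covers r > \<open>r0\<close>, where the trivial bound
    \<open>2 * M\<close> is at most \<open>2 / r0 powr \<gamma>\<close> times
    \<open>M * r powr \<gamma>\<close>.\<close>
  define C where "C = C0 + 2 / r0 powr \<gamma>"
  have C: "0 < C" "C0 \<le> C" "2 / r0 powr \<gamma> \<le> C" using C0(1) r0 by (auto simp: C_def add_nonneg_pos)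
  have main: "ennreal (cmod (v \<alpha> x - v \<alpha> y)) \<le> ennreal C * (seminormA A ?\<Omega> v * ennreal (r powr \<gamma>) + DI \<gamma> R0 r (osc_f \<kappa> B R0 f) + seminormA A ?\<Omega> v * DI \<gamma> R0 r (osc_a \<kappa> A B R0 a))"
    if T: "is_distribution ?\<Omega> T" and v: "\<forall>\<alpha>\<in>A. continuous_on ?\<Omega> (v \<alpha>) \<and> distr_deriv_eq ?\<Omega> T \<alpha> (v \<alpha>)"
      and av: "\<forall>\<alpha>\<in>A. \<forall>\<beta>\<in>B. loc_integrable ?\<Omega> (\<lambda>x. a \<alpha> \<beta> x * v \<alpha> x)" and f: "\<forall>\<beta>\<in>B. loc_integrable ?\<Omega> (f \<beta>)"
      and eqn: "\<forall>\<phi>\<in>test_fun ?\<Omega>. (\<Sum>\<beta>\<in>B. (-1) ^ mlen \<beta> * (\<Sum>\<alpha>\<in>A. integ ?\<Omega> (\<lambda>x. a \<alpha> \<beta> x * v \<alpha> x * Dm \<beta> \<phi> x)))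
          = (\<Sum>\<beta>\<in>B. (-1) ^ mlen \<beta> * integ ?\<Omega> (\<lambda>x. f \<beta> x * Dm \<beta> \<phi> x))"
      and ell: "\<forall>x\<in>?\<Omega>. \<forall>\<xi>::real^'n. lam * qdist \<kappa> \<xi> 0 ^ m \<le> cmod (symb A B a x \<xi>) \<and> cmod (symb A B a x \<xi>) \<le> Lam * qdist \<kappa> \<xi> 0 ^ m"
      and \<alpha>: "\<alpha> \<in> A" and r: "0 < r" and x: "x \<in> qball \<kappa> 0 (\<theta> * R0)" and y: "y \<in> qball \<kappa> 0 (\<theta> * R0)" and xy: "qdist \<kappa> x y \<le> r"
    for a :: "'n mindex \<Rightarrow> 'n mindex \<Rightarrow> real^'n \<Rightarrow> complex" and f T v \<alpha> r x y
  proof (cases "seminormA A ?\<Omega> v = top")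
    \<comment> \<open>If the seminorm is infinite, so is the right-hand side, because
      \<open>C\<close> and \<open>r powr \<gamma>\<close> are positive.\<close>
    case True
    have "ennreal C * (top * ennreal (r powr \<gamma>) + DI \<gamma> R0 r (osc_f \<kappa> B R0 f) + top * DI \<gamma> R0 r (osc_a \<kappa> A B R0 a)) = top"
      using C r by (simp add: ennreal_top_mult ennreal_mult_top)
    then show ?thesis unfolding True by simp
  next
    case False
    define M where "M = enn2real (seminormA A ?\<Omega> v)"
    have SM: "seminormA A ?\<Omega> v = ennreal M" using False by (simp add: M_def ennreal_enn2real_if)
    have M0: "0 \<le> M" by (simp add: M_def)
    have vM: "cmod (v \<alpha>' z) \<le> M" if "\<alpha>' \<in> A" "z \<in> ?\<Omega>" for \<alpha>' z
    proof -
      have "ennreal (cmod (v \<alpha>' z)) \<le> seminormA A ?\<Omega> v"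
        unfolding seminormA_def by (rule SUP_upper2[OF that(1)], rule SUP_upper[OF that(2)])
      then show ?thesis using M0 unfolding SM by simp
    qed
    have in\<Omega>: "z \<in> ?\<Omega>" if "z \<in> qball \<kappa> 0 (\<theta> * R0)" for z
    proof -
      have "\<theta> * R0 < R0" using th R0 by simp
      then show ?thesis using that by (simp add: qball_def)
    qed
    show ?thesis
    proof (cases "M = 0")
      \<comment> \<open>\<open>modulus_bound\<close> asks for a positive \<open>M\<close>, since it
        divides by \<open>M\<close>; for \<open>M = 0\<close> both values of
        \<open>v \<alpha>\<close> are 0.\<close>
      case True
      then have "v \<alpha> x = 0" "v \<alpha> y = 0" using vM[OF \<alpha> in\<Omega>[OF x]] vM[OF \<alpha> in\<Omega>[OF y]] by auto
      then show ?thesis by simp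
    next
      case False
      then have M: "0 < M" using M0 by simp
      have fr: "frozen \<kappa> A B m lam Lam d ?\<Omega> T v a f w M s" if w: "w \<in> qball \<kappa> 0 (\<theta> * R0)" for w
      proof -
        have sub: "cbx w d \<subseteq> ?\<Omega>"
        proof
          fix z assume "z \<in> cbx w d"
          then have "qdist \<kappa> (z - w) 0 \<le> s0" by (intro ds) (auto simp: cbx_def)
          then have "qdist \<kappa> z w \<le> s0" unfolding qdist_diff[of \<kappa> z w] .
          moreover have "qdist \<kappa> z 0 \<le> qdist \<kappa> z w + qdist \<kappa> w 0" by (rule qdist_triangle[OF kpos])
          moreover have "s0 + \<theta> * R0 < R0" using s0 by (simp add: algebra_simps)
          ultimately show "z \<in> ?\<Omega>" using w by (simp add: qball_def)
        qed
        interpret b: bump1 d "bfun d" by (rule bump1_bfun[OF d])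
        show ?thesis
        proof (intro frozen.intro frozen_axioms.intro)
          show "symb_class \<kappa> A B m lam" by (rule symb_class_axioms)
          show "0 < d" by (rule d)
          show "dbox d (bfun d) ?\<Omega> T A v w M"
            by unfold_locales (use T sub v vM M0 in auto)
          show "B \<noteq> {}" using pure_power_index(2)[OF lam(1), of \<kappa> m A B a w] ell in\<Omega>[OF w] by blast
          show "\<forall>l. (\<lambda>k. if k = l then s l else 0) \<in> A" by (rule s)
          show "elliptic (\<lambda>\<alpha> \<beta>. a \<alpha> \<beta> w)" by (rule elliptic_symb) (use ell in\<Omega>[OF w] in blast)
          show "set_integrable lebesgue (cbx w d) (\<lambda>z. a \<alpha> \<beta> z * v \<alpha> z)" if "\<alpha> \<in> A" "\<beta> \<in> B" for \<alpha> \<beta>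
            using av that sub compact_cbx[of w d] unfolding loc_integrable_def by blast
          show "set_integrable lebesgue (cbx w d) (f \<beta>)" if "\<beta> \<in> B" for \<beta>
            using f that sub compact_cbx[of w d] unfolding loc_integrable_def by blast
        qed (use eqn in blast)
      qed
      let ?F = "DI \<gamma> R0 r (osc_f \<kappa> B R0 f)" and ?Aa = "DI \<gamma> R0 r (osc_a \<kappa> A B R0 a)"
      show ?thesis
      proof (cases "r \<le> r0")
        case True
        have "ennreal (cmod (v \<alpha> x - v \<alpha> y)) \<le> ennreal C0 * (ennreal (M * r) + ?F + ennreal M * ?Aa)"
          by (rule C0(2)[OF fr[OF x] fr[OF y] \<alpha> M _ _ xy r]) (use x y True r0 in \<open>auto simp: qball_def\<close>)
        also have "\<dots> \<le> ennreal C * (ennreal M * ennreal (r powr \<gamma>) + ?F + ennreal M * ?Aa)"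
        proof (intro mult_mono add_mono order_refl)
          have "r powr 1 \<le> r powr \<gamma>" using r True r0 gam by (intro powr_mono') auto
          then have "M * r \<le> M * r powr \<gamma>" using M r by (intro mult_left_mono) auto
          then show "ennreal (M * r) \<le> ennreal M * ennreal (r powr \<gamma>)"
            using M by (simp add: ennreal_mult[symmetric] ennreal_leI)
          show "ennreal C0 \<le> ennreal C" using C by (simp add: ennreal_leI)
        qed auto
        finally show ?thesis unfolding SM .
      next
        case False
        have "1 \<le> (r / r0) powr \<gamma>" using False r0 gam by (intro ge_one_powr_ge_zero) (auto simp: le_divide_eq)
        have "cmod (v \<alpha> x - v \<alpha> y) \<le> 2 * M"
          using norm_triangle_ineq4[of "v \<alpha> x" "v \<alpha> y"] vM[OF \<alpha> in\<Omega>[OF x]] vM[OF \<alpha> in\<Omega>[OF y]] by linarith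
        also have "\<dots> \<le> 2 * M * (r / r0) powr \<gamma>" using \<open>1 \<le> (r / r0) powr \<gamma>\<close> M by simp
        also have "\<dots> = 2 / r0 powr \<gamma> * (M * r powr \<gamma>)" using r r0 by (simp add: powr_divide)
        also have "\<dots> \<le> C * (M * r powr \<gamma>)" using C M by (intro mult_right_mono) auto
        finally have "ennreal (cmod (v \<alpha> x - v \<alpha> y)) \<le> ennreal (C * (M * r powr \<gamma>))" by (rule ennreal_leI)
        also have "\<dots> = ennreal C * (ennreal M * ennreal (r powr \<gamma>))"
        proof -
          have "0 \<le> C" "0 \<le> M * r powr \<gamma>" "0 \<le> r powr \<gamma>" using C M by auto
          then show ?thesis by (simp only: ennreal_mult[of C] ennreal_mult[OF M0])
        qed
        also have "\<dots> \<le> ennreal C * (ennreal M * ennreal (r powr \<gamma>) + ?F + ennreal M * ?Aa)"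
          by (intro mult_left_mono) (simp_all add: add.assoc)
        finally show ?thesis unfolding SM .
      qed
    qed
  qed
  show ?thesis
  proof (intro exI[of _ C] allI impI ballI, elim conjE, rule SUP_least)
    fix a f T v \<alpha> r and xy :: "(real^'n) \<times> (real^'n)"
    assume H: "is_distribution ?\<Omega> T" "\<forall>\<alpha>\<in>A. continuous_on ?\<Omega> (v \<alpha>) \<and> distr_deriv_eq ?\<Omega> T \<alpha> (v \<alpha>)"
      "\<forall>\<alpha>\<in>A. \<forall>\<beta>\<in>B. loc_integrable ?\<Omega> (\<lambda>x. a \<alpha> \<beta> x * v \<alpha> x)" "\<forall>\<beta>\<in>B. loc_integrable ?\<Omega> (f \<beta>)"
      "\<forall>\<phi>\<in>test_fun ?\<Omega>. (\<Sum>\<beta>\<in>B. (-1) ^ mlen \<beta> * (\<Sum>\<alpha>\<in>A. integ ?\<Omega> (\<lambda>x. a \<alpha> \<beta> x * v \<alpha> x * Dm \<beta> \<phi> x)))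
          = (\<Sum>\<beta>\<in>B. (-1) ^ mlen \<beta> * integ ?\<Omega> (\<lambda>x. f \<beta> x * Dm \<beta> \<phi> x))"
      "\<forall>x\<in>?\<Omega>. \<forall>\<xi>::real^'n. lam * qdist \<kappa> \<xi> 0 ^ m \<le> cmod (symb A B a x \<xi>) \<and> cmod (symb A B a x \<xi>) \<le> Lam * qdist \<kappa> \<xi> 0 ^ m"
      and \<alpha>: "\<alpha> \<in> A" and r: "0 < r" and "r \<le> R0"
      and xy: "xy \<in> {(x, y). x \<in> qball \<kappa> 0 (\<theta> * R0) \<and> y \<in> qball \<kappa> 0 (\<theta> * R0) \<and> qdist \<kappa> x y \<le> r}"
    have "ennreal (cmod (v \<alpha> (fst xy) - v \<alpha> (snd xy))) \<le> ennreal C * (seminormA A ?\<Omega> v * ennreal (r powr \<gamma>) + DI \<gamma> R0 r (osc_f \<kappa> B R0 f) + seminormA A ?\<Omega> v * DI \<gamma> R0 r (osc_a \<kappa> A B R0 a))"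
      by (rule main[OF H \<alpha> r]) (use xy in auto)
    then show "ennreal (cmod (v \<alpha> (fst xy) - v \<alpha> (snd xy)))
         \<le> ennreal C * ( seminormA A ?\<Omega> v * ennreal (r powr \<gamma>)
                 + set_nn_integral lborel {0<..<r} (\<lambda>\<rho>. osc_f \<kappa> B R0 f \<rho> / ennreal \<rho>)
                 + ennreal (r powr \<gamma>) * set_nn_integral lborel {r<..<R0}
                      (\<lambda>\<rho>. osc_f \<kappa> B R0 f \<rho> / ennreal (\<rho> powr (1 + \<gamma>))))
           + ennreal C * seminormA A ?\<Omega> v *
               ( set_nn_integral lborel {0<..<r} (\<lambda>\<rho>. osc_a \<kappa> A B R0 a \<rho> / ennreal \<rho>)
                 + ennreal (r powr \<gamma>) * set_nn_integral lborel {r<..<R0}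
                      (\<lambda>\<rho>. osc_a \<kappa> A B R0 a \<rho> / ennreal (\<rho> powr (1 + \<gamma>))))"
      unfolding DI_def by (simp only: distrib_left add.assoc mult.assoc)
  qed
qed

end
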